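(* Let $X$ be a simplicial set, let $q,p,n\ge 0$ be integers, and let $\alpha\in N^n(X)$ be a cocycle. With $\bar J_\Psi: N_*(BV_4)\to N_{*+1}(BD_8)\subset N_{*+1}(B\Sigma_4)$ the explicit chain homotopy defined in the context and $x_q\times x_p\in N_{q+p}(BV_4)\subset N_{q+p}(B\Sigma_4)$, one has $$(x_q\times x_p)(\alpha)+d\big(\bar J_\Psi(x_q\times x_p)(\alpha)\big)=\sum_{\ell}\binom{p-\ell}{p-2\ell}Sq^{2n-q-\ell}Sq^{n-p+\ell}(\alpha)+d\big(N_{q,p,n}(\alpha)\big),$$ where $$N_{q,p,n}(\alpha)=\sum_{\ell,a}\binom{p-\ell-a}{p-2\ell}\binom{p-\ell+a}{p-2\ell}\;Sq^{n-p+\ell+a}(\alpha)\smile_{q-p+2\ell+1}Sq^{n-p+\ell-a}(\alpha).$$ Here the first sum is over integers $\ell$ with $0\le\ell\le p/2$ and $q-p+2\ell\ge0$; the second is over $\ell,a\in\frac12\mathbb{Z}$ with $0<a\le\ell\le p/2$, $a\equiv\ell \pmod{\mathbb{Z}}$, $q-p+2\ell\ge 0$. Symmetrically (exchanging $p$ and $q$ throughout), $$(x_p\times x_q)(\alpha)+d\big(\bar J_\Psi(x_p\times x_q)(\alpha)\big)=\sum_{\ell}\binom{q-\ell}{q-2\ell}Sq^{2n-p-\ell}Sq^{n-q+\ell}(\alpha)+d\big(N_{p,q,n}(\alpha)\big).$$ These are equalities of cochains in $N^*(X)$.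
   Context: **Chains.** All coefficients are $\mathbb{F}_2$. $N_*(X)$ is the normalized chain complex of a simplicial set $X$ (chains modulo degenerate simplices, boundary = sum of faces); $N^*(X)$ is its dual with coboundary $d$, graded here in non-negative degrees. Binomial coefficients are mod $2$, with $\binom AB=0$ unless $0\le B\le A$. **Classifying spaces.** $(EG)_k=G^{k+1}$, faces delete and degeneracies repeat entries, $g(g_0,\dots,g_k)=(gg_0,\dots,gg_k)$, $BG=G\backslash EG$; $N_*(BG)=N_*(EG)_G$ (coinvariants). For a subgroup $H\subset G$, regard $N_*(EH)\subset N_*(EG)$, $N_*(BH)\subset N_*(BG)$. The join $*:N_j(EG)\otimes N_k(EG)\to N_{j+k+1}(EG)$ is the bilinear extension of concatenation of tuples. For $\Sigma_2=\{1,T\}$: $\tilde x_k=(1,T,1,\dots,T^k)\in N_k(E\Sigma_2)$, and $x_k\in N_k(B\Sigma_2)$ is its image. **EZ and AW.** $EZ:N_*(Y)\otimes N_*(Z)\to N_*(Y\times Z)$ is the Eilenberg–Zilber shuffle map: on $\Delta^k\times\Delta^m$ it sends the tensor of top simplices to the sum of all $(k+m)$-simplices given by maximal chains in the product poset. It is associative, so defined for several factors. $AW:N_*(Y\times Z)\to N_*(Y)\otimes N_*(Z)$ is $AW(u,v)=\sum_i(\text{front }i\text{-face of }u)\otimes(\text{complementary back face of }v)$, and $AW_\Delta:N_*(Y)\to N_*(Y)\otimes N_*(Y)$ is $AW_\Delta(u)=AW(u,u)$. **Steenrod's map.** $\widetilde{AW}_\Delta:N_*(E\Sigma_2)\otimes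 N_*(Y)\to N_*(Y)\otimes N_*(Y)$ is, for a simplex $u:\Delta^N\to Y$, $$\widetilde{AW}_\Delta(\tilde x_m\otimes u)=\sum_{0\le k_1<\cdots<k_{m+1}\le N}u(I_{odd})\otimes u(I_{even}),$$ with $I_1=\{0,\dots,k_1\}$, $I_s=\{k_{s-1},\dots,k_s\}$ for $2\le s\le m+1$, $I_{m+2}=\{k_{m+1},\dots,N\}$, $I_{odd},I_{even}$ the unions of the odd- and even-indexed intervals and $u(I)$ the face spanned by $I$; and $\widetilde{AW}_\Delta(T\tilde x_m\otimes u)$ is obtained by switching tensor factors. The product $\smile_m$ is defined by $\langle\beta\smile_m\gamma,u\rangle=\langle\beta\otimes\gamma,\widetilde{AW}_\Delta(\tilde x_m\otimes u)\rangle$. For a cocycle $\beta$ of degree $i$, $Sq^k(\beta)=\beta\smile_{i-k}\beta$ as a cochain (zero if $k>i$). **Groups.** Permutations multiply as composed functions. In $\Sigma_4$ let $a=(13)(24)$, $b=(12)$, $c=(34)$ in cycle notation; $D_8=\langle a,b,c\rangle$ (order 8) and $V_4=\langle a,bc\rangle$. Identify $\Sigma_2\times\Sigma_2$ with $V_4$ by sending the generator of the first factor to $a$ and of the second to $bc$; so $E\Sigma_2\times E\Sigma_2=EV_4$, $B\Sigma_2\times B\Sigma_2=BV_4$. Put $\tilde x_q\times\tilde x_p=EZ(\tilde x_q\otimes\tilde x_p)\in N_*(EV_4)$ and $x_q\times x_p=EZ(x_q\otimes x_p)\in N_*(BV_4)$. The bijection $(T^{\epsilon_1},T^{\epsilon_2},T^{\epsilon_3})\mapsto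 c^{\epsilon_3}b^{\epsilon_2}a^{\epsilon_1}$ on vertices ($\epsilon_i\in\{0,1\}$) identifies the simplicial sets $E\Sigma_2\times E\Sigma_2\times E\Sigma_2=ED_8$. **$\Phi$, $\Psi$, $J_\Psi$.** $\Phi=(\mathrm{Id}\otimes\widetilde{AW}_\Delta)\circ(AW_\Delta\otimes\mathrm{Id}):N_*(E\Sigma_2)^{\otimes2}\to N_*(E\Sigma_2)^{\otimes3}$, and $\Psi=EZ\circ\Phi\circ AW:N_*(EV_4)=N_*(E\Sigma_2\times E\Sigma_2)\to N_*(E\Sigma_2\times E\Sigma_2\times E\Sigma_2)=N_*(ED_8)$. Define $$J_\Psi(g_0,\dots,g_k)=\sum_{j=0}^k(g_0,\dots,g_j)*\Psi(g_j,\dots,g_k)\in N_{k+1}(ED_8),\qquad g_i\in V_4.$$ It is $V_4$-equivariant and induces $\bar J_\Psi:N_*(BV_4)\to N_{*+1}(BD_8)$. **Action of $N_*(B\Sigma_4)$ on cochains.** Let $\mathcal S_r(k)$ be the $\mathbb{F}_2$-vector space on sequences $A=(A(1),\dots,A(r+k))$ in $\{1,\dots,r\}$, modulo non-surjective sequences and those with two equal consecutive entries. $A\in\mathcal S_r(k)$ acts on $\alpha_1\otimes\cdots\otimes\alpha_r$ (of total degree $k+N$) by $$\langle A(\alpha_1\otimes\cdots\otimes\alpha_r),u\rangle=\sum\prod_{\ell=1}^r\langle\alpha_\ell,u(I(\ell))\rangle,\qquad u:\Delta^N\to X,$$ the sum over all divisions of $\{0,\dots,N\}$ into $r+k$ non-empty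 intervals $I_1,\dots,I_{r+k}$, where $I_1$ starts at $0$, $I_{r+k}$ ends at $N$, the last point of each interval is the first point of the next, and $I_j\cap I_{j'}=\emptyset$ whenever $j\ne j'$ and $A(j)=A(j')$; $I(\ell)=\bigcup_{A(j)=\ell}I_j$. Evaluation on a face of the wrong dimension is $0$. Table reduction $TR:N_k(E\Sigma_r)\to\mathcal S_r(k)$ is $TR(\sigma_0,\dots,\sigma_k)=\sum_{\mathbf a}s_{\mathbf a}$ over tuples $\mathbf a=(a_0,\dots,a_k)$ of integers $\ge1$ with $\sum a_i=k+r$. Here $s_{\mathbf a}$ is formed from the table with rows $(\sigma_i(1),\dots,\sigma_i(r))$, $i=0,\dots,k$: write the first $a_0$ entries of row $0$, then delete all but the last of these values from all lower rows; append the first $a_1$ remaining entries of row $1$, then delete all but the last of these values from all lower rows; and so on through row $k$. For $y\in N_k(B\Sigma_4)$ and $\alpha\in N^n(X)$, $y(\alpha):=TR(\tilde y)(\alpha^{\otimes4})\in N^{4n-k}(X)$, where $\tilde y\in N_k(E\Sigma_4)$ is any lift of $y$ (the result is independent of the lift). *)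

theory Defs
  imports
    "HOL-Library.Z2"
    "HOL-Library.Poly_Mapping"
    "HOL-Library.Function_Algebras"
    "HOL-Algebra.Sym_Groups"
    "HOL-Algebra.Generated_Groups"
begin

section \<open>Simplicial sets\<close>

text \<open>
  A simplicial set is stored as the graded set of all its simplices, each simplex knowing its
  dimension. A weakly monotone map from \<open>[m]\<close> to \<open>[n]\<close> is the list of its \<open>m + 1\<close> values, and
  \<open>spull X u \<theta>\<close> is the contravariant action of \<open>\<theta>\<close> on the simplex \<open>u\<close>.
\<close>

record 'a sset =
  simplices :: "'a set"
  sdim :: "'a \<Rightarrow> nat"
  spull :: "'a \<Rightarrow> nat list \<Rightarrow> 'a"

definition mono_lists :: "nat \<Rightarrow> nat list set" where
  "mono_lists n = {\<theta>. \<theta> \<noteq> [] \<and> sorted \<theta> \<and> set \<theta> \<subseteq> {..n}}"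

definition simplicial_set :: "'a sset \<Rightarrow> bool" where
  "simplicial_set X \<longleftrightarrow>
    (\<forall>u\<in>simplices X.
      spull X u [0..<Suc (sdim X u)] = u \<and>
      (\<forall>\<theta>\<in>mono_lists (sdim X u).
        spull X u \<theta> \<in> simplices X \<and>
        sdim X (spull X u \<theta>) = length \<theta> - 1 \<and>
        (\<forall>\<eta>\<in>mono_lists (length \<theta> - 1).
          spull X (spull X u \<theta>) \<eta> = spull X u (map ((!) \<theta>) \<eta>))))"

definition sdegen :: "'a sset \<Rightarrow> nat \<Rightarrow> 'a \<Rightarrow> 'a" where
  "sdegen X j v = spull X v ([0..<Suc j] @ [j..<Suc (sdim X v)])"

definition nondegenerate :: "'a sset \<Rightarrow> 'a set" where
  "nondegenerate X =
    {u \<in> simplices X. \<not> (\<exists>v\<in>simplices X. \<exists>j\<le>sdim X v. u = sdegen X j v)}"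

text \<open>The face \<open>u(I)\<close> spanned by a nonempty set \<open>I\<close> of vertices.\<close>

definition sface :: "'a sset \<Rightarrow> 'a \<Rightarrow> nat set \<Rightarrow> 'a" where
  "sface X u I = spull X u (sorted_list_of_set I)"

text \<open>Simplices of the product are the pairs of simplices of equal dimension.\<close>

definition sprod :: "'a sset \<Rightarrow> 'b sset \<Rightarrow> ('a \<times> 'b) sset" where
  "sprod Y Z =
    \<lparr>simplices = {(u, v). u \<in> simplices Y \<and> v \<in> simplices Z \<and> sdim Y u = sdim Z v},
     sdim = (\<lambda>(u, v). sdim Y u),
     spull = (\<lambda>(u, v) \<theta>. (spull Y u \<theta>, spull Z v \<theta>))\<rparr>"


section \<open>Normalized chains and cochains over the field with two elements\<close>

text \<open>
  The normalized chains of \<open>X\<close> have the nondegenerate simplices as a basis, so a chain is a finitely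
  supported function that vanishes off them, and \<open>cls X u\<close> is the class of an
  arbitrary simplex \<open>u\<close>. Likewise an element of \<open>N(Y) \<otimes> N(Z)\<close> is a finitely supported function on
  pairs of nondegenerate simplices (of independent dimensions).
\<close>

type_synonym 'a chain = "'a \<Rightarrow>\<^sub>0 bit"
type_synonym 'a cochain = "'a \<Rightarrow> bit"

definition basis :: "'a \<Rightarrow> 'a chain" where
  "basis u = Poly_Mapping.single u 1"

definition cls :: "'a sset \<Rightarrow> 'a \<Rightarrow> 'a chain" where
  "cls X u = (if u \<in> nondegenerate X then basis u else 0)"

definition chains :: "'a sset \<Rightarrow> nat \<Rightarrow> 'a chain set" where
  "chains X k = {c. Poly_Mapping.keys c \<subseteq> {u \<in> nondegenerate X. sdim X u = k}}"

text \<open>Linear extension; every nonzero coefficient is \<open>1\<close>.\<close>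

definition lin :: "('a \<Rightarrow> 'b chain) \<Rightarrow> 'a chain \<Rightarrow> 'b chain" where
  "lin f c = (\<Sum>u\<in>Poly_Mapping.keys c. f u)"

definition tensor :: "'a chain \<Rightarrow> 'b chain \<Rightarrow> ('a \<times> 'b) chain" where
  "tensor c e = lin (\<lambda>u. lin (\<lambda>v. basis (u, v)) e) c"

definition tensor_swap :: "('a \<times> 'b) chain \<Rightarrow> ('b \<times> 'a) chain" where
  "tensor_swap = lin (\<lambda>(u, v). basis (v, u))"

text \<open>The map on chains induced by a simplicial map into \<open>Z\<close>.\<close>

definition push :: "'b sset \<Rightarrow> ('a \<Rightarrow> 'b) \<Rightarrow> 'a chain \<Rightarrow> 'b chain" where
  "push Z f = lin (\<lambda>u. cls Z (f u))"

definition boundary :: "'a sset \<Rightarrow> 'a chain \<Rightarrow> 'a chain" where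
  "boundary X = lin (\<lambda>u. if sdim X u = 0 then 0
     else \<Sum>i\<le>sdim X u. cls X (sface X u ({..sdim X u} - {i})))"

text \<open>
  A cochain is given by its values on the basis of nondegenerate simplices and is \<open>0\<close> on
  everything else; \<open>cochains X n\<close> is \<open>N\<^sup>n(X)\<close>.
\<close>

definition cochains :: "'a sset \<Rightarrow> nat \<Rightarrow> 'a cochain set" where
  "cochains X n = {\<beta>. \<forall>u. \<beta> u \<noteq> 0 \<longrightarrow> u \<in> nondegenerate X \<and> sdim X u = n}"

definition on_basis :: "'a sset \<Rightarrow> ('a \<Rightarrow> bit) \<Rightarrow> 'a cochain" where
  "on_basis X f = (\<lambda>u. if u \<in> nondegenerate X then f u else 0)"

definition pairing :: "'a cochain \<Rightarrow> 'a chain \<Rightarrow> bit" where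
  "pairing \<beta> c = (\<Sum>u\<in>Poly_Mapping.keys c. \<beta> u)"

definition cotensor :: "'a cochain \<Rightarrow> 'b cochain \<Rightarrow> ('a \<times> 'b) cochain" where
  "cotensor \<beta> \<gamma> = (\<lambda>(u, v). \<beta> u * \<gamma> v)"

definition cobd :: "'a sset \<Rightarrow> 'a cochain \<Rightarrow> 'a cochain" where
  "cobd X \<beta> = on_basis X (\<lambda>u. pairing \<beta> (boundary X (basis u)))"


section \<open>Eilenberg-Zilber, Alexander-Whitney and Steenrod maps\<close>

text \<open>Maximal chains of the product poset \<open>[k] \<times> [m]\<close>, listed increasingly.\<close>

definition max_chains :: "nat \<Rightarrow> nat \<Rightarrow> (nat \<times> nat) list set" where
  "max_chains k m =
    {w. length w = k + m + 1 \<and> set w \<subseteq> {..k} \<times> {..m} \<and>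
        sorted_wrt (\<lambda>x y. fst x \<le> fst y \<and> snd x \<le> snd y \<and> x \<noteq> y) w}"

definition EZ :: "'a sset \<Rightarrow> 'b sset \<Rightarrow> ('a \<times> 'b) chain \<Rightarrow> ('a \<times> 'b) chain" where
  "EZ Y Z = lin (\<lambda>(u, v). \<Sum>w\<in>max_chains (sdim Y u) (sdim Z v).
     cls (sprod Y Z) (spull Y u (map fst w), spull Z v (map snd w)))"

definition EZ3 ::
  "'a sset \<Rightarrow> 'b sset \<Rightarrow> 'c sset \<Rightarrow> ('a \<times> 'b \<times> 'c) chain \<Rightarrow> ('a \<times> 'b \<times> 'c) chain" where
  "EZ3 Y Z W = lin (\<lambda>(u, v, w). EZ Y (sprod Z W) (tensor (basis u) (EZ Z W (basis (v, w)))))"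

definition AW :: "'a sset \<Rightarrow> 'b sset \<Rightarrow> ('a \<times> 'b) chain \<Rightarrow> ('a \<times> 'b) chain" where
  "AW Y Z = lin (\<lambda>(u, v). \<Sum>i\<le>sdim Y u.
     tensor (cls Y (sface Y u {0..i})) (cls Z (sface Z v {i..sdim Z v})))"

definition AW_diag :: "'a sset \<Rightarrow> 'a chain \<Rightarrow> ('a \<times> 'a) chain" where
  "AW_diag Y = lin (\<lambda>u. \<Sum>i\<le>sdim Y u.
     tensor (cls Y (sface Y u {0..i})) (cls Y (sface Y u {i..sdim Y u})))"

definition EG :: "('g, 'm) monoid_scheme \<Rightarrow> 'g list sset" where
  "EG G = \<lparr>simplices = {l. l \<noteq> [] \<and> set l \<subseteq> carrier G},
           sdim = (\<lambda>l. length l - 1),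
           spull = (\<lambda>l \<theta>. map ((!) l) \<theta>)\<rparr>"

type_synonym perm = "nat \<Rightarrow> nat"

definition Sigma2 :: "perm monoid" where
  "Sigma2 = sym_group 2"

definition swap12 :: perm where
  "swap12 = transpose 1 2"

definition xt :: "nat \<Rightarrow> perm list" where
  "xt k = map (\<lambda>i. swap12 ^^ i) [0..<Suc k]"

text \<open>
  With \<open>t\<close> the list of division points of \<open>{0..N}\<close>, including the end points \<open>0\<close> and \<open>N\<close>, the
  intervals are numbered from \<open>1\<close>.
\<close>

definition interval :: "nat list \<Rightarrow> nat \<Rightarrow> nat set" where
  "interval t s = {t ! (s - 1) .. t ! s}"

definition steenrod_diag :: "'a sset \<Rightarrow> nat \<Rightarrow> 'a \<Rightarrow> ('a \<times> 'a) chain" where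
  "steenrod_diag Y m u =
    (\<Sum>k\<in>{k. length k = m + 1 \<and> sorted_wrt (<) k \<and> set k \<subseteq> {..sdim Y u}}.
      let t = 0 # k @ [sdim Y u] in
        tensor (cls Y (sface Y u (\<Union>s\<in>{s\<in>{1..m + 2}. odd s}. interval t s)))
               (cls Y (sface Y u (\<Union>s\<in>{s\<in>{1..m + 2}. even s}. interval t s))))"

text \<open>The only nondegenerate \<open>m\<close>-simplices of the universal bundle of \<open>Sigma2\<close> are \<open>xt m\<close> and its
  translate by \<open>swap12\<close>.\<close>

definition steenrod_AW :: "'a sset \<Rightarrow> (perm list \<times> 'a) chain \<Rightarrow> ('a \<times> 'a) chain" where
  "steenrod_AW Y = lin (\<lambda>(e, u). let m = length e - 1 in
     if e = xt m then steenrod_diag Y m u else tensor_swap (steenrod_diag Y m u))"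

definition cup :: "'a sset \<Rightarrow> nat \<Rightarrow> 'a cochain \<Rightarrow> 'a cochain \<Rightarrow> 'a cochain" where
  "cup X m \<beta> \<gamma> = on_basis X (\<lambda>u.
     pairing (cotensor \<beta> \<gamma>) (steenrod_AW X (tensor (basis (xt m)) (basis u))))"

text \<open>\<open>Sq X i k \<beta>\<close> is the cochain \<open>Sq\<^sup>k(\<beta>)\<close> for \<open>\<beta>\<close> of degree \<open>i\<close>.\<close>

definition Sq :: "'a sset \<Rightarrow> int \<Rightarrow> int \<Rightarrow> 'a cochain \<Rightarrow> 'a cochain" where
  "Sq X i k \<beta> = (if k > i then 0 else cup X (nat (i - k)) \<beta> \<beta>)"


section \<open>Classifying spaces\<close>

definition tuple_orbit :: "('g, 'm) monoid_scheme \<Rightarrow> 'g list \<Rightarrow> 'g list set" where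
  "tuple_orbit G l = (\<lambda>g. map (\<lambda>h. g \<otimes>\<^bsub>G\<^esub> h) l) ` carrier G"

definition BG :: "('g, 'm) monoid_scheme \<Rightarrow> 'g list set sset" where
  "BG G = \<lparr>simplices = tuple_orbit G ` simplices (EG G),
           sdim = (\<lambda>Q. sdim (EG G) (SOME l. l \<in> Q)),
           spull = (\<lambda>Q \<theta>. (\<lambda>l. spull (EG G) l \<theta>) ` Q)\<rparr>"

definition BG_proj :: "('g, 'm) monoid_scheme \<Rightarrow> 'g list chain \<Rightarrow> 'g list set chain" where
  "BG_proj G = push (BG G) (tuple_orbit G)"

definition lift_chain :: "('g, 'm) monoid_scheme \<Rightarrow> nat \<Rightarrow> 'g list set chain \<Rightarrow> 'g list chain" where
  "lift_chain G k y = (SOME c. c \<in> chains (EG G) k \<and> BG_proj G c = y)"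

text \<open>The inclusion of the chains of \<open>BG H\<close>, for any subgroup \<open>H\<close> of \<open>G\<close>, into those of \<open>BG G\<close>:
  an \<open>H\<close>-orbit goes to the \<open>G\<close>-orbit containing it.\<close>

definition BG_incl :: "('g, 'm) monoid_scheme \<Rightarrow> 'g list set chain \<Rightarrow> 'g list set chain" where
  "BG_incl G = push (BG G) (\<lambda>Q. \<Union>l\<in>Q. tuple_orbit G l)"

definition join_chain :: "('g, 'm) monoid_scheme \<Rightarrow> 'g list chain \<Rightarrow> 'g list chain \<Rightarrow> 'g list chain" where
  "join_chain G c e = lin (\<lambda>(l, l'). cls (EG G) (l @ l')) (tensor c e)"


section \<open>The groups\<close>

definition perm_a :: perm where
  "perm_a = transpose 1 3 \<circ> transpose 2 4"

definition perm_b :: perm where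
  "perm_b = transpose 1 2"

definition perm_c :: perm where
  "perm_c = transpose 3 4"

definition Sigma4 :: "perm monoid" where
  "Sigma4 = sym_group 4"

definition D8 :: "perm monoid" where
  "D8 = Sigma4\<lparr>carrier := generate Sigma4 {perm_a, perm_b, perm_c}\<rparr>"

definition V4 :: "perm monoid" where
  "V4 = Sigma4\<lparr>carrier := generate Sigma4 {perm_a, perm_b \<circ> perm_c}\<rparr>"

text \<open>The power \<open>g\<^sup>\<epsilon>\<close>, where the element \<open>s = swap12\<^sup>\<epsilon>\<close> of \<open>Sigma2\<close> encodes the exponent.\<close>

definition pow_by :: "perm \<Rightarrow> perm \<Rightarrow> perm" where
  "pow_by g s = (if s = swap12 then g else id)"

definition V4_iso :: "perm \<times> perm \<Rightarrow> perm" where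
  "V4_iso = (\<lambda>(s, t). pow_by perm_a s \<circ> pow_by (perm_b \<circ> perm_c) t)"

definition D8_bij :: "perm \<times> perm \<times> perm \<Rightarrow> perm" where
  "D8_bij = (\<lambda>(s1, s2, s3). pow_by perm_c s3 \<circ> pow_by perm_b s2 \<circ> pow_by perm_a s1)"

text \<open>The identifications of simplicial sets given vertexwise by these bijections: of \<open>EV\<^sub>4\<close>
  with \<open>E\<Sigma>\<^sub>2 \<times> E\<Sigma>\<^sub>2\<close>, and of \<open>E\<Sigma>\<^sub>2 \<times> E\<Sigma>\<^sub>2 \<times> E\<Sigma>\<^sub>2\<close> with \<open>ED\<^sub>8\<close>.\<close>

definition EV4_split :: "perm list \<Rightarrow> perm list \<times> perm list" where
  "EV4_split l =
    (let w = map (inv_into (carrier Sigma2 \<times> carrier Sigma2) V4_iso) l in (map fst w, map snd w))"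

definition ED8_merge :: "perm list \<times> perm list \<times> perm list \<Rightarrow> perm list" where
  "ED8_merge = (\<lambda>(e, f, g). map D8_bij (zip e (zip f g)))"

text \<open>The identification of \<open>B\<Sigma>\<^sub>2 \<times> B\<Sigma>\<^sub>2\<close> with \<open>BV\<^sub>4\<close>.\<close>

definition BV4_merge :: "perm list set \<times> perm list set \<Rightarrow> perm list set" where
  "BV4_merge = (\<lambda>(P, Q). {map V4_iso (zip e f) | e f. e \<in> P \<and> f \<in> Q})"

definition xB :: "nat \<Rightarrow> perm list set chain" where
  "xB k = BG_proj Sigma2 (basis (xt k))"

definition x_cross :: "nat \<Rightarrow> nat \<Rightarrow> perm list set chain" where
  "x_cross q p = push (BG V4) BV4_merge (EZ (BG Sigma2) (BG Sigma2) (tensor (xB q) (xB p)))"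


section \<open>The chain homotopy\<close>

definition Phi :: "(perm list \<times> perm list) chain \<Rightarrow> (perm list \<times> perm list \<times> perm list) chain" where
  "Phi = lin (\<lambda>(e, f). lin (\<lambda>(e', e'').
     tensor (basis e') (steenrod_AW (EG Sigma2) (basis (e'', f)))) (AW_diag (EG Sigma2) (basis e)))"

definition Psi :: "perm list chain \<Rightarrow> perm list chain" where
  "Psi c = push (EG D8) ED8_merge
     (EZ3 (EG Sigma2) (EG Sigma2) (EG Sigma2)
       (Phi (AW (EG Sigma2) (EG Sigma2)
         (push (sprod (EG Sigma2) (EG Sigma2)) EV4_split c))))"

definition J_Psi :: "perm list chain \<Rightarrow> perm list chain" where
  "J_Psi = lin (\<lambda>l. \<Sum>j<length l.
     join_chain D8 (cls (EG D8) (take (Suc j) l)) (Psi (cls (EG V4) (drop j l))))"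

text \<open>The map induced on chains of degree \<open>k\<close> of \<open>BV\<^sub>4\<close>, computed on any lift.\<close>

definition Jbar_Psi :: "nat \<Rightarrow> perm list set chain \<Rightarrow> perm list set chain" where
  "Jbar_Psi k y = BG_proj D8 (J_Psi (lift_chain V4 k y))"


section \<open>Surjection operations and table reduction\<close>

text \<open>The class of a sequence in \<open>\<S>\<^sub>r\<close>, in the basis of the surjective sequences without equal
  consecutive entries.\<close>

definition surj_cls :: "nat \<Rightarrow> nat list \<Rightarrow> nat list chain" where
  "surj_cls r A = (if set A = {1..r} \<and> (\<forall>i. Suc i < length A \<longrightarrow> A ! i \<noteq> A ! Suc i)
     then basis A else 0)"

definition divisions :: "nat list \<Rightarrow> nat \<Rightarrow> nat list set" where
  "divisions A N =
    {t. length t = length A + 1 \<and> sorted t \<and> hd t = 0 \<and> last t = N \<and>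
        (\<forall>j\<in>{1..length A}. \<forall>j'\<in>{1..length A}.
           j \<noteq> j' \<and> A ! (j - 1) = A ! (j' - 1) \<longrightarrow> interval t j \<inter> interval t j' = {})}"

definition seq_act :: "'a sset \<Rightarrow> nat \<Rightarrow> nat list \<Rightarrow> (nat \<Rightarrow> 'a cochain) \<Rightarrow> 'a cochain" where
  "seq_act X r A \<alpha>s = on_basis X (\<lambda>u.
     \<Sum>t\<in>divisions A (sdim X u). \<Prod>l\<in>{1..r}.
       \<alpha>s l (sface X u (\<Union>j\<in>{j\<in>{1..length A}. A ! (j - 1) = l}. interval t j)))"

definition surj_act :: "'a sset \<Rightarrow> nat \<Rightarrow> nat list chain \<Rightarrow> (nat \<Rightarrow> 'a cochain) \<Rightarrow> 'a cochain" where
  "surj_act X r c \<alpha>s = (\<Sum>A\<in>Poly_Mapping.keys c. seq_act X r A \<alpha>s)"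

fun table_seq :: "nat list \<Rightarrow> nat list list \<Rightarrow> nat list" where
  "table_seq (a # as) (row # rows) =
     (let w = take a row in
       w @ table_seq as (map (filter (\<lambda>v. v \<notin> set (butlast w))) rows))"
| "table_seq _ _ = []"

definition TR :: "nat \<Rightarrow> perm list chain \<Rightarrow> nat list chain" where
  "TR r = lin (\<lambda>\<sigma>s.
     \<Sum>a\<in>{a. length a = length \<sigma>s \<and> (\<forall>i\<in>set a. 1 \<le> i) \<and> sum_list a = (length \<sigma>s - 1) + r}.
       surj_cls r (table_seq a (map (\<lambda>\<sigma>. map \<sigma> [1..<Suc r]) \<sigma>s)))"

text \<open>\<open>Sigma4_act X k y \<alpha>\<close> is \<open>y(\<alpha>)\<close> for a \<open>k\<close>-chain \<open>y\<close> of \<open>B\<Sigma>\<^sub>4\<close>.\<close>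

definition Sigma4_act :: "'a sset \<Rightarrow> nat \<Rightarrow> perm list set chain \<Rightarrow> 'a cochain \<Rightarrow> 'a cochain" where
  "Sigma4_act X k y \<alpha> = surj_act X 4 (TR 4 (lift_chain Sigma4 k y)) (\<lambda>_. \<alpha>)"


section \<open>The right-hand side\<close>

definition binom2 :: "int \<Rightarrow> int \<Rightarrow> bit" where
  "binom2 A B = (if 0 \<le> B \<and> B \<le> A then of_nat (nat A choose nat B) else 0)"

definition smul :: "bit \<Rightarrow> 'a cochain \<Rightarrow> 'a cochain" where
  "smul r \<beta> = (\<lambda>u. r * \<beta> u)"

text \<open>The half-integers \<open>\<ell>\<close> and \<open>a\<close> are indexed by the integers \<open>L = 2\<ell>\<close> and \<open>A = 2a\<close>; since
  \<open>A \<equiv> L (mod 2)\<close>, the divisions below are exact and give \<open>\<ell> + a\<close> and \<open>\<ell> - a\<close>.\<close>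

definition N_cochain :: "'a sset \<Rightarrow> int \<Rightarrow> int \<Rightarrow> int \<Rightarrow> 'a cochain \<Rightarrow> 'a cochain" where
  "N_cochain X q p n \<alpha> =
    (\<Sum>(L, A)\<in>{(L, A). 0 < A \<and> A \<le> L \<and> L \<le> p \<and> even (L - A) \<and> 0 \<le> q - p + L}.
      smul (binom2 (p - (L + A) div 2) (p - L) * binom2 (p - (L - A) div 2) (p - L))
        (cup X (nat (q - p + L + 1))
          (Sq X n (n - p + (L + A) div 2) \<alpha>)
          (Sq X n (n - p + (L - A) div 2) \<alpha>)))"

end

theory Submission
  imports Defs
begin

text \<open>
  A chain is determined by the values on it of functions of vertex lists that vanish on lists with
  equal consecutive entries. On such values the Eilenberg-Zilber map, Steenrod's diagonal and the
  divisions into intervals are all sums over lattice paths, and deleting one entry acts on these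
  sums as a derivation. Hence \<open>\<Psi>\<close> is a chain map, \<open>J\<^sub>\<Psi>\<close> is a homotopy from the inclusion to
  \<open>\<Psi>\<close>, and, \<open>\<alpha>\<close> being a cocycle, the left-hand side is the action of \<open>\<Psi>(x\<^sub>q \<times> x\<^sub>p)\<close>. As
  \<open>AW \<circ> EZ\<close> is the identity, this is the product of \<open>\<Phi>(x\<^sub>q \<otimes> x\<^sub>p)\<close>, that is, of the \<open>x\<^sub>i\<close> with
  Steenrod's diagonal of \<open>x\<^sub>q\<^sub>-\<^sub>i \<otimes> x\<^sub>p\<close>, where with \<open>m = q - i\<close> and \<open>r + s = m + p\<close> the coefficient
  of \<open>x\<^sub>r \<otimes> x\<^sub>s\<close> is \<open>(r choose m) (s choose m)\<close>. Table reduction turns \<open>x\<^sub>i \<times> x\<^sub>r \<times> x\<^sub>s\<close> into the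
  operation \<open>(\<alpha> \<smile>\<^sub>r \<alpha>) \<smile>\<^sub>i (\<alpha> \<smile>\<^sub>s \<alpha>)\<close>. The terms with \<open>r = s\<close> are the iterated squares, and the
  terms for \<open>(r, s)\<close> and \<open>(s, r)\<close> add up to the coboundary of a \<open>\<smile>\<^sub>i\<^sub>+\<^sub>1\<close>-product.
\<close>

section \<open>Sums over lists of words\<close>

declare add_bit_eq_xor [simp del] mult_bit_eq_and [simp del]

lemma bit_add_self [simp]: "(x::bit) + x = 0"
  by (cases x) simp_all

lemma bit_add_self_left [simp]: "(x::bit) + (x + y) = y"
  by (simp flip: add.assoc)

lemma char2_eqI: "x + y = 0 \<Longrightarrow> (x::bit) = y"
  by (cases x; cases y) simp_all

lemma sum_list_concat: "sum_list (concat xss) = (\<Sum>xs\<leftarrow>xss. sum_list xs)"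
  by (induction xss) auto

lemma sum_list_swap:
  "(\<Sum>x\<leftarrow>xs. \<Sum>y\<leftarrow>ys. f x y) = (\<Sum>y\<leftarrow>ys. \<Sum>x\<leftarrow>xs. (f x y :: 'a :: comm_monoid_add))"
  by (induction xs) (simp_all add: sum_list_addf)

lemma sum_list_sum_swap:
  "(\<Sum>x\<leftarrow>xs. \<Sum>y\<in>A. f x y) = (\<Sum>y\<in>A. \<Sum>x\<leftarrow>xs. (f x y :: 'a :: comm_monoid_add))"
  by (induction xs) (simp_all add: sum.distrib)

lemma sum_list_zero: "(\<And>x. x \<in> set xs \<Longrightarrow> f x = 0) \<Longrightarrow> (\<Sum>x\<leftarrow>xs. f x) = (0::'a::monoid_add)"
  by (induction xs) auto

lemma sum_list_cong: "(\<And>x. x \<in> set xs \<Longrightarrow> f x = g x) \<Longrightarrow> (\<Sum>x\<leftarrow>xs. f x) = (\<Sum>x\<leftarrow>xs. g x)"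
  by (metis map_eq_conv)

primrec dels :: "'a list \<Rightarrow> 'a list list" where
  "dels [] = []"
| "dels (x # xs) = xs # map ((#) x) (dels xs)"

lemma length_dels: "w \<in> set (dels xs) \<Longrightarrow> Suc (length w) = length xs"
  by (induction xs arbitrary: w) auto

lemma set_dels: "w \<in> set (dels xs) \<Longrightarrow> set w \<subseteq> set xs"
  by (induction xs arbitrary: w) fastforce+

lemma dels_map: "dels (map f xs) = map (map f) (dels xs)"
  by (induction xs) auto

lemma sum_dels_nil:
  "(\<Sum>w\<leftarrow>dels u. if w = [] then c else 0) = (if length u = 1 then c else (0::bit))"
  by (cases u) (auto simp: o_def)

lemma sum_dels_stutter:
  assumes "\<And>w. \<not> distinct_adj w \<Longrightarrow> f w = (0::bit)" and "\<not> distinct_adj xs"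
  shows "(\<Sum>w\<leftarrow>dels xs. f w) = 0"
  using assms
proof (induction xs arbitrary: f)
  case (Cons x xs)
  show ?case
  proof (cases xs)
    case Nil then show ?thesis using Cons by simp
  next
    case (Cons y ys)
    show ?thesis
    proof (cases "x = y")
      case True
      have "(\<Sum>w\<leftarrow>dels ys. f (x # x # w)) = 0"
        by (rule sum_list_zero) (simp add: Cons.prems(1))
      then show ?thesis using Cons True by (simp add: o_def)
    next
      case False
      then have *: "\<not> distinct_adj xs" using Cons.prems Cons by simp
      have "(\<Sum>w\<leftarrow>dels xs. f (x # w)) = 0"
        by (rule Cons.IH[OF _ *]) (auto intro!: Cons.prems(1) dest: distinct_adj_ConsD)
      then show ?thesis using * by (simp add: o_def Cons.prems(1))
    qed
  qed
qed simp


section \<open>Shuffles\<close>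

text \<open>
  The paths in \<open>shuf u v\<close> are the Eilenberg-Zilber simplices of \<open>u \<times> v\<close>. A path in \<open>shuf A V\<close> is also
  a division of the vertices \<open>V\<close> into intervals numbered by the letters of \<open>A\<close>, and \<open>proj l\<close> reads off
  the face spanned by the intervals with the letter \<open>l\<close>.
\<close>

fun shuf :: "'a list \<Rightarrow> 'b list \<Rightarrow> ('a \<times> 'b) list list" where
  "shuf [] v = []"
| "shuf (x # u) [] = []"
| "shuf (x # u) (y # v) =
     map ((#) (x, y)) (if u = [] \<and> v = [] then [[]] else shuf u (y # v) @ shuf (x # u) v)"

lemma shuf_Nil2 [simp]: "shuf u [] = []"
  by (cases u) auto

lemma sum_shuf_Cons:
  "(\<Sum>w\<leftarrow>shuf (x # u) (y # v). f w) =
     (if u = [] \<and> v = [] then f [(x, y)] else 0) +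
     (\<Sum>w\<leftarrow>shuf u (y # v). f ((x, y) # w)) + (\<Sum>w\<leftarrow>shuf (x # u) v. f ((x, y) # w))"
  for f :: "_ \<Rightarrow> bit"
  by (auto simp: o_def)

declare shuf.simps(3) [simp del]

lemma shuf_dels:
  fixes f :: "_ \<Rightarrow> bit"
  shows "(\<Sum>w\<leftarrow>shuf u v. \<Sum>w'\<leftarrow>dels w. f w') =
    (\<Sum>u'\<leftarrow>dels u. \<Sum>w\<leftarrow>shuf u' v. f w) + (\<Sum>v'\<leftarrow>dels v. \<Sum>w\<leftarrow>shuf u v'. f w) +
    (if length u = 1 \<and> length v = 1 then f [] else 0)"
proof (induction u v arbitrary: f rule: shuf.induct)
  case (3 x u y v)
  show ?case
  proof (cases "u = [] \<and> v = []")
    case True then show ?thesis by (simp add: sum_shuf_Cons)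
  next
    case False
    note IH = "3.IH"[OF False, where f="\<lambda>w. f ((x, y) # w)"]
    have *: "(\<Sum>w'\<leftarrow>dels u. if w' = [] \<and> v = [] then f [(x, y)] else 0) = (if length u = 1 \<and> v = [] then f [(x, y)] else 0)"
      "(\<Sum>w'\<leftarrow>dels v. if u = [] \<and> w' = [] then f [(x, y)] else 0) = (if length v = 1 \<and> u = [] then f [(x, y)] else 0)"
      by (cases "u = []"; cases "v = []"; simp add: sum_dels_nil)+
    show ?thesis using False
      by - (rule char2_eqI, auto simp: sum_shuf_Cons sum_list_addf o_def IH * ac_simps)
  qed
qed (simp_all add: o_def)

lemma length_shuf: "w \<in> set (shuf u v) \<Longrightarrow> Suc (length w) = length u + length v"
  by (induction u v arbitrary: w rule: shuf.induct) (auto simp: shuf.simps(3) split: if_splits)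

lemma set_shuf: "w \<in> set (shuf u v) \<Longrightarrow> set w \<subseteq> set u \<times> set v"
  by (induction u v arbitrary: w rule: shuf.induct) (fastforce simp: shuf.simps(3) split: if_splits)+

lemma hd_shuf: "w \<in> set (shuf (x # u) (y # v)) \<Longrightarrow> \<exists>w'. w = (x, y) # w'"
  by (auto simp: shuf.simps(3) split: if_splits)

lemma shuf_map: "shuf (map f u) (map g v) = map (map (map_prod f g)) (shuf u v)"
  by (induction u v rule: shuf.induct) (auto simp: shuf.simps(3))

lemma shuf_swap:
  fixes f :: "_ \<Rightarrow> bit"
  shows "(\<Sum>w\<leftarrow>shuf v u. f w) = (\<Sum>w\<leftarrow>shuf u v. f (map prod.swap w))"
  by (induction u v arbitrary: f rule: shuf.induct) (auto simp: sum_shuf_Cons)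

lemma shuf_stutter1: "\<not> distinct_adj u \<Longrightarrow> w \<in> set (shuf u v) \<Longrightarrow> \<not> distinct_adj w"
proof (induction u v arbitrary: w rule: shuf.induct)
  case (3 x u y v)
  then have ne: "\<not> (u = [] \<and> v = [])" by auto
  from "3.prems" ne obtain w' where w: "w = (x, y) # w'" and
    w': "w' \<in> set (shuf u (y # v)) \<or> w' \<in> set (shuf (x # u) v)"
    by (auto simp: shuf.simps(3))
  show ?case
  proof (cases "w' \<in> set (shuf (x # u) v)")
    case True
    then show ?thesis using "3.IH"(2)[OF ne] "3.prems" w by (auto dest: distinct_adj_ConsD)
  next
    case False
    then have w'': "w' \<in> set (shuf u (y # v))" using w' by simp
    then obtain z u' where u: "u = z # u'" by (cases u) auto
    show ?thesis
    proof (cases "x = z")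
      case True then show ?thesis using w w'' u hd_shuf by fastforce
    next
      case False
      then have "\<not> distinct_adj u" using "3.prems" u by simp
      then show ?thesis using "3.IH"(1)[OF ne _ w''] w by (auto dest: distinct_adj_ConsD)
    qed
  qed
qed auto

lemma shuf_stutter2: "\<not> distinct_adj v \<Longrightarrow> w \<in> set (shuf u v) \<Longrightarrow> \<not> distinct_adj w"
proof (induction u v arbitrary: w rule: shuf.induct)
  case (3 x u y v)
  then have ne: "\<not> (u = [] \<and> v = [])" by auto
  from "3.prems" ne obtain w' where w: "w = (x, y) # w'" and
    w': "w' \<in> set (shuf u (y # v)) \<or> w' \<in> set (shuf (x # u) v)"
    by (auto simp: shuf.simps(3))
  show ?case
  proof (cases "w' \<in> set (shuf u (y # v))")
    case True
    then show ?thesis using "3.IH"(1)[OF ne] "3.prems" w by (auto dest: distinct_adj_ConsD)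
  next
    case False
    then have w'': "w' \<in> set (shuf (x # u) v)" using w' by simp
    then obtain z v' where u: "v = z # v'" by (cases v) auto
    show ?thesis
    proof (cases "y = z")
      case True then show ?thesis using w w'' u hd_shuf by fastforce
    next
      case False
      then have "\<not> distinct_adj v" using "3.prems" u by simp
      then show ?thesis using "3.IH"(2)[OF ne _ w''] w by (auto dest: distinct_adj_ConsD)
    qed
  qed
qed auto

definition proj :: "'a \<Rightarrow> ('a \<times> 'b) list \<Rightarrow> 'b list" where
  "proj l w = map snd (filter (\<lambda>p. fst p = l) w)"

lemma proj_simps [simp]:
  "proj l [] = []"
  "proj l ((c, v) # w) = (if c = l then v # proj l w else proj l w)"
  by (auto simp: proj_def)

lemma sum_dels_prod_proj:
  fixes \<phi> :: "'l \<Rightarrow> 'v list \<Rightarrow> bit"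
  assumes "finite \<Lambda>" "fst ` set w \<subseteq> \<Lambda>"
  shows "(\<Sum>w'\<leftarrow>dels w. \<Prod>l\<in>\<Lambda>. \<phi> l (proj l w')) =
    (\<Sum>l\<in>\<Lambda>. (\<Sum>L\<leftarrow>dels (proj l w). \<phi> l L) * (\<Prod>l'\<in>\<Lambda> - {l}. \<phi> l' (proj l' w)))"
  using assms(2)
proof (induction w arbitrary: \<phi>)
  case (Cons p w)
  obtain c v where p: "p = (c, v)" by (cases p)
  have c: "c \<in> \<Lambda>" and w: "fst ` set w \<subseteq> \<Lambda>" using Cons.prems p by auto
  define \<psi> where "\<psi> = \<phi>(c := \<lambda>L. \<phi> c (v # L))"
  have \<psi>: "\<phi> l (proj l (p # w')) = \<psi> l (proj l w')" for l w'
    by (simp add: \<psi>_def p)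
  have *: "(\<Sum>L\<leftarrow>dels (proj l (p # w)). \<phi> l L) =
      (if l = c then \<phi> c (proj c w) else 0) + (\<Sum>L\<leftarrow>dels (proj l w). \<psi> l L)" for l
    by (simp add: p \<psi>_def o_def)
  have "(\<Sum>w'\<leftarrow>dels (p # w). \<Prod>l\<in>\<Lambda>. \<phi> l (proj l w')) =
      (\<Prod>l\<in>\<Lambda>. \<phi> l (proj l w)) + (\<Sum>w'\<leftarrow>dels w. \<Prod>l\<in>\<Lambda>. \<psi> l (proj l w'))"
    by (simp add: \<psi> o_def)
  also have "(\<Prod>l\<in>\<Lambda>. \<phi> l (proj l w)) = \<phi> c (proj c w) * (\<Prod>l'\<in>\<Lambda> - {c}. \<psi> l' (proj l' w))"
    by (subst prod.remove[OF assms(1) c]) (auto simp: \<psi>_def intro!: prod.cong)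
  also have "\<dots> = (\<Sum>l\<in>\<Lambda>. (if l = c then \<phi> c (proj c w) else 0) * (\<Prod>l'\<in>\<Lambda> - {l}. \<psi> l' (proj l' w)))"
    by (subst sum.remove[OF assms(1) c]) (auto intro!: sum.neutral)
  also have "(\<Sum>w'\<leftarrow>dels w. \<Prod>l\<in>\<Lambda>. \<psi> l (proj l w')) =
     (\<Sum>l\<in>\<Lambda>. (\<Sum>L\<leftarrow>dels (proj l w). \<psi> l L) * (\<Prod>l'\<in>\<Lambda> - {l}. \<psi> l' (proj l' w)))"
    by (rule Cons.IH[OF w])
  finally show ?case
    unfolding * \<psi> by (simp add: distrib_right sum.distrib)
qed simp

lemma sorted_shuf:
  "w \<in> set (shuf u v) \<Longrightarrow> sorted v \<Longrightarrow> sorted (map snd w)"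
proof (induction u v arbitrary: w rule: shuf.induct)
  case (3 x u y v)
  show ?case
  proof (cases "u = [] \<and> v = []")
    case True then show ?thesis using "3.prems" by (simp add: shuf.simps(3))
  next
    case False
    obtain w' where w: "w = (x, y) # w'" and
      w': "w' \<in> set (shuf u (y # v)) \<or> w' \<in> set (shuf (x # u) v)"
      using "3.prems" False by (auto simp: shuf.simps(3))
    have "snd ` set w' \<subseteq> set (y # v)" using w' set_shuf by fastforce
    then have "\<forall>z\<in>set (map snd w'). y \<le> z" using "3.prems"(2) by auto
    moreover have "sorted (map snd w')" using w' "3.IH"[OF False] "3.prems"(2) by auto
    ultimately show ?thesis unfolding w by simp
  qed
qed auto

lemma sorted_proj: "sorted (map snd w) \<Longrightarrow> sorted (proj l w)"
  unfolding proj_def by (induction w) auto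

lemma set_proj: "set (proj l w) \<subseteq> snd ` set w"
  by (auto simp: proj_def)

lemma proj_eq_Nil: "l \<notin> fst ` set w \<longleftrightarrow> proj l w = []"
  by (auto simp: proj_def filter_empty_conv)

lemma shuf_stutter_proj:
  assumes "\<not> distinct_adj u" "w \<in> set (shuf u v)"
  shows "\<exists>l\<in>set u. \<not> distinct_adj (proj l w)"
  using assms
proof (induction u v arbitrary: w rule: shuf.induct)
  case (3 x u y v)
  then have ne: "\<not> (u = [] \<and> v = [])" by auto
  have step: "\<not> distinct_adj (proj l w') \<Longrightarrow> \<not> distinct_adj (proj l ((x, y) # w'))" for l w'
    by (cases "x = l"; cases "proj l w'") simp_all
  from "3.prems" ne obtain w' where w: "w = (x, y) # w'" and
    w': "w' \<in> set (shuf u (y # v)) \<or> w' \<in> set (shuf (x # u) v)"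
    by (auto simp: shuf.simps(3))
  show ?case
  proof (cases "w' \<in> set (shuf (x # u) v)")
    case True
    obtain l where l: "l \<in> set (x # u)" "\<not> distinct_adj (proj l w')"
      using "3.IH"(2)[OF ne "3.prems"(1) True] by blast
    show ?thesis unfolding w by (rule bexI[where x=l], rule step[OF l(2)], rule l(1))
  next
    case False
    then have w'': "w' \<in> set (shuf u (y # v))" using w' by simp
    then obtain z u' where u: "u = z # u'" by (cases u) auto
    show ?thesis
    proof (cases "x = z")
      case True
      obtain w2 where "w' = (z, y) # w2" using hd_shuf[OF w''[unfolded u]] by auto
      then have "\<not> distinct_adj (proj x w)" using w True by simp
      then show ?thesis by (rule bexI[where x=x]) simp
    next
      case False
      then have nu: "\<not> distinct_adj u" using "3.prems"(1) u by simp
      then obtain l where l: "l \<in> set u" "\<not> distinct_adj (proj l w')" using "3.IH"(1)[OF ne nu w''] by blast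
      show ?thesis unfolding w by (rule bexI[where x=l], rule step[OF l(2)]) (use l(1) in simp)
    qed
  qed
qed auto

lemma shuf_letters: "w \<in> set (shuf u v) \<Longrightarrow> fst ` set w = set u"
proof (induction u v arbitrary: w rule: shuf.induct)
  case (3 x u y v)
  show ?case
  proof (cases "u = [] \<and> v = []")
    case True then show ?thesis using "3.prems" by (simp add: shuf.simps(3))
  next
    case False
    obtain w' where w: "w = (x, y) # w'" and
      "w' \<in> set (shuf u (y # v)) \<or> w' \<in> set (shuf (x # u) v)"
      using "3.prems" False by (auto simp: shuf.simps(3))
    then show ?thesis using "3.IH"[OF False] unfolding w by auto
  qed
qed auto


section \<open>Table reduction\<close>

text \<open>
  Table reduction one letter at a time: a letter is either used up and removed from all rows, or it
  is the last one taken from its row and stays available. \<open>X\<close> is the set of letters used up.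
\<close>

function tabw :: "'v set \<Rightarrow> 'v list list \<Rightarrow> 'v list list" where
  "tabw X [] = []"
| "tabw X (row # rows) = (case filter (\<lambda>y. y \<notin> X) row of
      [] \<Rightarrow> (if rows = [] then [[]] else [])
    | x # s \<Rightarrow> map ((#) x) (tabw (insert x X) (row # rows) @ tabw X rows))"
  by pat_completeness auto
termination
proof (relation "inv_image (less_than <*lex*> less_than)
    (\<lambda>(X, rows). (length rows, length (filter (\<lambda>y. y \<notin> X) (hd rows))))")
  fix X :: "'v set" and row :: "'v list" and rows x s
  assume s: "filter (\<lambda>y. y \<notin> X) row = x # s"
  have "filter (\<lambda>y. y \<notin> insert x X) row = filter (\<lambda>y. y \<noteq> x) (filter (\<lambda>y. y \<notin> X) row)"
    by (simp add: conj_commute)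
  also have "\<dots> = filter (\<lambda>y. y \<noteq> x) s" unfolding s by simp
  finally have "length (filter (\<lambda>y. y \<notin> insert x X) row) < length (filter (\<lambda>y. y \<notin> X) row)"
    unfolding s by (simp add: le_imp_less_Suc)
  then show "((insert x X, row # rows), X, row # rows) \<in> inv_image (less_than <*lex*> less_than)
    (\<lambda>(X, rows). (length rows, length (filter (\<lambda>y. y \<notin> X) (hd rows))))"
    by simp
qed (simp_all add: wf_inv_image wf_lex_prod)

declare tabw.simps(2) [simp del]

lemma tabw_step:
  "filter (\<lambda>y. y \<notin> X) row = x # s \<Longrightarrow>
   (\<Sum>w\<leftarrow>tabw X (row # rows). f w) =
     (\<Sum>w\<leftarrow>tabw (insert x X) (row # rows). f (x # w)) + (\<Sum>w\<leftarrow>tabw X rows. f (x # w))"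
  by (subst tabw.simps(2)) (simp add: o_def)

lemma tabw_full:
  "filter (\<lambda>y. y \<notin> X) row = [] \<Longrightarrow> tabw X (row # rows) = (if rows = [] then [[]] else [])"
  by (subst tabw.simps(2)) simp

lemma tabw_dels:
  fixes f :: "'v list \<Rightarrow> bit"
  assumes "\<forall>row\<in>set rows. set row = U" and "finite U"
  shows "(\<Sum>w\<leftarrow>tabw X rows. \<Sum>w'\<leftarrow>dels w. f w') =
    (\<Sum>y\<in>U - X. \<Sum>w\<leftarrow>tabw (insert y X) rows. f w) +
    (\<Sum>rows'\<leftarrow>dels rows. \<Sum>w\<leftarrow>tabw X rows'. f w)"
  using assms(1)
proof (induction X rows arbitrary: f rule: tabw.induct)
  case (2 X row rows)
  have U: "set row = U" using "2.prems" by simp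
  show ?case
  proof (cases "filter (\<lambda>y. y \<notin> X) row")
    case Nil
    then have UX: "U - X = {}" using U by (auto simp: filter_empty_conv)
    then show ?thesis
    proof (cases rows)
      case Nil' : Nil
      then show ?thesis unfolding UX using Nil by (simp add: tabw_full)
    next
      case (Cons row' rest)
      then have "filter (\<lambda>y. y \<notin> X) row' = []" using "2.prems" UX
        by (auto simp: filter_empty_conv)
      moreover have "(\<Sum>rows'\<leftarrow>dels rest. sum_list (map f (tabw X (row # row' # rows')))) = 0"
        by (rule sum_list_zero) (simp add: tabw_full Nil)
      ultimately show ?thesis unfolding UX using Nil Cons by (simp add: tabw_full o_def)
    qed
  next
    case (Cons x s)
    have p: "\<forall>row\<in>set rows. set row = U" using "2.prems" by simp
    note IH = "2.IH"(1)[OF Cons "2.prems", where f="\<lambda>w. f (x # w)"]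
      "2.IH"(2)[OF Cons p, where f="\<lambda>w. f (x # w)"]
    have "x \<in> set (filter (\<lambda>y. y \<notin> X) row)" unfolding Cons by simp
    then have x: "x \<in> U" "x \<notin> X" using U by auto
    have xU: "U - X = insert x (U - insert x X)" using x by auto
    have hd: "\<exists>s'. filter (\<lambda>z. z \<notin> insert y X) row = x # s'" if "y \<noteq> x" for y
    proof -
      have "filter (\<lambda>z. z \<notin> insert y X) row = filter (\<lambda>z. z \<noteq> y) (filter (\<lambda>y. y \<notin> X) row)"
        by (simp add: conj_commute)
      then show ?thesis using Cons that by simp
    qed
    have A: "(\<Sum>w\<leftarrow>tabw (insert y X) (row # rows). f w) =
        (\<Sum>w\<leftarrow>tabw (insert y (insert x X)) (row # rows). f (x # w)) + (\<Sum>w\<leftarrow>tabw (insert y X) rows. f (x # w))"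
      if "y \<in> U - insert x X" for y
      using hd[of y] that tabw_step[of "insert y X" row x _ f rows] by (auto simp: insert_commute)
    have B: "(\<Sum>y\<in>U - X. g y) = g x + (\<Sum>y\<in>U - insert x X. g y)" for g :: "'v \<Rightarrow> bit"
      unfolding xU by (subst sum.insert) (use assms(2) in auto)
    show ?thesis
      unfolding tabw_step[OF Cons]
      by (rule char2_eqI) (simp add: sum_list_addf o_def IH A B sum.distrib tabw_step[OF Cons] ac_simps)
  qed
qed simp

lemma tabw_hd:
  "filter (\<lambda>y. y \<notin> X) row = x # s \<Longrightarrow> w \<in> set (tabw X (row # rows)) \<Longrightarrow> \<exists>w'. w = x # w'"
  by (auto simp: tabw.simps(2))

lemma tabw_avoid: "w \<in> set (tabw X rows) \<Longrightarrow> set w \<inter> X = {}"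
proof (induction X rows arbitrary: w rule: tabw.induct)
  case (2 X row rows)
  show ?case
  proof (cases "filter (\<lambda>y. y \<notin> X) row")
    case Nil then show ?thesis using "2.prems" by (simp add: tabw_full split: if_splits)
  next
    case (Cons x s)
    have "x \<in> set (filter (\<lambda>y. y \<notin> X) row)" unfolding Cons by simp
    then have x: "x \<notin> X" by simp
    obtain w' where w: "w = x # w'" and
      "w' \<in> set (tabw (insert x X) (row # rows)) \<or> w' \<in> set (tabw X rows)"
      using "2.prems" Cons by (auto simp: tabw.simps(2))
    then show ?thesis using "2.IH"(1)[OF Cons, of w'] "2.IH"(2)[OF Cons, of w'] x by auto
  qed
qed simp

lemma tabw_stutter: "\<not> distinct_adj rows \<Longrightarrow> w \<in> set (tabw X rows) \<Longrightarrow> \<not> distinct_adj w"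
proof (induction X rows arbitrary: w rule: tabw.induct)
  case (2 X row rows)
  then obtain row' rest where rows: "rows = row' # rest" by (cases rows) auto
  show ?case
  proof (cases "filter (\<lambda>y. y \<notin> X) row")
    case Nil then show ?thesis using 2 rows by (auto simp: tabw_full)
  next
    case (Cons x s)
    obtain w' where w: "w = x # w'" and
      w': "w' \<in> set (tabw (insert x X) (row # rows)) \<or> w' \<in> set (tabw X rows)"
      using "2.prems"(2) Cons by (auto simp: tabw.simps(2))
    consider "w' \<in> set (tabw (insert x X) (row # rows))" | "w' \<in> set (tabw X rows)" "row = row'"
      | "w' \<in> set (tabw X rows)" "row \<noteq> row'" using w' by blast
    then show ?thesis
    proof cases
      case 1 then show ?thesis using "2.IH"(1)[OF Cons "2.prems"(1)] w by (auto dest: distinct_adj_ConsD)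
    next
      case 2 then show ?thesis using tabw_hd[of X row' x s w' rest] Cons rows w by auto
    next
      case 3 then have "\<not> distinct_adj rows" using "2.prems" rows by simp
      then show ?thesis using "2.IH"(2)[OF Cons _ 3(1)] w by (auto dest: distinct_adj_ConsD)
    qed
  qed
qed simp

lemma tabw_map:
  assumes "inj g"
  shows "tabw (g ` X) (map (map g) rows) = map (map g) (tabw X rows)"
proof (induction X rows rule: tabw.induct)
  case (2 X row rows)
  have *: "filter (\<lambda>y. y \<notin> g ` X) (map g row) = map g (filter (\<lambda>y. y \<notin> X) row)"
    using assms by (auto simp: filter_map o_def inj_image_mem_iff)
  show ?case
    using 2 by (cases "filter (\<lambda>y. y \<notin> X) row") (auto simp: tabw.simps(2) *)
qed simp

section \<open>The shuffle of three alternating sequences\<close>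

definition shuf3 :: "'a list \<Rightarrow> 'b list \<Rightarrow> 'c list \<Rightarrow> ('a \<times> 'b \<times> 'c) list list" where
  "shuf3 u v t = concat (map (shuf u) (shuf v t))"

lemma sum_shuf3: "(\<Sum>w\<leftarrow>shuf3 u v t. f w) = (\<Sum>a\<leftarrow>shuf v t. \<Sum>w\<leftarrow>shuf u a. f w)"
  by (simp add: shuf3_def map_concat sum_list_concat o_def)

lemma shuf3_Nil [simp]: "shuf3 [] v t = []" "shuf3 u [] t = []" "shuf3 u v [] = []"
  by (auto simp: shuf3_def)

lemma shuf_neq_Nil: "w \<in> set (shuf u v) \<Longrightarrow> w \<noteq> []"
  by (cases u; cases v) (auto simp: shuf.simps(3) split: if_splits)

lemma sum_shuf3_Cons:
  fixes f :: "_ \<Rightarrow> bit"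
  shows "(\<Sum>w\<leftarrow>shuf3 (x # u) (y # v) (z # t). f w) =
    (if u = [] \<and> v = [] \<and> t = [] then f [(x, y, z)] else 0) +
    (\<Sum>w\<leftarrow>shuf3 u (y # v) (z # t). f ((x, y, z) # w)) +
    (\<Sum>w\<leftarrow>shuf3 (x # u) v (z # t). f ((x, y, z) # w)) +
    (\<Sum>w\<leftarrow>shuf3 (x # u) (y # v) t. f ((x, y, z) # w))"
proof -
  let ?f = "\<lambda>w. f ((x, y, z) # w)"
  have *: "(\<Sum>a\<leftarrow>shuf v' t'. \<Sum>w\<leftarrow>shuf (x # u) ((y, z) # a). f w) =
     (\<Sum>a\<leftarrow>shuf v' t'. \<Sum>w\<leftarrow>shuf u ((y, z) # a). ?f w) + (\<Sum>a\<leftarrow>shuf v' t'. \<Sum>w\<leftarrow>shuf (x # u) a. ?f w)"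
    for v' t'
    unfolding sum_list_addf[symmetric]
    by (rule sum_list_cong) (auto simp: sum_shuf_Cons dest: shuf_neq_Nil)
  have A: "(\<Sum>a\<leftarrow>shuf (y # v) (z # t). \<Sum>w\<leftarrow>shuf (x # u) a. f w) =
      (if v = [] \<and> t = [] then \<Sum>w\<leftarrow>shuf (x # u) [(y, z)]. f w else 0) +
      (\<Sum>a\<leftarrow>shuf v (z # t). \<Sum>w\<leftarrow>shuf (x # u) ((y, z) # a). f w) +
      (\<Sum>a\<leftarrow>shuf (y # v) t. \<Sum>w\<leftarrow>shuf (x # u) ((y, z) # a). f w)"
    by (rule sum_shuf_Cons)
  have B: "(\<Sum>a\<leftarrow>shuf (y # v) (z # t). \<Sum>w\<leftarrow>shuf u a. ?f w) =
      (if v = [] \<and> t = [] then \<Sum>w\<leftarrow>shuf u [(y, z)]. ?f w else 0) +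
      (\<Sum>a\<leftarrow>shuf v (z # t). \<Sum>w\<leftarrow>shuf u ((y, z) # a). ?f w) +
      (\<Sum>a\<leftarrow>shuf (y # v) t. \<Sum>w\<leftarrow>shuf u ((y, z) # a). ?f w)"
    by (rule sum_shuf_Cons)
  have C: "(\<Sum>w\<leftarrow>shuf (x # u) [(y, z)]. f w) =
      (if u = [] then f [(x, y, z)] else 0) + (\<Sum>w\<leftarrow>shuf u [(y, z)]. ?f w)"
    by (subst sum_shuf_Cons) simp
  show ?thesis
    unfolding sum_shuf3 A B C * by (auto simp: ac_simps)
qed

lemma hd_shuf3: "w \<in> set (shuf3 (x # u) (y # v) (z # t)) \<Longrightarrow> \<exists>w'. w = (x, y, z) # w'"
  by (auto simp: shuf3_def dest!: hd_shuf)

primrec altl :: "'a \<Rightarrow> 'a \<Rightarrow> nat \<Rightarrow> 'a list" where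
  "altl a b 0 = [a]"
| "altl a b (Suc k) = a # altl b a k"

abbreviation alt :: "bool \<Rightarrow> nat \<Rightarrow> bool list" where
  "alt b \<equiv> altl b (\<not> b)"

lemma altl_neq_Nil [simp]: "altl a b k \<noteq> []"
  by (cases k) auto

lemma length_altl [simp]: "length (altl a b k) = Suc k"
  by (induction k arbitrary: a b) auto

text \<open>
  The two blocks \<open>{1, 2}\<close> and \<open>{3, 4}\<close> in their two orders; \<open>rowl\<close> is the table row of
  the element \<open>c\<^sup>z b\<^sup>y a\<^sup>x\<close> of \<open>D\<^sub>8\<close>.
\<close>

definition blk :: "bool \<Rightarrow> bool \<Rightarrow> nat list" where
  "blk c y = (if c then (if y then [4, 3] else [3, 4]) else (if y then [2, 1] else [1, 2]))"

definition rowl :: "bool \<times> bool \<times> bool \<Rightarrow> nat list" where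
  "rowl = (\<lambda>(x, y, z). blk x (if x then z else y) @ blk (\<not> x) (if x then y else z))"

lemma rev_blk: "blk c (\<not> y) = rev (blk c y)"
  by (simp add: blk_def)

lemma distinct_rowl: "distinct (rowl e)"
  by (cases e) (auto simp: rowl_def blk_def)

lemma set_rowl: "set (rowl e) = {1..4}"
  by (cases e) (auto simp: rowl_def blk_def)

text \<open>
  \<open>tabsum P Q i m n f\<close> sums \<open>f\<close> over the table reductions of all lattice paths with \<open>i\<close> exchanges
  of the two blocks, \<open>m\<close> reversals of the leading block and \<open>n\<close> reversals of the other one, when
  \<open>P\<close> and \<open>Q\<close> are the surviving letters of the two blocks.
\<close>

function tabsum :: "'v list \<Rightarrow> 'v list \<Rightarrow> nat \<Rightarrow> nat \<Rightarrow> nat \<Rightarrow> ('v list \<Rightarrow> bit) \<Rightarrow> bit" where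
  "tabsum [] [] i m n f = (if i = 0 \<and> m = 0 \<and> n = 0 then f [] else 0)"
| "tabsum [] (h # Q) i m n f = tabsum [] Q i m n (\<lambda>w. f (h # w)) +
     (if 0 < i then tabsum (h # Q) [] (i - 1) n m (\<lambda>w. f (h # w)) else 0) +
     (if 0 < m then tabsum [] (h # Q) i (m - 1) n (\<lambda>w. f (h # w)) else 0) +
     (if 0 < n then tabsum [] (rev (h # Q)) i m (n - 1) (\<lambda>w. f (h # w)) else 0)"
| "tabsum (h # P) Q i m n f = tabsum P Q i m n (\<lambda>w. f (h # w)) +
     (if 0 < i then tabsum Q (h # P) (i - 1) n m (\<lambda>w. f (h # w)) else 0) +
     (if 0 < m then tabsum (rev (h # P)) Q i (m - 1) n (\<lambda>w. f (h # w)) else 0) +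
     (if 0 < n then tabsum (h # P) (rev Q) i m (n - 1) (\<lambda>w. f (h # w)) else 0)"
  by pat_completeness auto
termination
  by (relation "measure (\<lambda>(P, Q, i, m, n, f). i + m + n + length P + length Q)") auto

declare tabsum.simps(2,3) [simp del]

lemma shuf3_tabw_step:
  fixes f :: "nat list \<Rightarrow> bit"
  assumes "filter (\<lambda>a. a \<notin> X) (rowl (x, y, z)) = h # s"
  shows "(\<Sum>\<rho>\<leftarrow>shuf3 (alt x i) (alt y m) (alt z n). \<Sum>w\<leftarrow>tabw X (map rowl \<rho>). f w) =
    (\<Sum>\<rho>\<leftarrow>shuf3 (alt x i) (alt y m) (alt z n). \<Sum>w\<leftarrow>tabw (insert h X) (map rowl \<rho>). f (h # w)) +
    (if 0 < i then \<Sum>\<rho>\<leftarrow>shuf3 (alt (\<not> x) (i - 1)) (alt y m) (alt z n). \<Sum>w\<leftarrow>tabw X (map rowl \<rho>). f (h # w) else 0) +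
    (if 0 < m then \<Sum>\<rho>\<leftarrow>shuf3 (alt x i) (alt (\<not> y) (m - 1)) (alt z n). \<Sum>w\<leftarrow>tabw X (map rowl \<rho>). f (h # w) else 0) +
    (if 0 < n then \<Sum>\<rho>\<leftarrow>shuf3 (alt x i) (alt y m) (alt (\<not> z) (n - 1)). \<Sum>w\<leftarrow>tabw X (map rowl \<rho>). f (h # w) else 0)"
proof -
  define us where "us b k = (if k = 0 then [] else alt (\<not> b) (k - 1))" for b k
  have alt: "alt b k = b # us b k" for b k
    by (cases k) (auto simp: us_def)
  let ?S = "shuf3 (alt x i) (alt y m) (alt z n)"
  have "(\<Sum>\<rho>\<leftarrow>?S. \<Sum>w\<leftarrow>tabw X (map rowl \<rho>). f w) =
     (\<Sum>\<rho>\<leftarrow>?S. (\<Sum>w\<leftarrow>tabw (insert h X) (map rowl \<rho>). f (h # w)) + (\<Sum>w\<leftarrow>tabw X (map rowl (tl \<rho>)). f (h # w)))"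
    by (rule sum_list_cong, unfold alt, drule hd_shuf3) (auto simp: tabw_step[OF assms])
  also have "\<dots> = (\<Sum>\<rho>\<leftarrow>?S. \<Sum>w\<leftarrow>tabw (insert h X) (map rowl \<rho>). f (h # w)) +
     (\<Sum>\<rho>\<leftarrow>?S. \<Sum>w\<leftarrow>tabw X (map rowl (tl \<rho>)). f (h # w))"
    by (rule sum_list_addf)
  also have "(\<Sum>\<rho>\<leftarrow>?S. \<Sum>w\<leftarrow>tabw X (map rowl (tl \<rho>)). f (h # w)) =
    (\<Sum>\<rho>\<leftarrow>shuf3 (us x i) (alt y m) (alt z n). \<Sum>w\<leftarrow>tabw X (map rowl \<rho>). f (h # w)) +
    (\<Sum>\<rho>\<leftarrow>shuf3 (alt x i) (us y m) (alt z n). \<Sum>w\<leftarrow>tabw X (map rowl \<rho>). f (h # w)) +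
    (\<Sum>\<rho>\<leftarrow>shuf3 (alt x i) (alt y m) (us z n). \<Sum>w\<leftarrow>tabw X (map rowl \<rho>). f (h # w))"
    unfolding alt by (subst sum_shuf3_Cons) simp
  finally show ?thesis
    by (auto simp: us_def add.assoc)
qed

lemma shuf3_tabw_full:
  fixes f :: "nat list \<Rightarrow> bit"
  assumes "filter (\<lambda>a. a \<notin> X) (rowl (x, y, z)) = []"
  shows "(\<Sum>\<rho>\<leftarrow>shuf3 (alt x i) (alt y m) (alt z n). \<Sum>w\<leftarrow>tabw X (map rowl \<rho>). f w) =
    (if i = 0 \<and> m = 0 \<and> n = 0 then f [] else 0)"
proof -
  define us where "us b k = (if k = 0 then [] else alt (\<not> b) (k - 1))" for b k
  have alt: "alt b k = b # us b k" for b k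
    by (cases k) (auto simp: us_def)
  have us: "us b k = [] \<longleftrightarrow> k = 0" for b k by (simp add: us_def)
  have 0: "(\<Sum>\<rho>\<leftarrow>shuf3 u v t. \<Sum>w\<leftarrow>tabw X (map rowl ((x, y, z) # \<rho>)). f w) = 0" for u v t
    by (rule sum_list_zero) (auto simp: tabw_full[OF assms] shuf3_def dest: shuf_neq_Nil)
  show ?thesis unfolding alt
    by (subst sum_shuf3_Cons, unfold 0) (simp add: us tabw_full[OF assms])
qed

lemma filter_neq_Cons:
  assumes "distinct ((h # xs) @ ys)"
  shows "filter (\<lambda>a. a \<noteq> h) (h # xs) = xs" "filter (\<lambda>a. a \<noteq> h) ys = ys"
proof -
  have "\<forall>a\<in>set xs. a \<noteq> h" "\<forall>a\<in>set ys. a \<noteq> h" using assms by auto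
  then have "filter (\<lambda>a. a \<noteq> h) xs = xs" "filter (\<lambda>a. a \<noteq> h) ys = ys" by simp_all
  then show "filter (\<lambda>a. a \<noteq> h) (h # xs) = xs" "filter (\<lambda>a. a \<noteq> h) ys = ys" by simp_all
qed

lemma tabsum_shuf3:
  "(\<Sum>\<rho>\<leftarrow>shuf3 (alt x i) (alt y m) (alt z n). \<Sum>w\<leftarrow>tabw X (map rowl \<rho>). f w) =
    tabsum (filter (\<lambda>a. a \<notin> X) (blk x (if x then z else y)))
      (filter (\<lambda>a. a \<notin> X) (blk (\<not> x) (if x then y else z)))
      i (if x then n else m) (if x then m else n) f"
proof (induction k \<equiv> "i + m + n + card ({1..4} - X)"
    arbitrary: i m n x y z X f rule: less_induct)
  case less
  define P Q where "P = filter (\<lambda>a. a \<notin> X) (blk x (if x then z else y))"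
    and "Q = filter (\<lambda>a. a \<notin> X) (blk (\<not> x) (if x then y else z))"
  have row: "filter (\<lambda>a. a \<notin> X) (rowl (x, y, z)) = P @ Q" by (simp add: rowl_def P_def Q_def)
  have goal: "(\<Sum>\<rho>\<leftarrow>shuf3 (alt x i) (alt y m) (alt z n). \<Sum>w\<leftarrow>tabw X (map rowl \<rho>). f w) =
    tabsum P Q i (if x then n else m) (if x then m else n) f"
  proof (cases "P @ Q")
    case Nil
    then show ?thesis using shuf3_tabw_full[of X x y z f i m n] row by (cases x) auto
  next
    case (Cons h s)
    have hPQ: "h \<in> {1..4} - X"
    proof -
      have "h \<in> set (filter (\<lambda>a. a \<notin> X) (rowl (x, y, z)))" unfolding row Cons by simp
      then show ?thesis using set_rowl[of "(x, y, z)"] by auto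
    qed
    have "{1..4} - insert h X \<subset> {1..4} - X" using hPQ by blast
    then have card: "card ({1..4} - insert h X) < card ({1..4} - X)" by (intro psubset_card_mono) auto
    have d: "distinct (P @ Q)" unfolding row[symmetric] using distinct_rowl by simp
    have ins: "filter (\<lambda>a. a \<notin> insert h X) xs = filter (\<lambda>a. a \<noteq> h) (filter (\<lambda>a. a \<notin> X) xs)" for xs
      by (simp add: conj_commute)
    have IH1: "(\<Sum>\<rho>\<leftarrow>shuf3 (alt x i) (alt y m) (alt z n). \<Sum>w\<leftarrow>tabw (insert h X) (map rowl \<rho>). f (h # w)) =
      tabsum (filter (\<lambda>a. a \<noteq> h) P) (filter (\<lambda>a. a \<noteq> h) Q)
      i (if x then n else m) (if x then m else n) (\<lambda>w. f (h # w))"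
      using less[of i m n "insert h X" "\<lambda>w. f (h # w)" x y z] card
      unfolding ins P_def[symmetric] Q_def[symmetric] by linarith
    have IH2: "0 < i \<Longrightarrow> (\<Sum>\<rho>\<leftarrow>shuf3 (alt (\<not> x) (i - 1)) (alt y m) (alt z n). \<Sum>w\<leftarrow>tabw X (map rowl \<rho>). f (h # w)) =
      tabsum Q P (i - 1) (if x then m else n) (if x then n else m) (\<lambda>w. f (h # w))"
      using less[of "i - 1" m n X "\<lambda>w. f (h # w)" "\<not> x" y z]
      by (cases x) (simp_all add: P_def Q_def)
    have IH3: "0 < m \<Longrightarrow> (\<Sum>\<rho>\<leftarrow>shuf3 (alt x i) (alt (\<not> y) (m - 1)) (alt z n). \<Sum>w\<leftarrow>tabw X (map rowl \<rho>). f (h # w)) =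
      (if x then tabsum P (rev Q) i n (m - 1) (\<lambda>w. f (h # w)) else tabsum (rev P) Q i (m - 1) n (\<lambda>w. f (h # w)))"
      using less[of i "m - 1" n X "\<lambda>w. f (h # w)" x "\<not> y" z]
      by (cases x) (simp_all add: P_def Q_def rev_blk rev_filter)
    have IH4: "0 < n \<Longrightarrow> (\<Sum>\<rho>\<leftarrow>shuf3 (alt x i) (alt y m) (alt (\<not> z) (n - 1)). \<Sum>w\<leftarrow>tabw X (map rowl \<rho>). f (h # w)) =
      (if x then tabsum (rev P) Q i (n - 1) m (\<lambda>w. f (h # w)) else tabsum P (rev Q) i m (n - 1) (\<lambda>w. f (h # w)))"
      using less[of i m "n - 1" X "\<lambda>w. f (h # w)" x y "\<not> z"]
      by (cases x) (simp_all add: P_def Q_def rev_blk rev_filter)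
    note step = shuf3_tabw_step[of X x y z h s f i m n, unfolded row, OF Cons, unfolded IH1]
    show ?thesis
    proof (cases P)
      case Nil
      then have Q: "Q = h # s" using Cons by simp
      have F: "filter (\<lambda>a. a \<noteq> h) P = []" "filter (\<lambda>a. a \<noteq> h) Q = s"
        using filter_neq_Cons(1)[of h s "[]"] d unfolding Nil Q by simp_all
      show ?thesis unfolding step F unfolding Nil Q
        by (subst tabsum.simps(2), insert IH2 IH3 IH4) (cases x; cases i; cases m; cases n; simp add: Nil Q ac_simps)
    next
      case P: (Cons h' P')
      then have h: "h' = h" using Cons by simp
      have F: "filter (\<lambda>a. a \<noteq> h) P = P'" "filter (\<lambda>a. a \<noteq> h) Q = Q"
        using filter_neq_Cons[of h P' Q] d unfolding P h by blast+
      show ?thesis unfolding step F unfolding P h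
        by (subst tabsum.simps(3), insert IH2 IH3 IH4) (cases x; cases i; cases m; cases n; simp add: P h ac_simps)
    qed
  qed
  then show ?case unfolding P_def Q_def .
qed

lemma tabsum_zero_fun: "(\<And>w. f w = 0) \<Longrightarrow> tabsum P Q i m n f = 0"
proof (induction P Q i m n f rule: tabsum.induct)
  case (2 h Q i m n f)
  show ?case by (subst tabsum.simps(2), insert 2) (cases i; cases m; cases n; simp)
next
  case (3 h P Q i m n f)
  show ?case by (subst tabsum.simps(3), insert 3) (cases i; cases m; cases n; simp)
qed simp

lemma tabsum_zero_hd:
  assumes "P @ Q = h # s" "\<And>w. f (h # w) = 0"
  shows "tabsum P Q i m n f = 0"
proof (cases P)
  case Nil
  then have Q: "Q = h # s" using assms by simp
  show ?thesis unfolding Nil Q by (subst tabsum.simps(2)) (simp add: tabsum_zero_fun assms)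
next
  case (Cons h' P')
  then have "h' = h" using assms by simp
  then show ?thesis unfolding Cons by (subst tabsum.simps(3)) (simp add: tabsum_zero_fun assms)
qed

definition stutter_free :: "('v list \<Rightarrow> bit) \<Rightarrow> bool" where
  "stutter_free f \<longleftrightarrow> (\<forall>w. \<not> distinct_adj w \<longrightarrow> f w = 0)"

lemma stutter_free_Cons: "stutter_free f \<Longrightarrow> stutter_free (\<lambda>w. f (h # w))"
  by (auto simp: stutter_free_def dest: distinct_adj_ConsD)

lemma stutter_free_Cons2: "stutter_free f \<Longrightarrow> f (h # h # w) = 0"
  by (auto simp: stutter_free_def)

lemma rev_short: "length P \<le> 1 \<Longrightarrow> rev P = P"
  by (cases P) auto

text \<open>Once a block has lost a letter, permuting it does not change the table any more.\<close>

lemma tabsum_zero: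
  assumes "stutter_free f"
    and "(length P \<le> 1 \<and> 0 < m) \<or> (length Q \<le> 1 \<and> 0 < n) \<or> ((P = [] \<or> Q = []) \<and> 0 < i)"
  shows "tabsum P Q i m n f = 0"
  using assms
proof (induction "i + m + n + length P + length Q" arbitrary: P Q i m n f rule: less_induct)
  case less
  show ?case
  proof (cases "P @ Q")
    case Nil then show ?thesis using less.prems by auto
  next
    case (Cons h s)
    let ?g = "\<lambda>w. f (h # w)"
    have g: "stutter_free ?g" by (rule stutter_free_Cons[OF less.prems(1)])
    have kill: "tabsum P' Q' i' m' n' ?g = 0" if "P' @ Q' = P @ Q" for P' Q' i' m' n'
      by (rule tabsum_zero_hd[of _ _ h s]) (auto simp: that Cons stutter_free_Cons2[OF less.prems(1)])
    have A: "0 < i \<Longrightarrow> tabsum Q P (i - 1) n m ?g = 0"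
    proof (cases "P = [] \<or> Q = []")
      case True then show ?thesis by (intro kill) auto
    next
      case False assume "0 < i"
      then show ?thesis using False less.prems(2) by (intro less.hyps g) auto
    qed
    have B: "0 < m \<Longrightarrow> tabsum (rev P) Q i (m - 1) n ?g = 0"
    proof (cases "length P \<le> 1")
      case True then show ?thesis by (intro kill) (auto simp: rev_short)
    next
      case False assume "0 < m"
      then show ?thesis using False less.prems(2) by (intro less.hyps g) auto
    qed
    have C: "0 < n \<Longrightarrow> tabsum P (rev Q) i m (n - 1) ?g = 0"
    proof (cases "length Q \<le> 1")
      case True then show ?thesis by (intro kill) (auto simp: rev_short)
    next
      case False assume "0 < n"
      then show ?thesis using False less.prems(2) by (intro less.hyps g) auto
    qed
    show ?thesis
    proof (cases P)
      case Nil
      then have Q: "Q = h # s" using Cons by simp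
      have D: "tabsum [] s i m n ?g = 0"
        using less.prems(2) Nil Q by (intro less.hyps g) auto
      show ?thesis using A B C D unfolding Nil Q
        by (subst tabsum.simps(2)) (cases i; cases m; cases n; simp)
    next
      case P: (Cons h' P')
      then have h: "h' = h" using Cons by simp
      have D: "tabsum P' Q i m n ?g = 0"
        using less.prems(2) P by (intro less.hyps g) auto
      show ?thesis using A B C D unfolding P h
        by (subst tabsum.simps(3)) (cases i; cases m; cases n; simp)
    qed
  qed
qed

text \<open>
  \<open>wsum p p' q q' x y z f\<close> sums \<open>f\<close> over the words that start with \<open>p\<close> and change letter by \<open>x\<close>
  exchanges of the blocks \<open>{p, p'}\<close> and \<open>{q, q'}\<close>, each of which resumes where it was left, and by
  \<open>y\<close> and \<open>z\<close> changes of letter inside the blocks.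
\<close>

function wsum :: "'v \<Rightarrow> 'v \<Rightarrow> 'v \<Rightarrow> 'v \<Rightarrow> nat \<Rightarrow> nat \<Rightarrow> nat \<Rightarrow> ('v list \<Rightarrow> bit) \<Rightarrow> bit" where
  "wsum p p' q q' x y z f =
     (if x = 0 \<and> y = 0 \<and> z = 0 then f [p] else 0) +
     (if 0 < x then wsum q q' p p' (x - 1) z y (\<lambda>w. f (p # w)) else 0) +
     (if 0 < y then wsum p' p q q' x (y - 1) z (\<lambda>w. f (p # w)) else 0)"
  by pat_completeness auto
termination
  by (relation "measure (\<lambda>(p, p', q, q', x, y, z, f). x + y + z)") auto

declare wsum.simps [simp del]

lemma wsum_dead: "0 < z \<Longrightarrow> wsum p p' q q' 0 y z f = 0"
  by (induction y arbitrary: p p' f) (subst wsum.simps; simp)+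

lemma tabsum_one_block:
  assumes "stutter_free f"
  shows "tabsum [p, p'] [] 0 m 0 f = wsum p p' q q' 0 (Suc m) 0 f"
    and "tabsum [] [p, p'] 0 0 m f = wsum p p' q q' 0 (Suc m) 0 f"
proof -
  have "tabsum [p, p'] [] 0 m 0 f = wsum p p' q q' 0 (Suc m) 0 f \<and>
    tabsum [] [p, p'] 0 0 m f = wsum p p' q q' 0 (Suc m) 0 f"
    using assms
  proof (induction m arbitrary: p p' f)
    case 0
    show ?case
      by (simp add: tabsum.simps(2,3) wsum.simps[of p] wsum.simps[of p'])
  next
    case (Suc m)
    note g = stutter_free_Cons[OF Suc.prems, of p]
    have "tabsum [p'] [] 0 (Suc m) 0 (\<lambda>w. f (p # w)) = 0" "tabsum [] [p'] 0 0 (Suc m) (\<lambda>w. f (p # w)) = 0"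
      by (rule tabsum_zero[OF g]; simp)+
    then show ?case using Suc.IH[OF g, of p' p]
      by (simp add: tabsum.simps(2,3) wsum.simps[of p p'])
  qed
  then show "tabsum [p, p'] [] 0 m 0 f = wsum p p' q q' 0 (Suc m) 0 f"
    and "tabsum [] [p, p'] 0 0 m f = wsum p p' q q' 0 (Suc m) 0 f" by auto
qed

lemma tabsum_two_letters:
  assumes "stutter_free f"
  shows "tabsum [p] [q] i 0 0 f = wsum p p' q q' (Suc i) 0 0 f"
  using assms
proof (induction i arbitrary: p p' q q' f)
  case 0
  show ?case by (simp add: tabsum.simps(2,3) wsum.simps[of p] wsum.simps[of q])
next
  case (Suc i)
  note g = stutter_free_Cons[OF Suc.prems, of p]
  have "tabsum [] [q] (Suc i) 0 0 (\<lambda>w. f (p # w)) = 0" by (rule tabsum_zero[OF g]) simp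
  then show ?case using Suc.IH[OF g, of q p q' p']
    by (simp add: tabsum.simps(3)[of p] wsum.simps[of p])
qed

lemma tabsum_three_letters:
  assumes "stutter_free f"
  shows "tabsum [p] [q, q'] i 0 n f = wsum p p' q q' (Suc i) 0 (Suc n) f"
    and "tabsum [q, q'] [p] i n 0 f = wsum q q' p p' (Suc i) (Suc n) 0 f"
proof -
  have *: "tabsum [p] [q, q'] i 0 n f = wsum p p' q q' (Suc i) 0 (Suc n) f \<and>
     tabsum [q, q'] [p] i n 0 f = wsum q q' p p' (Suc i) (Suc n) 0 f"
    using assms
  proof (induction "i + n" arbitrary: i n p p' q q' f rule: less_induct)
    case less
    note g = stutter_free_Cons[OF less.prems]
    have kill: "tabsum [p] [q', q] i' m' n' (\<lambda>w. f (p # w)) = 0" for i' m' n'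
      by (rule tabsum_zero_hd) (auto intro: stutter_free_Cons2[OF less.prems])
    have 1: "tabsum [] [q, q'] i 0 n (\<lambda>w. f (p # w)) =
        (if i = 0 then wsum q q' p p' 0 (Suc n) 0 (\<lambda>w. f (p # w)) else 0)"
      using tabsum_one_block(2)[OF g] tabsum_zero[OF g] by auto
    have 2: "0 < i \<Longrightarrow> tabsum [q, q'] [p] (i - 1) n 0 (\<lambda>w. f (p # w)) = wsum q q' p p' i (Suc n) 0 (\<lambda>w. f (p # w))"
      using less.hyps[of "i - 1" n "\<lambda>w. f (p # w)", OF _ g] by auto
    have 3: "tabsum [q'] [p] i n 0 (\<lambda>w. f (q # w)) =
       (if n = 0 then wsum q' q p p' (Suc i) 0 0 (\<lambda>w. f (q # w)) else 0)"
      using tabsum_two_letters[OF g] tabsum_zero[OF g] by auto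
    have 4: "0 < i \<Longrightarrow> tabsum [p] [q, q'] (i - 1) 0 n (\<lambda>w. f (q # w)) = wsum p p' q q' i 0 (Suc n) (\<lambda>w. f (q # w))"
      using less.hyps[of "i - 1" n "\<lambda>w. f (q # w)", OF _ g] by auto
    have 5: "0 < n \<Longrightarrow> tabsum [q', q] [p] i (n - 1) 0 (\<lambda>w. f (q # w)) = wsum q' q p p' (Suc i) n 0 (\<lambda>w. f (q # w))"
      using less.hyps[of i "n - 1" "\<lambda>w. f (q # w)", OF _ g] by auto
    have T1: "tabsum [p] [q, q'] i 0 n f = tabsum [] [q, q'] i 0 n (\<lambda>w. f (p # w)) +
        (if 0 < i then tabsum [q, q'] [p] (i - 1) n 0 (\<lambda>w. f (p # w)) else 0)"
      by (subst tabsum.simps(3)) (simp add: kill)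
    have T2: "tabsum [q, q'] [p] i n 0 f = tabsum [q'] [p] i n 0 (\<lambda>w. f (q # w)) +
        (if 0 < i then tabsum [p] [q, q'] (i - 1) 0 n (\<lambda>w. f (q # w)) else 0) +
        (if 0 < n then tabsum [q', q] [p] i (n - 1) 0 (\<lambda>w. f (q # w)) else 0)"
      by (subst tabsum.simps(3)) simp
    have W1: "wsum p p' q q' (Suc i) 0 (Suc n) f = wsum q q' p p' i (Suc n) 0 (\<lambda>w. f (p # w))"
      by (subst wsum.simps) simp
    have W2: "wsum q q' p p' (Suc i) (Suc n) 0 f = wsum p p' q q' i 0 (Suc n) (\<lambda>w. f (q # w)) +
        wsum q' q p p' (Suc i) n 0 (\<lambda>w. f (q # w))"
      by (subst wsum.simps) simp
    show ?case unfolding T1 T2 W1 W2 1 3 using 2 4 5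
      by (cases "i = 0"; cases "n = 0"; simp add: wsum_dead ac_simps)
  qed
  show "tabsum [p] [q, q'] i 0 n f = wsum p p' q q' (Suc i) 0 (Suc n) f"
    by (rule conjunct1[OF *])
  show "tabsum [q, q'] [p] i n 0 f = wsum q q' p p' (Suc i) (Suc n) 0 f"
    by (rule conjunct2[OF *])
qed

lemma tabsum_eq_wsum:
  assumes "stutter_free f"
  shows "tabsum [p, p'] [q, q'] i m n f = wsum p p' q q' (Suc i) (Suc m) (Suc n) f"
  using assms
proof (induction "i + m + n" arbitrary: i m n p p' q q' f rule: less_induct)
  case less
  note g = stutter_free_Cons[OF less.prems, of p]
  have kill: "tabsum [p, p'] [q', q] i' m' n' (\<lambda>w. f (p # w)) = 0" for i' m' n'
    by (rule tabsum_zero_hd) (auto intro: stutter_free_Cons2[OF less.prems])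
  have 1: "tabsum [p'] [q, q'] i m n (\<lambda>w. f (p # w)) =
      (if m = 0 then wsum p' p q q' (Suc i) 0 (Suc n) (\<lambda>w. f (p # w)) else 0)"
    using tabsum_three_letters(1)[OF g] tabsum_zero[OF g] by auto
  have 2: "0 < i \<Longrightarrow> tabsum [q, q'] [p, p'] (i - 1) n m (\<lambda>w. f (p # w)) =
      wsum q q' p p' i (Suc n) (Suc m) (\<lambda>w. f (p # w))"
    using less.hyps[of "i - 1" n m "\<lambda>w. f (p # w)", OF _ g] by auto
  have 3: "0 < m \<Longrightarrow> tabsum [p', p] [q, q'] i (m - 1) n (\<lambda>w. f (p # w)) =
      wsum p' p q q' (Suc i) m (Suc n) (\<lambda>w. f (p # w))"
    using less.hyps[of i "m - 1" n "\<lambda>w. f (p # w)", OF _ g] by auto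
  have T: "tabsum [p, p'] [q, q'] i m n f = tabsum [p'] [q, q'] i m n (\<lambda>w. f (p # w)) +
      (if 0 < i then tabsum [q, q'] [p, p'] (i - 1) n m (\<lambda>w. f (p # w)) else 0) +
      (if 0 < m then tabsum [p', p] [q, q'] i (m - 1) n (\<lambda>w. f (p # w)) else 0)"
    by (subst tabsum.simps(3)) (simp add: kill)
  have W: "wsum p p' q q' (Suc i) (Suc m) (Suc n) f = wsum q q' p p' i (Suc n) (Suc m) (\<lambda>w. f (p # w)) +
      wsum p' p q q' (Suc i) m (Suc n) (\<lambda>w. f (p # w))"
    by (subst wsum.simps) simp
  show ?case unfolding T W 1 using 2 3
    by (cases "i = 0"; cases "m = 0"; simp add: wsum_dead ac_simps)
qed

theorem shuf3_tabw_alt: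
  assumes "stutter_free f"
  shows "(\<Sum>\<rho>\<leftarrow>shuf3 (alt False i) (alt False m) (alt False n). \<Sum>w\<leftarrow>tabw {} (map rowl \<rho>). f w) =
     wsum 1 2 3 4 (Suc i) (Suc m) (Suc n) f"
  using tabsum_shuf3[of f "{}" False i False m False n] tabsum_eq_wsum[OF assms, of 1 2 3 4 i m n]
  by (simp add: blk_def)

lemma wsum_cong:
  "(\<And>w. w \<noteq> [] \<Longrightarrow> set w \<subseteq> {p, p', q, q'} \<Longrightarrow> f w = g w) \<Longrightarrow>
   wsum p p' q q' x y z f = wsum p p' q q' x y z g"
proof (induction p p' q q' x y z f arbitrary: g rule: wsum.induct)
  case (1 p p' q q' x y z f)
  have eq: "f (p # w) = g (p # w)" if "set w \<subseteq> {p, p', q, q'}" for w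
    using "1.prems"[of "p # w"] that by simp
  have "0 < x \<Longrightarrow> wsum q q' p p' (x - 1) z y (\<lambda>w. f (p # w)) = wsum q q' p p' (x - 1) z y (\<lambda>w. g (p # w))"
    by (rule "1.IH"(1)) (auto intro!: eq)
  moreover have "0 < y \<Longrightarrow> wsum p' p q q' x (y - 1) z (\<lambda>w. f (p # w)) = wsum p' p q q' x (y - 1) z (\<lambda>w. g (p # w))"
    by (rule "1.IH"(2)) (auto intro!: eq)
  ultimately show ?case
    unfolding wsum.simps[of p p' q q' x y z] using eq[of "[]"]
    by (cases "x = 0"; cases "y = 0"; simp)
qed

lemma wsum_add:
  "wsum p p' q q' x y z (\<lambda>w. f w + g w) = wsum p p' q q' x y z f + wsum p p' q q' x y z g"
proof (induction p p' q q' x y z f arbitrary: g rule: wsum.induct)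
  case (1 p p' q q' x y z f)
  note 1 = "1.IH"(1)[of "\<lambda>w. g (p # w)"] "1.IH"(2)[of "\<lambda>w. g (p # w)"]
  show ?case
    unfolding wsum.simps[of p p' q q' x y z] using 1
    by (cases "x = 0"; cases "y = 0") (simp_all add: ac_simps)
qed

text \<open>The remaining part of a path that may already have used up its last vertex.\<close>

definition shufx :: "'a list \<Rightarrow> 'b list \<Rightarrow> ('a \<times> 'b) list list" where
  "shufx A V = (if V = [] \<and> length A = 1 then [[]] else shuf A V)"

lemma sum_shuf_altl:
  fixes h :: "_ \<Rightarrow> bit"
  shows "(\<Sum>w\<leftarrow>shuf (altl p p' y) (v # L). h w) =
    (if 0 < y then \<Sum>w\<leftarrow>shuf (altl p' p (y - 1)) (v # L). h ((p, v) # w) else 0) +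
    (\<Sum>w\<leftarrow>shufx (altl p p' y) L. h ((p, v) # w))"
  by (cases y) (auto simp: sum_shuf_Cons shufx_def)

lemma nested_step:
  fixes h1 h2 :: "_ \<Rightarrow> bit"
  shows "(\<Sum>\<omega>\<leftarrow>shuf (altl c (\<not> c) x) (v # V). (\<Sum>w\<leftarrow>shuf (altl p p' y) (proj c \<omega>). h1 w) *
      (\<Sum>w\<leftarrow>shufx (altl q q' z) (proj (\<not> c) \<omega>). h2 w)) =
    (if x = 0 \<and> y = 0 \<and> z = 0 \<and> V = [] then h1 [(p, v)] * h2 [] else 0) +
    (if 0 < x then \<Sum>\<omega>\<leftarrow>shuf (altl (\<not> c) c (x - 1)) (v # V). (\<Sum>w\<leftarrow>shuf (altl q q' z) (proj (\<not> c) \<omega>). h2 w) *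
      (\<Sum>w\<leftarrow>shufx (altl p p' y) (proj c \<omega>). h1 ((p, v) # w)) else 0) +
    (if 0 < y then \<Sum>\<omega>\<leftarrow>shuf (altl c (\<not> c) x) (v # V). (\<Sum>w\<leftarrow>shuf (altl p' p (y - 1)) (proj c \<omega>). h1 ((p, v) # w)) *
      (\<Sum>w\<leftarrow>shufx (altl q q' z) (proj (\<not> c) \<omega>). h2 w) else 0) +
    (\<Sum>\<omega>\<leftarrow>shuf (altl c (\<not> c) x) V. (\<Sum>w\<leftarrow>shuf (altl p p' y) (proj c \<omega>). h1 ((p, v) # w)) *
      (\<Sum>w\<leftarrow>shufx (altl q q' z) (proj (\<not> c) \<omega>). h2 w))"
proof -
  let ?h = "\<lambda>w. h1 ((p, v) # w)"
  let ?A = "altl p p' y" and ?B = "altl q q' z" and ?C = "altl c (\<not> c) x"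
  have "(\<Sum>\<omega>\<leftarrow>shuf ?C (v # V). (\<Sum>w\<leftarrow>shuf ?A (proj c \<omega>). h1 w) * (\<Sum>w\<leftarrow>shufx ?B (proj (\<not> c) \<omega>). h2 w)) =
    (\<Sum>\<omega>\<leftarrow>shuf ?C (v # V). (if 0 < y then \<Sum>w\<leftarrow>shuf (altl p' p (y - 1)) (proj c \<omega>). ?h w else 0) *
      (\<Sum>w\<leftarrow>shufx ?B (proj (\<not> c) \<omega>). h2 w) +
      (\<Sum>w\<leftarrow>shufx ?A (proj c (tl \<omega>)). ?h w) * (\<Sum>w\<leftarrow>shufx ?B (proj (\<not> c) (tl \<omega>)). h2 w))"
  proof (rule sum_list_cong)
    fix \<omega> assume \<omega>: "\<omega> \<in> set (shuf ?C (v # V))"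
    obtain C' where "?C = c # C'" by (cases x) auto
    then obtain \<omega>' where "\<omega> = (c, v) # \<omega>'" using hd_shuf \<omega> by metis
    then show "(\<Sum>w\<leftarrow>shuf ?A (proj c \<omega>). h1 w) * (\<Sum>w\<leftarrow>shufx ?B (proj (\<not> c) \<omega>). h2 w) =
      (if 0 < y then \<Sum>w\<leftarrow>shuf (altl p' p (y - 1)) (proj c \<omega>). ?h w else 0) *
      (\<Sum>w\<leftarrow>shufx ?B (proj (\<not> c) \<omega>). h2 w) +
      (\<Sum>w\<leftarrow>shufx ?A (proj c (tl \<omega>)). ?h w) * (\<Sum>w\<leftarrow>shufx ?B (proj (\<not> c) (tl \<omega>)). h2 w)"
      by (simp add: sum_shuf_altl[of _ p p' y] distrib_right)
  qed
  also have "\<dots> = (if 0 < y then \<Sum>\<omega>\<leftarrow>shuf ?C (v # V). (\<Sum>w\<leftarrow>shuf (altl p' p (y - 1)) (proj c \<omega>). ?h w) *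
      (\<Sum>w\<leftarrow>shufx ?B (proj (\<not> c) \<omega>). h2 w) else 0) +
    (\<Sum>\<omega>\<leftarrow>shuf ?C (v # V). (\<Sum>w\<leftarrow>shufx ?A (proj c (tl \<omega>)). ?h w) * (\<Sum>w\<leftarrow>shufx ?B (proj (\<not> c) (tl \<omega>)). h2 w))"
    by (simp add: sum_list_addf)
  also have "(\<Sum>\<omega>\<leftarrow>shuf ?C (v # V). (\<Sum>w\<leftarrow>shufx ?A (proj c (tl \<omega>)). ?h w) * (\<Sum>w\<leftarrow>shufx ?B (proj (\<not> c) (tl \<omega>)). h2 w)) =
    (if 0 < x then \<Sum>\<omega>\<leftarrow>shuf (altl (\<not> c) c (x - 1)) (v # V).
       (\<Sum>w\<leftarrow>shufx ?A (proj c \<omega>). ?h w) * (\<Sum>w\<leftarrow>shufx ?B (proj (\<not> c) \<omega>). h2 w) else 0) +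
    (\<Sum>\<omega>\<leftarrow>shufx ?C V. (\<Sum>w\<leftarrow>shufx ?A (proj c \<omega>). ?h w) * (\<Sum>w\<leftarrow>shufx ?B (proj (\<not> c) \<omega>). h2 w))"
    by (simp add: sum_shuf_altl[of _ c "\<not> c" x])
  also have "(if 0 < x then \<Sum>\<omega>\<leftarrow>shuf (altl (\<not> c) c (x - 1)) (v # V).
       (\<Sum>w\<leftarrow>shufx ?A (proj c \<omega>). ?h w) * (\<Sum>w\<leftarrow>shufx ?B (proj (\<not> c) \<omega>). h2 w) else 0) =
     (if 0 < x then \<Sum>\<omega>\<leftarrow>shuf (altl (\<not> c) c (x - 1)) (v # V). (\<Sum>w\<leftarrow>shuf ?B (proj (\<not> c) \<omega>). h2 w) *
      (\<Sum>w\<leftarrow>shufx ?A (proj c \<omega>). ?h w) else 0)"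
  proof -
    have "(\<Sum>w\<leftarrow>shufx ?B (proj (\<not> c) \<omega>). h2 w) = (\<Sum>w\<leftarrow>shuf ?B (proj (\<not> c) \<omega>). h2 w)"
      if \<omega>: "\<omega> \<in> set (shuf (altl (\<not> c) c (x - 1)) (v # V))" for \<omega>
    proof -
      obtain C' where "altl (\<not> c) c (x - 1) = (\<not> c) # C'" by (cases "x - 1") auto
      then obtain \<omega>' where "\<omega> = (\<not> c, v) # \<omega>'" using hd_shuf \<omega> by metis
      then show ?thesis by (simp add: shufx_def)
    qed
    then show ?thesis by (auto intro!: sum_list_cong)
  qed
  also have "(\<Sum>\<omega>\<leftarrow>shufx ?C V. (\<Sum>w\<leftarrow>shufx ?A (proj c \<omega>). ?h w) * (\<Sum>w\<leftarrow>shufx ?B (proj (\<not> c) \<omega>). h2 w)) =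
    (if x = 0 \<and> y = 0 \<and> z = 0 \<and> V = [] then h1 [(p, v)] * h2 [] else 0) +
    (\<Sum>\<omega>\<leftarrow>shuf ?C V. (\<Sum>w\<leftarrow>shuf ?A (proj c \<omega>). ?h w) * (\<Sum>w\<leftarrow>shufx ?B (proj (\<not> c) \<omega>). h2 w))"
  proof (cases V)
    case Nil then show ?thesis by (auto simp: shufx_def)
  next
    case (Cons v' V')
    have "(\<Sum>w\<leftarrow>shufx ?A (proj c \<omega>). ?h w) = (\<Sum>w\<leftarrow>shuf ?A (proj c \<omega>). ?h w)"
      if \<omega>: "\<omega> \<in> set (shuf ?C V)" for \<omega>
    proof -
      obtain C' where "?C = c # C'" by (cases x) auto
      then obtain \<omega>' where "\<omega> = (c, v') # \<omega>'" using hd_shuf \<omega> Cons by metis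
      then show ?thesis by (simp add: shufx_def)
    qed
    then show ?thesis using Cons by (auto simp: shufx_def intro!: sum_list_cong)
  qed
  finally show ?thesis by (simp only: ac_simps)
qed

lemma wsum_shuf_step:
  fixes H :: "_ \<Rightarrow> bit"
  shows "wsum p p' q q' x y z (\<lambda>A. \<Sum>w\<leftarrow>shuf A (v # V). H w) =
    (if x = 0 \<and> y = 0 \<and> z = 0 \<and> V = [] then H [(p, v)] else 0) +
    (if 0 < x then wsum q q' p p' (x - 1) z y (\<lambda>A. \<Sum>w\<leftarrow>shuf A (v # V). H ((p, v) # w)) else 0) +
    (if 0 < y then wsum p' p q q' x (y - 1) z (\<lambda>A. \<Sum>w\<leftarrow>shuf A (v # V). H ((p, v) # w)) else 0) +
    wsum p p' q q' x y z (\<lambda>A. \<Sum>w\<leftarrow>shuf A V. H ((p, v) # w))"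
proof -
  let ?H = "\<lambda>w. H ((p, v) # w)"
  have *: "wsum a a' b b' k l m (\<lambda>A. \<Sum>w\<leftarrow>shuf (p # A) (v # V). H w) =
      wsum a a' b b' k l m (\<lambda>A. \<Sum>w\<leftarrow>shuf A (v # V). ?H w) + wsum a a' b b' k l m (\<lambda>A. \<Sum>w\<leftarrow>shuf (p # A) V. ?H w)"
    for a a' b b' k l m
    unfolding wsum_add[symmetric] by (rule wsum_cong) (simp add: sum_shuf_Cons)
  show ?thesis
    by (subst (1 4) wsum.simps, unfold *)
      (cases "x = 0"; cases "y = 0"; cases "z = 0"; cases "V = []"; simp add: sum_shuf_Cons ac_simps)
qed

theorem wsum_shuf_nested:
  fixes h1 h2 :: "('l \<times> 'v) list \<Rightarrow> bit"
  assumes "{p, p'} \<inter> {q, q'} = {}"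
  shows "wsum p p' q q' x y z (\<lambda>A. \<Sum>w\<leftarrow>shuf A V.
      h1 (filter (\<lambda>e. fst e \<in> {p, p'}) w) * h2 (filter (\<lambda>e. fst e \<in> {q, q'}) w)) =
    (\<Sum>\<omega>\<leftarrow>shuf (altl c (\<not> c) x) V. (\<Sum>w\<leftarrow>shuf (altl p p' y) (proj c \<omega>). h1 w) *
      (\<Sum>w\<leftarrow>shufx (altl q q' z) (proj (\<not> c) \<omega>). h2 w))"
  using assms
proof (induction "x + y + z + length V" arbitrary: p p' q q' x y z V h1 h2 c rule: less_induct)
  case less
  show ?case
  proof (cases V)
    case Nil
    have "wsum p p' q q' x y z (\<lambda>A. 0) = (0::bit)" for p p' q q' x y z
      using wsum_add[of p p' q q' x y z "\<lambda>A. 0" "\<lambda>A. 0"] by simp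
    then show ?thesis by (simp add: Nil)
  next
    case (Cons v V')
    let ?h = "\<lambda>w. h1 ((p, v) # w)"
    define P Q where "P = (\<lambda>w :: ('l \<times> 'v) list. filter (\<lambda>e. fst e \<in> {p, p'}) w)"
      and "Q = (\<lambda>w :: ('l \<times> 'v) list. filter (\<lambda>e. fst e \<in> {q, q'}) w)"
    have fil: "P ((p, v) # w) = (p, v) # P w" "Q ((p, v) # w) = Q w" "P [] = []" "Q [] = []" for w
      using less.prems by (auto simp: P_def Q_def)
    have 1: "0 < x \<Longrightarrow> wsum q q' p p' (x - 1) z y (\<lambda>A. \<Sum>w\<leftarrow>shuf A V. h2 (Q w) * ?h (P w)) =
      (\<Sum>\<omega>\<leftarrow>shuf (altl (\<not> c) c (x - 1)) V. (\<Sum>w\<leftarrow>shuf (altl q q' z) (proj (\<not> c) \<omega>). h2 w) *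
        (\<Sum>w\<leftarrow>shufx (altl p p' y) (proj c \<omega>). ?h w))"
      using less.hyps[of "x - 1" z y V q q' p p' h2 ?h "\<not> c"] less.prems unfolding P_def Q_def by (simp add: Int_commute)
    have pp: "{p', p} = {p, p'}" by auto
    have 2: "0 < y \<Longrightarrow> wsum p' p q q' x (y - 1) z (\<lambda>A. \<Sum>w\<leftarrow>shuf A V. ?h (P w) * h2 (Q w)) =
      (\<Sum>\<omega>\<leftarrow>shuf (altl c (\<not> c) x) V. (\<Sum>w\<leftarrow>shuf (altl p' p (y - 1)) (proj c \<omega>). ?h w) *
        (\<Sum>w\<leftarrow>shufx (altl q q' z) (proj (\<not> c) \<omega>). h2 w))"
      using less.hyps[of x "y - 1" z V p' p q q' ?h h2 c] less.prems unfolding pp P_def Q_def by simp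
    have 3: "wsum p p' q q' x y z (\<lambda>A. \<Sum>w\<leftarrow>shuf A V'. ?h (P w) * h2 (Q w)) =
      (\<Sum>\<omega>\<leftarrow>shuf (altl c (\<not> c) x) V'. (\<Sum>w\<leftarrow>shuf (altl p p' y) (proj c \<omega>). ?h w) *
        (\<Sum>w\<leftarrow>shufx (altl q q' z) (proj (\<not> c) \<omega>). h2 w))"
      using less.hyps[of x y z V' p p' q q' ?h h2 c] less.prems Cons unfolding P_def Q_def by simp
    have "wsum p p' q q' x y z (\<lambda>A. \<Sum>w\<leftarrow>shuf A V. h1 (P w) * h2 (Q w)) =
      (if x = 0 \<and> y = 0 \<and> z = 0 \<and> V' = [] then h1 [(p, v)] * h2 [] else 0) +
      (if 0 < x then wsum q q' p p' (x - 1) z y (\<lambda>A. \<Sum>w\<leftarrow>shuf A V. h2 (Q w) * ?h (P w)) else 0) +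
      (if 0 < y then wsum p' p q q' x (y - 1) z (\<lambda>A. \<Sum>w\<leftarrow>shuf A V. ?h (P w) * h2 (Q w)) else 0) +
      wsum p p' q q' x y z (\<lambda>A. \<Sum>w\<leftarrow>shuf A V'. ?h (P w) * h2 (Q w))"
      unfolding Cons by (subst wsum_shuf_step) (simp add: fil mult.commute)
    then have "wsum p p' q q' x y z (\<lambda>A. \<Sum>w\<leftarrow>shuf A V. h1 (P w) * h2 (Q w)) =
      (\<Sum>\<omega>\<leftarrow>shuf (altl c (\<not> c) x) V. (\<Sum>w\<leftarrow>shuf (altl p p' y) (proj c \<omega>). h1 w) *
      (\<Sum>w\<leftarrow>shufx (altl q q' z) (proj (\<not> c) \<omega>). h2 w))"
      unfolding 3 using 1 2 unfolding Cons
      by (subst nested_step) (cases "x = 0"; cases "y = 0"; simp)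
    then show ?thesis unfolding P_def Q_def .
  qed
qed

section \<open>Alexander-Whitney and Steenrod maps on words\<close>

text \<open>\<open>aws l K\<close> is the sum of \<open>K\<close> over the Alexander-Whitney splittings of the list of pairs \<open>l\<close>.\<close>

primrec aws :: "('a \<times> 'b) list \<Rightarrow> ('a list \<Rightarrow> 'b list \<Rightarrow> bit) \<Rightarrow> bit" where
  "aws [] K = 0"
| "aws (p # l) K = K [fst p] (map snd (p # l)) + aws l (\<lambda>e. K (fst p # e))"

lemma aws_cong:
  "(\<And>e g. e \<noteq> [] \<Longrightarrow> g \<noteq> [] \<Longrightarrow> length e + length g = Suc (length l) \<Longrightarrow> K e g = K' e g) \<Longrightarrow>
   aws l K = aws l K'"
proof (induction l arbitrary: K K')
  case (Cons p l)
  have "aws l (\<lambda>e. K (fst p # e)) = aws l (\<lambda>e. K' (fst p # e))"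
    by (rule Cons.IH) (simp add: Cons.prems)
  then show ?case by (simp add: Cons.prems)
qed simp

lemma aws_zero: "aws l (\<lambda>e g. 0) = 0"
  by (induction l) auto

lemma aws_add: "aws l (\<lambda>e g. K e g + K' e g) = aws l K + aws l K'"
  by (induction l arbitrary: K K') (auto simp: ac_simps)

lemma aws_sum: "aws l (\<lambda>e g. \<Sum>x\<leftarrow>xs. K x e g) = (\<Sum>x\<leftarrow>xs. aws l (K x))"
  by (induction xs) (auto simp: aws_add aws_zero)

lemma aws_map: "aws (map (map_prod a b) l) K = aws l (\<lambda>e g. K (map a e) (map b g))"
  by (induction l arbitrary: K) (auto simp: o_def)

lemma aws_dels:
  "aws l (\<lambda>e g. (\<Sum>e'\<leftarrow>dels e. K e' g) + (\<Sum>g'\<leftarrow>dels g. K e g')) =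
    (\<Sum>l'\<leftarrow>dels l. aws l' K) + (if l = [] then 0 else K [] (map snd l) + K (map fst l) [])"
proof (induction l arbitrary: K)
  case (Cons p l)
  define K' where "K' = (\<lambda>e. K (fst p # e))"
  have "aws (p # l) (\<lambda>e g. (\<Sum>e'\<leftarrow>dels e. K e' g) + (\<Sum>g'\<leftarrow>dels g. K e g')) =
      K [] (map snd (p # l)) + (\<Sum>g'\<leftarrow>dels (map snd (p # l)). K [fst p] g') +
      aws l (\<lambda>e g. K e g + ((\<Sum>e'\<leftarrow>dels e. K' e' g) + (\<Sum>g'\<leftarrow>dels g. K' e g')))"
    by (simp add: K'_def o_def add.assoc)
  also have "aws l (\<lambda>e g. K e g + ((\<Sum>e'\<leftarrow>dels e. K' e' g) + (\<Sum>g'\<leftarrow>dels g. K' e g'))) =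
      aws l K + ((\<Sum>l'\<leftarrow>dels l. aws l' K') + (if l = [] then 0 else K' [] (map snd l) + K' (map fst l) []))"
    by (simp only: aws_add Cons.IH[of K', unfolded aws_add])
  also have "(\<Sum>l'\<leftarrow>dels (p # l). aws l' K) = aws l K +
      ((\<Sum>l'\<leftarrow>dels l. K [fst p] (snd p # map snd l')) + (\<Sum>l'\<leftarrow>dels l. aws l' K'))"
    by (simp add: o_def sum_list_addf K'_def)
  moreover have "(\<Sum>g'\<leftarrow>dels (map snd (p # l)). K [fst p] g') =
      K [fst p] (map snd l) + (\<Sum>l'\<leftarrow>dels l. K [fst p] (snd p # map snd l'))"
    by (simp add: dels_map o_def)
  ultimately show ?case
    by (cases "l = []") (auto simp: K'_def ac_simps)
qed simp

definition altword :: "bool list \<Rightarrow> bool list" where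
  "altword e = (if e = [] then [] else e @ [\<not> last e])"

lemma altword_Cons: "e \<noteq> [] \<Longrightarrow> altword (x # e) = x # altword e"
  by (simp add: altword_def)

lemma altword_simps [simp]: "altword [] = []" "altword [x] = [x, \<not> x]"
  by (simp_all add: altword_def)

lemma length_altword: "e \<noteq> [] \<Longrightarrow> length (altword e) = Suc (length e)"
  by (simp add: altword_def)

lemma altword_map: "altword (map (\<lambda>x. x \<noteq> a) e) = map (\<lambda>x. x \<noteq> a) (altword e)"
  by (auto simp: altword_def last_map)

lemma altword_dels2:
  assumes "stutter_free \<Phi>" "2 \<le> length e"
  shows "(\<Sum>A\<leftarrow>dels (altword e). \<Phi> A) = (\<Sum>e'\<leftarrow>dels e. \<Phi> (altword e'))"
  using assms
proof (induction e arbitrary: \<Phi>)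
  case (Cons x e)
  show ?case
  proof (cases "2 \<le> length e")
    case True
    note IH = Cons.IH[OF stutter_free_Cons[OF Cons.prems(1), of x] True]
    have "(\<Sum>e'\<leftarrow>dels e. \<Phi> (altword (x # e'))) = (\<Sum>e'\<leftarrow>dels e. \<Phi> (x # altword e'))"
    proof (rule sum_list_cong)
      fix e' assume "e' \<in> set (dels e)"
      then have "e' \<noteq> []" using length_dels True by fastforce
      then show "\<Phi> (altword (x # e')) = \<Phi> (x # altword e')" by (simp add: altword_Cons)
    qed
    moreover have "e \<noteq> []" using True by auto
    ultimately show ?thesis using IH by (simp add: altword_Cons o_def)
  next
    case False
    then obtain y where e: "e = [y]" using Cons.prems(2) by (cases e; cases "tl e") auto
    have "\<Phi> [x, x] = 0" using Cons.prems(1) by (simp add: stutter_free_def)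
    then show ?thesis by (cases x; cases y) (auto simp: e altword_def)
  qed
qed simp

lemma altword_dels:
  assumes "stutter_free \<Phi>" "\<Phi> [] = 0" "\<And>x. \<Phi> [x] = 0"
  shows "(\<Sum>A\<leftarrow>dels (altword e). \<Phi> A) = (\<Sum>e'\<leftarrow>dels e. \<Phi> (altword e'))"
proof (cases "2 \<le> length e")
  case True then show ?thesis using altword_dels2 assms by blast
next
  case False
  then show ?thesis by (cases e; cases "tl e") (auto simp: assms)
qed

text \<open>
  The word \<open>altword e\<close> has a repeated letter exactly when the simplex \<open>e\<close> is degenerate, and it
  starts with \<open>False\<close> or \<open>True\<close> when \<open>e\<close> is \<open>x\<^sub>m\<close> or its translate, so the exchange of the
  tensor factors is built in.
\<close>

definition stn :: "('v list \<Rightarrow> 'v list \<Rightarrow> bit) \<Rightarrow> bool list \<Rightarrow> 'v list \<Rightarrow> bit" where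
  "stn K e g = (\<Sum>\<omega>\<leftarrow>shuf (altword e) g. K (proj False \<omega>) (proj True \<omega>))"

lemma stn_Nil [simp]: "stn K [] g = 0" "stn K e [] = 0"
  by (simp_all add: stn_def)

lemma length_proj2: "length (proj False \<omega>) + length (proj True \<omega>) = length \<omega>"
  by (induction \<omega>) auto

lemma stn_add: "stn (\<lambda>L1 L2. K L1 L2 + K' L1 L2) e g = stn K e g + stn K' e g"
  by (simp add: stn_def sum_list_addf)

lemma stn_sum: "stn (\<lambda>L1 L2. \<Sum>x\<leftarrow>xs. K x L1 L2) e g = (\<Sum>x\<leftarrow>xs. stn (K x) e g)"
  unfolding stn_def by (rule sum_list_swap)

lemma sum_dels_proj2:
  fixes K :: "_ \<Rightarrow> _ \<Rightarrow> bit"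
  shows "(\<Sum>w\<leftarrow>dels \<omega>. K (proj False w) (proj True w)) =
    (\<Sum>L\<leftarrow>dels (proj False \<omega>). K L (proj True \<omega>)) + (\<Sum>L\<leftarrow>dels (proj True \<omega>). K (proj False \<omega>) L)"
proof (induction \<omega> arbitrary: K)
  case (Cons p \<omega>)
  obtain c v where p: "p = (c, v)" by (cases p)
  show ?case
    using Cons.IH[of "\<lambda>L. K (v # L)"] Cons.IH[of "\<lambda>L L'. K L (v # L')"]
    by (cases c) (simp_all add: p o_def ac_simps)
qed simp

lemma stn_dels:
  fixes K :: "'v list \<Rightarrow> 'v list \<Rightarrow> bit"
  assumes "\<And>L L'. \<not> distinct_adj L \<Longrightarrow> K L L' = 0" "\<And>L L'. \<not> distinct_adj L' \<Longrightarrow> K L L' = 0"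
    and "\<And>L. K [] L = 0" "\<And>L. K L [] = 0"
  shows "stn (\<lambda>L1 L2. (\<Sum>L\<leftarrow>dels L1. K L L2) + (\<Sum>L\<leftarrow>dels L2. K L1 L)) e g =
    (\<Sum>e'\<leftarrow>dels e. stn K e' g) + (\<Sum>g'\<leftarrow>dels g. stn K e g')"
proof -
  let ?F = "\<lambda>\<omega>. K (proj False \<omega>) (proj True \<omega>)"
  let ?\<Phi> = "\<lambda>A. \<Sum>\<omega>\<leftarrow>shuf A g. ?F \<omega>"
  have sf: "stutter_free ?\<Phi>"
    unfolding stutter_free_def
  proof (intro allI impI sum_list_zero)
    fix A :: "bool list" and \<omega> assume "\<not> distinct_adj A" "\<omega> \<in> set (shuf A g)"
    then obtain l where "\<not> distinct_adj (proj l \<omega>)" using shuf_stutter_proj by blast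
    then show "?F \<omega> = 0" using assms(1,2) by (cases l) auto
  qed
  have single: "?\<Phi> [x] = 0" for x
  proof (rule sum_list_zero)
    fix \<omega> assume "\<omega> \<in> set (shuf [x] g)"
    then have "(\<not> x) \<notin> fst ` set \<omega>" by (simp add: shuf_letters)
    then have "proj (\<not> x) \<omega> = []" by (simp add: proj_eq_Nil)
    then show "?F \<omega> = 0" using assms(3,4) by (cases x) auto
  qed
  have "length (altword e) \<noteq> 1" by (auto simp: altword_def)
  then show ?thesis
    unfolding stn_def sum_dels_proj2[symmetric]
    using shuf_dels[of ?F "altword e" g] altword_dels[OF sf _ single, of e] by simp
qed

section \<open>The chain map and the homotopy\<close>

lemma sum_shuf3_dels:
  fixes f :: "_ \<Rightarrow> bit"
  shows "(\<Sum>w\<leftarrow>shuf3 u v t. \<Sum>w'\<leftarrow>dels w. f w') =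
    (\<Sum>u'\<leftarrow>dels u. \<Sum>w\<leftarrow>shuf3 u' v t. f w) + (\<Sum>v'\<leftarrow>dels v. \<Sum>w\<leftarrow>shuf3 u v' t. f w) +
    (\<Sum>t'\<leftarrow>dels t. \<Sum>w\<leftarrow>shuf3 u v t'. f w) +
    (if length u = 1 \<and> length v = 1 \<and> length t = 1 then f [] else 0)"
proof -
  have A: "(\<Sum>a\<leftarrow>shuf v t. if length u = 1 \<and> length a = 1 then f [] else 0) =
      (if length u = 1 \<and> length v = 1 \<and> length t = 1 then f [] else 0)"
  proof (cases "length v = 1 \<and> length t = 1")
    case True then show ?thesis by (cases v; cases t) (auto simp: shuf.simps(3))
  next
    case False
    have "length a \<noteq> 1" if "a \<in> set (shuf v t)" for a
      using length_shuf[OF that] that False by (cases v; cases t) auto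
    then show ?thesis using False by (intro trans[OF sum_list_zero]) auto
  qed
  have B: "(\<Sum>a\<leftarrow>shuf v t. \<Sum>a'\<leftarrow>dels a. \<Sum>w\<leftarrow>shuf u a'. f w) =
     (\<Sum>v'\<leftarrow>dels v. \<Sum>a\<leftarrow>shuf v' t. \<Sum>w\<leftarrow>shuf u a. f w) +
     (\<Sum>t'\<leftarrow>dels t. \<Sum>a\<leftarrow>shuf v t'. \<Sum>w\<leftarrow>shuf u a. f w)"
    using shuf_dels[of "\<lambda>a. \<Sum>w\<leftarrow>shuf u a. f w" v t] by simp
  have C: "(\<Sum>a\<leftarrow>shuf v t. \<Sum>u'\<leftarrow>dels u. \<Sum>w\<leftarrow>shuf u' a. f w) =
      (\<Sum>u'\<leftarrow>dels u. \<Sum>a\<leftarrow>shuf v t. \<Sum>w\<leftarrow>shuf u' a. f w)"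
    by (rule sum_list_swap)
  have "(\<Sum>a\<leftarrow>shuf v t. \<Sum>w\<leftarrow>shuf u a. \<Sum>w'\<leftarrow>dels w. f w') =
      (\<Sum>a\<leftarrow>shuf v t. (\<Sum>u'\<leftarrow>dels u. \<Sum>w\<leftarrow>shuf u' a. f w) +
        (\<Sum>a'\<leftarrow>dels a. \<Sum>w\<leftarrow>shuf u a'. f w) +
        (if length u = 1 \<and> length a = 1 then f [] else 0))"
    by (rule sum_list_cong) (rule shuf_dels)
  also have "\<dots> = (\<Sum>u'\<leftarrow>dels u. \<Sum>a\<leftarrow>shuf v t. \<Sum>w\<leftarrow>shuf u' a. f w) +
     (\<Sum>v'\<leftarrow>dels v. \<Sum>a\<leftarrow>shuf v' t. \<Sum>w\<leftarrow>shuf u a. f w) +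
     (\<Sum>t'\<leftarrow>dels t. \<Sum>a\<leftarrow>shuf v t'. \<Sum>w\<leftarrow>shuf u a. f w) +
     (if length u = 1 \<and> length v = 1 \<and> length t = 1 then f [] else 0)"
    by (simp only: sum_list_addf A B C add.assoc)
  finally show ?thesis unfolding sum_shuf3 .
qed

definition phi :: "((bool \<times> bool \<times> bool) list \<Rightarrow> bit) \<Rightarrow> bool list \<Rightarrow> bool list \<Rightarrow> bit" where
  "phi f e g = aws (map (\<lambda>x. (x, x)) e)
     (\<lambda>e' e''. stn (\<lambda>L1 L2. \<Sum>w\<leftarrow>shuf3 e' L1 L2. f w) e'' g)"

definition psi :: "((bool \<times> bool \<times> bool) list \<Rightarrow> bit) \<Rightarrow> (bool \<times> bool) list \<Rightarrow> bit" where
  "psi f l = aws l (phi f)"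

lemma phi_Nil [simp]: "phi f [] g = 0" "phi f e [] = 0"
  by (simp_all add: phi_def aws_zero)

lemma psi_Nil [simp]: "psi f [] = 0"
  by (simp add: psi_def)

lemma shuf3_stutter:
  assumes "\<not> distinct_adj u \<or> \<not> distinct_adj v \<or> \<not> distinct_adj t" "w \<in> set (shuf3 u v t)"
  shows "\<not> distinct_adj w"
proof -
  obtain a where a: "a \<in> set (shuf v t)" "w \<in> set (shuf u a)"
    using assms(2) unfolding shuf3_def by auto
  show ?thesis
  proof (cases "distinct_adj u")
    case True
    then have "\<not> distinct_adj a" using assms(1) a(1) shuf_stutter1 shuf_stutter2 by blast
    then show ?thesis using a(2) by (rule shuf_stutter2)
  next
    case False then show ?thesis using a(2) by (rule shuf_stutter1)
  qed
qed

lemma phi_dels: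
  assumes "stutter_free f"
  shows "phi (\<lambda>w. \<Sum>w'\<leftarrow>dels w. f w') e g =
    (\<Sum>e'\<leftarrow>dels e. phi f e' g) + (\<Sum>g'\<leftarrow>dels g. phi f e g') +
    (if length e = 1 \<and> length g = 1 then f [] else 0)"
proof -
  define h where "h = (\<lambda>u L1 L2. \<Sum>w\<leftarrow>shuf3 u L1 L2. f w)"
  define S where "S u e'' = stn (h u) e'' g" for u e''
  let ?\<epsilon> = "\<lambda>e' L1 L2. if length e' = 1 \<and> length L1 = 1 \<and> length L2 = 1 then f [] else 0"
  have h0: "h u L L' = 0" if "\<not> distinct_adj L \<or> \<not> distinct_adj L'" for u L L'
    unfolding h_def
  proof (rule sum_list_zero)
    fix w assume "w \<in> set (shuf3 u L L')"
    then have "\<not> distinct_adj w" using that by (intro shuf3_stutter[of u L L']) auto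
    then show "f w = 0" using assms unfolding stutter_free_def by blast
  qed
  have kill: "\<And>L L'. \<not> distinct_adj L \<Longrightarrow> h u L L' = 0" "\<And>L L'. \<not> distinct_adj L' \<Longrightarrow> h u L L' = 0"
    "\<And>L. h u [] L = 0" "\<And>L. h u L [] = 0" for u
    using h0 by (simp_all add: h_def)
  have eps: "stn (?\<epsilon> e') e'' g = (if length e' = 1 \<and> length e'' = 1 \<and> length g = 1 then f [] else 0)"
    for e' e''
  proof (cases "length e'' = 1 \<and> length g = 1")
    case True
    then obtain x v where "e'' = [x]" "g = [v]" by (cases e''; cases g) auto
    then show ?thesis by (cases x) (auto simp: stn_def shuf.simps(3))
  next
    case False
    show ?thesis
    proof (cases "e'' = [] \<or> g = []")
      case True then show ?thesis by auto
    next
      case ne: False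
      have "length (proj False \<omega>) + length (proj True \<omega>) \<noteq> 2" if "\<omega> \<in> set (shuf (altword e'') g)" for \<omega>
      proof -
        have "length \<omega> = length e'' + length g" using length_shuf[OF that] ne by (simp add: length_altword)
        then show ?thesis unfolding length_proj2 using False ne by (cases e''; cases g) auto
      qed
      then have "stn (?\<epsilon> e') e'' g = 0"
        unfolding stn_def by (intro sum_list_zero) fastforce
      then show ?thesis using False by auto
    qed
  qed
  have "phi (\<lambda>w. \<Sum>w'\<leftarrow>dels w. f w') e g = aws (map (\<lambda>x. (x, x)) e)
     (\<lambda>e' e''. ((\<Sum>u'\<leftarrow>dels e'. S u' e'') + (\<Sum>u''\<leftarrow>dels e''. S e' u'')) +
       ((\<Sum>g'\<leftarrow>dels g. stn (h e') e'' g') +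
       (if length e' = 1 \<and> length e'' = 1 \<and> length g = 1 then f [] else 0)))"
    unfolding phi_def
  proof (intro arg_cong[where f="aws _"] ext)
    fix e' e''
    have e1: "stn (\<lambda>L1 L2. \<Sum>w\<leftarrow>shuf3 e' L1 L2. \<Sum>w'\<leftarrow>dels w. f w') e'' g =
       stn (\<lambda>L1 L2. (\<Sum>u'\<leftarrow>dels e'. h u' L1 L2) +
         (((\<Sum>L\<leftarrow>dels L1. h e' L L2) + (\<Sum>L\<leftarrow>dels L2. h e' L1 L)) + ?\<epsilon> e' L1 L2)) e'' g"
      unfolding sum_shuf3_dels h_def by (simp add: add.assoc)
    have sd: "stn (\<lambda>L1 L2. (\<Sum>L\<leftarrow>dels L1. h e' L L2) + (\<Sum>L\<leftarrow>dels L2. h e' L1 L)) e'' g =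
        (\<Sum>u''\<leftarrow>dels e''. stn (h e') u'' g) + (\<Sum>g'\<leftarrow>dels g. stn (h e') e'' g')"
      by (rule stn_dels) (simp_all add: kill)
    have "stn (\<lambda>L1 L2. (\<Sum>u'\<leftarrow>dels e'. h u' L1 L2) +
         (((\<Sum>L\<leftarrow>dels L1. h e' L L2) + (\<Sum>L\<leftarrow>dels L2. h e' L1 L)) + ?\<epsilon> e' L1 L2)) e'' g =
       (\<Sum>u'\<leftarrow>dels e'. S u' e'') + (((\<Sum>u''\<leftarrow>dels e''. S e' u'') +
       (\<Sum>g'\<leftarrow>dels g. stn (h e') e'' g')) +
       (if length e' = 1 \<and> length e'' = 1 \<and> length g = 1 then f [] else 0))"
      unfolding S_def by (simp only: stn_add[of "\<lambda>L1 L2. \<Sum>u'\<leftarrow>dels e'. h u' L1 L2"]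
        stn_add[of _ "?\<epsilon> e'"] stn_sum eps sd)
    note e2 = this
    show "stn (\<lambda>L1 L2. \<Sum>w\<leftarrow>shuf3 e' L1 L2. \<Sum>w'\<leftarrow>dels w. f w') e'' g =
      ((\<Sum>u'\<leftarrow>dels e'. S u' e'') + (\<Sum>u''\<leftarrow>dels e''. S e' u'')) +
       ((\<Sum>g'\<leftarrow>dels g. stn (h e') e'' g') +
       (if length e' = 1 \<and> length e'' = 1 \<and> length g = 1 then f [] else 0))"
      unfolding e1 e2 by (simp only: add.assoc)
  qed
  also have "\<dots> = aws (map (\<lambda>x. (x, x)) e)
     (\<lambda>e' e''. (\<Sum>u'\<leftarrow>dels e'. S u' e'') + (\<Sum>u''\<leftarrow>dels e''. S e' u'')) +
     (aws (map (\<lambda>x. (x, x)) e) (\<lambda>e' e''. \<Sum>g'\<leftarrow>dels g. stn (h e') e'' g') +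
     aws (map (\<lambda>x. (x, x)) e) (\<lambda>e' e''. if length e' = 1 \<and> length e'' = 1 \<and> length g = 1 then f [] else 0))"
    by (simp only: aws_add)
  also have "aws (map (\<lambda>x. (x, x)) e) (\<lambda>e' e''. \<Sum>g'\<leftarrow>dels g. stn (h e') e'' g') =
      (\<Sum>g'\<leftarrow>dels g. phi f e g')"
    unfolding aws_sum by (simp add: phi_def h_def)
  also have "aws (map (\<lambda>x. (x, x)) e)
     (\<lambda>e' e''. (\<Sum>u'\<leftarrow>dels e'. S u' e'') + (\<Sum>u''\<leftarrow>dels e''. S e' u'')) = (\<Sum>e'\<leftarrow>dels e. phi f e' g)"
  proof -
    have "S [] u = 0" "S u [] = 0" for u
      by (simp_all add: S_def stn_def h_def)
    then show ?thesis
      unfolding aws_dels by (simp add: dels_map o_def phi_def S_def h_def)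
  qed
  also have "aws (map (\<lambda>x. (x, x)) e) (\<lambda>e' e''. if length e' = 1 \<and> length e'' = 1 \<and> length g = 1 then f [] else 0) =
     (if length e = 1 \<and> length g = 1 then f [] else 0)"
  proof (cases "length e = 1")
    case True
    then obtain x where "e = [x]" by (cases e) auto
    then show ?thesis by simp
  next
    case False
    then show ?thesis
      by (subst aws_cong[where K'="\<lambda>e g. 0"]) (auto simp: aws_zero)
  qed
  finally show ?thesis by (simp add: add.assoc)
qed

lemma psi_dels:
  assumes "stutter_free f"
  shows "psi (\<lambda>w. \<Sum>w'\<leftarrow>dels w. f w') l = (\<Sum>l'\<leftarrow>dels l. psi f l') + (if length l = 1 then f [] else 0)"
proof -
  have "psi (\<lambda>w. \<Sum>w'\<leftarrow>dels w. f w') l =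
     aws l (\<lambda>e g. (\<Sum>e'\<leftarrow>dels e. phi f e' g) + (\<Sum>g'\<leftarrow>dels g. phi f e g')) +
     aws l (\<lambda>e g. if length e = 1 \<and> length g = 1 then f [] else 0)"
    unfolding psi_def phi_dels[OF assms, abs_def] by (simp only: aws_add)
  also have "aws l (\<lambda>e g. if length e = 1 \<and> length g = 1 then f [] else 0) = (if length l = 1 then f [] else 0)"
  proof (cases "length l = 1")
    case True
    then obtain x where "l = [x]" by (cases l) auto
    then show ?thesis by simp
  next
    case False
    then show ?thesis
      by (subst aws_cong[where K'="\<lambda>e g. 0"]) (auto simp: aws_zero)
  qed
  finally show ?thesis
    unfolding aws_dels psi_def by simp
qed

text \<open>\<open>V\<^sub>4\<close> sits in \<open>D\<^sub>8\<close> as the diagonal in the last two coordinates because \<open>b c\<close> moves both blocks.\<close>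

definition iota :: "bool \<times> bool \<Rightarrow> bool \<times> bool \<times> bool" where
  "iota = (\<lambda>(s, t). (s, t, t))"

primrec jsum :: "(bool \<times> bool) list \<Rightarrow> ((bool \<times> bool \<times> bool) list \<Rightarrow> bit) \<Rightarrow> bit" where
  "jsum [] f = 0"
| "jsum (p # l) f = psi (\<lambda>w. f (iota p # w)) (p # l) + jsum l (\<lambda>w. f (iota p # w))"

lemma psi_add: "psi (\<lambda>w. f w + f' w) l = psi f l + psi f' l"
  unfolding psi_def phi_def
  by (simp add: sum_list_addf stn_add aws_add)

lemma jsum_add: "jsum l (\<lambda>w. f w + f' w) = jsum l f + jsum l f'"
  by (induction l arbitrary: f f') (auto simp: psi_add ac_simps)

theorem jsum_dels:
  assumes "stutter_free f" "l \<noteq> []"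
  shows "jsum l (\<lambda>w. \<Sum>w'\<leftarrow>dels w. f w') =
    f (map iota l) + psi f l + (\<Sum>l'\<leftarrow>dels l. jsum l' f)"
  using assms
proof (induction l arbitrary: f)
  case (Cons p l)
  define g where "g = (\<lambda>w. f (iota p # w))"
  have g: "stutter_free g" unfolding g_def by (rule stutter_free_Cons[OF Cons.prems(1)])
  have D: "(\<lambda>w. \<Sum>w'\<leftarrow>dels (iota p # w). f w') = (\<lambda>w. f w + (\<Sum>w'\<leftarrow>dels w. g w'))"
    by (simp add: g_def o_def)
  have 1: "jsum (p # l) (\<lambda>w. \<Sum>w'\<leftarrow>dels w. f w') =
      psi f (p # l) + psi (\<lambda>w. \<Sum>w'\<leftarrow>dels w. g w') (p # l) + (jsum l f + jsum l (\<lambda>w. \<Sum>w'\<leftarrow>dels w. g w'))"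
    unfolding jsum.simps(2) D psi_add jsum_add ..
  have 2: "(\<Sum>l'\<leftarrow>dels (p # l). jsum l' f) =
      jsum l f + ((\<Sum>l'\<leftarrow>dels l. psi g (p # l')) + (\<Sum>l'\<leftarrow>dels l. jsum l' g))"
    by (simp add: o_def g_def sum_list_addf)
  have 3: "(\<Sum>l'\<leftarrow>dels (p # l). psi g l') = psi g l + (\<Sum>l'\<leftarrow>dels l. psi g (p # l'))"
    by (simp add: o_def)
  show ?case
  proof (cases "l = []")
    case True
    then show ?thesis unfolding 1 2 psi_dels[OF g] 3 by (simp add: g_def ac_simps)
  next
    case False
    then show ?thesis unfolding 1 2 psi_dels[OF g] 3 Cons.IH[OF g False]
      by (simp add: g_def ac_simps)
  qed
qed simp

subsection \<open>Equivariance\<close>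

lemma proj_map: "proj l (map (map_prod f g) w) = map g (map snd (filter (\<lambda>e. f (fst e) = l) w))"
  by (simp add: proj_def filter_map o_def)

lemma stn_map:
  "stn K (map (\<lambda>x. x \<noteq> a) e) (map \<tau> g) =
    stn (\<lambda>L1 L2. if a then K (map \<tau> L2) (map \<tau> L1) else K (map \<tau> L1) (map \<tau> L2)) e g"
  unfolding stn_def altword_map shuf_map
  by (auto simp: o_def proj_map proj_def[symmetric] intro!: sum_list_cong)

lemma sum_shuf3_map:
  "(\<Sum>w\<leftarrow>shuf3 (map a u) (map b v) (map c t). f w) =
    (\<Sum>w\<leftarrow>shuf3 u v t. f (map (map_prod a (map_prod b c)) w))"
  by (simp add: sum_shuf3 shuf_map o_def)

lemma map_prod_swap: "map_prod id prod.swap = (\<lambda>(x, y, z). (x, z, y))"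
  by auto

lemma sum_shuf3_swap:
  fixes f :: "_ \<Rightarrow> bit"
  shows "(\<Sum>w\<leftarrow>shuf3 u t v. f w) = (\<Sum>w\<leftarrow>shuf3 u v t. f (map (\<lambda>(x, y, z). (x, z, y)) w))"
proof -
  have "(\<Sum>w\<leftarrow>shuf3 u t v. f w) = (\<Sum>a\<leftarrow>shuf v t. \<Sum>w\<leftarrow>shuf u (map prod.swap a). f w)"
    unfolding sum_shuf3 by (rule shuf_swap)
  also have "(\<lambda>a. \<Sum>w\<leftarrow>shuf u (map prod.swap a). f w) =
      (\<lambda>a. \<Sum>w\<leftarrow>shuf u a. f (map (\<lambda>(x, y, z). (x, z, y)) w))"
  proof
    fix a
    show "(\<Sum>w\<leftarrow>shuf u (map prod.swap a). f w) =
        (\<Sum>w\<leftarrow>shuf u a. f (map (\<lambda>(x, y, z). (x, z, y)) w))"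
      using shuf_map[of id u prod.swap a] unfolding map_prod_swap by (simp add: o_def)
  qed
  finally show ?thesis by (simp add: sum_shuf3)
qed

definition d8act :: "bool \<Rightarrow> bool \<Rightarrow> bool \<times> bool \<times> bool \<Rightarrow> bool \<times> bool \<times> bool" where
  "d8act a b = (\<lambda>(x, y, z). if a then (\<not> x, z \<noteq> b, y \<noteq> b) else (x, y \<noteq> b, z \<noteq> b))"

lemma psi_map:
  "psi f (map (\<lambda>(s, t). (s \<noteq> a, t \<noteq> b)) l) = psi (\<lambda>w. f (map (d8act a b) w)) l"
proof -
  have eq: "(\<lambda>(s, t). (s \<noteq> a, t \<noteq> b)) = map_prod (\<lambda>s. s \<noteq> a) (\<lambda>t. t \<noteq> b)" by auto
  have "phi f (map (\<lambda>s. s \<noteq> a) e) (map (\<lambda>t. t \<noteq> b) g) = phi (\<lambda>w. f (map (d8act a b) w)) e g" for e g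
  proof -
    have dup: "map (\<lambda>x. (x, x)) (map (\<lambda>s. s \<noteq> a) e) =
        map (map_prod (\<lambda>s. s \<noteq> a) (\<lambda>s. s \<noteq> a)) (map (\<lambda>x. (x, x)) e)"
      by simp
    have *: "(if a then \<Sum>w\<leftarrow>shuf3 (map (\<lambda>s. s \<noteq> a) e') (map (\<lambda>t. t \<noteq> b) L2) (map (\<lambda>t. t \<noteq> b) L1). f w
        else \<Sum>w\<leftarrow>shuf3 (map (\<lambda>s. s \<noteq> a) e') (map (\<lambda>t. t \<noteq> b) L1) (map (\<lambda>t. t \<noteq> b) L2). f w) =
       (\<Sum>w\<leftarrow>shuf3 e' L1 L2. f (map (d8act a b) w))" for e' L1 L2
    proof (cases a)
      case True
      have comp: "map_prod (\<lambda>s. s \<noteq> a) (map_prod (\<lambda>t. t \<noteq> b) (\<lambda>t. t \<noteq> b)) \<circ> (\<lambda>(x, y, z). (x, z, y)) = d8act a b"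
        using True by (auto simp: d8act_def)
      show ?thesis
        unfolding if_P[OF True] sum_shuf3_map sum_shuf3_swap[of _ e' L2 L1] map_map comp ..
    next
      case False
      have comp: "map_prod (\<lambda>s. s \<noteq> a) (map_prod (\<lambda>t. t \<noteq> b) (\<lambda>t. t \<noteq> b)) = d8act a b"
        using False by (auto simp: d8act_def)
      show ?thesis unfolding if_not_P[OF False] sum_shuf3_map comp ..
    qed
    show ?thesis
      unfolding phi_def dup aws_map stn_map * ..
  qed
  then show ?thesis unfolding psi_def eq aws_map by simp
qed

lemma iota_map: "iota (s \<noteq> a, t \<noteq> b) = d8act a b (iota (s, t))"
  by (simp add: iota_def d8act_def)

lemma jsum_map:
  "jsum (map (\<lambda>(s, t). (s \<noteq> a, t \<noteq> b)) l) f = jsum l (\<lambda>w. f (map (d8act a b) w))"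
proof (induction l arbitrary: f)
  case (Cons p l)
  obtain s t where p: "p = (s, t)" by (cases p)
  show ?case
    unfolding p list.map prod.case jsum.simps iota_map
    using psi_map[of "\<lambda>w. f (d8act a b (iota (s, t)) # w)" a b "(s, t) # l"]
      Cons.IH[of "\<lambda>w. f (d8act a b (iota (s, t)) # w)"]
    by (simp only: list.map prod.case)
qed simp

subsection \<open>Evaluation on products of alternating sequences\<close>

lemma sum_shuf_snd:
  assumes "\<And>g. \<not> distinct_adj g \<Longrightarrow> K g = (0::bit)" "e \<noteq> []"
  shows "(\<Sum>l\<leftarrow>shuf e g. K (map snd l)) = (if length e = 1 then if g = [] then 0 else K g else 0)"
  using assms
proof (induction e g arbitrary: K rule: shuf.induct)
  case (3 x u y v)
  let ?K = "\<lambda>g. K (y # g)"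
  have K: "?K g = 0" if "\<not> distinct_adj g" for g
    using that "3.prems"(1) by (meson distinct_adj_ConsD)
  have 0: "(\<Sum>l\<leftarrow>shuf u (y # v). ?K (map snd l)) = 0"
  proof (cases u)
    case (Cons x' u')
    show ?thesis
      by (rule sum_list_zero, unfold Cons, drule hd_shuf) (auto intro!: "3.prems"(1))
  qed simp
  show ?case
  proof (cases "u = [] \<and> v = []")
    case True then show ?thesis by (simp add: sum_shuf_Cons)
  next
    case False
    show ?thesis using "3.IH"(2)[OF False, of ?K] K 0 False by (auto simp: sum_shuf_Cons)
  qed
qed auto

text \<open>The composite \<open>AW \<circ> EZ\<close> is the identity on normalized chains.\<close>

lemma sum_shuf_aws:
  assumes "\<And>e g. \<not> distinct_adj e \<Longrightarrow> K e g = 0" "\<And>e g. \<not> distinct_adj g \<Longrightarrow> K e g = 0"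
    and "e \<noteq> []" "g \<noteq> []"
  shows "(\<Sum>l\<leftarrow>shuf e g. aws l K) = K e g"
  using assms
proof (induction e g arbitrary: K rule: shuf.induct)
  case (3 x u y v)
  let ?K = "\<lambda>e. K (x # e)"
  have K: "\<And>e g. \<not> distinct_adj e \<Longrightarrow> ?K e g = 0" "\<And>e g. \<not> distinct_adj g \<Longrightarrow> ?K e g = 0"
    using "3.prems"(1,2) by (meson distinct_adj_ConsD)+
  show ?case
  proof (cases "u = [] \<and> v = []")
    case True then show ?thesis by (simp add: shuf.simps(3))
  next
    case False
    have 1: "(\<Sum>l\<leftarrow>shuf u (y # v). K [x] (y # map snd l)) = 0"
    proof (cases u)
      case (Cons x' u')
      show ?thesis
        by (rule sum_list_zero, unfold Cons, drule hd_shuf) (auto intro!: "3.prems"(2))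
    qed simp
    have 2: "(\<Sum>l\<leftarrow>shuf (x # u) v. K [x] (y # map snd l)) = (if u = [] \<and> v \<noteq> [] then K [x] (y # v) else 0)"
    proof -
      have Kx: "\<And>g. \<not> distinct_adj g \<Longrightarrow> K [x] (y # g) = 0"
        using "3.prems"(2) by (meson distinct_adj_ConsD)
      show ?thesis using sum_shuf_snd[of "\<lambda>g. K [x] (y # g)" "x # u" v, OF Kx] by auto
    qed
    have 3: "(\<Sum>l\<leftarrow>shuf u (y # v). aws l ?K) = (if u = [] then 0 else K (x # u) (y # v))"
      using "3.IH"(1)[OF False K] by auto
    have 4: "(\<Sum>l\<leftarrow>shuf (x # u) v. aws l ?K) = 0"
      using "3.IH"(2)[OF False K] "3.prems"(1) by (cases "v = []") auto
    show ?thesis using False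
      by (auto simp: sum_shuf_Cons sum_list_addf 1 2 3 4)
  qed
qed auto

lemma shuf_stutter_proj2:
  fixes u :: "'l list" and v :: "'v list"
  assumes "\<not> distinct_adj v" "w \<in> set (shuf u v)"
  shows "\<exists>l. \<not> distinct_adj (proj l w)"
  using assms
proof (induction u v arbitrary: w rule: shuf.induct)
  case (3 x u y v)
  then have ne: "\<not> (u = [] \<and> v = [])" by auto
  have step: "\<exists>l. \<not> distinct_adj (proj l ((x, y) # w'))" if ex: "\<exists>l. \<not> distinct_adj (proj l w')" for w' :: "('l \<times> 'v) list" and x y
  proof -
    obtain l where "\<not> distinct_adj (proj l w')" using ex by blast
    then have "\<not> distinct_adj (proj l ((x, y) # w'))"
      by (cases "x = l"; cases "proj l w'") simp_all
    then show ?thesis by blast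
  qed
  from "3.prems" ne obtain w' where w: "w = (x, y) # w'" and
    w': "w' \<in> set (shuf u (y # v)) \<or> w' \<in> set (shuf (x # u) v)"
    by (auto simp: shuf.simps(3))
  show ?case
  proof (cases "w' \<in> set (shuf u (y # v))")
    case True
    show ?thesis unfolding w by (rule step, rule "3.IH"(1)[OF ne "3.prems"(1) True])
  next
    case False
    then have w'': "w' \<in> set (shuf (x # u) v)" using w' by simp
    then obtain z v' where v: "v = z # v'" by (cases v) auto
    show ?thesis
    proof (cases "y = z")
      case True
      obtain w2 where "w' = (x, z) # w2" using hd_shuf[OF w''[unfolded v]] by auto
      then have "\<not> distinct_adj (proj x w)" using w True by simp
      then show ?thesis by blast
    next
      case False
      then have "\<not> distinct_adj v" using "3.prems"(1) v by simp
      then show ?thesis unfolding w by (intro step "3.IH"(2)[OF ne _ w''])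
    qed
  qed
qed auto

lemma aws_stutter:
  assumes "\<And>e g. \<not> distinct_adj e \<Longrightarrow> K e g = 0" "\<And>e g. \<not> distinct_adj g \<Longrightarrow> K e g = 0"
    and "\<not> distinct_adj l"
  shows "aws l K = 0"
  using assms
proof (induction l arbitrary: K)
  case (Cons p l)
  then obtain q l' where l: "l = q # l'" by (cases l) auto
  have snd: "K [fst p] (map snd (p # l)) = 0"
    using Cons.prems(2,3) distinct_adj_mapD by blast
  show ?case
  proof (cases "p = q")
    case True
    have z: "(\<lambda>e. K (fst p # fst p # e)) = (\<lambda>e g. 0)"
      by (intro ext Cons.prems(1)) simp
    have "aws l' (\<lambda>e. K (fst p # fst p # e)) = 0" unfolding z by (rule aws_zero)
    then show ?thesis using snd by (simp add: l True[symmetric] Cons.prems(1))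
  next
    case False
    then have "\<not> distinct_adj l" using Cons.prems(3) l by simp
    then have "aws l (\<lambda>e. K (fst p # e)) = 0"
      using Cons.prems(1,2) by (intro Cons.IH) (meson distinct_adj_ConsD)+
    then show ?thesis using snd by simp
  qed
qed simp

lemma stn_stutter:
  assumes "\<not> distinct_adj e \<or> \<not> distinct_adj g"
    and K: "\<And>L L'. \<not> distinct_adj L \<or> \<not> distinct_adj L' \<Longrightarrow> K L L' = 0"
  shows "stn K e g = 0"
  unfolding stn_def
proof (rule sum_list_zero)
  fix \<omega> assume \<omega>: "\<omega> \<in> set (shuf (altword e) g)"
  have "\<exists>l. \<not> distinct_adj (proj l \<omega>)"
  proof (cases "distinct_adj g")
    case True
    then have "\<not> distinct_adj (altword e)" using assms(1) by (auto simp: altword_def)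
    then show ?thesis using shuf_stutter_proj[OF _ \<omega>] by blast
  next
    case False then show ?thesis using shuf_stutter_proj2[OF _ \<omega>] by blast
  qed
  then obtain l where "\<not> distinct_adj (proj l \<omega>)" by blast
  then show "K (proj False \<omega>) (proj True \<omega>) = 0" by (intro K) (cases l; simp)
qed

lemma phi_stutter:
  assumes "stutter_free f"
  shows "\<not> distinct_adj e \<Longrightarrow> phi f e g = 0" and "\<not> distinct_adj g \<Longrightarrow> phi f e g = 0"
proof -
  have h: "(\<Sum>w\<leftarrow>shuf3 u v t. f w) = 0" if "\<not> distinct_adj u \<or> \<not> distinct_adj v \<or> \<not> distinct_adj t" for u v t
    using shuf3_stutter[OF that] assms by (intro sum_list_zero) (auto simp: stutter_free_def)
  show "phi f e g = 0" if "\<not> distinct_adj e"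
    unfolding phi_def
  proof (rule aws_stutter)
    show "\<not> distinct_adj (map (\<lambda>x. (x, x)) e)"
      using that by (subst distinct_adj_map_iff) (auto simp: inj_on_def)
    show "stn (\<lambda>L1 L2. sum_list (map f (shuf3 e' L1 L2))) e'' g = 0" if "\<not> distinct_adj e'" for e' e''
      using h that by (simp add: stn_def)
    show "stn (\<lambda>L1 L2. sum_list (map f (shuf3 e' L1 L2))) e'' g = 0" if "\<not> distinct_adj e''" for e' e''
      using h that by (intro stn_stutter) auto
  qed
  show "phi f e g = 0" if "\<not> distinct_adj g"
    unfolding phi_def using h that by (subst stn_stutter) (auto simp: aws_zero)
qed

theorem sum_shuf_psi:
  assumes "stutter_free f" "e \<noteq> []" "g \<noteq> []"
  shows "(\<Sum>l\<leftarrow>shuf e g. psi f l) = phi f e g"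
  unfolding psi_def using assms by (intro sum_shuf_aws) (simp_all add: phi_stutter)

lemma aws_dup_altl:
  "aws (map (\<lambda>x. (x, x)) (alt x q)) K = (\<Sum>i\<le>q. K (alt x i) (alt (x \<noteq> odd i) (q - i)))"
proof (induction q arbitrary: x K)
  case (Suc q)
  have "map snd (map (\<lambda>x. (x, x)) (alt (\<not> x) q)) = alt (\<not> x) q"
    by (simp add: o_def)
  then show ?case
    using Suc[of "\<not> x" "\<lambda>e. K (x # e)"]
    by (subst sum.atMost_Suc_shift) (simp add: o_def)
qed simp

lemma altword_alt: "altword (alt b m) = alt b (Suc m)"
proof (induction m arbitrary: b)
  case (Suc m)
  have "altword (alt b (Suc m)) = b # altword (alt (\<not> b) m)"
    by (simp add: altword_Cons del: altl.simps(2) altl_neq_Nil flip: altl.simps(2)) (simp add: altword_Cons)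
  then show ?case using Suc[of "\<not> b"] by simp
qed simp

lemma distinct_adj_alt: "distinct_adj (L :: bool list) \<Longrightarrow> L \<noteq> [] \<Longrightarrow> L = alt (hd L) (length L - 1)"
proof (induction L)
  case (Cons x L)
  show ?case
  proof (cases L)
    case (Cons y L')
    then have "y = (\<not> x)" "distinct_adj L" using Cons.prems by auto
    then show ?thesis using Cons.IH Cons by simp
  qed simp
qed simp

subsection \<open>Counting\<close>

definition dcount :: "bool list \<Rightarrow> nat \<Rightarrow> nat \<Rightarrow> bool \<Rightarrow> bool \<Rightarrow> nat \<Rightarrow> nat \<Rightarrow> bit" where
  "dcount pre M p b v i j = (\<Sum>\<omega>\<leftarrow>shuf (alt b M) (alt v p).
     of_bool (distinct_adj (proj b \<omega>) \<and> distinct_adj (pre @ proj (\<not> b) \<omega>) \<and>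
       length (proj b \<omega>) = Suc i \<and> length (proj (\<not> b) \<omega>) = j))"

lemma dcount_step:
  assumes "length pre \<le> 1"
  shows "dcount pre M p b v i j =
    (if M = 0 \<and> p = 0 then of_bool (i = 0 \<and> j = 0) else 0) +
    (if 0 < M \<and> 0 < j \<and> pre \<noteq> [v] then dcount [v] (M - 1) p (\<not> b) v (j - 1) i else 0) +
    (if 0 < p \<and> 0 < i then dcount pre M (p - 1) b (\<not> v) (i - 1) j else 0)"
proof -
  let ?H = "\<lambda>\<omega>. of_bool (distinct_adj (proj b \<omega>) \<and> distinct_adj (pre @ proj (\<not> b) \<omega>) \<and>
       length (proj b \<omega>) = Suc i \<and> length (proj (\<not> b) \<omega>) = j) :: bit"
  define us where "us c k = (if k = 0 then [] else alt (\<not> c) (k - 1))" for c k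
  have alt: "alt c k = c # us c k" and us: "us c k = [] \<longleftrightarrow> k = 0" for c k
    by (cases k; simp add: us_def)+
  have pre: "pre = [] \<or> (\<exists>u. pre = [u])" using assms by (cases pre) auto
  have 1: "(\<Sum>\<omega>\<leftarrow>shuf (us b M) (v # us v p). ?H ((b, v) # \<omega>)) =
      (if 0 < M \<and> 0 < j \<and> pre \<noteq> [v] then dcount [v] (M - 1) p (\<not> b) v (j - 1) i else 0)"
  proof (cases "M = 0")
    case False
    have "?H ((b, v) # \<omega>) = (if 0 < j \<and> pre \<noteq> [v] then of_bool (distinct_adj (proj (\<not> b) \<omega>) \<and>
        distinct_adj ([v] @ proj b \<omega>) \<and> length (proj (\<not> b) \<omega>) = Suc (j - 1) \<and> length (proj b \<omega>) = i) else 0)"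
      if \<omega>: "\<omega> \<in> set (shuf (alt (\<not> b) (M - 1)) (alt v p))" for \<omega>
    proof -
      obtain \<omega>' where "\<omega> = (\<not> b, v) # \<omega>'" using \<omega> unfolding alt by (auto dest: hd_shuf)
      then show ?thesis using pre by auto
    qed
    then have "(\<Sum>\<omega>\<leftarrow>shuf (alt (\<not> b) (M - 1)) (alt v p). ?H ((b, v) # \<omega>)) =
       (\<Sum>\<omega>\<leftarrow>shuf (alt (\<not> b) (M - 1)) (alt v p). if 0 < j \<and> pre \<noteq> [v] then of_bool (distinct_adj (proj (\<not> b) \<omega>) \<and>
        distinct_adj ([v] @ proj b \<omega>) \<and> length (proj (\<not> b) \<omega>) = Suc (j - 1) \<and> length (proj b \<omega>) = i) else 0)"
      by (intro sum_list_cong) blast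
    then show ?thesis using False unfolding dcount_def alt[symmetric]
      by (auto simp: us_def)
  qed (simp add: us_def)
  have 2: "(\<Sum>\<omega>\<leftarrow>shuf (b # us b M) (us v p). ?H ((b, v) # \<omega>)) =
      (if 0 < p \<and> 0 < i then dcount pre M (p - 1) b (\<not> v) (i - 1) j else 0)"
  proof (cases "p = 0")
    case False
    have "?H ((b, v) # \<omega>) = (if 0 < i then of_bool (distinct_adj (proj b \<omega>) \<and>
        distinct_adj (pre @ proj (\<not> b) \<omega>) \<and> length (proj b \<omega>) = Suc (i - 1) \<and> length (proj (\<not> b) \<omega>) = j) else 0)"
      if \<omega>: "\<omega> \<in> set (shuf (alt b M) (alt (\<not> v) (p - 1)))" for \<omega>
    proof -
      obtain \<omega>' where "\<omega> = (b, \<not> v) # \<omega>'" using \<omega> unfolding alt by (auto dest: hd_shuf)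
      then show ?thesis by auto
    qed
    then have "(\<Sum>\<omega>\<leftarrow>shuf (alt b M) (alt (\<not> v) (p - 1)). ?H ((b, v) # \<omega>)) =
       (\<Sum>\<omega>\<leftarrow>shuf (alt b M) (alt (\<not> v) (p - 1)). if 0 < i then of_bool (distinct_adj (proj b \<omega>) \<and>
        distinct_adj (pre @ proj (\<not> b) \<omega>) \<and> length (proj b \<omega>) = Suc (i - 1) \<and> length (proj (\<not> b) \<omega>) = j) else 0)"
      by (intro sum_list_cong) blast
    then show ?thesis using False unfolding dcount_def alt[symmetric]
      by (auto simp: us_def)
  qed (simp add: us_def)
  have 0: "?H [(b, v)] = of_bool (i = 0 \<and> j = 0)" using pre by auto
  show ?thesis
    unfolding dcount_def[of pre M p] alt[of b M] alt[of v p] sum_shuf_Cons 1 2 0 us by simp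
qed

definition cbin :: "nat \<Rightarrow> nat \<Rightarrow> bit" where
  "cbin j M = (if M = 0 then of_bool (j = 0) else if j = 0 then 0 else of_nat ((j - 1) choose (M - 1)))"

lemma binomial_char2: "of_nat (Suc (Suc n) choose Suc (Suc k)) = (of_nat (n choose Suc (Suc k)) + of_nat (n choose k) :: bit)"
  by (simp add: ac_simps)

lemma dcount_even_odd:
  shows "dcount [v] M p b v i j = of_bool (i + j = M + p) * of_nat (i choose M) * cbin j M"
    and "dcount [\<not> v] M p b v i j = of_bool (i + j = M + p) * of_nat (Suc i choose M) * cbin j M"
proof (induction "M + p" arbitrary: M p b v i j rule: less_induct)
  case less
  have IH1: "dcount [v] M' p' b v i j = of_bool (i + j = M' + p') * of_nat (i choose M') * cbin j M'"
    and IH2: "dcount [\<not> v] M' p' b v i j = of_bool (i + j = M' + p') * of_nat (Suc i choose M') * cbin j M'"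
    if "M' + p' < M + p" for M' p' b v i j
    using less[OF that] by auto
  {
    case 1
    have "dcount [v] M p b v i j = (if M = 0 \<and> p = 0 then of_bool (i = 0 \<and> j = 0) else 0) +
      (if 0 < p \<and> 0 < i then of_bool (i - 1 + j = M + (p - 1)) * of_nat (i choose M) * cbin j M else 0)"
      by (subst dcount_step) (use IH2[of M "p - 1" "\<not> v" b "i - 1" j] in auto)
    also have "\<dots> = of_bool (i + j = M + p) * of_nat (i choose M) * cbin j M"
      by (cases p; cases i; cases M) (auto simp: cbin_def binomial_eq_0)
    finally show ?case .
  next
    case 2
    have "dcount [\<not> v] M p b v i j = (if M = 0 \<and> p = 0 then of_bool (i = 0 \<and> j = 0) else 0) +
      (if 0 < M \<and> 0 < j then of_bool (j - 1 + i = M - 1 + p) * of_nat ((j - 1) choose (M - 1)) * cbin i (M - 1) else 0) +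
      (if 0 < p \<and> 0 < i then of_bool (i - 1 + j = M + (p - 1)) * of_nat ((i - 1) choose M) * cbin j M else 0)"
      by (subst dcount_step) (use IH1[of M "p - 1" "\<not> v" b "i - 1" j] IH1[of "M - 1" p v "\<not> b" "j - 1" i] in auto)
    also have "\<dots> = of_bool (i + j = M + p) * of_nat (Suc i choose M) * cbin j M"
    proof (cases M)
      case 0 then show ?thesis by (cases p; cases i) (auto simp: cbin_def)
    next
      case (Suc M')
      show ?thesis
      proof (cases M')
        case 0 then show ?thesis using Suc by (cases p; cases i; cases j) (auto simp: cbin_def)
      next
        case (Suc M'')
        then show ?thesis using \<open>M = Suc M'\<close>
          by (cases p; cases i; cases j)
            (auto simp: cbin_def binomial_eq_0 binomial_char2 algebra_simps simp del: binomial_Suc_Suc)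
      qed
    qed
    finally show ?case .
  }
qed

lemma dcount_init:
  "dcount [] (Suc m) p b v i (Suc j) =
    of_bool (i + j = m + p) * of_nat (i choose m) * of_nat (j choose m)"
proof (induction p arbitrary: v i)
  case 0
  show ?case
    by (subst dcount_step, simp) (cases i; cases m; auto simp: dcount_even_odd cbin_def binomial_eq_0)
next
  case (Suc p)
  show ?case
    by (subst dcount_step, simp, insert Suc[of "\<not> v" "i - 1"])
      (cases i; cases m; auto simp: dcount_even_odd cbin_def binomial_eq_0 algebra_simps)
qed

theorem stn_alt:
  assumes K: "\<And>L L'. \<not> distinct_adj L \<or> \<not> distinct_adj L' \<Longrightarrow> K L L' = 0"
    and h: "\<And>x y r s. K (alt x r) (alt y s) = h r s"
  shows "stn K (alt b m) (alt v p) = (\<Sum>r\<le>m + p. of_nat (r choose m) * of_nat ((m + p - r) choose m) *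
     (if b then h (m + p - r) r else h r (m + p - r)))"
proof -
  let ?h = "\<lambda>r. if b then h (m + p - r) r else h r (m + p - r)"
  have "K (proj False \<omega>) (proj True \<omega>) = (\<Sum>r\<le>m + p. of_bool (distinct_adj (proj b \<omega>) \<and>
      distinct_adj ([] @ proj (\<not> b) \<omega>) \<and> length (proj b \<omega>) = Suc r \<and> length (proj (\<not> b) \<omega>) = Suc (m + p - r)) * ?h r)"
    (is "_ = sum ?s _") if \<omega>: "\<omega> \<in> set (shuf (alt b (Suc m)) (alt v p))" for \<omega>
  proof (cases "distinct_adj (proj b \<omega>) \<and> distinct_adj (proj (\<not> b) \<omega>)")
    case False
    then have "K (proj False \<omega>) (proj True \<omega>) = 0" by (intro K) (cases b; auto)
    then show ?thesis using False by auto
  next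
    case True
    have "fst ` set \<omega> = set (alt b (Suc m))" using shuf_letters[OF \<omega>] .
    moreover have "{b, \<not> b} \<subseteq> set (alt b (Suc m))" by (cases m) auto
    ultimately have ne: "proj b \<omega> \<noteq> []" "proj (\<not> b) \<omega> \<noteq> []"
      unfolding proj_eq_Nil[symmetric] by auto
    define r s where "r = length (proj b \<omega>) - 1" and "s = length (proj (\<not> b) \<omega>) - 1"
    have len: "length (proj b \<omega>) = Suc r" "length (proj (\<not> b) \<omega>) = Suc s"
      using ne by (auto simp: r_def s_def)
    have "length (proj b \<omega>) + length (proj (\<not> b) \<omega>) = length \<omega>"
      using length_proj2[of \<omega>] by (cases b) auto
    then have rs: "r + s = m + p" using length_shuf[OF \<omega>] len by simp
    have "proj b \<omega> = alt (hd (proj b \<omega>)) r" "proj (\<not> b) \<omega> = alt (hd (proj (\<not> b) \<omega>)) s"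
      using True ne distinct_adj_alt by (auto simp: r_def s_def)
    then obtain x y where xy: "proj b \<omega> = alt x r" "proj (\<not> b) \<omega> = alt y s" by blast
    have "K (proj False \<omega>) (proj True \<omega>) = (if b then h s r else h r s)"
      using xy h by (cases b) simp_all
    moreover have "sum ?s {..m + p} = ?s r"
    proof -
      have "?s r' = (if r' = r then ?s r else 0)" for r'
        by (cases "r' = r") (simp_all add: len)
      then have "sum ?s {..m + p} = (\<Sum>r'\<le>m + p. if r' = r then ?s r else 0)"
        by (intro sum.cong refl)
      also have "\<dots> = ?s r" using rs by (subst sum.delta) simp_all
      finally show ?thesis .
    qed
    moreover have "m + p - r = s" using rs by simp
    ultimately show ?thesis using True len by simp
  qed
  then have "stn K (alt b m) (alt v p) = (\<Sum>\<omega>\<leftarrow>shuf (alt b (Suc m)) (alt v p). \<Sum>r\<le>m + p. of_bool (distinct_adj (proj b \<omega>) \<and>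
      distinct_adj ([] @ proj (\<not> b) \<omega>) \<and> length (proj b \<omega>) = Suc r \<and> length (proj (\<not> b) \<omega>) = Suc (m + p - r)) * ?h r)"
    unfolding stn_def altword_alt by (intro sum_list_cong) blast
  also have "\<dots> = (\<Sum>r\<le>m + p. dcount [] (Suc m) p b v r (Suc (m + p - r)) * ?h r)"
    unfolding sum_list_sum_swap dcount_def by (simp add: sum_list_mult_const)
  finally show ?thesis by (simp add: dcount_init)
qed

section \<open>Evaluating cochains on chains\<close>

lemma pairing_alt:
  assumes "finite S" "Poly_Mapping.keys c \<subseteq> S"
  shows "pairing \<beta> c = (\<Sum>u\<in>S. \<beta> u * Poly_Mapping.lookup c u)"
proof -
  have "pairing \<beta> c = (\<Sum>u\<in>Poly_Mapping.keys c. \<beta> u * Poly_Mapping.lookup c u)"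
    unfolding pairing_def by (rule sum.cong) (auto simp: in_keys_iff)
  also have "\<dots> = (\<Sum>u\<in>S. \<beta> u * Poly_Mapping.lookup c u)"
    using assms by (intro sum.mono_neutral_left) (auto simp: in_keys_iff)
  finally show ?thesis .
qed

lemma pairing_add: "pairing \<beta> (c + e) = pairing \<beta> c + pairing \<beta> e"
proof -
  let ?S = "Poly_Mapping.keys c \<union> Poly_Mapping.keys e"
  have "finite ?S" by simp
  then show ?thesis
    using pairing_alt[of ?S "c + e" \<beta>] pairing_alt[of ?S c \<beta>] pairing_alt[of ?S e \<beta>] keys_add[of c e]
    by (simp add: lookup_add distrib_left sum.distrib)
qed

lemma pairing_zero [simp]: "pairing \<beta> 0 = 0"
  by (simp add: pairing_def)

lemma pairing_sum: "pairing \<beta> (\<Sum>x\<in>A. c x) = (\<Sum>x\<in>A. pairing \<beta> (c x))"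
  by (induction A rule: infinite_finite_induct) (auto simp: pairing_add)

lemma keys_basis [simp]: "Poly_Mapping.keys (basis u) = {u}"
  by (simp add: basis_def)

lemma pairing_basis [simp]: "pairing \<beta> (basis u) = \<beta> u"
  by (simp add: pairing_def)

lemma lin_basis [simp]: "lin f (basis u) = f u"
  by (simp add: lin_def)

lemma pairing_lin: "pairing \<beta> (lin f c) = pairing (\<lambda>u. pairing \<beta> (f u)) c"
  by (simp add: lin_def pairing_sum) (simp add: pairing_def)

lemma pairing_cls: "pairing \<beta> (cls X u) = (if u \<in> nondegenerate X then \<beta> u else 0)"
  by (simp add: cls_def)

lemma tensor_basis [simp]: "tensor (basis u) (basis v) = basis (u, v)"
  by (simp add: tensor_def)

lemma pairing_tensor: "pairing \<beta> (tensor c e) = pairing (\<lambda>u. pairing (\<lambda>v. \<beta> (u, v)) e) c"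
  by (simp add: tensor_def pairing_lin)

lemma pairing_push: "pairing \<beta> (push Z f c) = pairing (\<lambda>u. if f u \<in> nondegenerate Z then \<beta> (f u) else 0) c"
  by (simp add: push_def pairing_lin pairing_cls)

lemma pairing_cong: "(\<And>u. u \<in> Poly_Mapping.keys c \<Longrightarrow> \<beta> u = \<gamma> u) \<Longrightarrow> pairing \<beta> c = pairing \<gamma> c"
  by (simp add: pairing_def)

lemma lookup_eq_pairing: "Poly_Mapping.lookup c u = pairing (\<lambda>x. of_bool (x = u)) c"
proof -
  have "pairing (\<lambda>x. of_bool (x = u)) c = (\<Sum>x\<in>insert u (Poly_Mapping.keys c). of_bool (x = u) * Poly_Mapping.lookup c x)"
    by (rule pairing_alt) auto
  also have "\<dots> = (\<Sum>x\<in>insert u (Poly_Mapping.keys c). if x = u then Poly_Mapping.lookup c x else 0)"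
    by (rule sum.cong) auto
  also have "\<dots> = Poly_Mapping.lookup c u" by (subst sum.delta) auto
  finally show ?thesis by simp
qed

lemma chain_eqI:
  fixes c e :: "'a chain"
  assumes "\<And>\<beta> :: 'a \<Rightarrow> bit. pairing \<beta> c = pairing \<beta> e"
  shows "c = e"
  by (rule poly_mapping_eqI) (simp add: lookup_eq_pairing assms)

lemma keys_subset_iff: "Poly_Mapping.keys c \<subseteq> S \<longleftrightarrow> (\<forall>u. u \<notin> S \<longrightarrow> pairing (\<lambda>x. of_bool (x = u)) c = 0)"
  unfolding lookup_eq_pairing[symmetric] by (auto simp: in_keys_iff)


section \<open>Divisions as shuffles\<close>

fun path_of :: "'l list \<Rightarrow> nat list \<Rightarrow> ('l \<times> nat) list" where
  "path_of (x # A) (a # b # t) = map (Pair x) [a..<Suc b] @ path_of A (b # t)"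
| "path_of _ _ = []"

definition cuts :: "'l list \<Rightarrow> nat \<Rightarrow> nat \<Rightarrow> nat list set" where
  "cuts A a N = {t. length t = Suc (length A) \<and> sorted t \<and> hd t = a \<and> last t = N}"

lemma finite_cuts: "finite (cuts A a N)"
proof (rule finite_subset)
  show "cuts A a N \<subseteq> {t. set t \<subseteq> {..N} \<and> length t = Suc (length A)}"
  proof
    fix t assume t: "t \<in> cuts A a N"
    then have "t \<noteq> []" "sorted t" "last t = N" by (auto simp: cuts_def)
    have "x \<le> N" if "x \<in> set t" for x
    proof -
      obtain i where i: "i < length t" "x = t ! i" using \<open>x \<in> set t\<close> by (metis in_set_conv_nth)
      then have "t ! i \<le> t ! (length t - 1)" using \<open>sorted t\<close> by (intro sorted_nth_mono) auto
      then show ?thesis using i \<open>t \<noteq> []\<close> \<open>last t = N\<close> by (simp add: last_conv_nth)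
    qed
    then show "t \<in> {t. set t \<subseteq> {..N} \<and> length t = Suc (length A)}" using t by (auto simp: cuts_def)
  qed
qed (rule finite_lists_length_eq, simp)

lemma cuts_Cons:
  "A \<noteq> [] \<Longrightarrow> cuts (x # A) a N = (\<lambda>(b, t). a # t) ` (SIGMA b:{a..N}. cuts A b N)"
proof (intro equalityI subsetI)
  fix t assume A: "A \<noteq> []" and t: "t \<in> cuts (x # A) a N"
  then obtain t' where t': "t = a # t'" "length t' = Suc (length A)" "sorted (a # t')" "last t = N"
    by (cases t) (auto simp: cuts_def)
  then have ne: "t' \<noteq> []" by auto
  then have l: "last t' = N" using t' by simp
  have "hd t' \<le> last t'" using t'(3) ne
    by (metis last_in_set list.collapse sorted_wrt.simps(2) set_ConsD order_refl)
  moreover have "a \<le> hd t'" using t'(3) ne by simp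
  ultimately show "t \<in> (\<lambda>(b, t). a # t) ` (SIGMA b:{a..N}. cuts A b N)"
    using t' ne l by (auto simp: cuts_def image_iff)
next
  fix t assume A: "A \<noteq> []" and "t \<in> (\<lambda>(b, t). a # t) ` (SIGMA b:{a..N}. cuts A b N)"
  then obtain b t' where t: "t = a # t'" "a \<le> b" "t' \<in> cuts A b N" by auto
  then have "t' \<noteq> []" by (auto simp: cuts_def)
  then obtain t'' where "t' = b # t''" using t by (cases t') (auto simp: cuts_def)
  then show "t \<in> cuts (x # A) a N" using t by (auto simp: cuts_def)
qed

lemma sum_shuf_upt:
  fixes H :: "_ \<Rightarrow> bit"
  assumes "A \<noteq> []" "a \<le> N"
  shows "(\<Sum>\<omega>\<leftarrow>shuf (x # A) [a..<Suc N]. H \<omega>) =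
    (\<Sum>b\<in>{a..N}. \<Sum>\<omega>\<leftarrow>shuf A [b..<Suc N]. H (map (Pair x) [a..<Suc b] @ \<omega>))"
  using assms(2)
proof (induction "N - a" arbitrary: a H)
  case 0
  then have "a = N" by simp
  then show ?case using assms(1) by (simp add: sum_shuf_Cons)
next
  case (Suc d)
  then have a: "a < N" "d = N - Suc a" by auto
  have "(\<Sum>\<omega>\<leftarrow>shuf (x # A) [a..<Suc N]. H \<omega>) =
      (\<Sum>\<omega>\<leftarrow>shuf A [a..<Suc N]. H ((x, a) # \<omega>)) + (\<Sum>\<omega>\<leftarrow>shuf (x # A) [Suc a..<Suc N]. H ((x, a) # \<omega>))"
    using a assms(1) by (simp add: upt_conv_Cons[of a] sum_shuf_Cons del: upt_Suc)
  also have "(\<Sum>\<omega>\<leftarrow>shuf (x # A) [Suc a..<Suc N]. H ((x, a) # \<omega>)) =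
      (\<Sum>b\<in>{Suc a..N}. \<Sum>\<omega>\<leftarrow>shuf A [b..<Suc N]. H ((x, a) # map (Pair x) [Suc a..<Suc b] @ \<omega>))"
    by (rule Suc.hyps(1)[OF a(2)]) (use a in simp)
  also have "\<dots> = (\<Sum>b\<in>{Suc a..N}. \<Sum>\<omega>\<leftarrow>shuf A [b..<Suc N]. H (map (Pair x) [a..<Suc b] @ \<omega>))"
    by (rule sum.cong) (auto simp: upt_conv_Cons[of a] simp del: upt_Suc)
  also have "(\<Sum>\<omega>\<leftarrow>shuf A [a..<Suc N]. H ((x, a) # \<omega>)) =
      (\<Sum>\<omega>\<leftarrow>shuf A [a..<Suc N]. H (map (Pair x) [a..<Suc a] @ \<omega>))" by simp
  finally show ?case
    using a by (simp add: sum.atLeast_Suc_atMost[of a N] del: upt_Suc)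
qed

lemma sum_shuf_cuts:
  fixes H :: "_ \<Rightarrow> bit"
  assumes "A \<noteq> []" "a \<le> N"
  shows "(\<Sum>\<omega>\<leftarrow>shuf A [a..<Suc N]. H \<omega>) = (\<Sum>t\<in>cuts A a N. H (path_of A t))"
  using assms
proof (induction A arbitrary: a H)
  case (Cons x A)
  show ?case
  proof (cases "A = []")
    case True
    have "cuts [x] a N = {[a, N]}"
    proof (intro equalityI subsetI)
      fix t assume t: "t \<in> cuts [x] a N"
      then obtain u v where "t = [u, v]" by (cases t; cases "tl t") (auto simp: cuts_def)
      then show "t \<in> {[a, N]}" using t by (simp add: cuts_def)
    qed (use Cons.prems in \<open>simp add: cuts_def\<close>)
    moreover have "shuf [x] (y # v) = [map (Pair x) (y # v)]" for y and v :: "nat list"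
      by (induction v arbitrary: y) (auto simp: shuf.simps(3))
    ultimately show ?thesis using Cons.prems True
      by (simp add: upt_conv_Cons[of a] del: upt_Suc)
  next
    case False
    have inj: "inj_on (\<lambda>(b, t). a # t) (SIGMA b:{a..N}. cuts A b N)"
      by (auto simp: inj_on_def cuts_def)
    have p: "path_of (x # A) (a # t) = map (Pair x) [a..<Suc b] @ path_of A t" if "t \<in> cuts A b N" for b t
      using that by (cases t) (auto simp: cuts_def)
    have "(\<Sum>t\<in>cuts (x # A) a N. H (path_of (x # A) t)) =
        (\<Sum>(b, t)\<in>(SIGMA b:{a..N}. cuts A b N). H (path_of (x # A) (a # t)))"
      unfolding cuts_Cons[OF False] by (subst sum.reindex[OF inj]) (simp add: o_def case_prod_unfold)
    also have "\<dots> = (\<Sum>b\<in>{a..N}. \<Sum>t\<in>cuts A b N. H (path_of (x # A) (a # t)))"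
      by (subst sum.Sigma) (auto simp: finite_cuts)
    also have "\<dots> = (\<Sum>b\<in>{a..N}. \<Sum>t\<in>cuts A b N. H (map (Pair x) [a..<Suc b] @ path_of A t))"
      by (intro sum.cong refl arg_cong[where f=H] p)
    also have "\<dots> = (\<Sum>b\<in>{a..N}. \<Sum>\<omega>\<leftarrow>shuf A [b..<Suc N]. H (map (Pair x) [a..<Suc b] @ \<omega>))"
      by (intro sum.cong refl Cons.IH[symmetric]) (use False in auto)
    finally show ?thesis using sum_shuf_upt[OF False, of a N H x] Cons.prems by simp
  qed
qed simp

lemma proj_append [simp]: "proj l (w @ w') = proj l w @ proj l w'"
  by (simp add: proj_def)

lemma proj_map_Pair: "proj l (map (Pair x) v) = (if x = l then v else [])"
  by (induction v) auto

lemma set_proj_path: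
  "length t = Suc (length A) \<Longrightarrow>
   v \<in> set (proj l (path_of A t)) \<longleftrightarrow> (\<exists>j<length A. A ! j = l \<and> t ! j \<le> v \<and> v \<le> t ! Suc j)"
proof (induction A t rule: path_of.induct)
  case (1 x A a b t)
  have *: "(\<exists>j<Suc n. P j) \<longleftrightarrow> P 0 \<or> (\<exists>j<n. P (Suc j))" for n and P :: "nat \<Rightarrow> bool"
    using less_Suc_eq_0_disj by auto
  have IH: "v \<in> set (proj l (path_of A (b # t))) \<longleftrightarrow>
      (\<exists>j<length A. A ! j = l \<and> (b # t) ! j \<le> v \<and> v \<le> (b # t) ! Suc j)"
    using 1 by simp
  have "v \<in> set (proj l (path_of (x # A) (a # b # t))) \<longleftrightarrow> (x = l \<and> a \<le> v \<and> v \<le> b) \<or>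
      v \<in> set (proj l (path_of A (b # t)))"
    by (simp add: proj_map_Pair less_Suc_eq_le del: upt_Suc)
  then show ?case unfolding IH length_Cons * by simp
qed auto

definition apart :: "'l list \<Rightarrow> nat list \<Rightarrow> bool" where
  "apart A t \<longleftrightarrow> (\<forall>j<length A. \<forall>j'<length A. j \<noteq> j' \<and> A ! j = A ! j' \<longrightarrow>
     {t ! j..t ! Suc j} \<inter> {t ! j'..t ! Suc j'} = {})"

lemma apart_Cons:
  "apart (x # A) (a # b # t) \<longleftrightarrow> apart A (b # t) \<and>
    (\<forall>j<length A. A ! j = x \<longrightarrow> {a..b} \<inter> {(b # t) ! j..(b # t) ! Suc j} = {})"
proof -
  have *: "(\<forall>j<Suc n. P j) \<longleftrightarrow> P 0 \<and> (\<forall>j<n. P (Suc j))" for n and P :: "nat \<Rightarrow> bool"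
    using less_Suc_eq_0_disj by auto
  show ?thesis
    unfolding apart_def length_Cons * by (auto simp: Int_commute)
qed

lemma distinct_proj_path:
  "length t = Suc (length A) \<Longrightarrow> (\<forall>l. distinct (proj l (path_of A t))) \<longleftrightarrow> apart A t"
proof (induction A t rule: path_of.induct)
  case (1 x A a b t)
  have len: "length (b # t) = Suc (length A)" using 1 by simp
  have "distinct (proj l (path_of (x # A) (a # b # t))) \<longleftrightarrow> distinct (proj l (path_of A (b # t))) \<and>
      (l = x \<longrightarrow> {a..b} \<inter> set (proj x (path_of A (b # t))) = {})" for l
    by (cases "l = x") (auto simp: proj_map_Pair atLeastLessThanSuc_atLeastAtMost simp del: upt_Suc)
  then have "(\<forall>l. distinct (proj l (path_of (x # A) (a # b # t)))) \<longleftrightarrow>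
      (\<forall>l. distinct (proj l (path_of A (b # t)))) \<and> {a..b} \<inter> set (proj x (path_of A (b # t))) = {}"
    by blast
  also have "{a..b} \<inter> set (proj x (path_of A (b # t))) = {} \<longleftrightarrow>
      (\<forall>j<length A. A ! j = x \<longrightarrow> {a..b} \<inter> {(b # t) ! j..(b # t) ! Suc j} = {})"
    using set_proj_path[OF len, of _ x] by fastforce
  finally show ?case unfolding apart_Cons using 1 by simp
qed (auto simp: apart_def)

lemma divisions_eq: "divisions A N = {t \<in> cuts A 0 N. apart A t}"
proof -
  have *: "(\<forall>j\<in>{1..n}. P (j - 1) j) \<longleftrightarrow> (\<forall>j<n. P j (Suc j))" for n and P :: "nat \<Rightarrow> nat \<Rightarrow> bool"
  proof
    assume P: "\<forall>j\<in>{1..n}. P (j - 1) j"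
    show "\<forall>j<n. P j (Suc j)"
    proof (intro allI impI)
      fix j assume "j < n"
      then show "P j (Suc j)" using bspec[OF P, of "Suc j"] by simp
    qed
  next
    assume P: "\<forall>j<n. P j (Suc j)"
    show "\<forall>j\<in>{1..n}. P (j - 1) j"
    proof
      fix j assume "j \<in> {1..n}"
      then obtain i where "j = Suc i" "i < n" by (cases j) auto
      then show "P (j - 1) j" using P by simp
    qed
  qed
  have "apart A t \<longleftrightarrow> (\<forall>j\<in>{1..length A}. \<forall>j'\<in>{1..length A}.
           j \<noteq> j' \<and> A ! (j - 1) = A ! (j' - 1) \<longrightarrow> interval t j \<inter> interval t j' = {})" for t
  proof -
    have "(\<forall>j\<in>{1..length A}. \<forall>j'\<in>{1..length A}.
           j \<noteq> j' \<and> A ! (j - 1) = A ! (j' - 1) \<longrightarrow> interval t j \<inter> interval t j' = {}) \<longleftrightarrow>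
      (\<forall>j<length A. \<forall>j'\<in>{1..length A}. Suc j \<noteq> j' \<and> A ! j = A ! (j' - 1) \<longrightarrow> interval t (Suc j) \<inter> interval t j' = {})"
      by (rule *[of "length A" "\<lambda>i j. \<forall>j'\<in>{1..length A}. j \<noteq> j' \<and> A ! i = A ! (j' - 1) \<longrightarrow> interval t j \<inter> interval t j' = {}"])
    also have "\<dots> \<longleftrightarrow> (\<forall>j<length A. \<forall>j'<length A. Suc j \<noteq> Suc j' \<and> A ! j = A ! j' \<longrightarrow>
        interval t (Suc j) \<inter> interval t (Suc j') = {})"
      using *[of "length A" "\<lambda>i j'. Suc _ \<noteq> j' \<and> A ! _ = A ! i \<longrightarrow> interval t (Suc _) \<inter> interval t j' = {}"]
      by simp
    also have "\<dots> \<longleftrightarrow> apart A t" by (simp add: apart_def interval_def)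
    finally show ?thesis by blast
  qed
  then show ?thesis by (auto simp: divisions_def cuts_def)
qed

lemma sorted_path_of: "sorted t \<Longrightarrow> sorted (map snd (path_of A t)) \<and> (\<forall>v\<in>snd ` set (path_of A t). hd t \<le> v)"
proof (induction A t rule: path_of.induct)
  case (1 x A a b t)
  then show ?case by (fastforce simp: sorted_append o_def simp del: upt_Suc)
qed auto

lemma sorted_list_of_intervals:
  assumes "t \<in> divisions A N"
  shows "sorted_list_of_set (\<Union>j\<in>{j \<in> {1..length A}. A ! (j - 1) = l}. interval t j) = proj l (path_of A t)"
proof -
  have t: "length t = Suc (length A)" "sorted t" "apart A t"
    using assms by (auto simp: divisions_eq cuts_def)
  have "(\<Union>j\<in>{j \<in> {1..length A}. A ! (j - 1) = l}. interval t j) = set (proj l (path_of A t))"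
  proof (rule Set.set_eqI, rule iffI)
    fix v assume "v \<in> (\<Union>j\<in>{j \<in> {1..length A}. A ! (j - 1) = l}. interval t j)"
    then obtain j where "j \<in> {1..length A}" "A ! (j - 1) = l" "v \<in> interval t j" by blast
    then show "v \<in> set (proj l (path_of A t))"
      unfolding set_proj_path[OF t(1)] by (intro exI[of _ "j - 1"]) (auto simp: interval_def)
  next
    fix v assume "v \<in> set (proj l (path_of A t))"
    then obtain j where j: "j < length A" "A ! j = l" "t ! j \<le> v" "v \<le> t ! Suc j"
      unfolding set_proj_path[OF t(1)] by blast
    then have "Suc j \<in> {j \<in> {1..length A}. A ! (j - 1) = l}" "v \<in> interval t (Suc j)"
      by (auto simp: interval_def)
    then show "v \<in> (\<Union>j\<in>{j \<in> {1..length A}. A ! (j - 1) = l}. interval t j)" by blast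
  qed
  moreover have "sorted (proj l (path_of A t))"
    by (rule sorted_proj) (rule conjunct1[OF sorted_path_of[OF t(2)]])
  moreover have "distinct (proj l (path_of A t))"
    using distinct_proj_path[OF t(1)] t(3) by blast
  ultimately show ?thesis by (simp add: sorted_list_of_set.idem_if_sorted_distinct)
qed

lemma sum_divisions:
  fixes G :: "(nat \<Rightarrow> nat list) \<Rightarrow> bit"
  assumes "A \<noteq> []"
    and G: "\<And>g l. l \<in> set A \<Longrightarrow> \<forall>l. sorted (g l) \<Longrightarrow> \<not> distinct (g l) \<Longrightarrow> G g = 0"
  shows "(\<Sum>t\<in>divisions A N. G (\<lambda>l. sorted_list_of_set
      (\<Union>j\<in>{j \<in> {1..length A}. A ! (j - 1) = l}. interval t j))) =
    (\<Sum>\<omega>\<leftarrow>shuf A [0..<Suc N]. G (\<lambda>l. proj l \<omega>))"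
proof -
  have "(\<Sum>t\<in>divisions A N. G (\<lambda>l. sorted_list_of_set
      (\<Union>j\<in>{j \<in> {1..length A}. A ! (j - 1) = l}. interval t j))) =
    (\<Sum>t\<in>divisions A N. G (\<lambda>l. proj l (path_of A t)))"
    by (intro sum.cong refl arg_cong[where f = G] ext sorted_list_of_intervals)
  also have "\<dots> = (\<Sum>t\<in>cuts A 0 N. G (\<lambda>l. proj l (path_of A t)))"
  proof (rule sum.mono_neutral_left)
    show "\<forall>t\<in>cuts A 0 N - divisions A N. G (\<lambda>l. proj l (path_of A t)) = 0"
    proof
      fix t assume "t \<in> cuts A 0 N - divisions A N"
      then have t: "length t = Suc (length A)" "\<not> apart A t" "sorted t" by (auto simp: divisions_eq cuts_def)
      then obtain l where l: "\<not> distinct (proj l (path_of A t))" using distinct_proj_path[OF t(1)] by blast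
      then obtain v where "v \<in> set (proj l (path_of A t))" by (cases "proj l (path_of A t)") auto
      then have "l \<in> set A" unfolding set_proj_path[OF t(1)] by auto
      then show "G (\<lambda>l. proj l (path_of A t)) = 0"
        by (rule G) (use l sorted_path_of[OF t(3)] in \<open>auto intro!: sorted_proj\<close>)
    qed
  qed (auto simp: finite_cuts divisions_eq)
  also have "\<dots> = (\<Sum>\<omega>\<leftarrow>shuf A [0..<Suc N]. G (\<lambda>l. proj l \<omega>))"
    by (rule sum_shuf_cuts[symmetric]) (use assms in auto)
  finally show ?thesis .
qed


section \<open>Cochain operations on vertex lists\<close>

definition ncochain :: "'a sset \<Rightarrow> 'a cochain \<Rightarrow> bool" where
  "ncochain X \<beta> \<longleftrightarrow> (\<forall>u. u \<notin> nondegenerate X \<longrightarrow> \<beta> u = 0)"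

definition ev :: "'a sset \<Rightarrow> 'a \<Rightarrow> 'a cochain \<Rightarrow> nat list \<Rightarrow> bit" where
  "ev X u \<beta> L = (if L \<in> mono_lists (sdim X u) then \<beta> (spull X u L) else 0)"

lemma ev_Nil [simp]: "ev X u \<beta> [] = 0"
  by (simp add: ev_def mono_lists_def)

lemma simplicial_setD:
  assumes "simplicial_set X" "u \<in> simplices X"
  shows "spull X u [0..<Suc (sdim X u)] = u"
    and "\<theta> \<in> mono_lists (sdim X u) \<Longrightarrow> spull X u \<theta> \<in> simplices X"
    and "\<theta> \<in> mono_lists (sdim X u) \<Longrightarrow> sdim X (spull X u \<theta>) = length \<theta> - 1"
    and "\<theta> \<in> mono_lists (sdim X u) \<Longrightarrow> \<eta> \<in> mono_lists (length \<theta> - 1) \<Longrightarrow>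
      spull X (spull X u \<theta>) \<eta> = spull X u (map ((!) \<theta>) \<eta>)"
  using assms unfolding simplicial_set_def by blast+

lemma not_distinct_adj_decomp: "\<not> distinct_adj L \<Longrightarrow> \<exists>xs x zs. L = xs @ x # x # zs"
proof (induction L)
  case (Cons y L)
  show ?case
  proof (cases L)
    case Nil then show ?thesis using Cons by simp
  next
    case L: (Cons z L')
    show ?thesis
    proof (cases "y = z")
      case True then show ?thesis using L by (intro exI[of _ "[]"]) auto
    next
      case False
      then obtain xs x zs where "L = xs @ x # x # zs" using Cons L by auto
      then show ?thesis by (intro exI[of _ "y # xs"]) auto
    qed
  qed
qed simp

lemma degenerate_spull:
  assumes "simplicial_set X" "u \<in> simplices X" "L \<in> mono_lists (sdim X u)" "\<not> distinct_adj L"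
  shows "spull X u L \<notin> nondegenerate X"
proof -
  obtain xs x zs where L: "L = xs @ x # x # zs" using not_distinct_adj_decomp[OF assms(4)] by blast
  let ?L = "xs @ x # zs" and ?i = "length xs"
  have m: "?L \<in> mono_lists (sdim X u)" using assms(3) by (auto simp: mono_lists_def L sorted_append)
  define v where "v = spull X u ?L"
  have v: "v \<in> simplices X" "sdim X v = length xs + length zs"
    using simplicial_setD[OF assms(1,2)] m by (auto simp: v_def)
  let ?\<eta> = "[0..<Suc ?i] @ [?i..<Suc (sdim X v)]"
  have "?\<eta> \<in> mono_lists (length ?L - 1)"
    using v(2) by (auto simp: mono_lists_def sorted_append)
  then have "sdegen X ?i v = spull X u (map ((!) ?L) ?\<eta>)"
    unfolding sdegen_def unfolding v_def using simplicial_setD(4)[OF assms(1,2) m] v(2) v_def by simp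
  also have "map ((!) ?L) ?\<eta> = L"
  proof -
    have "map ((!) ?L) [0..<Suc ?i] = xs @ [x]"
      by (rule nth_equalityI) (auto simp: nth_append less_Suc_eq simp del: upt_Suc)
    moreover have "map ((!) ?L) [?i..<Suc (sdim X v)] = x # zs"
      by (rule nth_equalityI) (auto simp: nth_append v(2) simp del: upt_Suc)
    ultimately show ?thesis unfolding L by simp
  qed
  finally have "spull X u L = sdegen X ?i v" by simp
  moreover have "?i \<le> sdim X v" using v(2) by simp
  ultimately show ?thesis using v(1) unfolding nondegenerate_def by blast
qed

lemma ev_stutter:
  assumes "simplicial_set X" "u \<in> simplices X" "ncochain X \<beta>" "\<not> distinct_adj L"
  shows "ev X u \<beta> L = 0"
  using assms degenerate_spull[OF assms(1,2) _ assms(4)] by (auto simp: ev_def ncochain_def)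

lemma sorted_distinct_adj: "sorted L \<Longrightarrow> distinct_adj L \<Longrightarrow> distinct (L :: nat list)"
proof (induction L)
  case (Cons x L)
  show ?case
  proof (cases L)
    case (Cons y L')
    then have "x < y" "distinct L" using Cons.prems Cons.IH by auto
    moreover have "\<forall>z\<in>set L. y \<le> z" using Cons Cons.prems by auto
    ultimately show ?thesis by auto
  qed simp
qed simp

lemma ev_not_distinct:
  assumes "simplicial_set X" "u \<in> simplices X" "ncochain X \<beta>" "\<not> distinct L"
  shows "ev X u \<beta> L = 0"
proof (cases "sorted L")
  case True
  then have "\<not> distinct_adj L" using sorted_distinct_adj assms(4) by blast
  then show ?thesis by (rule ev_stutter[OF assms(1-3)])
qed (simp add: ev_def mono_lists_def)

lemma ev_spull:
  assumes "simplicial_set X" "u \<in> simplices X" "V \<in> mono_lists (sdim X u)" "L \<in> mono_lists (length V - 1)"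
  shows "ev X (spull X u V) \<beta> L = ev X u \<beta> (map ((!) V) L)"
proof -
  have "map ((!) V) L \<in> mono_lists (sdim X u)"
  proof -
    have L: "\<forall>i\<in>set L. i < length V" "L \<noteq> []" "sorted L" "V \<noteq> []" "sorted V" "set V \<subseteq> {..sdim X u}"
      using assms(3,4) by (auto simp: mono_lists_def Suc_le_eq less_Suc_eq_le) (metis Suc_pred atMost_iff in_mono le_imp_less_Suc length_greater_0_conv)
    have "sorted (map ((!) V) L)"
      using L(3) unfolding sorted_map
      by (rule sorted_wrt_mono_rel[rotated]) (use L in \<open>auto intro: sorted_nth_mono\<close>)
    moreover have "set (map ((!) V) L) \<subseteq> set V" using L(1) by auto
    ultimately show ?thesis using L by (auto simp: mono_lists_def)
  qed
  then show ?thesis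
    using simplicial_setD[OF assms(1,2)] assms(3,4) by (simp add: ev_def)
qed

lemma mono_upt: "[0..<Suc n] \<in> mono_lists n"
  by (simp add: mono_lists_def atLeast0LessThan lessThan_Suc_atMost del: upt_Suc)

lemma mono_proj_shuf:
  assumes "V \<in> mono_lists n" "\<omega> \<in> set (shuf A V)" "proj l \<omega> \<noteq> []"
  shows "proj l \<omega> \<in> mono_lists n"
proof -
  have "sorted V" using assms(1) by (simp add: mono_lists_def)
  then have "sorted (proj l \<omega>)" by (rule sorted_proj[OF sorted_shuf[OF assms(2)]])
  moreover have "set (proj l \<omega>) \<subseteq> set V" using set_proj set_shuf[OF assms(2)] by fastforce
  ultimately show ?thesis using assms by (auto simp: mono_lists_def)
qed

definition actw :: "'l set \<Rightarrow> ('l \<Rightarrow> 'v list \<Rightarrow> bit) \<Rightarrow> 'v list \<Rightarrow> 'l list \<Rightarrow> bit" where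
  "actw \<Lambda> \<phi> V A = (\<Sum>\<omega>\<leftarrow>shuf A V. \<Prod>l\<in>\<Lambda>. \<phi> l (proj l \<omega>))"

lemma map_snd_proj: "proj l (map (map_prod id f) w) = map f (proj l w)"
  by (induction w) auto

lemma actw_stutter_vertices:
  assumes "finite \<Lambda>" "set A \<subseteq> \<Lambda>" "\<And>l L. l \<in> \<Lambda> \<Longrightarrow> \<not> distinct_adj L \<Longrightarrow> \<phi> l L = 0" "\<not> distinct_adj V"
  shows "actw \<Lambda> \<phi> V A = 0"
  unfolding actw_def
proof (rule sum_list_zero)
  fix \<omega> assume \<omega>: "\<omega> \<in> set (shuf A V)"
  then obtain l where l: "\<not> distinct_adj (proj l \<omega>)" using shuf_stutter_proj2[OF assms(4)] by blast
  then have "proj l \<omega> \<noteq> []" by auto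
  then have "l \<in> set A" using proj_eq_Nil[of l \<omega>] shuf_letters[OF \<omega>] by blast
  then show "(\<Prod>l\<in>\<Lambda>. \<phi> l (proj l \<omega>)) = 0" using assms l by (intro prod_zero) auto
qed

lemma degeneracy_stutter:
  assumes "j \<le> n"
  shows "\<not> distinct_adj ([0..<Suc j] @ [j..<Suc n])"
proof -
  have "[0..<Suc j] @ [j..<Suc n] = [0..<j] @ j # j # [Suc j..<Suc n]"
    using assms by (simp add: upt_conv_Cons[of j "Suc n"] upt_Suc_append[of 0 j] del: upt_Suc)
  moreover have "\<not> distinct_adj ([0..<j] @ j # j # [Suc j..<Suc n])"
    by (metis distinct_adj_Cons_Cons distinct_adj_appendD2)
  ultimately show ?thesis by simp
qed

text \<open>
  On degenerate simplices the sum over divisions vanishes by itself: two equal consecutive vertices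
  always occur together in some interval. So one formula is valid on all faces of a simplex.
\<close>

lemma seq_act_spull:
  assumes X: "simplicial_set X" "u \<in> simplices X" and V: "V \<in> mono_lists (sdim X u)"
    and A: "set A = {1..r}" "1 \<le> r" and \<beta>: "\<And>l. ncochain X (\<beta> l)"
  shows "seq_act X r A \<beta> (spull X u V) = actw {1..r} (\<lambda>l. ev X u (\<beta> l)) V A"
proof -
  have A0: "A \<noteq> []" using A by auto
  have main: "(\<Sum>t\<in>divisions A (sdim X w). \<Prod>l\<in>{1..r}.
       \<beta> l (sface X w (\<Union>j\<in>{j\<in>{1..length A}. A ! (j - 1) = l}. interval t j))) =
     actw {1..r} (\<lambda>l. ev X w (\<beta> l)) [0..<Suc (sdim X w)] A" if w: "w \<in> simplices X" for w
  proof -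
    have "(\<Sum>t\<in>divisions A (sdim X w). \<Prod>l\<in>{1..r}.
       \<beta> l (sface X w (\<Union>j\<in>{j\<in>{1..length A}. A ! (j - 1) = l}. interval t j))) =
      (\<Sum>t\<in>divisions A (sdim X w). \<Prod>l\<in>{1..r}. ev X w (\<beta> l) (sorted_list_of_set
        (\<Union>j\<in>{j\<in>{1..length A}. A ! (j - 1) = l}. interval t j)))"
    proof (intro sum.cong prod.cong refl)
      fix t l assume t: "t \<in> divisions A (sdim X w)" and l: "l \<in> {1..r}"
      let ?U = "\<Union>j\<in>{j\<in>{1..length A}. A ! (j - 1) = l}. interval t j"
      have len: "length t = Suc (length A)" "sorted t" "last t = sdim X w" using t by (auto simp: divisions_def)
      have fin: "finite ?U" by (auto simp: interval_def)
      have "?U \<subseteq> {..sdim X w}"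
      proof
        fix v assume "v \<in> ?U"
        then obtain j where j: "j \<le> length A" "v \<le> t ! j" by (auto simp: interval_def)
        have "t ! j \<le> t ! length A" using len j by (intro sorted_nth_mono) auto
        also have "\<dots> = sdim X w" using len by (metis diff_Suc_1 last_conv_nth length_0_conv nat.distinct(1))
        finally show "v \<in> {..sdim X w}" using j by simp
      qed
      moreover have "?U \<noteq> {}"
      proof -
        obtain j where j: "j < length A" "A ! j = l" using l A by (metis in_set_conv_nth)
        then have "t ! j \<le> t ! Suc j" using len by (intro sorted_nth_mono) auto
        then have "t ! j \<in> interval t (Suc j)" by (auto simp: interval_def)
        moreover have "Suc j \<in> {j\<in>{1..length A}. A ! (j - 1) = l}" using j by auto
        ultimately show ?thesis by blast
      qed
      ultimately have "sorted_list_of_set ?U \<in> mono_lists (sdim X w)"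
        using fin by (auto simp: mono_lists_def)
      then show "\<beta> l (sface X w ?U) = ev X w (\<beta> l) (sorted_list_of_set ?U)"
        by (simp add: ev_def sface_def)
    qed
    also have "\<dots> = actw {1..r} (\<lambda>l. ev X w (\<beta> l)) [0..<Suc (sdim X w)] A"
      unfolding actw_def
      by (rule sum_divisions[OF A0, where G = "\<lambda>g. \<Prod>l\<in>{1..r}. ev X w (\<beta> l) (g l)"], rule prod_zero)
        (use A ev_not_distinct[OF X(1) w \<beta>] in \<open>auto intro!: bexI simp del: One_nat_def\<close>)
    finally show ?thesis .
  qed
  have move: "actw {1..r} (\<lambda>l. ev X (spull X u V) (\<beta> l)) [0..<Suc (length V - 1)] A =
      actw {1..r} (\<lambda>l. ev X u (\<beta> l)) V A" if u: "u \<in> simplices X" and V: "V \<in> mono_lists (sdim X u)" for u V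
  proof -
    have V0: "Suc (length V - 1) = length V" using V by (cases V) (auto simp: mono_lists_def)
    have "shuf A V = shuf (map id A) (map ((!) V) [0..<length V])" by (simp add: map_nth)
    also have "\<dots> = map (map (map_prod id ((!) V))) (shuf A [0..<length V])" by (rule shuf_map)
    finally have s: "shuf A V = map (map (map_prod id ((!) V))) (shuf A [0..<length V])" .
    have "(\<Prod>l\<in>{1..r}. ev X (spull X u V) (\<beta> l) (proj l \<omega>)) =
        (\<Prod>l\<in>{1..r}. ev X u (\<beta> l) (map ((!) V) (proj l \<omega>)))" if \<omega>: "\<omega> \<in> set (shuf A [0..<length V])" for \<omega>
    proof (rule prod.cong[OF refl])
      fix l
      show "ev X (spull X u V) (\<beta> l) (proj l \<omega>) = ev X u (\<beta> l) (map ((!) V) (proj l \<omega>))"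
      proof (cases "proj l \<omega> = []")
        case False
        have "proj l \<omega> \<in> mono_lists (length V - 1)"
          by (rule mono_proj_shuf[OF _ \<omega> False]) (use mono_upt[of "length V - 1", unfolded V0] in assumption)
        then show ?thesis by (intro ev_spull[OF X(1) u V])
      qed simp
    qed
    then show ?thesis unfolding actw_def s V0 by (simp add: o_def map_snd_proj cong: map_cong)
  qed
  define w where "w = spull X u V"
  have w: "w \<in> simplices X" "sdim X w = length V - 1"
    using simplicial_setD[OF X] V by (auto simp: w_def)
  show ?thesis
  proof (cases "w \<in> nondegenerate X")
    case True
    show ?thesis
      unfolding seq_act_def on_basis_def w_def[symmetric] if_P[OF True] w(2) main[OF w(1), unfolded w(2)]
      by (rule move[OF X(2) V, folded w_def])
  next
    case False
    then obtain v j where v: "v \<in> simplices X" "j \<le> sdim X v" "w = sdegen X j v"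
      using w unfolding nondegenerate_def by blast
    let ?\<theta> = "[0..<Suc j] @ [j..<Suc (sdim X v)]"
    have \<theta>: "?\<theta> \<in> mono_lists (sdim X v)" using v(2) by (auto simp: mono_lists_def sorted_append)
    have wv: "w = spull X v ?\<theta>" using v by (simp add: sdegen_def)
    have nd: "\<not> distinct_adj ?\<theta>" using v(2) by (rule degeneracy_stutter)
    have "actw {1..r} (\<lambda>l. ev X u (\<beta> l)) V A = actw {1..r} (\<lambda>l. ev X v (\<beta> l)) ?\<theta> A"
      using move[OF X(2) V, folded w_def] move[OF v(1) \<theta>, folded wv] w(2) simplicial_setD(3)[OF X(1) v(1) \<theta>, folded wv]
      by simp
    also have "\<dots> = 0"
      by (rule actw_stutter_vertices) (use A nd ev_stutter[OF X(1) v(1) \<beta>] in auto)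
    finally show ?thesis using False unfolding seq_act_def on_basis_def w_def by simp
  qed
qed

section \<open>Cup products\<close>

definition cupw :: "nat \<Rightarrow> ('v list \<Rightarrow> bit) \<Rightarrow> ('v list \<Rightarrow> bit) \<Rightarrow> 'v list \<Rightarrow> bit" where
  "cupw m \<phi> \<psi> V = (\<Sum>\<omega>\<leftarrow>shuf (altl False True (Suc m)) V. \<phi> (proj False \<omega>) * \<psi> (proj True \<omega>))"

lemma altl_map: "altl (f a) (f b) k = map f (altl a b k)"
  by (induction k arbitrary: a b) auto

lemma proj_map_inj: "inj f \<Longrightarrow> proj (f c) (map (map_prod f id) w) = proj c w"
  by (induction w) (auto simp: inj_eq)

lemma sum_shuf_altl_rename:
  fixes V :: "'v list"
  assumes "a \<noteq> b"
  shows "(\<Sum>\<omega>\<leftarrow>shuf (altl a b k) V. H (proj a \<omega>) (proj b \<omega>)) =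
    (\<Sum>\<omega>\<leftarrow>shuf (altl False True k) V. H (proj False \<omega>) (proj True \<omega>))"
proof -
  define f where "f c = (if c then b else a)" for c
  have "inj f" using assms by (auto simp: inj_def f_def)
  have "altl a b k = map f (altl False True k)" using altl_map[of f False True k] by (simp add: f_def)
  then have "shuf (altl a b k) V = map (map (map_prod f id)) (shuf (altl False True k) V)"
    using shuf_map[of f "altl False True k" id V] by simp
  moreover have "proj a (map (map_prod f id) w) = proj False w" "proj b (map (map_prod f id) w) = proj True w"
    for w :: "(bool \<times> 'v) list"
    using proj_map_inj[OF \<open>inj f\<close>, of False w] proj_map_inj[OF \<open>inj f\<close>, of True w] by (simp_all add: f_def)
  ultimately show ?thesis by (simp add: o_def)
qed

lemma nth_altl: "j \<le> k \<Longrightarrow> altl a b k ! j = (if even j then a else b)"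
proof (induction k arbitrary: a b j)
  case (Suc k)
  then show ?case by (cases j) auto
qed simp

lemma set_altl: "set (altl a b (Suc k)) = {a, b}"
  by (induction k arbitrary: a b) auto

lemma divisions_altl:
  assumes "a \<noteq> b"
  shows "divisions (altl a b (Suc m)) N =
    (\<lambda>k. 0 # k @ [N]) ` {k. length k = m + 1 \<and> sorted_wrt (<) k \<and> set k \<subseteq> {..N}}"
proof (intro equalityI subsetI)
  let ?A = "altl a b (Suc m)"
  fix t assume "t \<in> divisions ?A N"
  then have t: "length t = m + 3" "sorted t" "hd t = 0" "last t = N" "apart ?A t"
    by (auto simp: divisions_eq cuts_def)
  then obtain k where k: "t = 0 # k @ [N]" "length k = m + 1"
    by (cases t; cases "tl t" rule: rev_cases) auto
  have "k ! i < k ! Suc i" if i: "Suc i < length k" for i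
  proof -
    have "{t ! i..t ! Suc i} \<inter> {t ! (i + 2)..t ! Suc (i + 2)} = {}"
    proof -
      have "?A ! i = ?A ! (i + 2)" "i < length ?A" "i + 2 < length ?A"
        using i k(2) by (simp_all add: nth_altl del: altl.simps)
      then show ?thesis using t(5)[unfolded apart_def, rule_format, of i "i + 2"] by simp
    qed
    moreover have "t ! i \<le> t ! Suc i" "t ! Suc i \<le> t ! (i + 2)" "t ! (i + 2) \<le> t ! Suc (i + 2)"
      using t(1,2) i k(2) by (auto intro!: sorted_nth_mono)
    ultimately have "t ! Suc i < t ! (i + 2)" by (cases "t ! Suc i = t ! (i + 2)") auto
    then show ?thesis using i by (simp add: k(1) nth_append)
  qed
  then have "sorted_wrt (<) k" by (simp add: sorted_wrt_iff_nth_Suc_transp)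
  moreover have "set k \<subseteq> {..N}" using t(2) unfolding k(1) by (auto simp: sorted_append)
  ultimately show "t \<in> (\<lambda>k. 0 # k @ [N]) ` {k. length k = m + 1 \<and> sorted_wrt (<) k \<and> set k \<subseteq> {..N}}"
    using k by blast
next
  let ?A = "altl a b (Suc m)"
  fix t assume "t \<in> (\<lambda>k. 0 # k @ [N]) ` {k. length k = m + 1 \<and> sorted_wrt (<) k \<and> set k \<subseteq> {..N}}"
  then obtain k where k: "t = 0 # k @ [N]" "length k = m + 1" "sorted_wrt (<) k" "set k \<subseteq> {..N}" by blast
  have "sorted k" using k(3) by (simp add: strict_sorted_imp_sorted)
  then have "sorted t" using k by (auto simp: sorted_append)
  have less: "{t ! j..t ! Suc j} \<inter> {t ! j'..t ! Suc j'} = {}"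
    if j: "j < j'" "j' < m + 2" "?A ! j = ?A ! j'" for j j'
  proof -
    have "even j = even j'" using j assms by (auto simp: nth_altl simp del: altl.simps split: if_splits)
    then have "Suc j \<noteq> j'" by auto
    then have "k ! j < k ! (j' - 1)" using j k(2,3) by (intro sorted_wrt_nth_less[of "(<)"]) auto
    moreover have "t ! Suc j = k ! j" "t ! j' = k ! (j' - 1)"
      using j k(2) by (auto simp: k(1) nth_append nth_Cons split: nat.splits)
    ultimately show ?thesis by auto
  qed
  have "apart ?A t"
    unfolding apart_def
  proof (intro allI impI)
    fix j j' assume "j < length ?A" "j' < length ?A" "j \<noteq> j' \<and> ?A ! j = ?A ! j'"
    then show "{t ! j..t ! Suc j} \<inter> {t ! j'..t ! Suc j'} = {}"
      using less[of j j'] less[of j' j] by (cases "j < j'") auto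
  qed
  then show "t \<in> divisions ?A N" using k \<open>sorted t\<close> by (simp add: divisions_eq cuts_def)
qed

lemma cup_eq_seq_act:
  assumes "ncochain X \<beta>" "ncochain X \<gamma>"
  shows "cup X m \<beta> \<gamma> = seq_act X 2 (altl 1 2 (Suc m)) (\<lambda>l. if l = 1 then \<beta> else \<gamma>)"
proof
  fix u
  let ?A = "altl 1 2 (Suc m) :: nat list" and ?N = "sdim X u"
  let ?K = "{k. length k = m + 1 \<and> sorted_wrt (<) k \<and> set k \<subseteq> {..?N}}"
  have len: "length ?A = m + 2" by simp
  have odd: "{j \<in> {1..length ?A}. ?A ! (j - 1) = 1} = {s \<in> {1..m + 2}. odd s}"
    and even: "{j \<in> {1..length ?A}. ?A ! (j - 1) = 2} = {s \<in> {1..m + 2}. even s}"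
    unfolding len by (auto simp: nth_altl simp del: altl.simps split: if_splits)
  have inj: "inj_on (\<lambda>k. 0 # k @ [?N]) ?K" by (auto simp: inj_on_def)
  have "pairing (cotensor \<beta> \<gamma>) (tensor (cls X x) (cls X y)) = \<beta> x * \<gamma> y" for x y
    using assms by (simp add: pairing_tensor pairing_cls cotensor_def ncochain_def)
  then have "pairing (cotensor \<beta> \<gamma>) (steenrod_AW X (tensor (basis (xt m)) (basis u))) =
     (\<Sum>k\<in>?K. let t = 0 # k @ [?N] in
       \<beta> (sface X u (\<Union>s\<in>{s\<in>{1..m + 2}. odd s}. interval t s)) *
       \<gamma> (sface X u (\<Union>s\<in>{s\<in>{1..m + 2}. even s}. interval t s)))"
    by (simp add: steenrod_AW_def xt_def steenrod_diag_def pairing_sum Let_def)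
  also have "\<dots> = (\<Sum>t\<in>divisions ?A ?N.
       \<beta> (sface X u (\<Union>s\<in>{s\<in>{1..m + 2}. odd s}. interval t s)) *
       \<gamma> (sface X u (\<Union>s\<in>{s\<in>{1..m + 2}. even s}. interval t s)))"
    by (subst divisions_altl, simp, subst sum.reindex[OF inj]) (simp add: o_def Let_def)
  also have "\<dots> = (\<Sum>t\<in>divisions ?A ?N. \<Prod>l\<in>{1..2}. (if l = 1 then \<beta> else \<gamma>)
       (sface X u (\<Union>j\<in>{j\<in>{1..length ?A}. ?A ! (j - 1) = l}. interval t j)))"
  proof (rule sum.cong[OF refl])
    fix t
    have "{1..2} = {1, 2 :: nat}" by auto
    then show "\<beta> (sface X u (\<Union>s\<in>{s\<in>{1..m + 2}. odd s}. interval t s)) *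
       \<gamma> (sface X u (\<Union>s\<in>{s\<in>{1..m + 2}. even s}. interval t s)) =
       (\<Prod>l\<in>{1..2}. (if l = 1 then \<beta> else \<gamma>)
       (sface X u (\<Union>j\<in>{j\<in>{1..length ?A}. ?A ! (j - 1) = l}. interval t j)))"
      using odd even by simp
  qed
  finally show "cup X m \<beta> \<gamma> u = seq_act X 2 ?A (\<lambda>l. if l = 1 then \<beta> else \<gamma>) u"
    by (simp add: cup_def seq_act_def on_basis_def del: altl.simps)
qed

lemma ncochain_cup: "ncochain X (cup X m \<beta> \<gamma>)"
  by (simp add: ncochain_def cup_def on_basis_def)

lemma cup_spull:
  assumes X: "simplicial_set X" "u \<in> simplices X" and V: "V \<in> mono_lists (sdim X u)"
    and "ncochain X \<beta>" "ncochain X \<gamma>"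
  shows "cup X m \<beta> \<gamma> (spull X u V) = cupw m (ev X u \<beta>) (ev X u \<gamma>) V"
proof -
  have 12: "{1..2} = {1, 2 :: nat}" by auto
  have "cup X m \<beta> \<gamma> (spull X u V) =
      actw {1..2} (\<lambda>l. ev X u (if l = 1 then \<beta> else \<gamma>)) V (altl 1 (2::nat) (Suc m))"
    unfolding cup_eq_seq_act[OF assms(4,5)]
    by (rule seq_act_spull[OF X V]) (use assms in \<open>auto simp: set_altl 12 simp del: altl.simps\<close>)
  also have "\<dots> = (\<Sum>\<omega>\<leftarrow>shuf (altl 1 2 (Suc m)) V. ev X u \<beta> (proj 1 \<omega>) * ev X u \<gamma> (proj (2::nat) \<omega>))"
    unfolding actw_def 12 by simp
  also have "\<dots> = cupw m (ev X u \<beta>) (ev X u \<gamma>) V"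
    unfolding cupw_def by (rule sum_shuf_altl_rename) simp
  finally show ?thesis .
qed

lemma cupw_Nil [simp]: "cupw m \<phi> \<psi> [] = 0"
  by (simp add: cupw_def)

lemma cupw_cong:
  assumes "V \<in> mono_lists n" "\<And>L. L \<in> mono_lists n \<Longrightarrow> \<phi> L = \<phi>' L" "\<phi> [] = \<phi>' []"
    and "\<And>L. L \<in> mono_lists n \<Longrightarrow> \<psi> L = \<psi>' L" "\<psi> [] = \<psi>' []"
  shows "cupw m \<phi> \<psi> V = cupw m \<phi>' \<psi>' V"
  unfolding cupw_def
proof (rule sum_list_cong)
  fix \<omega> assume \<omega>: "\<omega> \<in> set (shuf (altl False True (Suc m)) V)"
  have "\<phi> (proj l \<omega>) = \<phi>' (proj l \<omega>)" "\<psi> (proj l \<omega>) = \<psi>' (proj l \<omega>)" for l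
    using mono_proj_shuf[OF assms(1) \<omega>, of l] assms by (cases "proj l \<omega> = []"; simp)+
  then show "\<phi> (proj False \<omega>) * \<psi> (proj True \<omega>) = \<phi>' (proj False \<omega>) * \<psi>' (proj True \<omega>)" by simp
qed

lemma stutter_free_cupw:
  fixes \<phi> \<psi> :: "'v list \<Rightarrow> bit"
  assumes "stutter_free \<phi>" "stutter_free \<psi>"
  shows "stutter_free (cupw m \<phi> \<psi>)"
  unfolding stutter_free_def cupw_def
proof (intro allI impI sum_list_zero)
  fix V :: "'v list" and \<omega> assume "\<not> distinct_adj V" "\<omega> \<in> set (shuf (altl False True (Suc m)) V)"
  then obtain l where "\<not> distinct_adj (proj l \<omega>)" using shuf_stutter_proj2 by blast
  then show "\<phi> (proj False \<omega>) * \<psi> (proj True \<omega>) = 0"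
    using assms by (cases l) (auto simp: stutter_free_def)
qed

lemma sum_dels_altl:
  assumes "stutter_free \<Phi>"
  shows "(\<Sum>A\<leftarrow>dels (altl a b (Suc k)). \<Phi> A) = \<Phi> (altl b a k) + \<Phi> (altl a b k)"
  using assms
proof (induction k arbitrary: a b \<Phi>)
  case (Suc k)
  have s: "(\<Sum>A\<leftarrow>dels (altl b a (Suc k)). \<Phi> (a # A)) = \<Phi> (a # altl a b k) + \<Phi> (a # altl b a k)"
    by (rule Suc.IH) (rule stutter_free_Cons[OF Suc.prems])
  have "\<not> distinct_adj (a # altl a b k)" by (cases k) auto
  then have "\<Phi> (a # altl a b k) = 0" using Suc.prems by (simp add: stutter_free_def)
  then show ?case using s by (simp add: o_def)
qed simp

definition cocw :: "nat \<Rightarrow> (nat list \<Rightarrow> bit) \<Rightarrow> bool" where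
  "cocw N \<phi> \<longleftrightarrow> (\<forall>L. sorted L \<and> set L \<subseteq> {..N} \<longrightarrow> (\<Sum>L'\<leftarrow>dels L. \<phi> L') = 0)"

lemma cocw_proj:
  assumes "cocw N \<phi>" "sorted V" "set V \<subseteq> {..N}" "\<omega> \<in> set (shuf A V)"
  shows "(\<Sum>L'\<leftarrow>dels (proj l \<omega>). \<phi> L') = 0"
proof -
  have "sorted (proj l \<omega>)" by (rule sorted_proj[OF sorted_shuf[OF assms(4,2)]])
  moreover have "set (proj l \<omega>) \<subseteq> set V" using set_proj[of l \<omega>] set_shuf[OF assms(4)] by fastforce
  ultimately show ?thesis using assms unfolding cocw_def by blast
qed

lemma cupw_dels:
  assumes "\<phi> [] = 0" "\<psi> [] = 0" "stutter_free \<phi>" "stutter_free \<psi>" "cocw N \<phi>" "cocw N \<psi>"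
    and V: "sorted V" "set V \<subseteq> {..N}"
  shows "(\<Sum>V'\<leftarrow>dels V. cupw m \<phi> \<psi> V') =
    (if m = 0 then 0 else cupw (m - 1) \<phi> \<psi> V + cupw (m - 1) \<psi> \<phi> V)"
proof -
  let ?A = "altl False True (Suc m)"
  let ?g = "\<lambda>\<omega>. \<phi> (proj False \<omega>) * \<psi> (proj True \<omega>)"
  let ?\<Phi> = "\<lambda>A. \<Sum>\<omega>\<leftarrow>shuf A V. ?g \<omega>"
  have "(\<Sum>\<omega>\<leftarrow>shuf ?A V. \<Sum>\<omega>'\<leftarrow>dels \<omega>. ?g \<omega>') = 0"
  proof (rule sum_list_zero)
    fix \<omega> assume \<omega>: "\<omega> \<in> set (shuf ?A V)"
    have "(\<Sum>L\<leftarrow>dels (proj False \<omega>). \<phi> L) = 0" "(\<Sum>L\<leftarrow>dels (proj True \<omega>). \<psi> L) = 0"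
      by (rule cocw_proj[OF assms(5) V \<omega>], rule cocw_proj[OF assms(6) V \<omega>])
    then show "(\<Sum>\<omega>'\<leftarrow>dels \<omega>. ?g \<omega>') = 0"
      unfolding sum_dels_proj2[of "\<lambda>L L'. \<phi> L * \<psi> L'"]
      by (simp add: sum_list_mult_const sum_list_const_mult)
  qed
  then have 0: "(\<Sum>A\<leftarrow>dels ?A. ?\<Phi> A) + (\<Sum>V'\<leftarrow>dels V. cupw m \<phi> \<psi> V') = 0"
    unfolding cupw_def using shuf_dels[of ?g ?A V] by simp
  have sf: "stutter_free ?\<Phi>"
    unfolding stutter_free_def
  proof (intro allI impI sum_list_zero)
    fix A :: "bool list" and \<omega> assume "\<not> distinct_adj A" "\<omega> \<in> set (shuf A V)"
    then obtain l where "\<not> distinct_adj (proj l \<omega>)" using shuf_stutter_proj by blast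
    then show "?g \<omega> = 0" using assms(3,4) by (cases l) (auto simp: stutter_free_def)
  qed
  have "(\<Sum>A\<leftarrow>dels ?A. ?\<Phi> A) = ?\<Phi> (altl True False m) + ?\<Phi> (altl False True m)"
    by (rule sum_dels_altl[OF sf])
  also have "\<dots> = (if m = 0 then 0 else cupw (m - 1) \<phi> \<psi> V + cupw (m - 1) \<psi> \<phi> V)"
  proof (cases m)
    case 0
    have "?\<Phi> [x] = 0" for x
    proof (rule sum_list_zero)
      fix \<omega> assume "\<omega> \<in> set (shuf [x] V)"
      then have "(\<not> x) \<notin> fst ` set \<omega>" by (simp add: shuf_letters)
      then have "proj (\<not> x) \<omega> = []" by (simp add: proj_eq_Nil)
      then show "?g \<omega> = 0" using assms(1,2) by (cases x) auto
    qed
    then show ?thesis using 0 by simp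
  next
    case (Suc m')
    have "?\<Phi> (altl True False m) = (\<Sum>\<omega>\<leftarrow>shuf (altl True False m) V. \<psi> (proj True \<omega>) * \<phi> (proj False \<omega>))"
      by (simp add: mult.commute)
    also have "\<dots> = cupw m' \<psi> \<phi> V"
      unfolding cupw_def Suc by (rule sum_shuf_altl_rename) simp
    finally show ?thesis using Suc by (simp add: cupw_def add.commute del: altl.simps)
  qed
  finally show ?thesis using 0 by (metis (no_types, lifting) char2_eqI add.commute)
qed

lemma cocw_cupw:
  assumes "\<phi> [] = 0" "stutter_free \<phi>" "cocw N \<phi>"
  shows "cocw N (cupw m \<phi> \<phi>)"
  unfolding cocw_def using cupw_dels[of \<phi> \<phi> N _ m] assms by simp


section \<open>Coboundaries\<close>

lemma dels_nth: "dels xs = map (\<lambda>i. take i xs @ drop (Suc i) xs) [0..<length xs]"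
proof (induction xs)
  case (Cons x xs)
  show ?case
    by (simp add: Cons upt_conv_Cons map_Suc_upt[symmetric] o_def del: upt_Suc map_Suc_upt)
qed simp

lemma dels_upt: "dels [0..<Suc n] = map (\<lambda>i. sorted_list_of_set ({..n} - {i})) [0..<Suc n]"
proof -
  have "take i [0..<Suc n] @ drop (Suc i) [0..<Suc n] = sorted_list_of_set ({..n} - {i})" if "i < Suc n" for i
  proof -
    have "set ([0..<i] @ [Suc i..<Suc n]) = {..n} - {i}" using that by auto
    moreover have "sorted ([0..<i] @ [Suc i..<Suc n])" "distinct ([0..<i] @ [Suc i..<Suc n])"
      using that by (auto simp: sorted_append)
    ultimately have "sorted_list_of_set ({..n} - {i}) = [0..<i] @ [Suc i..<Suc n]"
      by (metis sorted_list_of_set.idem_if_sorted_distinct)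
    then show ?thesis using that by (simp add: take_upt drop_upt del: upt_Suc)
  qed
  then show ?thesis unfolding dels_nth by (auto simp del: upt_Suc)
qed

lemma cobd_eq:
  assumes "simplicial_set X" "u \<in> nondegenerate X" "ncochain X \<beta>"
  shows "cobd X \<beta> u = (\<Sum>V\<leftarrow>dels [0..<Suc (sdim X u)]. ev X u \<beta> V)"
proof (cases "sdim X u = 0")
  case True
  then show ?thesis using assms by (simp add: cobd_def on_basis_def boundary_def)
next
  case False
  let ?n = "sdim X u"
  have mono: "sorted_list_of_set ({..?n} - {i}) \<in> mono_lists ?n" if "i \<le> ?n" for i
  proof -
    have "\<exists>j\<le>?n. j \<noteq> i" using False by (cases "i = 0") auto
    then have "{..?n} - {i} \<noteq> {}" by auto
    then show ?thesis by (auto simp: mono_lists_def)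
  qed
  have "cobd X \<beta> u = (\<Sum>i\<le>?n. \<beta> (sface X u ({..?n} - {i})))"
    using assms False
    by (auto simp: cobd_def on_basis_def boundary_def pairing_sum pairing_cls ncochain_def intro!: sum.cong)
  also have "\<dots> = (\<Sum>i\<le>?n. ev X u \<beta> (sorted_list_of_set ({..?n} - {i})))"
    by (rule sum.cong) (auto simp: ev_def sface_def mono)
  also have "\<dots> = (\<Sum>V\<leftarrow>dels [0..<Suc ?n]. ev X u \<beta> V)"
    unfolding dels_upt map_map interv_sum_list_conv_sum_set_nat
    by (simp add: o_def atLeast0LessThan lessThan_Suc_atMost del: upt_Suc)
  finally show ?thesis .
qed

lemma sum_dels_ev:
  assumes X: "simplicial_set X" "u \<in> simplices X" and V: "V \<in> mono_lists (sdim X u)"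
  shows "(\<Sum>L\<leftarrow>dels V. ev X u \<beta> L) = (\<Sum>L\<leftarrow>dels [0..<length V]. ev X (spull X u V) \<beta> L)"
proof -
  have V0: "V \<noteq> []" using V by (auto simp: mono_lists_def)
  have "(\<Sum>L\<leftarrow>dels V. ev X u \<beta> L) = (\<Sum>L\<leftarrow>dels (map ((!) V) [0..<length V]). ev X u \<beta> L)"
    by (simp add: map_nth)
  also have "\<dots> = (\<Sum>L\<leftarrow>dels [0..<length V]. ev X u \<beta> (map ((!) V) L))"
    by (simp add: dels_map o_def)
  also have "\<dots> = (\<Sum>L\<leftarrow>dels [0..<length V]. ev X (spull X u V) \<beta> L)"
  proof (rule sum_list_cong)
    fix L assume L: "L \<in> set (dels [0..<length V])"
    show "ev X u \<beta> (map ((!) V) L) = ev X (spull X u V) \<beta> L"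
    proof (cases "L = []")
      case False
      have "sorted L"
        using L unfolding dels_nth by (auto simp: sorted_append take_upt drop_upt)
      moreover have "set L \<subseteq> {..length V - 1}" using set_dels[OF L] by auto
      ultimately have "L \<in> mono_lists (length V - 1)" using False by (simp add: mono_lists_def)
      then show ?thesis by (rule ev_spull[OF X V, symmetric])
    qed simp
  qed
  finally show ?thesis .
qed

lemma cocw_ev:
  assumes X: "simplicial_set X" "u \<in> simplices X" and \<alpha>: "ncochain X \<alpha>" "cobd X \<alpha> = 0"
  shows "cocw (sdim X u) (ev X u \<alpha>)"
  unfolding cocw_def
proof (intro allI impI)
  fix L assume "sorted L \<and> set L \<subseteq> {..sdim X u}"
  show "(\<Sum>L'\<leftarrow>dels L. ev X u \<alpha> L') = 0"
  proof (cases "L = []")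
    case False
    then have L: "L \<in> mono_lists (sdim X u)" using \<open>sorted L \<and> _\<close> by (simp add: mono_lists_def)
    define w where "w = spull X u L"
    have w: "w \<in> simplices X" "sdim X w = length L - 1"
      using simplicial_setD[OF X] L by (auto simp: w_def)
    have len: "length L = Suc (sdim X w)" using w False by simp
    show ?thesis
    proof (cases "w \<in> nondegenerate X")
      case True
      have "(\<Sum>L'\<leftarrow>dels L. ev X u \<alpha> L') = cobd X \<alpha> w"
        unfolding sum_dels_ev[OF X L] cobd_eq[OF X(1) True \<alpha>(1)] w_def[symmetric] len ..
      then show ?thesis using \<alpha>(2) by simp
    next
      case nd: False
      then obtain v j where v: "v \<in> simplices X" "j \<le> sdim X v" "w = sdegen X j v"
        using w unfolding nondegenerate_def by blast
      let ?\<theta> = "[0..<Suc j] @ [j..<Suc (sdim X v)]"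
      have \<theta>: "?\<theta> \<in> mono_lists (sdim X v)" using v(2) by (auto simp: mono_lists_def sorted_append)
      have wv: "w = spull X v ?\<theta>" using v by (simp add: sdegen_def)
      have "\<not> distinct_adj ?\<theta>" using v(2) by (rule degeneracy_stutter)
      then have "(\<Sum>L'\<leftarrow>dels ?\<theta>. ev X v \<alpha> L') = 0"
        by (intro sum_dels_stutter ev_stutter[OF X(1) v(1) \<alpha>(1)])
      moreover have "length ?\<theta> = length L"
        using simplicial_setD(3)[OF X(1) v(1) \<theta>, folded wv] len by simp
      ultimately show ?thesis
        using sum_dels_ev[OF X(1) v(1) \<theta>, of \<alpha>] unfolding sum_dels_ev[OF X L] wv[symmetric] w_def[symmetric]
        by simp
    qed
  qed simp
qed


section \<open>Table reduction and the action\<close>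

definition comps :: "nat \<Rightarrow> nat \<Rightarrow> nat list set" where
  "comps k r = {a. length a = k \<and> (\<forall>i\<in>set a. 1 \<le> i) \<and> sum_list a = (k - 1) + r}"

lemma finite_comps: "finite (comps k r)"
proof (rule finite_subset)
  show "comps k r \<subseteq> {a. set a \<subseteq> {..k + r} \<and> length a = k}"
  proof
    fix a assume a: "a \<in> comps k r"
    have "x \<le> sum_list a" if "x \<in> set a" for x using that by (simp add: member_le_sum_list)
    then show "a \<in> {a. set a \<subseteq> {..k + r} \<and> length a = k}" using a by (fastforce simp: comps_def)
  qed
qed (rule finite_lists_length_eq, simp)

lemma sum_list_ge_length: "\<forall>i\<in>set a. 1 \<le> i \<Longrightarrow> length a \<le> sum_list (a :: nat list)"
  by (induction a) auto

lemma comps_Suc_0: "comps (Suc k) 0 = {}"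
  using sum_list_ge_length by (fastforce simp: comps_def)

lemma comps_0: "1 \<le> r \<Longrightarrow> comps 0 r = {}"
  by (auto simp: comps_def)

lemma sum_comps:
  fixes G :: "nat list \<Rightarrow> bit"
  assumes "1 \<le> r" "\<not> (k = 0 \<and> r = 1)"
  shows "(\<Sum>a\<in>comps (Suc k) r. G a) = (\<Sum>a\<in>comps (Suc k) (r - 1). G (Suc (hd a) # tl a)) +
    (\<Sum>a\<in>comps k r. G (1 # a))"
proof -
  let ?f = "\<lambda>a :: nat list. Suc (hd a) # tl a"
  have "comps (Suc k) r = ?f ` comps (Suc k) (r - 1) \<union> (#) 1 ` comps k r"
  proof (intro equalityI subsetI)
    fix a assume a: "a \<in> comps (Suc k) r"
    then obtain b as where ab: "a = b # as" by (cases a) (auto simp: comps_def)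
    show "a \<in> ?f ` comps (Suc k) (r - 1) \<union> (#) 1 ` comps k r"
    proof (cases "b = 1")
      case True
      have "as \<in> comps k r" using a True assms by (cases k) (auto simp: comps_def ab)
      then show ?thesis using ab True by blast
    next
      case False
      then have "2 \<le> b" using a ab by (auto simp: comps_def)
      then have "(b - 1) # as \<in> comps (Suc k) (r - 1)" using a assms by (auto simp: comps_def ab)
      moreover have "a = ?f ((b - 1) # as)" using \<open>2 \<le> b\<close> ab by simp
      ultimately show ?thesis by blast
    qed
  next
    fix a assume "a \<in> ?f ` comps (Suc k) (r - 1) \<union> (#) 1 ` comps k r"
    then show "a \<in> comps (Suc k) r"
    proof
      assume "a \<in> ?f ` comps (Suc k) (r - 1)"
      then obtain a' where a': "a' \<in> comps (Suc k) (r - 1)" "a = ?f a'" by blast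
      then show ?thesis using assms by (cases a') (auto simp: comps_def)
    next
      assume "a \<in> (#) 1 ` comps k r"
      then show ?thesis using assms by (cases k) (auto simp: comps_def)
    qed
  qed
  moreover have "?f ` comps (Suc k) (r - 1) \<inter> (#) 1 ` comps k r = {}"
  proof -
    have "1 \<le> hd a" if "a \<in> comps (Suc k) (r - 1)" for a
      using that by (cases a) (auto simp: comps_def)
    then show ?thesis by fastforce
  qed
  moreover have "inj_on ?f (comps (Suc k) (r - 1))"
  proof (rule inj_onI)
    fix a a' assume "a \<in> comps (Suc k) (r - 1)" "a' \<in> comps (Suc k) (r - 1)" "?f a = ?f a'"
    then show "a = a'" by (cases a; cases a') (auto simp: comps_def)
  qed
  ultimately show ?thesis
    by (simp add: sum.union_disjoint finite_comps sum.reindex)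
qed

lemma table_seq_tabw:
  assumes "rows \<noteq> []" "\<forall>row\<in>set rows. set row = U \<and> distinct row" "finite U" "1 \<le> card (U - X)"
  shows "(\<Sum>a\<in>comps (length rows) (card (U - X)). G (table_seq a (map (filter (\<lambda>v. v \<notin> X)) rows))) =
    (\<Sum>w\<leftarrow>tabw X rows. (G w :: bit))"
  using assms
proof (induction X rows arbitrary: G rule: tabw.induct)
  case (2 X row rows)
  have row: "set row = U" "distinct row" using "2.prems" by auto
  have len: "length (filter (\<lambda>v. v \<notin> X) row) = card (U - X)"
  proof -
    have "length (filter (\<lambda>v. v \<notin> X) row) = card (set (filter (\<lambda>v. v \<notin> X) row))"
      using row by (intro distinct_card[symmetric]) simp
    also have "set (filter (\<lambda>v. v \<notin> X) row) = U - X" using row by auto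
    finally show ?thesis .
  qed
  then obtain x s where xs: "filter (\<lambda>v. v \<notin> X) row = x # s"
    using "2.prems"(4) by (cases "filter (\<lambda>v. v \<notin> X) row") auto
  have x: "x \<in> U" "x \<notin> X"
  proof -
    have "x \<in> set (filter (\<lambda>v. v \<notin> X) row)" unfolding xs by simp
    then show "x \<in> U" "x \<notin> X" using row by auto
  qed
  have ins: "filter (\<lambda>v. v \<notin> insert x X) ys = filter (\<lambda>v. v \<noteq> x) (filter (\<lambda>v. v \<notin> X) ys)" for ys
    by (simp add: conj_commute)
  have s: "filter (\<lambda>v. v \<notin> insert x X) row = s"
  proof -
    have "distinct (x # s)" unfolding xs[symmetric] using row(2) by simp
    then show ?thesis unfolding ins xs using filter_neq_Cons(1)[of x s "[]"] by simp
  qed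
  have card: "card (U - insert x X) = card (U - X) - 1"
    using x "2.prems"(3) by (metis DiffI Diff_insert card_Diff_singleton)
  let ?r = "card (U - X)" and ?T = "map (filter (\<lambda>v. v \<notin> X)) rows"
  let ?T' = "map (filter (\<lambda>v. v \<notin> insert x X)) (row # rows)"
  show ?case
  proof (cases "rows = [] \<and> ?r = 1")
    case True
    then have "s = []" using len xs by simp
    then have sX: "filter (\<lambda>v. v \<notin> insert x X) row = []" using s by simp
    have "comps (Suc 0) 1 = {[1]}"
    proof (intro equalityI subsetI)
      fix a :: "nat list" assume a: "a \<in> comps (Suc 0) 1"
      then show "a \<in> {[1]}" by (cases a) (auto simp: comps_def)
    qed (auto simp: comps_def)
    then show ?thesis using True xs \<open>s = []\<close>
      by (simp add: tabw_step[OF xs] tabw_full[OF sX])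
  next
    case False
    have A: "(\<Sum>a\<in>comps (Suc (length rows)) (?r - 1). G (table_seq (Suc (hd a) # tl a) ((x # s) # ?T))) =
        (\<Sum>w\<leftarrow>tabw (insert x X) (row # rows). G (x # w))"
    proof (cases "?r = 1")
      case True
      then have "s = []" using len xs by simp
      then have "filter (\<lambda>v. v \<notin> insert x X) row = []" using s by simp
      then show ?thesis using True False by (simp add: comps_Suc_0 tabw_full)
    next
      case r: False
      have "(\<Sum>a\<in>comps (length (row # rows)) (card (U - insert x X)). G (x # table_seq a ?T')) =
          (\<Sum>w\<leftarrow>tabw (insert x X) (row # rows). G (x # w))"
        by (rule "2.IH"(1)[OF xs, of "\<lambda>w. G (x # w)"]) (use "2.prems" r card in auto)
      moreover have "table_seq (Suc (hd a) # tl a) ((x # s) # ?T) = x # table_seq a ?T'"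
        if a: "a \<in> comps (Suc (length rows)) (?r - 1)" for a
      proof -
        obtain b as where ab: "a = b # as" "1 \<le> b" using a by (cases a) (auto simp: comps_def)
        have "s \<noteq> []" using r len xs by auto
        then have ne: "take b s \<noteq> []" using ab by simp
        have "filter (\<lambda>v. v \<notin> set (butlast (x # take b s))) (filter (\<lambda>v. v \<notin> X) ys) =
           filter (\<lambda>v. v \<notin> set (butlast (take b s))) (filter (\<lambda>v. v \<notin> insert x X) ys)" for ys
          using ne by (auto simp: conj_ac intro!: filter_cong)
        then have e1: "map (filter (\<lambda>v. v \<notin> set (butlast (x # take b s)))) ?T =
            map (filter (\<lambda>v. v \<notin> set (butlast (take b s)))) (map (filter (\<lambda>v. v \<notin> insert x X)) rows)"
          unfolding map_map o_def by simp
        have e2: "table_seq (b # as) ?T' = take b s @ table_seq as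
            (map (filter (\<lambda>v. v \<notin> set (butlast (take b s)))) (map (filter (\<lambda>v. v \<notin> insert x X)) rows))"
          unfolding list.map s by (simp only: table_seq.simps Let_def)
        have e3: "table_seq (Suc b # as) ((x # s) # ?T) = x # take b s @
            table_seq as (map (filter (\<lambda>v. v \<notin> set (butlast (x # take b s)))) ?T)"
          by (simp only: table_seq.simps Let_def take_Suc_Cons append_Cons)
        show ?thesis unfolding ab list.sel e3 e2 e1 by (simp only: append_Cons)
      qed
      ultimately show ?thesis unfolding card by simp
    qed
    have B: "(\<Sum>a\<in>comps (length rows) ?r. G (table_seq (1 # a) ((x # s) # ?T))) = (\<Sum>w\<leftarrow>tabw X rows. G (x # w))"
    proof (cases "rows = []")
      case True
      then show ?thesis using comps_0[of ?r] "2.prems"(4) by simp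
    next
      case False
      have "(\<Sum>a\<in>comps (length rows) ?r. G (x # table_seq a ?T)) = (\<Sum>w\<leftarrow>tabw X rows. G (x # w))"
        by (rule "2.IH"(2)[OF xs, of "\<lambda>w. G (x # w)"]) (use "2.prems" False in auto)
      then show ?thesis by (simp add: Let_def o_def)
    qed
    have "(\<Sum>a\<in>comps (length (row # rows)) ?r. G (table_seq a (map (filter (\<lambda>v. v \<notin> X)) (row # rows)))) =
       (\<Sum>a\<in>comps (Suc (length rows)) ?r. G (table_seq a ((x # s) # ?T)))"
      using xs by simp
    also have "\<dots> = (\<Sum>a\<in>comps (Suc (length rows)) (?r - 1). G (table_seq (Suc (hd a) # tl a) ((x # s) # ?T))) +
        (\<Sum>a\<in>comps (length rows) ?r. G (table_seq (1 # a) ((x # s) # ?T)))"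
      by (rule sum_comps) (use "2.prems"(4) False in auto)
    finally show ?thesis unfolding A B tabw_step[OF xs] .
  qed
qed simp

definition act4 :: "('v list \<Rightarrow> bit) \<Rightarrow> 'v list \<Rightarrow> nat list \<Rightarrow> bit" where
  "act4 \<phi> V A = (if set A \<subseteq> {1..4} then actw {1..4} (\<lambda>_. \<phi>) V A else 0)"

definition tabF :: "('v list \<Rightarrow> bit) \<Rightarrow> 'v list \<Rightarrow> nat list list \<Rightarrow> bit" where
  "tabF \<phi> V rows = (\<Sum>A\<leftarrow>tabw {} rows. act4 \<phi> V A)"

lemma stutter_free_act4:
  assumes "stutter_free \<phi>"
  shows "stutter_free (act4 \<phi> V)"
  unfolding stutter_free_def
proof (intro allI impI)
  fix A :: "nat list" assume A: "\<not> distinct_adj A"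
  show "act4 \<phi> V A = 0"
  proof (cases "set A \<subseteq> {1..4}")
    case True
    have "(\<Prod>l\<in>{1..4}. \<phi> (proj l \<omega>)) = 0" if \<omega>: "\<omega> \<in> set (shuf A V)" for \<omega>
    proof -
      obtain l where l: "l \<in> set A" "\<not> distinct_adj (proj l \<omega>)" using shuf_stutter_proj[OF A \<omega>] by blast
      have "l \<in> {1..4}" using l(1) True by blast
      moreover have "\<phi> (proj l \<omega>) = 0" using assms l(2) by (simp add: stutter_free_def)
      ultimately show ?thesis by (intro prod_zero) auto
    qed
    then show ?thesis using True by (auto simp: act4_def actw_def intro!: sum_list_zero)
  qed (auto simp: act4_def)
qed

lemma act4_missing:
  assumes "\<phi> [] = 0" "l \<in> {1..4}" "l \<notin> set A"
  shows "act4 \<phi> V A = 0"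
proof (cases "set A \<subseteq> {1..4}")
  case True
  have "(\<Prod>l\<in>{1..4}. \<phi> (proj l \<omega>)) = 0" if \<omega>: "\<omega> \<in> set (shuf A V)" for \<omega>
  proof -
    have "proj l \<omega> = []" using assms(3) shuf_letters[OF \<omega>] proj_eq_Nil[of l \<omega>] by blast
    then have "\<phi> (proj l \<omega>) = 0" using assms(1) by simp
    then show ?thesis using assms(2) by (intro prod_zero) auto
  qed
  then show ?thesis using True by (auto simp: act4_def actw_def intro!: sum_list_zero)
qed (auto simp: act4_def)

lemma set_tabw: "w \<in> set (tabw X rows) \<Longrightarrow> set w \<subseteq> \<Union> (set ` set rows)"
proof (induction X rows arbitrary: w rule: tabw.induct)
  case (2 X row rows)
  show ?case
  proof (cases "filter (\<lambda>y. y \<notin> X) row")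
    case Nil then show ?thesis using "2.prems" by (simp add: tabw_full split: if_splits)
  next
    case (Cons x s)
    have "x \<in> set (filter (\<lambda>y. y \<notin> X) row)" unfolding Cons by simp
    then have x: "x \<in> set row" by simp
    obtain w' where w: "w = x # w'" and
      "w' \<in> set (tabw (insert x X) (row # rows)) \<or> w' \<in> set (tabw X rows)"
      using "2.prems" Cons by (auto simp: tabw.simps(2))
    then have "set w' \<subseteq> \<Union> (set ` set (row # rows))"
      using "2.IH"(1)[OF Cons, of w'] "2.IH"(2)[OF Cons, of w'] by auto
    then show ?thesis using w x by auto
  qed
qed simp

lemma set_tabw_subset: "\<forall>row\<in>set rows. set row \<subseteq> U \<Longrightarrow> w \<in> set (tabw X rows) \<Longrightarrow> set w \<subseteq> U"
  using set_tabw[of w X rows] by blast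

lemma tabF_Nil [simp]: "tabF \<phi> V [] = 0"
  by (simp add: tabF_def)

lemma stutter_free_tabF: "stutter_free \<phi> \<Longrightarrow> stutter_free (tabF \<phi> V)"
  unfolding stutter_free_def[of "tabF \<phi> V"] tabF_def
proof (intro allI impI sum_list_zero)
  fix rows and w :: "nat list" assume "stutter_free \<phi>" "\<not> distinct_adj rows" "w \<in> set (tabw {} rows)"
  then have "stutter_free (act4 \<phi> V)" "\<not> distinct_adj w" using stutter_free_act4 tabw_stutter by blast+
  then show "act4 \<phi> V w = 0" unfolding stutter_free_def by blast
qed

lemma act4_map:
  assumes "g permutes {1..4}"
  shows "act4 \<phi> V (map g A) = act4 \<phi> V A"
proof -
  have inj: "inj g" using permutes_inj[OF assms] .
  have img: "g ` S \<subseteq> {1..4} \<longleftrightarrow> S \<subseteq> {1..4}" for S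
    using permutes_in_image[OF assms] by auto
  have sh: "shuf (map g A) V = map (map (map_prod g id)) (shuf A V)"
    using shuf_map[of g A id V] by simp
  have "(\<Prod>l\<in>{1..4}. \<phi> (proj l (map (map_prod g id) \<omega>))) = (\<Prod>l\<in>{1..4}. \<phi> (proj l \<omega>))" for \<omega> :: "(nat \<times> 'a) list"
    by (subst prod.permute[OF assms]) (simp add: proj_map_inj[OF inj])
  then show ?thesis
    by (simp add: act4_def actw_def img sh o_def del: One_nat_def)
qed

lemma tabF_map:
  assumes "g permutes {1..4}"
  shows "tabF \<phi> V (map (map g) rows) = tabF \<phi> V rows"
  using tabw_map[OF permutes_inj[OF assms], of "{}" rows]
  by (simp add: tabF_def o_def act4_map[OF assms])

lemma act4_dels:
  assumes "\<phi> [] = 0" "cocw N \<phi>" "sorted V" "set V \<subseteq> {..N}" "set A \<subseteq> {1..4}"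
  shows "(\<Sum>A'\<leftarrow>dels A. act4 \<phi> V A') = (\<Sum>V'\<leftarrow>dels V. act4 \<phi> V' A)"
proof -
  let ?g = "\<lambda>\<omega>. \<Prod>l\<in>{1..4::nat}. \<phi> (proj l \<omega>)"
  have "(\<Sum>\<omega>\<leftarrow>shuf A V. \<Sum>\<omega>'\<leftarrow>dels \<omega>. ?g \<omega>') = 0"
  proof (rule sum_list_zero)
    fix \<omega> assume \<omega>: "\<omega> \<in> set (shuf A V)"
    have "(\<Sum>\<omega>'\<leftarrow>dels \<omega>. ?g \<omega>') = (\<Sum>l\<in>{1..4}. (\<Sum>L\<leftarrow>dels (proj l \<omega>). \<phi> L) * (\<Prod>l'\<in>{1..4} - {l}. \<phi> (proj l' \<omega>)))"
      by (rule sum_dels_prod_proj) (use shuf_letters[OF \<omega>] assms(5) in auto)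
    then show "(\<Sum>\<omega>'\<leftarrow>dels \<omega>. ?g \<omega>') = 0"
      using cocw_proj[OF assms(2-4) \<omega>] by simp
  qed
  moreover have z: "?g [] = 0" using assms(1) by simp
  ultimately have "(\<Sum>A'\<leftarrow>dels A. \<Sum>\<omega>\<leftarrow>shuf A' V. ?g \<omega>) + (\<Sum>V'\<leftarrow>dels V. \<Sum>\<omega>\<leftarrow>shuf A V'. ?g \<omega>) = 0"
    using shuf_dels[of ?g A V, unfolded z] by simp
  then have "(\<Sum>A'\<leftarrow>dels A. actw {1..4} (\<lambda>_. \<phi>) V A') = (\<Sum>V'\<leftarrow>dels V. actw {1..4} (\<lambda>_. \<phi>) V' A)"
    unfolding actw_def by (rule char2_eqI)
  moreover have "(\<Sum>A'\<leftarrow>dels A. act4 \<phi> V A') = (\<Sum>A'\<leftarrow>dels A. actw {1..4} (\<lambda>_. \<phi>) V A')"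
    by (rule sum_list_cong) (use set_dels assms(5) in \<open>force simp: act4_def\<close>)
  ultimately show ?thesis using assms(5) by (simp add: act4_def)
qed

lemma tabF_dels:
  assumes "\<phi> [] = 0" "cocw N \<phi>" "sorted V" "set V \<subseteq> {..N}" "\<forall>row\<in>set rows. set row = {1..4}"
  shows "(\<Sum>rows'\<leftarrow>dels rows. tabF \<phi> V rows') = (\<Sum>V'\<leftarrow>dels V. tabF \<phi> V' rows)"
proof -
  have 1: "(\<Sum>w\<leftarrow>tabw {} rows. \<Sum>w'\<leftarrow>dels w. act4 \<phi> V w') = (\<Sum>w\<leftarrow>tabw {} rows. \<Sum>V'\<leftarrow>dels V. act4 \<phi> V' w)"
  proof (rule sum_list_cong)
    fix w assume "w \<in> set (tabw {} rows)"
    then have "set w \<subseteq> {1..4}" by (rule set_tabw_subset[rotated]) (use assms(5) in blast)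
    then show "(\<Sum>w'\<leftarrow>dels w. act4 \<phi> V w') = (\<Sum>V'\<leftarrow>dels V. act4 \<phi> V' w)"
      by (rule act4_dels[OF assms(1-4)])
  qed
  have 2: "(\<Sum>w\<leftarrow>tabw {y} rows. act4 \<phi> V w) = 0" if "y \<in> {1..4}" for y
    by (rule sum_list_zero, rule act4_missing[of \<phi> y, OF assms(1) that]) (use tabw_avoid in blast)
  have "(\<Sum>w\<leftarrow>tabw {} rows. \<Sum>w'\<leftarrow>dels w. act4 \<phi> V w') =
    (\<Sum>y\<in>{1..4} - {}. \<Sum>w\<leftarrow>tabw (insert y {}) rows. act4 \<phi> V w) +
    (\<Sum>rows'\<leftarrow>dels rows. \<Sum>w\<leftarrow>tabw {} rows'. act4 \<phi> V w)"
    by (rule tabw_dels) (use assms(5) in auto)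
  then show ?thesis
    unfolding 1 using 2 by (simp add: tabF_def sum_list_swap[of _ "dels V"])
qed

lemma sum_fun_apply: "(\<Sum>x\<in>S. f x) w = (\<Sum>x\<in>S. f x w :: bit)"
  by (induction S rule: infinite_finite_induct) auto

lemma surj_act_pairing: "surj_act X r c \<alpha>s w = pairing (\<lambda>A. seq_act X r A \<alpha>s w) c"
  by (simp add: surj_act_def sum_fun_apply pairing_def)

lemma pairing_surj_cls:
  assumes X: "simplicial_set X" "u \<in> simplices X" and V: "V \<in> mono_lists (sdim X u)"
    and \<alpha>: "ncochain X \<alpha>" and A: "set A \<subseteq> {1..4}"
  shows "pairing (\<lambda>A. seq_act X 4 A (\<lambda>_. \<alpha>) (spull X u V)) (surj_cls 4 A) = act4 (ev X u \<alpha>) V A"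
proof (cases "set A = {1..4} \<and> distinct_adj A")
  case True
  then have "surj_cls 4 A = basis A"
    unfolding surj_cls_def distinct_adj_conv_nth by simp
  then show ?thesis
    using seq_act_spull[OF X V, of A 4 "\<lambda>_. \<alpha>"] True \<alpha> by (simp add: act4_def)
next
  case False
  then have "surj_cls 4 A = 0"
    unfolding surj_cls_def distinct_adj_conv_nth by auto
  moreover have "act4 (ev X u \<alpha>) V A = 0"
  proof (cases "distinct_adj A")
    case True
    then obtain l where "l \<in> {1..4}" "l \<notin> set A" using False A by blast
    then show ?thesis by (intro act4_missing[of _ l]) simp_all
  next
    case False
    have "stutter_free (ev X u \<alpha>)" using ev_stutter[OF X \<alpha>] by (simp add: stutter_free_def)
    then show ?thesis using stutter_free_act4 False unfolding stutter_free_def by blast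
  qed
  ultimately show ?thesis by simp
qed

definition rowp :: "(nat \<Rightarrow> nat) \<Rightarrow> nat list" where
  "rowp \<sigma> = map \<sigma> [1..<Suc 4]"

lemma rowp_permutes:
  assumes "\<sigma> permutes {1..4}"
  shows "set (rowp \<sigma>) = {1..4}" "distinct (rowp \<sigma>)"
proof -
  have "{1..<Suc 4} = {1..4::nat}" by auto
  then show "set (rowp \<sigma>) = {1..4}" using permutes_image[OF assms] by (simp add: rowp_def del: upt_Suc)
  have "inj_on \<sigma> (set [1..<Suc 4])" using permutes_inj[OF assms] by (rule inj_on_subset) simp
  then show "distinct (rowp \<sigma>)" by (simp add: rowp_def distinct_map del: upt_Suc)
qed

lemma surj_act_TR:
  assumes X: "simplicial_set X" "u \<in> simplices X" and V: "V \<in> mono_lists (sdim X u)"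
    and \<alpha>: "ncochain X \<alpha>"
    and c: "Poly_Mapping.keys c \<subseteq> {\<sigma>s. \<sigma>s \<noteq> [] \<and> (\<forall>\<sigma>\<in>set \<sigma>s. \<sigma> permutes {1..4})}"
  shows "surj_act X 4 (TR 4 c) (\<lambda>_. \<alpha>) (spull X u V) = pairing (\<lambda>\<sigma>s. tabF (ev X u \<alpha>) V (map rowp \<sigma>s)) c"
proof -
  let ?G = "\<lambda>A. seq_act X 4 A (\<lambda>_. \<alpha>) (spull X u V)"
  show ?thesis
    unfolding surj_act_pairing TR_def pairing_lin
  proof (rule pairing_cong)
    fix \<sigma>s assume "\<sigma>s \<in> Poly_Mapping.keys c"
    then have \<sigma>s: "\<sigma>s \<noteq> []" "\<And>\<sigma>. \<sigma> \<in> set \<sigma>s \<Longrightarrow> \<sigma> permutes {1..4}" using c by auto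
    let ?rows = "map rowp \<sigma>s"
    have rows: "?rows \<noteq> []" "\<forall>row\<in>set ?rows. set row = {1..4} \<and> distinct row"
      using \<sigma>s rowp_permutes by auto
    have id: "map (filter (\<lambda>v. v \<notin> {})) ?rows = ?rows" by (simp add: map_idI)
    have "(\<Sum>a\<in>{a. length a = length \<sigma>s \<and> (\<forall>i\<in>set a. 1 \<le> i) \<and> sum_list a = (length \<sigma>s - 1) + 4}.
        pairing ?G (surj_cls 4 (table_seq a (map (\<lambda>\<sigma>. map \<sigma> [1..<Suc 4]) \<sigma>s)))) =
      (\<Sum>a\<in>comps (length ?rows) (card ({1..4::nat} - {})).
        pairing ?G (surj_cls 4 (table_seq a (map (filter (\<lambda>v. v \<notin> {})) ?rows))))"
      unfolding id by (simp add: comps_def rowp_def[abs_def] del: upt_Suc)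
    also have "\<dots> = (\<Sum>w\<leftarrow>tabw {} ?rows. pairing ?G (surj_cls 4 w))"
      by (rule table_seq_tabw[OF rows, of "{}"]) auto
    also have "\<dots> = tabF (ev X u \<alpha>) V ?rows"
      unfolding tabF_def
    proof (rule sum_list_cong)
      fix w assume "w \<in> set (tabw {} ?rows)"
      then have "set w \<subseteq> {1..4}" by (rule set_tabw_subset[rotated]) (use rows(2) in blast)
      then show "pairing ?G (surj_cls 4 w) = act4 (ev X u \<alpha>) V w"
        by (rule pairing_surj_cls[OF X V \<alpha>])
    qed
    finally show "pairing ?G (\<Sum>a\<in>{a. length a = length \<sigma>s \<and> (\<forall>i\<in>set a. 1 \<le> i) \<and> sum_list a = (length \<sigma>s - 1) + 4}.
        surj_cls 4 (table_seq a (map (\<lambda>\<sigma>. map \<sigma> [1..<Suc 4]) \<sigma>s))) = tabF (ev X u \<alpha>) V ?rows"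
      unfolding pairing_sum .
  qed
qed

section \<open>The action of products of alternating sequences\<close>

lemma proj_filter: "l \<in> S \<Longrightarrow> proj l (filter (\<lambda>e. fst e \<in> S) w) = proj l w"
  by (induction w) (auto simp: proj_def)

theorem tabF_shuf3:
  assumes "stutter_free \<phi>"
  shows "(\<Sum>\<rho>\<leftarrow>shuf3 (alt False i) (alt False r) (alt False s). tabF \<phi> V (map rowl \<rho>)) =
    cupw i (cupw r \<phi> \<phi>) (cupw s \<phi> \<phi>) V"
proof -
  define h :: "nat \<Rightarrow> nat \<Rightarrow> (nat \<times> 'a) list \<Rightarrow> bit" where "h a b w = \<phi> (proj a w) * \<phi> (proj b w)" for a b w
  have 4: "{1..4} = {1, 2, 3, 4 :: nat}" by auto
  have "(\<Sum>\<rho>\<leftarrow>shuf3 (alt False i) (alt False r) (alt False s). tabF \<phi> V (map rowl \<rho>)) =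
      wsum 1 2 3 4 (Suc i) (Suc r) (Suc s) (act4 \<phi> V)"
    unfolding tabF_def by (rule shuf3_tabw_alt[OF stutter_free_act4[OF assms]])
  also have "\<dots> = wsum 1 2 3 4 (Suc i) (Suc r) (Suc s) (\<lambda>A. \<Sum>w\<leftarrow>shuf A V.
      h 1 2 (filter (\<lambda>e. fst e \<in> {1, 2}) w) * h 3 4 (filter (\<lambda>e. fst e \<in> {3, 4}) w))"
  proof (rule wsum_cong)
    fix A :: "nat list" assume A: "set A \<subseteq> {1, 2, 3, 4}"
    have P: "proj 1 (filter (\<lambda>e. fst e \<in> {1, 2}) w) = proj 1 w" "proj 2 (filter (\<lambda>e. fst e \<in> {1, 2}) w) = proj 2 w"
      "proj 3 (filter (\<lambda>e. fst e \<in> {3, 4}) w) = proj 3 w" "proj 4 (filter (\<lambda>e. fst e \<in> {3, 4}) w) = proj 4 w"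
      for w :: "(nat \<times> 'a) list"
      by (rule proj_filter; simp)+
    have "(\<Prod>l\<in>{1, 2, 3, 4}. \<phi> (proj l w)) = \<phi> (proj 1 w) * \<phi> (proj 2 w) * (\<phi> (proj 3 w) * \<phi> (proj 4 w))"
      for w :: "(nat \<times> 'a) list" by (simp add: mult.assoc)
    then show "act4 \<phi> V A = (\<Sum>w\<leftarrow>shuf A V.
      h 1 2 (filter (\<lambda>e. fst e \<in> {1, 2}) w) * h 3 4 (filter (\<lambda>e. fst e \<in> {3, 4}) w))"
      unfolding act4_def 4 actw_def h_def P using A by (simp add: mult.assoc)
  qed
  also have "\<dots> = (\<Sum>\<omega>\<leftarrow>shuf (altl False (\<not> False) (Suc i)) V.
      (\<Sum>w\<leftarrow>shuf (altl 1 2 (Suc r)) (proj False \<omega>). h 1 2 w) *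
      (\<Sum>w\<leftarrow>shufx (altl 3 4 (Suc s)) (proj (\<not> False) \<omega>). h 3 4 w))"
    by (rule wsum_shuf_nested) simp
  also have "\<dots> = cupw i (cupw r \<phi> \<phi>) (cupw s \<phi> \<phi>) V"
  proof -
    have "(\<Sum>w\<leftarrow>shuf (altl a b (Suc k)) L. h a b w) = cupw k \<phi> \<phi> L" if "a \<noteq> b" for a b k L
      unfolding h_def cupw_def by (rule sum_shuf_altl_rename[OF that])
    moreover have "shufx (altl 3 (4::nat) (Suc s)) L = shuf (altl 3 4 (Suc s)) L" for L :: "'a list"
      by (simp add: shufx_def)
    ultimately show ?thesis by (simp add: cupw_def[of i] del: altl.simps)
  qed
  finally show ?thesis .
qed


section \<open>The homotopy formula\<close>

lemma perm_abc_permutes: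
  "perm_a permutes {1..4}" "perm_b permutes {1..4}" "perm_c permutes {1..4}"
  unfolding perm_a_def perm_b_def perm_c_def
  by (auto intro!: permutes_compose permutes_swap_id)

lemma perm_abc_eval [simp]:
  "perm_a 1 = 3" "perm_a 2 = 4" "perm_a 3 = 1" "perm_a 4 = 2"
  "perm_b 1 = 2" "perm_b 2 = 1" "perm_b 3 = 3" "perm_b 4 = 4"
  "perm_c 1 = 1" "perm_c 2 = 2" "perm_c 3 = 4" "perm_c 4 = 3"
  "perm_a (Suc 0) = 3" "perm_b (Suc 0) = 2" "perm_c (Suc 0) = Suc 0"
  by (simp_all add: perm_a_def perm_b_def perm_c_def transpose_def)

definition d8perm :: "bool \<Rightarrow> bool \<Rightarrow> nat \<Rightarrow> nat" where
  "d8perm a b = (if a then perm_a else id) \<circ> (if b then perm_b \<circ> perm_c else id)"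

lemma d8perm_permutes: "d8perm a b permutes {1..4}"
  unfolding d8perm_def using perm_abc_permutes by (auto intro!: permutes_compose simp: permutes_id)

lemma rowl_d8act: "rowl (d8act a b e) = map (d8perm a b) (rowl e)"
proof -
  obtain x y z where "e = (x, y, z)" by (cases e)
  then show ?thesis
    by (cases a; cases b; cases x; cases y; cases z) (simp_all add: rowl_def d8act_def d8perm_def blk_def)
qed

lemma rowl_flip:
  "rowl (x, y \<noteq> a, z \<noteq> b) = map ((if a then perm_b else id) \<circ> (if b then perm_c else id)) (rowl (x, y, z))"
  by (cases a; cases b; cases x; cases y; cases z) (simp_all add: rowl_def blk_def)

lemma tabF_d8act: "tabF \<phi> V (map rowl (map (d8act a b) \<rho>)) = tabF \<phi> V (map rowl \<rho>)"
  using tabF_map[OF d8perm_permutes[of a b], of \<phi> V "map rowl \<rho>"] by (simp add: o_def rowl_d8act)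

lemma alt_flip: "map (\<lambda>t. t \<noteq> x) (alt b r) = alt (b \<noteq> x) r"
proof -
  have "map (\<lambda>t. t \<noteq> x) (altl b c r) = altl (b \<noteq> x) (c \<noteq> x) r" for b c
    by (induction r arbitrary: b c) auto
  then show ?thesis by (cases x) auto
qed

lemma sum_shuf3_tabF_flip:
  "(\<Sum>\<rho>\<leftarrow>shuf3 (alt False i) (alt x r) (alt y s). tabF \<phi> V (map rowl \<rho>)) =
   (\<Sum>\<rho>\<leftarrow>shuf3 (alt False i) (alt False r) (alt False s). tabF \<phi> V (map rowl \<rho>))"
proof -
  let ?g = "(if x then perm_b else id) \<circ> (if y then perm_c else id)"
  have g: "?g permutes {1..4}"
    using perm_abc_permutes by (auto intro!: permutes_compose simp: permutes_id)
  have alts: "alt False i = map (\<lambda>t. t) (alt False i)" "alt x r = map (\<lambda>t. t \<noteq> x) (alt False r)"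
    "alt y s = map (\<lambda>t. t \<noteq> y) (alt False s)"
    using alt_flip[of x False r] alt_flip[of y False s] by simp_all
  have el: "rowl (map_prod (\<lambda>t. t) (map_prod (\<lambda>t. t \<noteq> x) (\<lambda>t. t \<noteq> y)) e) = map ?g (rowl e)" for e
    by (cases e) (simp only: map_prod_simp rowl_flip)
  have "map rowl (map (map_prod (\<lambda>t. t) (map_prod (\<lambda>t. t \<noteq> x) (\<lambda>t. t \<noteq> y))) \<rho>) = map (map ?g) (map rowl \<rho>)" for \<rho>
    by (simp only: map_map o_def el)
  then show ?thesis
    by (subst (1) alts(1), subst (1) alts(2), subst (1) alts(3), subst sum_shuf3_map)
       (simp only: tabF_map[OF g])
qed

lemma psi_stutter: "stutter_free g \<Longrightarrow> \<not> distinct_adj l \<Longrightarrow> psi g l = 0"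
  unfolding psi_def by (rule aws_stutter) (simp_all add: phi_stutter)

lemma psi_zero: "psi (\<lambda>w. 0) l = 0"
  using psi_add[of "\<lambda>w. 0" "\<lambda>w. 0" l] by simp

lemma jsum_zero: "jsum l (\<lambda>w. 0) = 0"
  using jsum_add[of l "\<lambda>w. 0" "\<lambda>w. 0"] by simp

lemma jsum_sum: "jsum l (\<lambda>w. \<Sum>x\<leftarrow>xs. f x w) = (\<Sum>x\<leftarrow>xs. jsum l (f x))"
  by (induction xs) (auto simp: jsum_add jsum_zero)

lemma jsum_stutter: "stutter_free f \<Longrightarrow> \<not> distinct_adj l \<Longrightarrow> jsum l f = 0"
proof (induction l arbitrary: f)
  case (Cons p l)
  then obtain q l' where l: "l = q # l'" by (cases l) auto
  note g = stutter_free_Cons[OF Cons.prems(1), of "iota p"]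
  have 1: "psi (\<lambda>w. f (iota p # w)) (p # l) = 0" by (rule psi_stutter[OF g Cons.prems(2)])
  have 2: "jsum l (\<lambda>w. f (iota p # w)) = 0"
  proof (cases "p = q")
    case True
    have "(\<lambda>w. f (iota p # iota p # w)) = (\<lambda>w. 0)"
      using stutter_free_Cons2[OF Cons.prems(1)] by simp
    then show ?thesis using True l by (simp add: psi_zero jsum_zero)
  next
    case False
    then show ?thesis using Cons.IH[OF g] Cons.prems(2) l by simp
  qed
  show ?case using 1 2 by simp
qed simp

lemma sum_shuf_alt_flip:
  "(\<Sum>l\<leftarrow>shuf (alt (\<not> b) k) (alt c m). f l) = (\<Sum>l\<leftarrow>shuf (alt b k) (alt c m). f (map (\<lambda>(s, t). (s \<noteq> True, t \<noteq> False)) l))"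
  "(\<Sum>l\<leftarrow>shuf (alt b k) (alt (\<not> c) m). f l) = (\<Sum>l\<leftarrow>shuf (alt b k) (alt c m). f (map (\<lambda>(s, t). (s \<noteq> False, t \<noteq> True)) l))"
proof -
  have e: "(\<lambda>(s, t). (s \<noteq> True, t \<noteq> False)) = map_prod (\<lambda>s. s \<noteq> True) (\<lambda>t. t)"
    "(\<lambda>(s, t). (s \<noteq> False, t \<noteq> True)) = map_prod (\<lambda>s. s) (\<lambda>t. t \<noteq> True)" by auto
  show "(\<Sum>l\<leftarrow>shuf (alt (\<not> b) k) (alt c m). f l) = (\<Sum>l\<leftarrow>shuf (alt b k) (alt c m). f (map (\<lambda>(s, t). (s \<noteq> True, t \<noteq> False)) l))"
    using shuf_map[of "\<lambda>s. s \<noteq> True" "alt b k" "\<lambda>t. t" "alt c m"] alt_flip[of True b k] unfolding e by (simp add: o_def)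
  show "(\<Sum>l\<leftarrow>shuf (alt b k) (alt (\<not> c) m). f l) = (\<Sum>l\<leftarrow>shuf (alt b k) (alt c m). f (map (\<lambda>(s, t). (s \<noteq> False, t \<noteq> True)) l))"
    using shuf_map[of "\<lambda>s. s" "alt b k" "\<lambda>t. t \<noteq> True" "alt c m"] alt_flip[of True c m] unfolding e by (simp add: o_def)
qed

text \<open>
  The boundary of \<open>x\<^sub>q \<times> x\<^sub>p\<close> consists of pairs of simplices in the same \<open>V\<^sub>4\<close>-orbit, on which an
  invariant function cancels.
\<close>

lemma sum_shuf_alt_dels_zero:
  fixes J :: "(bool \<times> bool) list \<Rightarrow> bit"
  assumes sf: "stutter_free J" and J: "J [] = 0"
    and inv: "\<And>a b l. J (map (\<lambda>(s, t). (s \<noteq> a, t \<noteq> b)) l) = J l"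
  shows "(\<Sum>l\<leftarrow>shuf (alt False q) (alt False p). \<Sum>l'\<leftarrow>dels l. J l') = 0"
proof -
  have 1: "(\<Sum>e\<leftarrow>dels (alt False q). \<Sum>l\<leftarrow>shuf e (alt False p). J l) = 0"
  proof (cases q)
    case (Suc k)
    have "stutter_free (\<lambda>e. \<Sum>l\<leftarrow>shuf e (alt False p). J l)"
      unfolding stutter_free_def
    proof (intro allI impI sum_list_zero)
      fix e :: "bool list" and l assume "\<not> distinct_adj e" "l \<in> set (shuf e (alt False p))"
      then have "\<not> distinct_adj l" by (rule shuf_stutter1)
      then show "J l = 0" using sf by (simp add: stutter_free_def)
    qed
    from sum_dels_altl[OF this, of False "\<not> False" k] show ?thesis
      using sum_shuf_alt_flip(1)[of J False k False p] inv[of True False] Suc by simp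
  qed simp
  have 2: "(\<Sum>g\<leftarrow>dels (alt False p). \<Sum>l\<leftarrow>shuf (alt False q) g. J l) = 0"
  proof (cases p)
    case (Suc k)
    have "stutter_free (\<lambda>g. \<Sum>l\<leftarrow>shuf (alt False q) g. J l)"
      unfolding stutter_free_def
    proof (intro allI impI sum_list_zero)
      fix g :: "bool list" and l assume "\<not> distinct_adj g" "l \<in> set (shuf (alt False q) g)"
      then have "\<not> distinct_adj l" by (rule shuf_stutter2)
      then show "J l = 0" using sf by (simp add: stutter_free_def)
    qed
    from sum_dels_altl[OF this, of False "\<not> False" k] show ?thesis
      using sum_shuf_alt_flip(2)[of J False q False k] inv[of False True] Suc by simp
  qed simp
  show ?thesis unfolding shuf_dels 1 2 by (simp add: J)
qed

lemma jsum_tabF_map: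
  "jsum (map (\<lambda>(s, t). (s \<noteq> a, t \<noteq> b)) l) (\<lambda>\<rho>. tabF \<phi> V (map rowl \<rho>)) = jsum l (\<lambda>\<rho>. tabF \<phi> V (map rowl \<rho>))"
  unfolding jsum_map tabF_d8act ..

lemma stutter_free_tabF_rowl:
  assumes "stutter_free \<phi>"
  shows "stutter_free (\<lambda>\<rho>. tabF \<phi> V (map rowl \<rho>))"
  unfolding stutter_free_def
proof (intro allI impI)
  fix \<rho> :: "(bool \<times> bool \<times> bool) list" assume "\<not> distinct_adj \<rho>"
  then have "\<not> distinct_adj (map rowl \<rho>)" by (meson distinct_adj_mapD)
  then show "tabF \<phi> V (map rowl \<rho>) = 0" using stutter_free_tabF[OF assms, of V] by (simp add: stutter_free_def)
qed

theorem homotopy_formula: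
  assumes "\<phi> [] = 0" "stutter_free \<phi>" "cocw N \<phi>" "sorted V" "set V \<subseteq> {..N}"
  shows "(\<Sum>l\<leftarrow>shuf (alt False q) (alt False p). tabF \<phi> V (map rowl (map iota l))) +
    (\<Sum>V'\<leftarrow>dels V. \<Sum>l\<leftarrow>shuf (alt False q) (alt False p). jsum l (\<lambda>\<rho>. tabF \<phi> V' (map rowl \<rho>))) =
    (\<Sum>i\<le>q. \<Sum>r\<le>q - i + p. of_nat (r choose (q - i)) * of_nat ((q - i + p - r) choose (q - i)) *
       cupw i (cupw r \<phi> \<phi>) (cupw (q - i + p - r) \<phi> \<phi>) V)"
proof -
  define G where "G = (\<lambda>V \<rho>. tabF \<phi> V (map rowl \<rho>))"
  let ?c = "shuf (alt False q) (alt False p)"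
  have sf: "stutter_free (G V)" unfolding G_def by (rule stutter_free_tabF_rowl[OF assms(2)])
  have D: "(\<Sum>V'\<leftarrow>dels V. G V' \<rho>) = (\<Sum>\<rho>'\<leftarrow>dels \<rho>. G V \<rho>')" for \<rho>
    unfolding G_def using tabF_dels[OF assms(1,3,4,5), of "map rowl \<rho>"]
    by (simp add: dels_map o_def set_rowl)
  have "(\<Sum>V'\<leftarrow>dels V. \<Sum>l\<leftarrow>?c. jsum l (G V')) = (\<Sum>l\<leftarrow>?c. jsum l (\<lambda>\<rho>. \<Sum>V'\<leftarrow>dels V. G V' \<rho>))"
    unfolding jsum_sum by (rule sum_list_swap)
  also have "\<dots> = (\<Sum>l\<leftarrow>?c. G V (map iota l) + psi (G V) l + (\<Sum>l'\<leftarrow>dels l. jsum l' (G V)))"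
    unfolding D by (rule sum_list_cong) (auto intro!: jsum_dels[OF sf] dest: shuf_neq_Nil)
  also have "\<dots> = (\<Sum>l\<leftarrow>?c. G V (map iota l)) + (\<Sum>l\<leftarrow>?c. psi (G V) l)"
  proof -
    have "(\<Sum>l\<leftarrow>?c. \<Sum>l'\<leftarrow>dels l. jsum l' (G V)) = 0"
    proof (rule sum_shuf_alt_dels_zero)
      show "stutter_free (\<lambda>l. jsum l (G V))"
        using jsum_stutter[OF sf] by (simp add: stutter_free_def)
      show "jsum (map (\<lambda>(s, t). (s \<noteq> a, t \<noteq> b)) l) (G V) = jsum l (G V)" for a b l
        unfolding G_def by (rule jsum_tabF_map)
    qed simp
    then show ?thesis by (simp add: sum_list_addf)
  qed
  also have "(\<Sum>l\<leftarrow>?c. psi (G V) l) = phi (G V) (alt False q) (alt False p)"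
    by (rule sum_shuf_psi[OF sf]) simp_all
  also have "\<dots> = (\<Sum>i\<le>q. stn (\<lambda>L1 L2. \<Sum>\<rho>\<leftarrow>shuf3 (alt False i) L1 L2. G V \<rho>) (alt (odd i) (q - i)) (alt False p))"
    unfolding phi_def aws_dup_altl by simp
  also have "\<dots> = (\<Sum>i\<le>q. \<Sum>r\<le>q - i + p. of_nat (r choose (q - i)) * of_nat ((q - i + p - r) choose (q - i)) *
       cupw i (cupw r \<phi> \<phi>) (cupw (q - i + p - r) \<phi> \<phi>) V)"
  proof (rule sum.cong[OF refl])
    fix i
    let ?m = "q - i" and ?n = "q - i + p"
    define h where "h r s = cupw i (cupw r \<phi> \<phi>) (cupw s \<phi> \<phi>) V" for r s
    have "stn (\<lambda>L1 L2. \<Sum>\<rho>\<leftarrow>shuf3 (alt False i) L1 L2. G V \<rho>) (alt (odd i) ?m) (alt False p) =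
      (\<Sum>r\<le>?m + p. of_nat (r choose ?m) * of_nat ((?m + p - r) choose ?m) *
       (if odd i then h (?m + p - r) r else h r (?m + p - r)))"
    proof (rule stn_alt)
      fix L L' :: "bool list" assume LL: "\<not> distinct_adj L \<or> \<not> distinct_adj L'"
      show "(\<Sum>\<rho>\<leftarrow>shuf3 (alt False i) L L'. G V \<rho>) = 0"
      proof (rule sum_list_zero)
        fix \<rho> assume "\<rho> \<in> set (shuf3 (alt False i) L L')"
        then have "\<not> distinct_adj \<rho>" using LL by (intro shuf3_stutter[of "alt False i" L L']) auto
        then show "G V \<rho> = 0" using sf by (simp add: stutter_free_def)
      qed
    next
      fix x y r s
      show "(\<Sum>\<rho>\<leftarrow>shuf3 (alt False i) (alt x r) (alt y s). G V \<rho>) = h r s"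
        unfolding G_def h_def by (rule trans[OF sum_shuf3_tabF_flip tabF_shuf3[OF assms(2)]])
    qed
    also have "\<dots> = (\<Sum>r\<le>?n. of_nat (r choose ?m) * of_nat ((?n - r) choose ?m) * h r (?n - r))"
    proof (cases "odd i")
      case True
      then show ?thesis
        by (intro sum.reindex_bij_witness[of _ "\<lambda>r. ?n - r" "\<lambda>r. ?n - r"]) (auto simp: mult_ac)
    qed simp
    finally show "stn (\<lambda>L1 L2. \<Sum>\<rho>\<leftarrow>shuf3 (alt False i) L1 L2. G V \<rho>) (alt (odd i) ?m) (alt False p) =
      (\<Sum>r\<le>?n. of_nat (r choose ?m) * of_nat ((?n - r) choose ?m) *
         cupw i (cupw r \<phi> \<phi>) (cupw (?n - r) \<phi> \<phi>) V)"
      unfolding h_def .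
  qed
  finally have "(\<Sum>V'\<leftarrow>dels V. \<Sum>l\<leftarrow>?c. jsum l (G V')) = (\<Sum>l\<leftarrow>?c. G V (map iota l)) +
    (\<Sum>i\<le>q. \<Sum>r\<le>q - i + p. of_nat (r choose (q - i)) * of_nat ((q - i + p - r) choose (q - i)) *
       cupw i (cupw r \<phi> \<phi>) (cupw (q - i + p - r) \<phi> \<phi>) V)" .
  then show ?thesis unfolding G_def by (simp only: bit_add_self_left)
qed

section \<open>Maximal chains as shuffles\<close>

definition chain_less :: "nat \<times> nat \<Rightarrow> nat \<times> nat \<Rightarrow> bool" where
  "chain_less = (\<lambda>x y. fst x \<le> fst y \<and> snd x \<le> snd y \<and> x \<noteq> y)"

lemma chain_ranks:
  assumes "length w = (k - a) + (m - b) + 1" "a \<le> k" "b \<le> m"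
    and "set w \<subseteq> {a..k} \<times> {b..m}" "sorted_wrt chain_less w"
  shows "map (\<lambda>p. fst p + snd p) w = [a + b..<Suc (k + m)]"
proof -
  let ?r = "map (\<lambda>p. fst p + snd p) w"
  have "sorted_wrt (\<lambda>x y. fst x + snd x < fst y + snd y) w"
    by (rule sorted_wrt_mono_rel[OF _ assms(5)]) (auto simp: chain_less_def prod_eq_iff)
  then have s: "sorted_wrt (<) ?r" by (simp add: sorted_wrt_map)
  then have d: "distinct ?r" "sorted ?r" by (auto simp: strict_sorted_iff)
  have "set ?r \<subseteq> {a + b..k + m}" using assms(4) by fastforce
  moreover have "card (set ?r) = card {a + b..k + m}"
    using d(1) assms(1-3) by (simp add: distinct_card del: set_map)
  ultimately have "set ?r = {a + b..k + m}" by (intro card_subset_eq) auto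
  then have "set ?r = set [a + b..<Suc (k + m)]" by auto
  then show ?thesis using d by (intro sorted_distinct_set_unique) (auto simp del: upt_Suc)
qed

lemma shuf_chain:
  assumes "a \<le> k" "b \<le> m"
  shows "w \<in> set (shuf [a..<Suc k] [b..<Suc m]) \<longleftrightarrow>
    length w = (k - a) + (m - b) + 1 \<and> set w \<subseteq> {a..k} \<times> {b..m} \<and> sorted_wrt chain_less w"
  using assms
proof (induction "(k - a) + (m - b)" arbitrary: a b w rule: less_induct)
  case less
  have ua: "[a..<Suc k] = a # [Suc a..<Suc k]" and ub: "[b..<Suc m] = b # [Suc b..<Suc m]"
    using less.prems by (simp_all add: upt_conv_Cons del: upt_Suc)
  show ?case
  proof (intro iffI conjI)
    assume w: "w \<in> set (shuf [a..<Suc k] [b..<Suc m])"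
    show "length w = (k - a) + (m - b) + 1" using length_shuf[OF w] less.prems by (simp del: upt_Suc)
    show set: "set w \<subseteq> {a..k} \<times> {b..m}" using set_shuf[OF w] by (auto simp del: upt_Suc)
    obtain w' where w': "w = (a, b) # w'" using w unfolding ua ub by (auto dest: hd_shuf)
    show "sorted_wrt chain_less w"
    proof (cases "a = k \<and> b = m")
      case True then show ?thesis using w unfolding ua ub by (simp add: shuf.simps(3))
    next
      case False
      then have "\<not> ([Suc a..<Suc k] = [] \<and> [Suc b..<Suc m] = [])" using less.prems by auto
      then consider (1) "w' \<in> set (shuf [Suc a..<Suc k] [b..<Suc m])"
        | (2) "w' \<in> set (shuf [a..<Suc k] [Suc b..<Suc m])"
        using w w' unfolding ua ub by (auto simp: shuf.simps(3) simp del: upt_Suc)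
      then show ?thesis
      proof cases
        case 1
        then have "Suc a \<le> k" by (cases "Suc a \<le> k") auto
        then have "sorted_wrt chain_less w'" "set w' \<subseteq> {Suc a..k} \<times> {b..m}"
          using less.hyps[of "Suc a" b w'] 1 less.prems by auto
        then show ?thesis unfolding w' by (fastforce simp: chain_less_def)
      next
        case 2
        then have "Suc b \<le> m" by (cases "Suc b \<le> m") auto
        then have "sorted_wrt chain_less w'" "set w' \<subseteq> {a..k} \<times> {Suc b..m}"
          using less.hyps[of a "Suc b" w'] 2 less.prems by auto
        then show ?thesis unfolding w' by (fastforce simp: chain_less_def)
      qed
    qed
  next
    assume w: "length w = (k - a) + (m - b) + 1 \<and> set w \<subseteq> {a..k} \<times> {b..m} \<and> sorted_wrt chain_less w"
    then obtain h w' where hw: "w = h # w'" by (cases w) auto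
    have ranks: "map (\<lambda>p. fst p + snd p) w = [a + b..<Suc (k + m)]"
      using w less.prems by (intro chain_ranks) auto
    then have "fst h + snd h = a + b" using less.prems unfolding hw
      by (simp add: upt_conv_Cons[of "a + b"] del: upt_Suc)
    then have h: "h = (a, b)" using w unfolding hw by (cases h) auto
    show "w \<in> set (shuf [a..<Suc k] [b..<Suc m])"
    proof (cases w')
      case Nil
      then have "k = a" "m = b" using w less.prems unfolding hw by auto
      then show ?thesis by (simp add: hw h Nil shuf.simps(3))
    next
      case (Cons h2 w2)
      have "a + b < k + m" using w less.prems unfolding hw Cons by auto
      then have "fst h2 + snd h2 = Suc (a + b)" using ranks unfolding hw Cons
        by (simp add: upt_conv_Cons[of "a + b"] upt_conv_Cons[of "Suc (a + b)"] del: upt_Suc)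
      moreover have "a \<le> fst h2" "b \<le> snd h2" using w unfolding hw Cons by auto
      ultimately have h2: "h2 = (Suc a, b) \<or> h2 = (a, Suc b)" by (cases h2) auto
      have ge: "fst h2 \<le> fst p \<and> snd h2 \<le> snd p" if "p \<in> set w'" for p
        using w that unfolding hw Cons by (auto simp: chain_less_def)
      have inw: "set w' \<subseteq> {a..k} \<times> {b..m}" "sorted_wrt chain_less w'" "length w' = (k - a) + (m - b)"
        "h2 \<in> {a..k} \<times> {b..m}"
        using w unfolding hw Cons by auto
      from h2 have "w' \<in> set (shuf [Suc a..<Suc k] [b..<Suc m]) \<or> w' \<in> set (shuf [a..<Suc k] [Suc b..<Suc m])"
      proof
        assume h2: "h2 = (Suc a, b)"
        have "set w' \<subseteq> {Suc a..k} \<times> {b..m}" using ge inw(1) h2 by fastforce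
        then show ?thesis using less.hyps[of "Suc a" b w'] inw h2 less.prems by auto
      next
        assume h2: "h2 = (a, Suc b)"
        have "set w' \<subseteq> {a..k} \<times> {Suc b..m}" using ge inw(1) h2 by fastforce
        then show ?thesis using less.hyps[of a "Suc b" w'] inw h2 less.prems by auto
      qed
      then show ?thesis unfolding ua ub hw h by (auto simp: shuf.simps(3) simp del: upt_Suc)
    qed
  qed
qed

lemma distinct_shuf: "distinct u \<Longrightarrow> distinct (shuf u v)"
proof (induction u v rule: shuf.induct)
  case (3 x u y v)
  show ?case
  proof (cases "u = [] \<and> v = []")
    case False
    have "set (shuf u (y # v)) \<inter> set (shuf (x # u) v) = {}"
    proof (rule ccontr)
      assume "set (shuf u (y # v)) \<inter> set (shuf (x # u) v) \<noteq> {}"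
      then obtain w where w: "w \<in> set (shuf u (y # v))" "w \<in> set (shuf (x # u) v)" by blast
      then obtain x' u' y' v' where uv: "u = x' # u'" "v = y' # v'" by (cases u; cases v) auto
      obtain w1 w2 where "w = (x', y) # w1" "w = (x, y') # w2"
        using hd_shuf[OF w(1)[unfolded uv]] hd_shuf[OF w(2)[unfolded uv(2)]] by auto
      then show False using "3.prems" uv by simp
    qed
    then show ?thesis using "3.IH"[OF False] "3.prems" False
      by (auto simp: shuf.simps(3) distinct_map)
  qed (simp add: shuf.simps(3))
qed auto

lemma sum_max_chains:
  fixes H :: "_ \<Rightarrow> bit"
  shows "(\<Sum>w\<in>max_chains k m. H w) = (\<Sum>w\<leftarrow>shuf [0..<Suc k] [0..<Suc m]. H w)"
proof -
  have "max_chains k m = set (shuf [0..<Suc k] [0..<Suc m])"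
    using shuf_chain[of 0 k 0 m]
    by (auto simp: max_chains_def chain_less_def atLeast0AtMost simp del: upt_Suc)
  then show ?thesis by (simp add: sum_list_distinct_conv_sum_set distinct_shuf del: upt_Suc)
qed

lemma shuf_nth: "shuf u v = map (map (map_prod ((!) u) ((!) v))) (shuf [0..<length u] [0..<length v])"
proof -
  have "shuf u v = shuf (map ((!) u) [0..<length u]) (map ((!) v) [0..<length v])" by (simp only: map_nth)
  then show ?thesis by (simp only: shuf_map)
qed

lemma shuf_distinct_adj: "distinct_adj u \<Longrightarrow> distinct_adj v \<Longrightarrow> w \<in> set (shuf u v) \<Longrightarrow> distinct_adj w"
proof (induction u v arbitrary: w rule: shuf.induct)
  case (3 x u y v)
  show ?case
  proof (cases "u = [] \<and> v = []")
    case True then show ?thesis using "3.prems" by (simp add: shuf.simps(3))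
  next
    case False
    obtain w' where w: "w = (x, y) # w'" and
      "w' \<in> set (shuf u (y # v)) \<or> w' \<in> set (shuf (x # u) v)"
      using "3.prems"(3) False by (auto simp: shuf.simps(3))
    then show ?thesis
    proof (elim disjE)
      assume w': "w' \<in> set (shuf u (y # v))"
      then obtain x' u' where u: "u = x' # u'" by (cases u) auto
      obtain w2 where w2: "w' = (x', y) # w2" using hd_shuf[OF w'[unfolded u]] by auto
      have "distinct_adj w'" using "3.IH"(1)[OF False _ _ w'] "3.prems" u by (auto dest: distinct_adj_ConsD)
      then show ?thesis using w w2 "3.prems"(1) u by simp
    next
      assume w': "w' \<in> set (shuf (x # u) v)"
      then obtain y' v' where v: "v = y' # v'" by (cases v) auto
      obtain w2 where w2: "w' = (x, y') # w2" using hd_shuf[OF w'[unfolded v]] by auto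
      have "distinct_adj w'" using "3.IH"(2)[OF False _ _ w'] "3.prems" v by (auto dest: distinct_adj_ConsD)
      then show ?thesis using w w2 "3.prems"(2) v by simp
    qed
  qed
qed auto

lemma distinct_adj_altl: "a \<noteq> b \<Longrightarrow> distinct_adj (altl a b k)"
proof (induction k arbitrary: a b)
  case (Suc k)
  then show ?case by (cases k) auto
qed simp


section \<open>Simplices of universal bundles and classifying spaces\<close>

lemma degenerate_list:
  "map ((!) (xs @ x # zs)) ([0..<Suc (length xs)] @ [length xs..<Suc (length xs + length zs)]) = xs @ x # x # zs"
proof -
  have "map ((!) (xs @ x # zs)) [0..<Suc (length xs)] = xs @ [x]"
    by (rule nth_equalityI) (auto simp: nth_append less_Suc_eq simp del: upt_Suc)
  moreover have "map ((!) (xs @ x # zs)) [length xs..<Suc (length xs + length zs)] = x # zs"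
    by (rule nth_equalityI) (auto simp: nth_append simp del: upt_Suc)
  ultimately show ?thesis by (simp del: upt_Suc)
qed

lemma nondegenerate_EG:
  "l \<in> nondegenerate (EG G) \<longleftrightarrow> l \<noteq> [] \<and> set l \<subseteq> carrier G \<and> distinct_adj l"
proof
  assume l: "l \<in> nondegenerate (EG G)"
  then have s: "l \<noteq> []" "set l \<subseteq> carrier G" by (auto simp: nondegenerate_def EG_def)
  have "distinct_adj l"
  proof (rule ccontr)
    assume "\<not> distinct_adj l"
    then obtain xs x zs where xs: "l = xs @ x # x # zs" using not_distinct_adj_decomp by blast
    let ?v = "xs @ x # zs"
    have "l = sdegen (EG G) (length xs) ?v"
      unfolding sdegen_def EG_def using degenerate_list[of xs x zs] xs by simp
    moreover have "?v \<in> simplices (EG G)" "length xs \<le> sdim (EG G) ?v" using s xs by (auto simp: EG_def)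
    ultimately show False using l unfolding nondegenerate_def by blast
  qed
  then show "l \<noteq> [] \<and> set l \<subseteq> carrier G \<and> distinct_adj l" using s by simp
next
  assume l: "l \<noteq> [] \<and> set l \<subseteq> carrier G \<and> distinct_adj l"
  have "l \<noteq> sdegen (EG G) j v" if "j \<le> sdim (EG G) v" for j v
  proof
    assume "l = sdegen (EG G) j v"
    then have "l = map ((!) v) ([0..<Suc j] @ [j..<Suc (sdim (EG G) v)])" by (simp add: sdegen_def EG_def)
    then show False using l degeneracy_stutter[OF that] distinct_adj_mapD by metis
  qed
  then show "l \<in> nondegenerate (EG G)" using l by (auto simp: nondegenerate_def EG_def)
qed

lemma zip_map_same: "zip (map f xs) (map g xs) = map (\<lambda>i. (f i, g i)) xs"
  by (induction xs) auto

lemma nondegenerate_sprod_EG: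
  assumes "u \<noteq> []" "length u = length v" "set u \<subseteq> carrier G" "set v \<subseteq> carrier H" "distinct_adj (zip u v)"
  shows "(u, v) \<in> nondegenerate (sprod (EG G) (EG H))"
proof -
  have "(u, v) \<noteq> sdegen (sprod (EG G) (EG H)) j z" if "j \<le> sdim (sprod (EG G) (EG H)) z" for j z
  proof
    assume *: "(u, v) = sdegen (sprod (EG G) (EG H)) j z"
    let ?i = "[0..<Suc j] @ [j..<Suc (sdim (sprod (EG G) (EG H)) z)]"
    obtain z1 z2 where z: "z = (z1, z2)" by (cases z)
    have uv: "u = map ((!) z1) ?i" "v = map ((!) z2) ?i"
      using * by (simp_all add: z sdegen_def sprod_def EG_def del: upt_Suc)
    have "zip u v = map (\<lambda>i. (z1 ! i, z2 ! i)) ?i"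
      unfolding uv by (rule zip_map_same)
    then show False using assms(5) degeneracy_stutter[OF that] distinct_adj_mapD by metis
  qed
  moreover have "v \<noteq> []" using assms(1,2) by auto
  ultimately show ?thesis using assms by (auto simp: nondegenerate_def sprod_def EG_def)
qed

lemma nondegenerate_sprod3_EG:
  assumes "\<rho> \<noteq> []" "\<forall>e\<in>set \<rho>. fst e \<in> carrier G \<and> fst (snd e) \<in> carrier H \<and> snd (snd e) \<in> carrier K" "distinct_adj \<rho>"
  shows "(map fst \<rho>, map (fst \<circ> snd) \<rho>, map (snd \<circ> snd) \<rho>) \<in> nondegenerate (sprod (EG G) (sprod (EG H) (EG K)))"
proof -
  let ?X = "sprod (EG G) (sprod (EG H) (EG K))"
  let ?u = "(map fst \<rho>, map (fst \<circ> snd) \<rho>, map (snd \<circ> snd) \<rho>)"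
  have "?u \<noteq> sdegen ?X j z" if "j \<le> sdim ?X z" for j z
  proof
    assume *: "?u = sdegen ?X j z"
    let ?i = "[0..<Suc j] @ [j..<Suc (sdim ?X z)]"
    obtain z1 z2 z3 where z: "z = (z1, z2, z3)" by (cases z) auto
    have "map fst \<rho> = map ((!) z1) ?i" "map (fst \<circ> snd) \<rho> = map ((!) z2) ?i" "map (snd \<circ> snd) \<rho> = map ((!) z3) ?i"
      using * by (simp_all add: z sdegen_def sprod_def EG_def del: upt_Suc)
    then have "zip (map fst \<rho>) (zip (map (fst \<circ> snd) \<rho>) (map (snd \<circ> snd) \<rho>)) =
        map (\<lambda>i. (z1 ! i, z2 ! i, z3 ! i)) ?i"
      by (simp only: zip_map_same)
    then have \<rho>: "\<rho> = map (\<lambda>i. (z1 ! i, z2 ! i, z3 ! i)) ?i"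
      by (simp only: zip_map_same o_def prod.collapse map_idI)
    have "distinct_adj ?i" by (rule distinct_adj_mapD[OF assms(3)[unfolded \<rho>]])
    then show False using degeneracy_stutter[OF that] by simp
  qed
  then show ?thesis using assms(1,2) by (fastforce simp: nondegenerate_def sprod_def EG_def)
qed

lemma tuple_orbit_length: "m \<in> tuple_orbit G l \<Longrightarrow> length m = length l"
  by (auto simp: tuple_orbit_def)

lemma (in monoid) tuple_orbit_refl: "set l \<subseteq> carrier G \<Longrightarrow> l \<in> tuple_orbit G l"
proof -
  assume "set l \<subseteq> carrier G"
  then have "map (\<lambda>h. \<one> \<otimes> h) l = l" by (intro map_idI) auto
  then show ?thesis unfolding tuple_orbit_def by (metis image_eqI one_closed)
qed

lemma sdim_BG:
  assumes "Q = tuple_orbit G l" "m \<in> Q"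
  shows "sdim (BG G) Q = length m - 1"
proof -
  have "(SOME l. l \<in> Q) \<in> Q" using assms(2) by (rule someI)
  then have "length (SOME l. l \<in> Q) = length m" using assms tuple_orbit_length by metis
  then show ?thesis by (simp add: BG_def EG_def)
qed

lemma (in monoid) degenerate_BG:
  assumes "tuple_orbit G l = spull (BG G) Q \<theta>" "set l \<subseteq> carrier G"
  obtains m where "m \<in> Q" "l = map ((!) m) \<theta>"
  using tuple_orbit_refl[OF assms(2)] assms(1) that by (auto simp: BG_def EG_def)

lemma (in monoid) nondegenerate_BG:
  assumes "l \<in> nondegenerate (EG G)"
  shows "tuple_orbit G l \<in> nondegenerate (BG G)"
proof -
  have l: "l \<noteq> []" "set l \<subseteq> carrier G" "distinct_adj l" using assms by (auto simp: nondegenerate_EG)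
  have "tuple_orbit G l \<noteq> sdegen (BG G) j Q" if "j \<le> sdim (BG G) Q" for j Q
  proof
    assume "tuple_orbit G l = sdegen (BG G) j Q"
    then obtain m where "l = map ((!) m) ([0..<Suc j] @ [j..<Suc (sdim (BG G) Q)])"
      unfolding sdegen_def using l(2) by (rule degenerate_BG)
    then show False using l(3) degeneracy_stutter[OF that] distinct_adj_mapD by metis
  qed
  then show ?thesis using l by (auto simp: nondegenerate_def BG_def EG_def)
qed

lemma (in monoid) nondegenerate_sprod_BG:
  assumes "monoid H" "u \<noteq> []" "length u = length v" "set u \<subseteq> carrier G" "set v \<subseteq> carrier H" "distinct_adj (zip u v)"
  shows "(tuple_orbit G u, tuple_orbit H v) \<in> nondegenerate (sprod (BG G) (BG H))"
proof -
  interpret H: monoid H by (rule assms(1))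
  let ?X = "sprod (BG G) (BG H)"
  have "(tuple_orbit G u, tuple_orbit H v) \<noteq> sdegen ?X j z" if "j \<le> sdim ?X z" for j z
  proof
    assume *: "(tuple_orbit G u, tuple_orbit H v) = sdegen ?X j z"
    let ?i = "[0..<Suc j] @ [j..<Suc (sdim ?X z)]"
    obtain P Q where z: "z = (P, Q)" by (cases z)
    have PQ: "tuple_orbit G u = spull (BG G) P ?i" "tuple_orbit H v = spull (BG H) Q ?i"
      using * by (simp_all add: z sdegen_def sprod_def)
    obtain m where m: "u = map ((!) m) ?i" using degenerate_BG[OF PQ(1) assms(4)] by blast
    obtain m' where m': "v = map ((!) m') ?i" using H.degenerate_BG[OF PQ(2) assms(5)] by blast
    have "zip u v = map (\<lambda>i. (m ! i, m' ! i)) ?i"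
      unfolding m m' by (rule zip_map_same)
    then show False using assms(6) degeneracy_stutter[OF that] distinct_adj_mapD by metis
  qed
  moreover have "v \<noteq> []" using assms(2,3) by auto
  moreover have "sdim (BG G) (tuple_orbit G u) = sdim (BG H) (tuple_orbit H v)"
    using sdim_BG[OF refl tuple_orbit_refl[OF assms(4)]] sdim_BG[OF refl H.tuple_orbit_refl[OF assms(5)]] assms(3)
    by simp
  ultimately show ?thesis using assms by (auto simp: nondegenerate_def sprod_def BG_def EG_def)
qed

text \<open>An invariant function on tuples factors through the classifying space, so its value on a lift
  depends only on the chain that is lifted.\<close>

lemma (in group) pairing_BG_proj:
  assumes "Poly_Mapping.keys c \<subseteq> nondegenerate (EG G)"
    and inv: "\<And>g l. g \<in> carrier G \<Longrightarrow> set l \<subseteq> carrier G \<Longrightarrow> F (map (\<lambda>h. g \<otimes> h) l) = (F l :: bit)"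
  shows "pairing F c = pairing (\<lambda>Q. F (SOME l. l \<in> Q)) (BG_proj G c)"
  unfolding BG_proj_def pairing_push
proof (rule pairing_cong)
  fix l assume "l \<in> Poly_Mapping.keys c"
  then have l: "l \<in> nondegenerate (EG G)" using assms(1) by blast
  then have s: "set l \<subseteq> carrier G" by (simp add: nondegenerate_EG)
  have "(SOME m. m \<in> tuple_orbit G l) \<in> tuple_orbit G l"
    by (rule someI[of "\<lambda>m. m \<in> tuple_orbit G l", OF tuple_orbit_refl[OF s]])
  then obtain g where "g \<in> carrier G" "(SOME m. m \<in> tuple_orbit G l) = map (\<lambda>h. g \<otimes> h) l"
    by (auto simp: tuple_orbit_def)
  then show "F l = (if tuple_orbit G l \<in> nondegenerate (BG G) then F (SOME m. m \<in> tuple_orbit G l) else 0)"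
    using nondegenerate_BG[OF l] inv[OF _ s] by simp
qed

lemma lift_chain:
  assumes "c \<in> chains (EG G) k"
  shows "lift_chain G k (BG_proj G c) \<in> chains (EG G) k" "BG_proj G (lift_chain G k (BG_proj G c)) = BG_proj G c"
  using someI[of "\<lambda>e. e \<in> chains (EG G) k \<and> BG_proj G e = BG_proj G c" c] assms
  unfolding lift_chain_def by auto

lemma (in group) pairing_lift_chain:
  assumes "c \<in> chains (EG G) k"
    and inv: "\<And>g l. g \<in> carrier G \<Longrightarrow> set l \<subseteq> carrier G \<Longrightarrow> F (map (\<lambda>h. g \<otimes> h) l) = (F l :: bit)"
  shows "pairing F (lift_chain G k (BG_proj G c)) = pairing F c"
proof -
  have k: "Poly_Mapping.keys e \<subseteq> nondegenerate (EG G)" if "e \<in> chains (EG G) k" for e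
    using that by (auto simp: chains_def)
  show ?thesis
    using pairing_BG_proj[OF k[OF lift_chain(1)[OF assms(1)]] inv] pairing_BG_proj[OF k[OF assms(1)] inv]
    unfolding lift_chain(2)[OF assms(1)] by simp
qed

lemma (in group) tuple_orbit_Union:
  assumes "subgroup H G" "set l \<subseteq> carrier G"
  shows "(\<Union>m\<in>tuple_orbit (G\<lparr>carrier := H\<rparr>) l. tuple_orbit G m) = tuple_orbit G l"
proof (rule Set.set_eqI, rule iffI)
  fix m assume "m \<in> (\<Union>m\<in>tuple_orbit (G\<lparr>carrier := H\<rparr>) l. tuple_orbit G m)"
  then obtain g h where gh: "g \<in> carrier G" "h \<in> H" "m = map (\<lambda>x. g \<otimes> x) (map (\<lambda>x. h \<otimes> x) l)"
    by (auto simp: tuple_orbit_def)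
  have h: "h \<in> carrier G" using gh(2) assms(1) subgroup.mem_carrier by metis
  have "m = map (\<lambda>x. (g \<otimes> h) \<otimes> x) l"
    unfolding gh(3) map_map using gh(1) h assms(2)
    by (intro map_cong[OF refl]) (simp add: m_assoc subset_iff)
  then show "m \<in> tuple_orbit G l" using gh(1) h unfolding tuple_orbit_def by blast
next
  fix m assume m: "m \<in> tuple_orbit G l"
  have "map (\<lambda>x. \<one> \<otimes> x) l = l" using assms(2) by (intro map_idI) auto
  moreover have "\<one> \<in> H" using assms(1) by (rule subgroup.one_closed)
  ultimately have "l \<in> tuple_orbit (G\<lparr>carrier := H\<rparr>) l"
    unfolding tuple_orbit_def by (auto intro!: image_eqI[where x = "\<one>"])
  then show "m \<in> (\<Union>m\<in>tuple_orbit (G\<lparr>carrier := H\<rparr>) l. tuple_orbit G m)" using m by blast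
qed

lemma (in group) BG_incl_proj:
  assumes "subgroup H G" "Poly_Mapping.keys c \<subseteq> nondegenerate (EG (G\<lparr>carrier := H\<rparr>))"
  shows "BG_incl G (BG_proj (G\<lparr>carrier := H\<rparr>) c) = BG_proj G c"
proof (rule chain_eqI)
  fix \<beta> :: "'a list set \<Rightarrow> bit"
  interpret H: group "G\<lparr>carrier := H\<rparr>" by (rule subgroup_imp_group[OF assms(1)])
  show "pairing \<beta> (BG_incl G (BG_proj (G\<lparr>carrier := H\<rparr>) c)) = pairing \<beta> (BG_proj G c)"
    unfolding BG_incl_def BG_proj_def pairing_push
  proof (rule pairing_cong)
    fix l assume "l \<in> Poly_Mapping.keys c"
    then have l: "l \<in> nondegenerate (EG (G\<lparr>carrier := H\<rparr>))" using assms(2) by blast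
    have "set l \<subseteq> carrier G" using l subgroup.subset[OF assms(1)] by (auto simp: nondegenerate_EG)
    then show "(if tuple_orbit (G\<lparr>carrier := H\<rparr>) l \<in> nondegenerate (BG (G\<lparr>carrier := H\<rparr>))
        then if (\<Union>l\<in>tuple_orbit (G\<lparr>carrier := H\<rparr>) l. tuple_orbit G l) \<in> nondegenerate (BG G)
             then \<beta> (\<Union>l\<in>tuple_orbit (G\<lparr>carrier := H\<rparr>) l. tuple_orbit G l) else 0 else 0) =
      (if tuple_orbit G l \<in> nondegenerate (BG G) then \<beta> (tuple_orbit G l) else 0)"
      using H.nondegenerate_BG[OF l] tuple_orbit_Union[OF assms(1)] by simp
  qed
qed

section \<open>Chain maps between universal bundles\<close>

definition restr :: "'a sset \<Rightarrow> ('a \<Rightarrow> bit) \<Rightarrow> 'a \<Rightarrow> bit" where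
  "restr X F u = (if u \<in> nondegenerate X then F u else 0)"

definition restr2 :: "'a sset \<Rightarrow> 'b sset \<Rightarrow> ('a \<times> 'b \<Rightarrow> bit) \<Rightarrow> 'a \<Rightarrow> 'b \<Rightarrow> bit" where
  "restr2 X Y F u v = (if u \<in> nondegenerate X \<and> v \<in> nondegenerate Y then F (u, v) else 0)"

lemma pairing_cls_restr: "pairing F (cls X u) = restr X F u"
  by (simp add: pairing_cls restr_def)

lemma pairing_tensor_cls: "pairing F (tensor (cls X u) (cls Y v)) = restr2 X Y F u v"
  by (simp add: pairing_tensor pairing_cls restr2_def)

lemma pairing_lin_basis: "pairing F (lin h c) = pairing (\<lambda>u. pairing F (lin h (basis u))) c"
  by (simp add: pairing_lin)

lemma map_nth_take_drop:
  assumes "i < length u"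
  shows "map ((!) u) (sorted_list_of_set {0..i}) = take (Suc i) u"
    and "map ((!) u) (sorted_list_of_set {i..length u - 1}) = drop i u"
proof -
  have "sorted_list_of_set {0..i} = [0..<Suc i]" "sorted_list_of_set {i..length u - 1} = [i..<length u]"
    using assms by (cases u; auto simp: atLeastLessThanSuc_atLeastAtMost[symmetric] simp del: upt_Suc)+
  then show "map ((!) u) (sorted_list_of_set {0..i}) = take (Suc i) u"
    "map ((!) u) (sorted_list_of_set {i..length u - 1}) = drop i u"
    using assms by (auto intro!: nth_equalityI simp del: upt_Suc)
qed

lemma aws_eq: "aws l K = (\<Sum>i<length l. K (map fst (take (Suc i) l)) (map snd (drop i l)))"
  by (induction l arbitrary: K) (simp_all add: sum.lessThan_Suc_shift del: sum.lessThan_Suc)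

lemma pairing_AW_EG:
  assumes "l \<noteq> []"
  shows "pairing F (AW (EG G) (EG H) (basis (map fst l, map snd l))) = aws l (restr2 (EG G) (EG H) F)"
proof -
  have "{..length l - 1} = {..<length l}" using assms by (cases l) auto
  moreover have "pairing F (tensor (cls (EG G) (map ((!) (map fst l)) (sorted_list_of_set {0..i})))
      (cls (EG H) (map ((!) (map snd l)) (sorted_list_of_set {i..length l - 1})))) =
      restr2 (EG G) (EG H) F (map fst (take (Suc i) l)) (map snd (drop i l))" if "i < length l" for i
    using map_nth_take_drop(1)[of i "map fst l"] map_nth_take_drop(2)[of i "map snd l"] that
    by (simp add: pairing_tensor_cls take_map drop_map)
  ultimately show ?thesis
    unfolding aws_eq by (simp add: AW_def pairing_sum EG_def sface_def)
qed

lemma AW_diag_basis: "AW_diag Y (basis u) = AW Y Y (basis (u, u))"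
  by (simp add: AW_diag_def AW_def)

lemma sum_max_chains_nth:
  fixes H :: "_ \<Rightarrow> bit"
  assumes "u \<noteq> []" "v \<noteq> []"
  shows "(\<Sum>w\<in>max_chains (length u - 1) (length v - 1). H (map (map_prod ((!) u) ((!) v)) w)) = (\<Sum>w\<leftarrow>shuf u v. H w)"
proof -
  have "Suc (length u - 1) = length u" "Suc (length v - 1) = length v" using assms by auto
  then show ?thesis by (subst shuf_nth) (simp add: sum_max_chains o_def del: upt_Suc)
qed

lemma pairing_EZ_EG:
  assumes "u \<in> nondegenerate (EG G)" "v \<in> nondegenerate (EG H)"
  shows "pairing F (EZ (EG G) (EG H) (basis (u, v))) = (\<Sum>w\<leftarrow>shuf u v. F (map fst w, map snd w))"
proof -
  have u: "u \<noteq> []" "set u \<subseteq> carrier G" "distinct_adj u" and v: "v \<noteq> []" "set v \<subseteq> carrier H" "distinct_adj v"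
    using assms by (auto simp: nondegenerate_EG)
  let ?F = "restr (sprod (EG G) (EG H)) F"
  have "pairing F (EZ (EG G) (EG H) (basis (u, v))) =
      (\<Sum>w\<in>max_chains (length u - 1) (length v - 1). ?F (map fst (map (map_prod ((!) u) ((!) v)) w),
        map snd (map (map_prod ((!) u) ((!) v)) w)))"
    by (simp add: EZ_def pairing_sum pairing_cls_restr EG_def o_def)
  also have "\<dots> = (\<Sum>w\<leftarrow>shuf u v. ?F (map fst w, map snd w))"
    using sum_max_chains_nth[OF u(1) v(1), of "\<lambda>w. ?F (map fst w, map snd w)"] by simp
  also have "\<dots> = (\<Sum>w\<leftarrow>shuf u v. F (map fst w, map snd w))"
  proof (rule sum_list_cong)
    fix w assume w: "w \<in> set (shuf u v)"
    have "(map fst w, map snd w) \<in> nondegenerate (sprod (EG G) (EG H))"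
      by (rule nondegenerate_sprod_EG)
        (use set_shuf[OF w] shuf_neq_Nil[OF w] shuf_distinct_adj[OF u(3) v(3) w] u v in
          \<open>auto simp: zip_map_fst_snd\<close>)
    then show "?F (map fst w, map snd w) = F (map fst w, map snd w)" by (simp add: restr_def)
  qed
  finally show ?thesis .
qed

lemma pairing_EZ3_EG:
  assumes "u \<in> nondegenerate (EG G)" "v \<in> nondegenerate (EG H)" "t \<in> nondegenerate (EG K)"
  shows "pairing F (EZ3 (EG G) (EG H) (EG K) (basis (u, v, t))) =
    (\<Sum>w\<leftarrow>shuf3 u v t. F (map fst w, map (fst \<circ> snd) w, map (snd \<circ> snd) w))"
proof -
  let ?X = "sprod (EG G) (sprod (EG H) (EG K))"
  have u: "u \<noteq> []" "set u \<subseteq> carrier G" "distinct_adj u"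
    and v: "v \<noteq> []" "set v \<subseteq> carrier H" "distinct_adj v"
    and t: "t \<noteq> []" "set t \<subseteq> carrier K" "distinct_adj t"
    using assms by (auto simp: nondegenerate_EG)
  have inner: "pairing F (EZ (EG G) (sprod (EG H) (EG K)) (basis (u, map fst a, map snd a))) =
      (\<Sum>w\<leftarrow>shuf u a. F (map fst w, map (fst \<circ> snd) w, map (snd \<circ> snd) w))" if a: "a \<in> set (shuf v t)" for a
  proof -
    have a0: "a \<noteq> []" by (rule shuf_neq_Nil[OF a])
    have "pairing F (EZ (EG G) (sprod (EG H) (EG K)) (basis (u, map fst a, map snd a))) =
        (\<Sum>w\<in>max_chains (length u - 1) (length a - 1).
          restr ?X F (map ((!) u) (map fst w), map ((!) (map fst a)) (map snd w), map ((!) (map snd a)) (map snd w)))"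
      by (simp add: EZ_def pairing_sum pairing_cls_restr sprod_def EG_def)
    also have "\<dots> = (\<Sum>w\<in>max_chains (length u - 1) (length a - 1).
          (\<lambda>w. restr ?X F (map fst w, map (fst \<circ> snd) w, map (snd \<circ> snd) w)) (map (map_prod ((!) u) ((!) a)) w))"
    proof (rule sum.cong[OF refl])
      fix w assume "w \<in> max_chains (length u - 1) (length a - 1)"
      then have "\<forall>e\<in>set w. snd e < length a" using a0 by (force simp: max_chains_def less_Suc_eq_le[symmetric])
      then show "restr ?X F (map ((!) u) (map fst w), map ((!) (map fst a)) (map snd w), map ((!) (map snd a)) (map snd w)) =
        (\<lambda>w. restr ?X F (map fst w, map (fst \<circ> snd) w, map (snd \<circ> snd) w)) (map (map_prod ((!) u) ((!) a)) w)"
        by (simp add: o_def cong: map_cong)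
    qed
    also have "\<dots> = (\<Sum>w\<leftarrow>shuf u a. restr ?X F (map fst w, map (fst \<circ> snd) w, map (snd \<circ> snd) w))"
      by (rule sum_max_chains_nth[OF u(1) a0])
    also have "\<dots> = (\<Sum>w\<leftarrow>shuf u a. F (map fst w, map (fst \<circ> snd) w, map (snd \<circ> snd) w))"
    proof (rule sum_list_cong)
      fix w assume w: "w \<in> set (shuf u a)"
      have "(map fst w, map (fst \<circ> snd) w, map (snd \<circ> snd) w) \<in> nondegenerate ?X"
      proof (rule nondegenerate_sprod3_EG[OF shuf_neq_Nil[OF w]])
        show "distinct_adj w" by (rule shuf_distinct_adj[OF u(3) shuf_distinct_adj[OF v(3) t(3) a] w])
        show "\<forall>e\<in>set w. fst e \<in> carrier G \<and> fst (snd e) \<in> carrier H \<and> snd (snd e) \<in> carrier K"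
          using set_shuf[OF w] set_shuf[OF a] u(2) v(2) t(2) by fastforce
      qed
      then show "restr ?X F (map fst w, map (fst \<circ> snd) w, map (snd \<circ> snd) w) =
          F (map fst w, map (fst \<circ> snd) w, map (snd \<circ> snd) w)" by (simp add: restr_def)
    qed
    finally show ?thesis .
  qed
  let ?Z = "EZ (EG G) (sprod (EG H) (EG K))"
  have "pairing F (EZ3 (EG G) (EG H) (EG K) (basis (u, v, t))) =
      pairing (\<lambda>z. pairing F (?Z (basis z))) (tensor (basis u) (EZ (EG H) (EG K) (basis (v, t))))"
    unfolding EZ3_def lin_basis prod.case by (subst EZ_def, subst pairing_lin_basis) (simp only: EZ_def)
  also have "\<dots> = pairing (\<lambda>z. pairing F (?Z (basis (u, z)))) (EZ (EG H) (EG K) (basis (v, t)))"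
    by (simp add: pairing_tensor)
  also have "\<dots> = (\<Sum>a\<leftarrow>shuf v t. pairing F (?Z (basis (u, map fst a, map snd a))))"
    by (rule pairing_EZ_EG[OF assms(2,3)])
  also have "\<dots> = (\<Sum>w\<leftarrow>shuf3 u v t. F (map fst w, map (fst \<circ> snd) w, map (snd \<circ> snd) w))"
    unfolding sum_shuf3 by (rule sum_list_cong) (rule inner)
  finally show ?thesis .
qed

lemma pairing_steenrod_diag_EG:
  assumes "u \<noteq> []"
  shows "pairing F (steenrod_diag (EG G) m u) =
    (\<Sum>\<omega>\<leftarrow>shuf (altl False True (Suc m)) u. restr2 (EG G) (EG G) F (proj False \<omega>) (proj True \<omega>))"
proof -
  let ?A = "altl 1 2 (Suc m) :: nat list" and ?N = "length u - 1"
  let ?R = "restr2 (EG G) (EG G) F"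
  let ?K = "{k. length k = m + 1 \<and> sorted_wrt (<) k \<and> set k \<subseteq> {..?N}}"
  let ?G = "\<lambda>g. ?R (map ((!) u) (g (1::nat))) (map ((!) u) (g 2))"
  have N: "Suc ?N = length u" using assms by (cases u) auto
  have len: "length ?A = m + 2" by simp
  have odd: "{s \<in> {1..m + 2}. odd s} = {j \<in> {1..length ?A}. ?A ! (j - 1) = 1}"
    and even: "{s \<in> {1..m + 2}. even s} = {j \<in> {1..length ?A}. ?A ! (j - 1) = 2}"
    unfolding len by (auto simp: nth_altl simp del: altl.simps split: if_splits)
  have inj: "inj_on (\<lambda>k. 0 # k @ [?N]) ?K" by (auto simp: inj_on_def)
  have "pairing F (steenrod_diag (EG G) m u) =
    (\<Sum>k\<in>?K. ?G (\<lambda>l. sorted_list_of_set (\<Union>j\<in>{j \<in> {1..length ?A}. ?A ! (j - 1) = l}. interval (0 # k @ [?N]) j)))"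
    unfolding odd[symmetric] even[symmetric]
    by (simp add: steenrod_diag_def pairing_sum Let_def EG_def sface_def pairing_tensor_cls)
  also have "\<dots> = (\<Sum>t\<in>divisions ?A ?N.
      ?G (\<lambda>l. sorted_list_of_set (\<Union>j\<in>{j \<in> {1..length ?A}. ?A ! (j - 1) = l}. interval t j)))"
    by (subst divisions_altl, simp, subst sum.reindex[OF inj]) (simp only: o_def)
  also have "\<dots> = (\<Sum>\<omega>\<leftarrow>shuf ?A [0..<Suc ?N]. ?G (\<lambda>l. proj l \<omega>))"
  proof (rule sum_divisions)
    fix g :: "nat \<Rightarrow> nat list" and l
    assume g: "l \<in> set ?A" "\<forall>l. sorted (g l)" "\<not> distinct (g l)"
    have "\<not> distinct_adj (g l)" using g sorted_distinct_adj by blast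
    then have "\<not> distinct_adj (map ((!) u) (g l))" using distinct_adj_mapD by blast
    moreover have "l = 1 \<or> l = 2" using g(1) by (simp add: set_altl del: altl.simps)
    ultimately show "?G g = 0" by (auto simp: restr2_def nondegenerate_EG)
  qed simp
  also have "\<dots> = (\<Sum>\<omega>\<leftarrow>shuf ?A [0..<length u]. ?R (map ((!) u) (proj 1 \<omega>)) (map ((!) u) (proj 2 \<omega>)))"
    unfolding N ..
  also have "\<dots> = (\<Sum>\<omega>\<leftarrow>shuf ?A u. ?R (proj 1 \<omega>) (proj 2 \<omega>))"
  proof -
    have "shuf ?A u = shuf (map id ?A) (map ((!) u) [0..<length u])" by (simp only: map_nth list.map_id)
    also have "\<dots> = map (map (map_prod id ((!) u))) (shuf ?A [0..<length u])" by (rule shuf_map)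
    finally show ?thesis by (simp add: o_def map_snd_proj del: altl.simps One_nat_def)
  qed
  also have "\<dots> = (\<Sum>\<omega>\<leftarrow>shuf (altl False True (Suc m)) u. ?R (proj False \<omega>) (proj True \<omega>))"
    by (rule sum_shuf_altl_rename) simp
  finally show ?thesis .
qed

section \<open>The groups of the theorem in coordinates\<close>

text \<open>Elements of the groups are encoded by their exponents: \<open>tau s\<close> is \<open>T\<^sup>s\<close>, \<open>d8perm s t\<close> is
  the element \<open>(s, t)\<close> of \<open>V\<^sub>4\<close>, and \<open>dperm (x, y, z)\<close> is \<open>c\<^sup>z b\<^sup>y a\<^sup>x\<close>.\<close>

definition tau :: "bool \<Rightarrow> perm" where
  "tau b = (if b then swap12 else id)"

lemma swap12_neq_id [simp]: "swap12 \<noteq> id" "id \<noteq> swap12"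
proof -
  have "swap12 1 \<noteq> id 1" by (simp add: swap12_def)
  then show "swap12 \<noteq> id" "id \<noteq> swap12" by metis+
qed

lemma tau_eq_iff [simp]: "tau a = tau b \<longleftrightarrow> a = b"
  by (auto simp: tau_def)

lemma tau_comp: "tau a \<circ> tau b = tau (b \<noteq> a)"
  by (auto simp: tau_def swap12_def)

lemma Sigma2_simps: "carrier Sigma2 = range tau" "f \<otimes>\<^bsub>Sigma2\<^esub> g = f \<circ> g" "\<one>\<^bsub>Sigma2\<^esub> = id"
proof -
  have "{1..2} = {1, 2 :: nat}" by auto
  then have "carrier Sigma2 = {id, swap12}"
    by (auto simp: Sigma2_def sym_group_def permutes_doubleton_iff swap12_def)
  then show "carrier Sigma2 = range tau" by (auto simp: tau_def UNIV_bool)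
qed (simp_all add: Sigma2_def sym_group_def)

lemma monoid_Sigma2: "monoid Sigma2"
  using sym_group_is_group[of 2] by (simp add: Sigma2_def group.is_monoid)

lemma tau_carrier [simp]: "tau b \<in> carrier Sigma2"
  by (simp add: Sigma2_simps)

lemma distinct_adj_map_tau [simp]: "distinct_adj (map tau l) \<longleftrightarrow> distinct_adj l"
  by (rule distinct_adj_map_iff) (simp add: inj_on_def)

lemma nondegenerate_map_tau: "map tau l \<in> nondegenerate (EG Sigma2) \<longleftrightarrow> l \<noteq> [] \<and> distinct_adj l"
  by (auto simp: nondegenerate_EG)

lemma xt_eq: "xt k = map tau (alt False k)"
proof -
  have "swap12 ^^ i = tau (odd i)" for i
    by (induction i) (auto simp: tau_def swap12_def)
  then show ?thesis
    unfolding xt_def by (intro nth_equalityI) (auto simp: nth_altl simp del: upt_Suc)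
qed

lemma pairing_steenrod_AW_Sigma2:
  assumes "distinct_adj e" "e \<noteq> []" "g \<noteq> []"
  shows "pairing F (steenrod_AW (EG Sigma2) (basis (map tau e, map tau g))) =
    stn (\<lambda>L1 L2. restr2 (EG Sigma2) (EG Sigma2) F (map tau L1) (map tau L2)) e g"
proof -
  let ?E = "EG Sigma2"
  define b m where "b = hd e" and "m = length e - 1"
  have e: "e = alt b m" unfolding b_def m_def by (rule distinct_adj_alt[OF assms(1,2)])
  have shuf_tau: "shuf A (map tau g) = map (map (map_prod id tau)) (shuf A g)" for A :: "bool list"
    using shuf_map[of id A tau g] by simp
  have diag: "pairing F (steenrod_diag ?E m (map tau g)) =
      (\<Sum>\<omega>\<leftarrow>shuf (altl False True (Suc m)) g. restr2 ?E ?E F (map tau (proj False \<omega>)) (map tau (proj True \<omega>)))" for F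
    using assms(3) by (simp add: pairing_steenrod_diag_EG shuf_tau o_def map_snd_proj del: altl.simps)
  have m: "length (map tau e) - 1 = m" by (simp add: m_def)
  show ?thesis
  proof (cases b)
    case False
    then have "map tau e = xt m" unfolding e xt_eq by simp
    then have "steenrod_AW ?E (basis (map tau e, map tau g)) = steenrod_diag ?E m (map tau g)"
      unfolding steenrod_AW_def lin_basis prod.case m Let_def by (rule if_P)
    then show ?thesis unfolding e stn_def altword_alt using False by (simp add: diag del: altl.simps)
  next
    case True
    have "map tau e \<noteq> xt m" unfolding e xt_eq using True by (cases m) auto
    then have "steenrod_AW ?E (basis (map tau e, map tau g)) = tensor_swap (steenrod_diag ?E m (map tau g))"
      unfolding steenrod_AW_def lin_basis prod.case m Let_def by (rule if_not_P)
    then have "pairing F (steenrod_AW ?E (basis (map tau e, map tau g))) =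
        pairing (\<lambda>(u, v). F (v, u)) (steenrod_diag ?E m (map tau g))"
      by (simp add: tensor_swap_def pairing_lin case_prod_unfold)
    also have "\<dots> = (\<Sum>\<omega>\<leftarrow>shuf (altl False True (Suc m)) g.
        restr2 ?E ?E F (map tau (proj True \<omega>)) (map tau (proj False \<omega>)))"
      unfolding diag by (rule sum_list_cong) (simp add: restr2_def conj_commute)
    also have "\<dots> = (\<Sum>\<omega>\<leftarrow>shuf (altl True False (Suc m)) g.
        restr2 ?E ?E F (map tau (proj False \<omega>)) (map tau (proj True \<omega>)))"
      by (rule sum_shuf_altl_rename[symmetric, where
        H = "\<lambda>x y. restr2 ?E ?E F (map tau y) (map tau x)"]) simp
    finally show ?thesis unfolding e stn_def altword_alt using True by simp
  qed
qed

lemma permutes_4_eqI: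
  assumes "\<sigma> permutes {1..4}" "\<pi> permutes {1..4 :: nat}"
    and "\<sigma> 1 = \<pi> 1" "\<sigma> 2 = \<pi> 2" "\<sigma> 3 = \<pi> 3" "\<sigma> 4 = \<pi> 4"
  shows "\<sigma> = \<pi>"
proof
  fix x :: nat
  have "x \<in> {1..4} \<Longrightarrow> x = 1 \<or> x = 2 \<or> x = 3 \<or> x = 4" by auto
  then show "\<sigma> x = \<pi> x"
    using assms(3-6) permutes_not_in[OF assms(1)] permutes_not_in[OF assms(2)] by metis
qed

lemma d8perm_eval:
  "d8perm a b 1 = (if a then if b then 4 else 3 else if b then 2 else 1)"
  "d8perm a b 2 = (if a then if b then 3 else 4 else if b then 1 else 2)"
  "d8perm a b 3 = (if a then if b then 2 else 1 else if b then 4 else 3)"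
  "d8perm a b 4 = (if a then if b then 1 else 2 else if b then 3 else 4)"
  by (simp_all add: d8perm_def del: One_nat_def)

lemma d8perm_comp: "d8perm a b \<circ> d8perm s t = d8perm (s \<noteq> a) (t \<noteq> b)"
  by (rule permutes_4_eqI[OF permutes_compose[OF d8perm_permutes d8perm_permutes] d8perm_permutes])
    (simp_all add: d8perm_eval del: One_nat_def)

lemma d8perm_eq_iff [simp]: "d8perm a b = d8perm s t \<longleftrightarrow> a = s \<and> b = t"
  using d8perm_eval(1)[of a b] d8perm_eval(1)[of s t] by (cases a; cases b; cases s; cases t; auto)

definition v4 :: "bool \<times> bool \<Rightarrow> perm" where
  "v4 = (\<lambda>(s, t). d8perm s t)"

definition dperm :: "bool \<times> bool \<times> bool \<Rightarrow> perm" where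
  "dperm = (\<lambda>(x, y, z). D8_bij (tau x, tau y, tau z))"

lemma inj_v4: "inj v4"
  by (auto simp: inj_def v4_def)

lemma pow_by_tau: "pow_by g (tau s) = (if s then g else id)"
  by (simp add: pow_by_def tau_def)

lemma V4_iso_tau: "V4_iso (tau s, tau t) = v4 (s, t)"
  by (simp add: V4_iso_def pow_by_tau v4_def d8perm_def)

lemma dperm_eq: "dperm (x, y, z) = (if z then perm_c else id) \<circ> (if y then perm_b else id) \<circ> (if x then perm_a else id)"
  by (simp add: dperm_def D8_bij_def pow_by_tau)

lemma dperm_permutes: "dperm e permutes {1..4}"
  by (cases e) (auto simp: dperm_eq simp del: One_nat_def intro!: permutes_compose perm_abc_permutes permutes_id)

lemma rowp_eq: "rowp \<sigma> = [\<sigma> 1, \<sigma> 2, \<sigma> 3, \<sigma> 4]"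
proof -
  have "[1..<Suc 4] = [1, 2, 3, 4]" by (simp add: upt_rec)
  then show ?thesis by (simp add: rowp_def)
qed

lemma rowp_dperm: "rowp (dperm e) = rowl e"
  by (cases e) (auto simp: rowp_eq dperm_eq rowl_def blk_def simp del: One_nat_def)

lemma dperm_iota: "dperm (iota e) = v4 e"
proof -
  obtain s t where e: "e = (s, t)" by (cases e)
  show ?thesis
    unfolding e v4_def prod.case
    by (rule permutes_4_eqI[OF dperm_permutes d8perm_permutes])
      (simp_all add: d8perm_eval dperm_eq iota_def del: One_nat_def)
qed

lemma Sigma4_simps: "carrier Sigma4 = {\<sigma>. \<sigma> permutes {1..4}}" "f \<otimes>\<^bsub>Sigma4\<^esub> g = f \<circ> g" "\<one>\<^bsub>Sigma4\<^esub> = id"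
  by (simp_all add: Sigma4_def sym_group_def)

lemma group_Sigma4: "group Sigma4"
  by (simp add: Sigma4_def sym_group_is_group)

lemma subgroup_V4: "subgroup (carrier V4) Sigma4" and subgroup_D8: "subgroup (carrier D8) Sigma4"
  using perm_abc_permutes permutes_compose[OF perm_abc_permutes(3,2)]
  by (auto simp: V4_def D8_def Sigma4_simps intro!: group.generate_is_subgroup group_Sigma4)

lemma V4_update: "Sigma4\<lparr>carrier := carrier V4\<rparr> = V4" and D8_update: "Sigma4\<lparr>carrier := carrier D8\<rparr> = D8"
  by (simp_all add: V4_def D8_def)

lemma group_V4: "group V4" and group_D8: "group D8"
  using group.subgroup_imp_group[OF group_Sigma4 subgroup_V4] group.subgroup_imp_group[OF group_Sigma4 subgroup_D8]
  by (simp_all add: V4_update D8_update)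

lemma mult_V4: "f \<otimes>\<^bsub>V4\<^esub> g = f \<circ> g"
  by (simp add: V4_def Sigma4_simps)

lemma carrier_V4: "carrier V4 = range v4"
proof
  have inverse: "inv\<^bsub>Sigma4\<^esub> (d8perm s t) = d8perm s t" for s t
    by (rule group.inv_equality[OF group_Sigma4])
      (simp_all add: Sigma4_simps d8perm_comp d8perm_permutes del: One_nat_def, simp add: d8perm_def)
  have gens: "perm_a = d8perm True False" "perm_b \<circ> perm_c = d8perm False True" "id = d8perm False False"
    by (simp_all add: d8perm_def)
  show "carrier V4 \<subseteq> range v4"
  proof
    fix g assume "g \<in> carrier V4"
    then have "g \<in> generate Sigma4 {perm_a, perm_b \<circ> perm_c}" by (simp add: V4_def)
    then have "\<exists>s t. g = d8perm s t"
    proof (induction rule: generate.induct)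
      case one then show ?case unfolding Sigma4_simps gens(3) by blast
    next
      case (incl h) then show ?case using gens by blast
    next
      case (inv h)
      then obtain s t where "h = d8perm s t" using gens by blast
      then show ?case using inverse[of s t] by blast
    next
      case (eng h1 h2)
      then obtain s t s' t' where "h1 = d8perm s t" "h2 = d8perm s' t'" by blast
      then have "h1 \<otimes>\<^bsub>Sigma4\<^esub> h2 = d8perm (s' \<noteq> s) (t' \<noteq> t)" by (simp only: Sigma4_simps(2) d8perm_comp)
      then show ?case by blast
    qed
    then show "g \<in> range v4" by (auto simp: v4_def image_iff)
  qed
  interpret V4: group V4 by (rule group_V4)
  have ab: "perm_a \<in> carrier V4" "perm_b \<circ> perm_c \<in> carrier V4" by (auto simp: V4_def intro: generate.incl)
  have "id \<in> carrier V4" using V4.one_closed by (simp add: V4_def Sigma4_simps)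
  then have "d8perm s t \<in> carrier V4" for s t
    using ab V4.m_closed[OF ab] by (auto simp: d8perm_def mult_V4)
  then show "range v4 \<subseteq> carrier V4" by (auto simp: v4_def)
qed

lemma dperm_carrier: "dperm e \<in> carrier D8"
proof -
  interpret D8: group D8 by (rule group_D8)
  have m: "f \<circ> g \<in> carrier D8" if "f \<in> carrier D8" "g \<in> carrier D8" for f g
    using D8.m_closed[OF that] by (simp add: D8_def Sigma4_simps)
  have "perm_a \<in> carrier D8" "perm_b \<in> carrier D8" "perm_c \<in> carrier D8"
    by (auto simp: D8_def intro: generate.incl)
  moreover have "id \<in> carrier D8" using D8.one_closed by (simp add: D8_def Sigma4_simps)
  ultimately show ?thesis by (cases e) (auto simp only: dperm_eq intro!: m split: if_splits)
qed

lemma v4_carrier: "v4 e \<in> carrier V4" "v4 e \<in> carrier D8"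
  using dperm_carrier[of "iota e"] by (auto simp: carrier_V4 dperm_iota)

lemma distinct_adj_map_v4 [simp]: "distinct_adj (map v4 l) \<longleftrightarrow> distinct_adj l"
  by (rule distinct_adj_map_iff) (rule inj_on_subset[OF inj_v4], simp)

lemma nondegenerate_map_v4:
  "map v4 l \<in> nondegenerate (EG V4) \<longleftrightarrow> l \<noteq> [] \<and> distinct_adj l"
  "map v4 l \<in> nondegenerate (EG D8) \<longleftrightarrow> l \<noteq> [] \<and> distinct_adj l"
  by (auto simp: nondegenerate_EG v4_carrier)

lemma nondegenerate_EV4: "m \<in> nondegenerate (EG V4) \<Longrightarrow> \<exists>l. m = map v4 l \<and> l \<noteq> [] \<and> distinct_adj l"
proof -
  assume m: "m \<in> nondegenerate (EG V4)"
  then have "set m \<subseteq> range v4" by (auto simp: nondegenerate_EG carrier_V4)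
  then have "m \<in> lists (range v4)" by auto
  then obtain l where "m = map v4 l" by (auto simp: lists_image)
  then show ?thesis using m nondegenerate_map_v4(1) by blast
qed

lemma EV4_split_v4: "EV4_split (map v4 l) = (map fst (map (map_prod tau tau) l), map snd (map (map_prod tau tau) l))"
proof -
  let ?S = "carrier Sigma2 \<times> carrier Sigma2"
  have "inj_on V4_iso ?S"
    using inj_v4 by (auto simp: inj_on_def Sigma2_simps V4_iso_tau)
  then have "inv_into ?S V4_iso (V4_iso (tau s, tau t)) = (tau s, tau t)" for s t
    by (rule inv_into_f_f) simp
  then have "inv_into ?S V4_iso (v4 e) = map_prod tau tau e" for e
    by (cases e) (simp add: V4_iso_tau)
  then show ?thesis by (simp add: EV4_split_def Let_def o_def)
qed

lemma ED8_merge_tau: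
  "ED8_merge (map fst (map (map_prod tau (map_prod tau tau)) \<rho>),
     map (fst \<circ> snd) (map (map_prod tau (map_prod tau tau)) \<rho>),
     map (snd \<circ> snd) (map (map_prod tau (map_prod tau tau)) \<rho>)) = map dperm \<rho>"
  by (induction \<rho>) (auto simp: ED8_merge_def dperm_def)


section \<open>The chain homotopy in coordinates\<close>

lemma pairing_EZ3_basis: "pairing F (EZ3 X Y Z c) = pairing (\<lambda>p. pairing F (EZ3 X Y Z (basis p))) c"
  unfolding EZ3_def by (rule pairing_lin_basis)

lemma pairing_AW_basis: "pairing F (AW X Y c) = pairing (\<lambda>p. pairing F (AW X Y (basis p))) c"
  unfolding AW_def by (rule pairing_lin_basis)

lemma pairing_Phi_basis: "pairing F (Phi c) = pairing (\<lambda>p. pairing F (Phi (basis p))) c"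
  unfolding Phi_def by (rule pairing_lin_basis)

lemma pairing_Phi:
  fixes F :: "_ \<Rightarrow> bit"
  defines "f \<equiv> (\<lambda>\<rho>. let r = map (map_prod tau (map_prod tau tau)) \<rho> in
      F (map fst r, map (fst \<circ> snd) r, map (snd \<circ> snd) r))"
  assumes f: "stutter_free f" and e: "e \<noteq> []" and g: "g \<noteq> []"
  shows "pairing F (EZ3 (EG Sigma2) (EG Sigma2) (EG Sigma2) (Phi (basis (map tau e, map tau g)))) = phi f e g"
proof -
  let ?E = "EG Sigma2"
  let ?Z = "EZ3 ?E ?E ?E"
  let ?l = "map (\<lambda>x. (x, x)) e"
  have ez: "restr2 ?E ?E (\<lambda>p. pairing F (?Z (basis (map tau e', p)))) (map tau L1) (map tau L2) =
      (\<Sum>w\<leftarrow>shuf3 e' L1 L2. f w)"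
    if "distinct_adj e'" "e' \<noteq> []" for e' L1 L2
  proof (cases "distinct_adj L1 \<and> distinct_adj L2 \<and> L1 \<noteq> [] \<and> L2 \<noteq> []")
    case True
    then have n: "map tau e' \<in> nondegenerate ?E" "map tau L1 \<in> nondegenerate ?E" "map tau L2 \<in> nondegenerate ?E"
      using that by (auto simp: nondegenerate_map_tau)
    then show ?thesis
      using pairing_EZ3_EG[OF n, of F] by (simp add: restr2_def sum_shuf3_map Let_def f_def)
  next
    case False
    then have "L1 = [] \<or> L2 = [] \<or> \<not> distinct_adj L1 \<or> \<not> distinct_adj L2" by blast
    then have "(\<Sum>w\<leftarrow>shuf3 e' L1 L2. f w) = 0"
      using f shuf3_stutter[of e' L1 L2] by (intro sum_list_zero) (auto simp: stutter_free_def)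
    then show ?thesis using False by (auto simp: restr2_def nondegenerate_map_tau)
  qed
  define H where "H = (\<lambda>(e', e''). pairing (\<lambda>p. pairing F (?Z (basis (e', p)))) (steenrod_AW ?E (basis (e'', map tau g))))"
  have st: "restr2 ?E ?E H (map tau e') (map tau e'') = stn (\<lambda>L1 L2. \<Sum>w\<leftarrow>shuf3 e' L1 L2. f w) e'' g"
    if ne: "e' \<noteq> []" "e'' \<noteq> []" for e' e''
  proof (cases "distinct_adj e' \<and> distinct_adj e''")
    case True
    then have "restr2 ?E ?E H (map tau e') (map tau e'') = H (map tau e', map tau e'')"
      using ne by (simp add: restr2_def nondegenerate_map_tau)
    also have "\<dots> = stn (\<lambda>L1 L2. restr2 ?E ?E (\<lambda>p. pairing F (?Z (basis (map tau e', p)))) (map tau L1) (map tau L2)) e'' g"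
      unfolding H_def prod.case using True ne g by (intro pairing_steenrod_AW_Sigma2) auto
    also have "\<dots> = stn (\<lambda>L1 L2. \<Sum>w\<leftarrow>shuf3 e' L1 L2. f w) e'' g"
      using True ne by (simp only: ez simp_thms)
    finally show ?thesis .
  next
    case False
    have z: "(\<Sum>w\<leftarrow>shuf3 e' L1 L2. f w) = 0"
      if "\<not> distinct_adj e' \<or> \<not> distinct_adj L1 \<or> \<not> distinct_adj L2" for L1 L2
      using f shuf3_stutter[OF that] by (intro sum_list_zero) (auto simp: stutter_free_def)
    have "stn (\<lambda>L1 L2. \<Sum>w\<leftarrow>shuf3 e' L1 L2. f w) e'' g = 0"
    proof (cases "distinct_adj e'")
      case True
      then show ?thesis using False z by (intro stn_stutter) auto
    next
      case False
      then have "(\<lambda>L1 L2. \<Sum>w\<leftarrow>shuf3 e' L1 L2. f w) = (\<lambda>L1 L2. 0)" using z by blast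
      then show ?thesis by (simp add: stn_def)
    qed
    then show ?thesis using False by (auto simp: restr2_def nondegenerate_map_tau)
  qed
  have l: "(map tau e, map tau e) = (map fst (map (map_prod tau tau) ?l), map snd (map (map_prod tau tau) ?l))"
    by (simp add: o_def)
  have "pairing F (?Z (Phi (basis (map tau e, map tau g)))) =
      pairing (\<lambda>p. pairing F (?Z (basis p))) (Phi (basis (map tau e, map tau g)))"
    by (rule pairing_EZ3_basis)
  also have "\<dots> = pairing H (AW ?E ?E (basis (map tau e, map tau e)))"
    unfolding Phi_def lin_basis prod.case pairing_lin AW_diag_basis
    by (rule pairing_cong) (simp add: H_def pairing_tensor case_prod_unfold)
  also have "\<dots> = aws (map (map_prod tau tau) ?l) (restr2 ?E ?E H)"
    unfolding l by (rule pairing_AW_EG) (use e in simp)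
  also have "\<dots> = phi f e g"
    unfolding phi_def aws_map by (rule aws_cong) (rule st)
  finally show ?thesis .
qed

definition fD8 :: "(perm list \<Rightarrow> bit) \<Rightarrow> (bool \<times> bool \<times> bool) list \<Rightarrow> bit" where
  "fD8 f \<rho> = restr (EG D8) f (map dperm \<rho>)"

lemma stutter_free_fD8: "stutter_free (fD8 f)"
  unfolding stutter_free_def fD8_def restr_def nondegenerate_EG using distinct_adj_mapD by metis

lemma pairing_Psi:
  "pairing f (Psi (cls (EG V4) (map v4 l))) = psi (fD8 f) l"
proof (cases "l \<noteq> [] \<and> distinct_adj l")
  case False
  have "cls (EG V4) (map v4 l) = 0" unfolding cls_def nondegenerate_map_v4 using False by (rule if_not_P)
  moreover have "psi (fD8 f) l = 0" using False psi_stutter[OF stutter_free_fD8] by (cases "l = []") auto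
  moreover have "pairing f (Psi 0) = 0"
    by (simp add: Psi_def pairing_push pairing_EZ3_basis[of _ _ _ _ "Phi _"] pairing_Phi_basis[of _ "AW _ _ _"]
      pairing_AW_basis[of _ _ _ "push _ _ _"])
  ultimately show ?thesis by simp
next
  case True
  let ?E = "EG Sigma2" and ?l = "map (map_prod tau tau) l"
  define F where "F = (\<lambda>r. restr (EG D8) f (ED8_merge r))"
  have fF: "fD8 f = (\<lambda>\<rho>. let r = map (map_prod tau (map_prod tau tau)) \<rho> in
      F (map fst r, map (fst \<circ> snd) r, map (snd \<circ> snd) r))"
    unfolding F_def Let_def ED8_merge_tau by (rule ext) (rule fD8_def)
  have "distinct_adj ?l" using True by (subst distinct_adj_map_iff) (auto simp: inj_on_def)
  then have nd: "(map fst ?l, map snd ?l) \<in> nondegenerate (sprod ?E ?E)"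
    using True by (intro nondegenerate_sprod_EG) (auto simp: zip_map_fst_snd simp del: map_map)
  have push: "push (sprod ?E ?E) EV4_split (cls (EG V4) (map v4 l)) = basis (map fst ?l, map snd ?l)"
    using nd True by (simp only: push_def cls_def nondegenerate_map_v4 lin_basis EV4_split_v4 if_True simp_thms)
  have "pairing f (Psi (cls (EG V4) (map v4 l))) =
      pairing F (EZ3 ?E ?E ?E (Phi (AW ?E ?E (basis (map fst ?l, map snd ?l)))))"
    unfolding Psi_def push by (simp add: pairing_push F_def restr_def)
  also have "\<dots> = pairing (\<lambda>p. pairing F (EZ3 ?E ?E ?E (Phi (basis p)))) (AW ?E ?E (basis (map fst ?l, map snd ?l)))"
    by (subst pairing_EZ3_basis, subst pairing_Phi_basis, subst (2) pairing_EZ3_basis, rule refl)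
  also have "\<dots> = aws ?l (restr2 ?E ?E (\<lambda>p. pairing F (EZ3 ?E ?E ?E (Phi (basis p)))))"
    by (rule pairing_AW_EG) (use True in simp)
  also have "\<dots> = psi (fD8 f) l"
    unfolding psi_def aws_map
  proof (rule aws_cong)
    fix e g :: "bool list" assume ne: "e \<noteq> []" "g \<noteq> []"
    show "restr2 ?E ?E (\<lambda>p. pairing F (EZ3 ?E ?E ?E (Phi (basis p)))) (map tau e) (map tau g) = phi (fD8 f) e g"
      using ne pairing_Phi[OF _ ne, of F, folded fF] phi_stutter[OF stutter_free_fD8, of e f g]
        phi_stutter(2)[OF stutter_free_fD8, of g f e] stutter_free_fD8
      by (auto simp: restr2_def nondegenerate_map_tau)
  qed
  finally show ?thesis .
qed

lemma psi_cong:
  assumes "\<And>w. length w = length l \<Longrightarrow> f w = f' w"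
  shows "psi f l = psi f' l"
  unfolding psi_def
proof (rule aws_cong)
  fix e g :: "bool list" assume eg: "e \<noteq> []" "g \<noteq> []" "length e + length g = Suc (length l)"
  show "phi f e g = phi f' e g"
    unfolding phi_def
  proof (rule aws_cong)
    fix e' e'' :: "bool list"
    assume e: "e' \<noteq> []" "e'' \<noteq> []" "length e' + length e'' = Suc (length (map (\<lambda>x. (x, x)) e))"
    show "stn (\<lambda>L1 L2. \<Sum>w\<leftarrow>shuf3 e' L1 L2. f w) e'' g = stn (\<lambda>L1 L2. \<Sum>w\<leftarrow>shuf3 e' L1 L2. f' w) e'' g"
      unfolding stn_def
    proof (intro sum_list_cong)
      fix \<omega> w assume \<omega>: "\<omega> \<in> set (shuf (altword e'') g)" and w: "w \<in> set (shuf3 e' (proj False \<omega>) (proj True \<omega>))"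
      obtain a where a: "a \<in> set (shuf (proj False \<omega>) (proj True \<omega>))" "w \<in> set (shuf e' a)"
        using w by (auto simp: shuf3_def)
      show "f w = f' w"
        by (rule assms)
          (use length_shuf[OF \<omega>] length_shuf[OF a(1)] length_shuf[OF a(2)] length_proj2[of \<omega>] length_altword[OF e(2)] e(3) eg(3) in simp)
    qed
  qed
qed

lemma jsum_eq: "jsum l f = (\<Sum>j<length l. psi (\<lambda>w. f (map iota (take (Suc j) l) @ w)) (drop j l))"
  by (induction l arbitrary: f) (simp_all add: sum.lessThan_Suc_shift del: sum.lessThan_Suc)

lemma pairing_J_Psi:
  assumes "l \<noteq> []" "distinct_adj l"
  shows "pairing f (J_Psi (basis (map v4 l))) = jsum l (fD8 f)"
proof -
  have "pairing f (join_chain D8 (cls (EG D8) (take (Suc j) (map v4 l))) (Psi (cls (EG V4) (drop j (map v4 l))))) =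
      psi (\<lambda>w. fD8 f (map iota (take (Suc j) l) @ w)) (drop j l)" if j: "j < length l" for j
  proof -
    let ?u = "map v4 (take (Suc j) l)"
    have "distinct_adj (take (Suc j) l)"
      by (rule distinct_adj_appendD1[of _ "drop (Suc j) l"]) (simp add: assms(2))
    then have u: "?u \<in> nondegenerate (EG D8)" using assms(1) by (simp add: nondegenerate_map_v4)
    have "psi (fD8 (\<lambda>v. restr (EG D8) f (?u @ v))) (drop j l) = psi (\<lambda>w. fD8 f (map iota (take (Suc j) l) @ w)) (drop j l)"
    proof (rule psi_cong)
      fix w :: "(bool \<times> bool \<times> bool) list" assume "length w = length (drop j l)"
      then have "w \<noteq> []" using j by auto
      then have nd: "map dperm w \<in> nondegenerate (EG D8)" if "?u @ map dperm w \<in> nondegenerate (EG D8)"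
        using that distinct_adj_appendD2[of ?u "map dperm w"] by (simp add: nondegenerate_EG)
      have eq: "map dperm (map iota (take (Suc j) l) @ w) = ?u @ map dperm w"
        by (simp add: o_def dperm_iota)
      show "fD8 (\<lambda>v. restr (EG D8) f (?u @ v)) w = fD8 f (map iota (take (Suc j) l) @ w)"
        unfolding fD8_def restr_def eq using nd by simp
    qed
    moreover have "cls (EG D8) ?u = basis ?u" using u by (simp add: cls_def)
    moreover have "pairing f (join_chain D8 (basis ?u) c) = pairing (\<lambda>v. restr (EG D8) f (?u @ v)) c" for c
      by (simp only: join_chain_def pairing_lin pairing_tensor pairing_basis prod.case pairing_cls_restr)
    ultimately show ?thesis
      by (simp only: take_map drop_map pairing_Psi)
  qed
  then show ?thesis
    by (simp add: J_Psi_def pairing_sum jsum_eq)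
qed

lemma jsum_cong:
  assumes "\<And>w. length w = Suc (length l) \<Longrightarrow> f w = f' w"
  shows "jsum l f = jsum l f'"
  using assms
proof (induction l arbitrary: f f')
  case (Cons p l)
  have "psi (\<lambda>w. f (iota p # w)) (p # l) = psi (\<lambda>w. f' (iota p # w)) (p # l)"
    by (rule psi_cong) (use Cons.prems in simp)
  moreover have "jsum l (\<lambda>w. f (iota p # w)) = jsum l (\<lambda>w. f' (iota p # w))"
    by (rule Cons.IH) (use Cons.prems in simp)
  ultimately show ?case by simp
qed simp

lemma pairing_J_Psi_basis: "pairing F (J_Psi c) = pairing (\<lambda>m. pairing F (J_Psi (basis m))) c"
  unfolding J_Psi_def by (rule pairing_lin_basis)

lemma chains_EG:
  "c \<in> chains (EG G) k \<longleftrightarrow>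
    (\<forall>l\<in>Poly_Mapping.keys c. length l = Suc k \<and> set l \<subseteq> carrier G \<and> distinct_adj l)"
proof -
  have "l \<in> nondegenerate (EG G) \<and> sdim (EG G) l = k \<longleftrightarrow>
      length l = Suc k \<and> set l \<subseteq> carrier G \<and> distinct_adj l" for l
    by (cases l) (auto simp: nondegenerate_EG, auto simp: EG_def)
  then show ?thesis unfolding chains_def by blast
qed

lemma chains_EV4:
  assumes "c \<in> chains (EG V4) k" "m \<in> Poly_Mapping.keys c"
  obtains l where "m = map v4 l" "l \<noteq> []" "distinct_adj l" "length l = Suc k"
proof -
  have m: "length m = Suc k" "set m \<subseteq> carrier V4" "distinct_adj m" using assms by (auto simp: chains_EG)
  then have "m \<in> nondegenerate (EG V4)" by (auto simp: nondegenerate_EG)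
  then show thesis using that m(1) nondegenerate_EV4 by fastforce
qed

lemma J_Psi_chains:
  assumes c: "c \<in> chains (EG V4) k"
  shows "J_Psi c \<in> chains (EG D8) (Suc k)"
proof -
  let ?S = "{u. length u = Suc (Suc k) \<and> set u \<subseteq> carrier D8 \<and> distinct_adj u}"
  have "pairing (\<lambda>x. of_bool (x = u)) (J_Psi c) = 0" if u: "u \<notin> ?S" for u
  proof -
    have "pairing (\<lambda>x. of_bool (x = u)) (J_Psi (basis m)) = (0 :: bit)" if m: "m \<in> Poly_Mapping.keys c" for m
    proof -
      obtain l where l: "m = map v4 l" "l \<noteq> []" "distinct_adj l" "length l = Suc k"
        using chains_EV4[OF c m] by blast
      have "fD8 (\<lambda>x. of_bool (x = u)) w = 0" if "length w = Suc (length l)" for w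
        using that u l(4) by (auto simp: fD8_def restr_def nondegenerate_EG)
      then have "jsum l (fD8 (\<lambda>x. of_bool (x = u))) = jsum l (\<lambda>w. 0)" by (rule jsum_cong)
      then show ?thesis unfolding l(1) pairing_J_Psi[OF l(2,3)] by (simp add: jsum_zero)
    qed
    then have "pairing (\<lambda>x. of_bool (x = u)) (J_Psi c) = pairing (\<lambda>m. 0) c"
      unfolding pairing_J_Psi_basis[of _ c] by (rule pairing_cong)
    then show ?thesis by (simp add: pairing_def)
  qed
  then have "Poly_Mapping.keys (J_Psi c) \<subseteq> ?S" unfolding keys_subset_iff by blast
  then show ?thesis unfolding chains_EG by blast
qed

definition v4_chain :: "nat \<Rightarrow> nat \<Rightarrow> perm list chain" where
  "v4_chain q p = (\<Sum>l\<leftarrow>shuf (alt False q) (alt False p). basis (map v4 l))"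

lemma pairing_v4_chain: "pairing F (v4_chain q p) = (\<Sum>l\<leftarrow>shuf (alt False q) (alt False p). F (map v4 l))"
proof -
  have "pairing F (\<Sum>x\<leftarrow>xs. basis (h x)) = (\<Sum>x\<leftarrow>xs. F (h x))" for xs and h :: "(bool \<times> bool) list \<Rightarrow> perm list"
    by (induction xs) (simp_all add: pairing_add)
  then show ?thesis by (simp add: v4_chain_def)
qed

lemma shuf_alt:
  assumes "l \<in> set (shuf (alt a q) (alt b p))"
  shows "l \<noteq> []" "distinct_adj l" "length l = Suc (q + p)"
  using shuf_neq_Nil[OF assms] length_shuf[OF assms]
    shuf_distinct_adj[OF distinct_adj_altl distinct_adj_altl assms] by auto

lemma v4_chain_chains: "v4_chain q p \<in> chains (EG V4) (q + p)"
proof -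
  let ?S = "{u. length u = Suc (q + p) \<and> set u \<subseteq> carrier V4 \<and> distinct_adj u}"
  have "pairing (\<lambda>x. of_bool (x = u)) (v4_chain q p) = 0" if u: "u \<notin> ?S" for u
    unfolding pairing_v4_chain
  proof (rule sum_list_zero)
    fix l assume l: "l \<in> set (shuf (alt False q) (alt False p))"
    have "map v4 l \<in> ?S" using shuf_alt[OF l] by (auto simp: v4_carrier)
    then show "of_bool (map v4 l = u) = (0 :: bit)" using u by (cases "map v4 l = u") auto
  qed
  then have "Poly_Mapping.keys (v4_chain q p) \<subseteq> ?S" unfolding keys_subset_iff by blast
  then show ?thesis unfolding chains_EG by blast
qed

lemma v4_mult: "v4 (a, b) \<circ> v4 (s, t) = v4 (s \<noteq> a, t \<noteq> b)"
  by (simp add: v4_def d8perm_comp)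

lemma tuple_orbit_tau: "tuple_orbit Sigma2 (map tau u) = range (\<lambda>a. map (\<lambda>s. tau (s \<noteq> a)) u)"
  by (auto simp: tuple_orbit_def Sigma2_simps tau_comp image_image)

lemma tuple_orbit_v4:
  "tuple_orbit V4 (map v4 l) = range (\<lambda>(a, b). map (\<lambda>(s, t). v4 (s \<noteq> a, t \<noteq> b)) l)"
  unfolding tuple_orbit_def carrier_V4 image_image mult_V4
  by (rule image_cong) (auto simp: v4_mult split: prod.splits)

lemma BV4_merge_orbit:
  "BV4_merge (tuple_orbit Sigma2 (map tau (map fst l)), tuple_orbit Sigma2 (map tau (map snd l))) =
    tuple_orbit V4 (map v4 l)"
proof -
  have "map V4_iso (zip (map (\<lambda>s. tau (s \<noteq> a)) (map fst l)) (map (\<lambda>t. tau (t \<noteq> b)) (map snd l))) =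
      map (\<lambda>(s, t). v4 (s \<noteq> a, t \<noteq> b)) l" for a b
    by (induction l) (auto simp: V4_iso_tau)
  moreover have "BV4_merge (range P, range Q) = range (\<lambda>(a, b). map V4_iso (zip (P a) (Q b)))"
    for P Q :: "bool \<Rightarrow> perm list"
    by (auto simp: BV4_merge_def)
  ultimately show ?thesis unfolding tuple_orbit_tau tuple_orbit_v4 by simp
qed

lemma spull_BG:
  assumes "set \<theta> \<subseteq> {..<length u}"
  shows "spull (BG G) (tuple_orbit G u) \<theta> = tuple_orbit G (map ((!) u) \<theta>)"
proof -
  have "map ((!) (map (\<lambda>h. g \<otimes>\<^bsub>G\<^esub> h) u)) \<theta> = map (\<lambda>h. g \<otimes>\<^bsub>G\<^esub> h) (map ((!) u) \<theta>)" for g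
    using assms by auto
  then show ?thesis by (simp only: BG_def EG_def tuple_orbit_def image_image sset.simps)
qed

lemma x_cross_eq: "x_cross q p = BG_proj V4 (v4_chain q p)"
proof (rule chain_eqI)
  fix \<beta> :: "perm list set \<Rightarrow> bit"
  interpret S: monoid Sigma2 by (rule monoid_Sigma2)
  let ?B = "BG Sigma2" and ?o = "tuple_orbit Sigma2"
  let ?u = "map tau (alt False q)" and ?v = "map tau (alt False p)"
  define H where "H z = restr (BG V4) \<beta> (BV4_merge z)" for z
  have nd: "map tau (alt False k) \<in> nondegenerate (EG Sigma2)" for k
    by (simp add: nondegenerate_map_tau distinct_adj_altl)
  have xB: "xB k = basis (?o (map tau (alt False k)))" for k
    using S.nondegenerate_BG[OF nd[of k]] by (simp add: xB_def xt_eq BG_proj_def push_def cls_def)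
  have sdim: "sdim ?B (?o (map tau (alt False k))) = length (map tau (alt False k)) - 1" for k
    by (rule sdim_BG[OF refl S.tuple_orbit_refl]) auto
  have "pairing \<beta> (x_cross q p) = pairing H (EZ ?B ?B (basis (?o ?u, ?o ?v)))"
    by (simp add: x_cross_def xB pairing_push H_def[abs_def] restr_def)
  also have "\<dots> = (\<Sum>w\<in>max_chains (length ?u - 1) (length ?v - 1).
      restr (sprod ?B ?B) H (spull ?B (?o ?u) (map fst w), spull ?B (?o ?v) (map snd w)))"
    unfolding EZ_def lin_basis prod.case sdim by (simp only: pairing_sum pairing_cls_restr)
  also have "\<dots> = (\<Sum>w\<in>max_chains (length ?u - 1) (length ?v - 1).
      (\<lambda>w. restr (sprod ?B ?B) H (?o (map fst w), ?o (map snd w))) (map (map_prod ((!) ?u) ((!) ?v)) w))"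
  proof (rule sum.cong[OF refl])
    fix w assume w: "w \<in> max_chains (length ?u - 1) (length ?v - 1)"
    have "set (map fst w) \<subseteq> {..<length ?u}" "set (map snd w) \<subseteq> {..<length ?v}"
      using w by (fastforce simp: max_chains_def)+
    then show "restr (sprod ?B ?B) H (spull ?B (?o ?u) (map fst w), spull ?B (?o ?v) (map snd w)) =
      (\<lambda>w. restr (sprod ?B ?B) H (?o (map fst w), ?o (map snd w))) (map (map_prod ((!) ?u) ((!) ?v)) w)"
      by (simp only: spull_BG map_map o_def fst_map_prod snd_map_prod)
  qed
  also have "\<dots> = (\<Sum>w\<leftarrow>shuf ?u ?v. restr (sprod ?B ?B) H (?o (map fst w), ?o (map snd w)))"
    by (rule sum_max_chains_nth) simp_all
  also have "\<dots> = (\<Sum>l\<leftarrow>shuf (alt False q) (alt False p).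
      restr (sprod ?B ?B) H (?o (map tau (map fst l)), ?o (map tau (map snd l))))"
    by (simp add: shuf_map o_def)
  also have "\<dots> = (\<Sum>l\<leftarrow>shuf (alt False q) (alt False p). restr (BG V4) \<beta> (tuple_orbit V4 (map v4 l)))"
  proof (rule sum_list_cong)
    fix l assume l: "l \<in> set (shuf (alt False q) (alt False p))"
    have "zip (map tau (map fst l)) (map tau (map snd l)) = map (map_prod tau tau) l"
      by (induction l) auto
    moreover have "distinct_adj (map (map_prod tau tau) l)"
      using shuf_alt(2)[OF l] by (subst distinct_adj_map_iff) (auto simp: inj_on_def)
    ultimately have "(?o (map tau (map fst l)), ?o (map tau (map snd l))) \<in> nondegenerate (sprod ?B ?B)"
      using shuf_alt(1)[OF l] by (intro S.nondegenerate_sprod_BG[OF monoid_Sigma2]) auto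
    then show "restr (sprod ?B ?B) H (?o (map tau (map fst l)), ?o (map tau (map snd l))) =
        restr (BG V4) \<beta> (tuple_orbit V4 (map v4 l))"
      unfolding restr_def[of "sprod ?B ?B"] H_def BV4_merge_orbit by (rule if_P)
  qed
  also have "\<dots> = pairing \<beta> (BG_proj V4 (v4_chain q p))"
    by (simp add: BG_proj_def pairing_push pairing_v4_chain restr_def)
  finally show "pairing \<beta> (x_cross q p) = pairing \<beta> (BG_proj V4 (v4_chain q p))" .
qed


section \<open>Evaluating the operations\<close>

lemma rowp_comp: "rowp (g \<circ> h) = map g (rowp h)"
  by (simp add: rowp_def)

lemma Sigma4_act_BG_proj:
  assumes X: "simplicial_set X" "u \<in> simplices X" and V: "V \<in> mono_lists (sdim X u)"
    and \<alpha>: "ncochain X \<alpha>" and c: "c \<in> chains (EG Sigma4) k"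
  shows "Sigma4_act X k (BG_proj Sigma4 c) \<alpha> (spull X u V) =
    pairing (\<lambda>\<sigma>s. tabF (ev X u \<alpha>) V (map rowp \<sigma>s)) c"
proof -
  have k: "Poly_Mapping.keys (lift_chain Sigma4 k (BG_proj Sigma4 c)) \<subseteq>
      {\<sigma>s. \<sigma>s \<noteq> [] \<and> (\<forall>\<sigma>\<in>set \<sigma>s. \<sigma> permutes {1..4})}"
    using lift_chain(1)[OF c] unfolding chains_EG Sigma4_simps by force
  have "tabF (ev X u \<alpha>) V (map rowp (map (\<lambda>h. g \<otimes>\<^bsub>Sigma4\<^esub> h) l)) = tabF (ev X u \<alpha>) V (map rowp l)"
    if "g \<in> carrier Sigma4" for g l
    using tabF_map[of g "ev X u \<alpha>" V "map rowp l"] that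
    by (simp add: Sigma4_simps rowp_comp o_def[of _ rowp] o_def[of rowp] del: One_nat_def)
  then show ?thesis
    unfolding Sigma4_act_def surj_act_TR[OF X V \<alpha> k] by (intro group.pairing_lift_chain[OF group_Sigma4 c])
qed

lemma chains_subgroup: "carrier H \<subseteq> carrier G \<Longrightarrow> c \<in> chains (EG H) k \<Longrightarrow> c \<in> chains (EG G) k"
  unfolding chains_EG by blast

lemma chains_keys: "c \<in> chains X k \<Longrightarrow> Poly_Mapping.keys c \<subseteq> nondegenerate X"
  by (auto simp: chains_def)

lemma Sigma4_act_x_cross:
  assumes X: "simplicial_set X" "u \<in> simplices X" and V: "V \<in> mono_lists (sdim X u)"
    and \<alpha>: "ncochain X \<alpha>"
  shows "Sigma4_act X (q + p) (BG_incl Sigma4 (x_cross q p)) \<alpha> (spull X u V) =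
    (\<Sum>l\<leftarrow>shuf (alt False q) (alt False p). tabF (ev X u \<alpha>) V (map rowl (map iota l)))"
proof -
  have "BG_incl Sigma4 (x_cross q p) = BG_proj Sigma4 (v4_chain q p)"
    using group.BG_incl_proj[OF group_Sigma4 subgroup_V4, unfolded V4_update, OF chains_keys[OF v4_chain_chains]]
    by (simp add: x_cross_eq)
  moreover have "v4_chain q p \<in> chains (EG Sigma4) (q + p)"
    by (rule chains_subgroup[OF subgroup.subset[OF subgroup_V4] v4_chain_chains])
  moreover have "rowp (v4 e) = rowl (iota e)" for e
    using rowp_dperm[of "iota e"] by (simp add: dperm_iota)
  ultimately show ?thesis
    by (simp add: Sigma4_act_BG_proj[OF X V \<alpha>] pairing_v4_chain o_def)
qed

lemma Sigma4_act_Jbar_Psi: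
  assumes X: "simplicial_set X" "u \<in> simplices X" and V: "V \<in> mono_lists (sdim X u)"
    and \<alpha>: "ncochain X \<alpha>"
  shows "Sigma4_act X (q + p + 1) (BG_incl Sigma4 (Jbar_Psi (q + p) (x_cross q p))) \<alpha> (spull X u V) =
    (\<Sum>l\<leftarrow>shuf (alt False q) (alt False p). jsum l (\<lambda>\<rho>. tabF (ev X u \<alpha>) V (map rowl \<rho>)))"
proof -
  let ?F = "\<lambda>\<rho>. tabF (ev X u \<alpha>) V (map rowl \<rho>)"
  let ?c = "lift_chain V4 (q + p) (x_cross q p)"
  have c: "?c \<in> chains (EG V4) (q + p)"
    using lift_chain(1)[OF v4_chain_chains] by (simp add: x_cross_eq)
  have J: "J_Psi ?c \<in> chains (EG D8) (q + p + 1)" using J_Psi_chains[OF c] by simp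
  have incl: "BG_incl Sigma4 (Jbar_Psi (q + p) (x_cross q p)) = BG_proj Sigma4 (J_Psi ?c)"
    using group.BG_incl_proj[OF group_Sigma4 subgroup_D8, unfolded D8_update, OF chains_keys[OF J]]
    by (simp add: Jbar_Psi_def)
  define v4' where "v4' = inv_into UNIV v4"
  have v4': "map v4' (map v4 l) = l" for l
    by (simp add: v4'_def inj_v4 o_def)
  have sf: "stutter_free (tabF (ev X u \<alpha>) V)"
    by (rule stutter_free_tabF) (use ev_stutter[OF X \<alpha>] in \<open>auto simp: stutter_free_def\<close>)
  have fD8: "fD8 (\<lambda>\<sigma>s. tabF (ev X u \<alpha>) V (map rowp \<sigma>s)) = ?F"
  proof
    fix \<rho>
    have rows: "map rowp (map dperm \<rho>) = map rowl \<rho>" by (simp add: rowp_dperm)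
    have "?F \<rho> = 0" if "map dperm \<rho> \<notin> nondegenerate (EG D8)"
    proof (cases "\<rho> = []")
      case False
      then have "\<not> distinct_adj (map dperm \<rho>)" using that dperm_carrier by (auto simp: nondegenerate_EG)
      then have "\<not> distinct_adj (map rowl \<rho>)" unfolding rows[symmetric] using distinct_adj_mapD by blast
      then show ?thesis using sf by (simp add: stutter_free_def)
    qed simp
    then show "fD8 (\<lambda>\<sigma>s. tabF (ev X u \<alpha>) V (map rowp \<sigma>s)) \<rho> = ?F \<rho>"
      unfolding fD8_def restr_def rows by simp
  qed
  have "Sigma4_act X (q + p + 1) (BG_incl Sigma4 (Jbar_Psi (q + p) (x_cross q p))) \<alpha> (spull X u V) =
      pairing (\<lambda>\<sigma>s. tabF (ev X u \<alpha>) V (map rowp \<sigma>s)) (J_Psi ?c)"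
    unfolding incl
    by (rule Sigma4_act_BG_proj[OF X V \<alpha> chains_subgroup[OF subgroup.subset[OF subgroup_D8] J]])
  also have "\<dots> = pairing (\<lambda>m. jsum (map v4' m) ?F) ?c"
    unfolding pairing_J_Psi_basis[of _ ?c]
  proof (rule pairing_cong)
    fix m assume m: "m \<in> Poly_Mapping.keys ?c"
    obtain l where l: "m = map v4 l" "l \<noteq> []" "distinct_adj l" using chains_EV4[OF c m] by blast
    show "pairing (\<lambda>\<sigma>s. tabF (ev X u \<alpha>) V (map rowp \<sigma>s)) (J_Psi (basis m)) = jsum (map v4' m) ?F"
      unfolding l(1) v4' pairing_J_Psi[OF l(2,3)] fD8 ..
  qed
  also have "\<dots> = pairing (\<lambda>m. jsum (map v4' m) ?F) (v4_chain q p)"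
    unfolding x_cross_eq
  proof (rule group.pairing_lift_chain[OF group_V4 v4_chain_chains])
    fix g l assume g: "g \<in> carrier V4" and l: "set l \<subseteq> carrier V4"
    obtain a b where g: "g = v4 (a, b)" using g by (auto simp: carrier_V4)
    have "l \<in> lists (range v4)" using l by (auto simp: carrier_V4)
    then obtain l' where l: "l = map v4 l'" by (auto simp: lists_image)
    have "map (\<lambda>h. g \<otimes>\<^bsub>V4\<^esub> h) l = map v4 (map (\<lambda>(s, t). (s \<noteq> a, t \<noteq> b)) l')"
      unfolding g l by (auto simp: mult_V4 v4_mult)
    then show "jsum (map v4' (map (\<lambda>h. g \<otimes>\<^bsub>V4\<^esub> h) l)) ?F = jsum (map v4' l) ?F"
      unfolding l by (simp only: v4' jsum_tabF_map)
  qed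
  also have "\<dots> = (\<Sum>l\<leftarrow>shuf (alt False q) (alt False p). jsum l ?F)"
    unfolding pairing_v4_chain v4' ..
  finally show ?thesis .
qed

lemma ncochain_Sigma4_act: "ncochain X (Sigma4_act X k y \<alpha>)"
  by (auto simp: ncochain_def Sigma4_act_def surj_act_def seq_act_def on_basis_def sum_fun_apply)

section \<open>Reindexing\<close>

lemma binom2_nat: "binom2 A B = (if 0 \<le> B \<and> 0 \<le> A then of_nat (nat A choose nat B) else 0)"
  by (auto simp: binom2_def binomial_eq_0)

text \<open>The diagonal terms \<open>r = s\<close> on the left give the iterated squares with \<open>l = p - r\<close>; the others
  pair up, with \<open>L = p - (q - i)\<close> and \<open>A = \<bar>s - r\<bar>\<close>. The binomial coefficients vanish unless
  \<open>q - i \<le> r \<le> p\<close>.\<close>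

lemma sum_reindex:
  fixes D :: "nat \<Rightarrow> nat \<Rightarrow> nat \<Rightarrow> bit"
  shows "(\<Sum>i\<le>q. \<Sum>r\<le>q - i + p. of_nat (r choose (q - i)) * of_nat ((q - i + p - r) choose (q - i)) *
      D i r (q - i + p - r)) =
    (\<Sum>l\<in>{l::int. 0 \<le> l \<and> 2 * l \<le> int p \<and> 0 \<le> int q - int p + 2 * l}. binom2 (int p - l) (int p - 2 * l) *
      D (nat (int q - int p + 2 * l)) (nat (int p - l)) (nat (int p - l))) +
    (\<Sum>(L, A)\<in>{(L, A). 0 < A \<and> A \<le> L \<and> L \<le> int p \<and> even (L - A) \<and> 0 \<le> int q - int p + L}.
      binom2 (int p - (L + A) div 2) (int p - L) * binom2 (int p - (L - A) div 2) (int p - L) *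
      (D (nat (int q - int p + L)) (nat (int p - (L + A) div 2)) (nat (int p - (L - A) div 2)) +
       D (nat (int q - int p + L)) (nat (int p - (L - A) div 2)) (nat (int p - (L + A) div 2))))"
proof -
  let ?s = "\<lambda>i r. q - i + p - r"
  let ?C = "\<lambda>i r. of_nat (r choose (q - i)) * of_nat (?s i r choose (q - i)) :: bit"
  define T where "T = {(i, r). i \<le> q \<and> q - i \<le> r \<and> r \<le> p}"
  define E where "E = {(i, r) \<in> T. r = ?s i r}"
  define U where "U = {(i, r) \<in> T. r < ?s i r}"
  define R where "R = {(i, r) \<in> T. r > ?s i r}"
  have finT: "finite T" by (rule finite_subset[of _ "{..q} \<times> {..p}"]) (auto simp: T_def)
  have fin: "finite E" "finite U" "finite R"
    by (auto intro: finite_subset[OF _ finT] simp: E_def U_def R_def)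
  have T: "T = E \<union> (U \<union> R)" by (auto simp: E_def U_def R_def)
  have "(\<Sum>i\<le>q. \<Sum>r\<le>q - i + p. ?C i r * D i r (?s i r)) =
      (\<Sum>(i, r)\<in>Sigma {..q} (\<lambda>i. {..q - i + p}). ?C i r * D i r (?s i r))"
    by (rule sum.Sigma) auto
  also have "\<dots> = (\<Sum>(i, r)\<in>T. ?C i r * D i r (?s i r))"
  proof (rule sum.mono_neutral_right)
    have "?C i r = 0" if "i \<le> q" "r \<le> q - i + p" "\<not> (q - i \<le> r \<and> r \<le> p)" for i r
    proof -
      have "r < q - i \<or> ?s i r < q - i" using that by linarith
      then show ?thesis by (auto simp: binomial_eq_0)
    qed
    then show "\<forall>x\<in>Sigma {..q} (\<lambda>i. {..q - i + p}) - T. (case x of (i, r) \<Rightarrow> ?C i r * D i r (?s i r)) = 0"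
      unfolding T_def by fastforce
  qed (auto simp: T_def)
  also have "\<dots> = (\<Sum>(i, r)\<in>E. ?C i r * D i r (?s i r)) + (\<Sum>(i, r)\<in>U \<union> R. ?C i r * D i r (?s i r))"
    unfolding T by (rule sum.union_disjoint) (use fin in \<open>auto simp: E_def U_def R_def\<close>)
  also have "(\<Sum>(i, r)\<in>U \<union> R. ?C i r * D i r (?s i r)) =
      (\<Sum>(i, r)\<in>U. ?C i r * D i r (?s i r)) + (\<Sum>(i, r)\<in>R. ?C i r * D i r (?s i r))"
    by (rule sum.union_disjoint) (use fin in \<open>auto simp: U_def R_def\<close>)
  also have "(\<Sum>(i, r)\<in>R. ?C i r * D i r (?s i r)) = (\<Sum>(i, r)\<in>U. ?C i r * D i (?s i r) r)"
    by (rule sum.reindex_bij_witness[where i = "\<lambda>(i, r). (i, ?s i r)" and j = "\<lambda>(i, r). (i, ?s i r)"])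
      (auto simp: U_def R_def T_def mult.commute)
  also have "(\<Sum>(i, r)\<in>U. ?C i r * D i r (?s i r)) + (\<Sum>(i, r)\<in>U. ?C i r * D i (?s i r) r) =
      (\<Sum>(i, r)\<in>U. ?C i r * (D i r (?s i r) + D i (?s i r) r))"
    by (simp add: sum.distrib[symmetric] distrib_left case_prod_unfold)
  also have "(\<Sum>(i, r)\<in>E. ?C i r * D i r (?s i r)) =
      (\<Sum>l\<in>{l::int. 0 \<le> l \<and> 2 * l \<le> int p \<and> 0 \<le> int q - int p + 2 * l}. binom2 (int p - l) (int p - 2 * l) *
      D (nat (int q - int p + 2 * l)) (nat (int p - l)) (nat (int p - l)))"
  proof (rule sum.reindex_bij_witness[where
      i = "\<lambda>l. (nat (int q - int p + 2 * l), nat (int p - l))" and j = "\<lambda>(i, r). int p - int r"])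
    fix x assume x: "x \<in> E"
    obtain i r where ir: "x = (i, r)" by (cases x)
    have *: "i \<le> q" "q - i \<le> r" "r \<le> p" "q - i + p = 2 * r" using x ir by (auto simp: E_def T_def)
    define l where "l = int p - int r"
    have l: "nat (int q - int p + 2 * l) = i" "nat (int p - l) = r" "nat (int p - 2 * l) = q - i" "?s i r = r"
      "0 \<le> int p - 2 * l \<and> 0 \<le> int p - l"
      using * by (auto simp: l_def)
    have "c * c = c" for c :: bit by (cases c) auto
    then have "binom2 (int p - l) (int p - 2 * l) * D (nat (int q - int p + 2 * l)) (nat (int p - l)) (nat (int p - l)) =
        ?C i r * D i r (?s i r)"
      unfolding binom2_nat if_P[OF l(5)] l by simp
    then show "binom2 (int p - (case x of (i, r) \<Rightarrow> int p - int r)) (int p - 2 * (case x of (i, r) \<Rightarrow> int p - int r)) *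
        D (nat (int q - int p + 2 * (case x of (i, r) \<Rightarrow> int p - int r)))
          (nat (int p - (case x of (i, r) \<Rightarrow> int p - int r))) (nat (int p - (case x of (i, r) \<Rightarrow> int p - int r))) =
        (case x of (i, r) \<Rightarrow> ?C i r * D i r (?s i r))"
      unfolding ir prod.case l_def .
  qed (auto simp: E_def T_def)
  also have "(\<Sum>(i, r)\<in>U. ?C i r * (D i r (?s i r) + D i (?s i r) r)) =
    (\<Sum>(L, A)\<in>{(L, A). 0 < A \<and> A \<le> L \<and> L \<le> int p \<and> even (L - A) \<and> 0 \<le> int q - int p + L}.
      binom2 (int p - (L + A) div 2) (int p - L) * binom2 (int p - (L - A) div 2) (int p - L) *
      (D (nat (int q - int p + L)) (nat (int p - (L + A) div 2)) (nat (int p - (L - A) div 2)) +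
       D (nat (int q - int p + L)) (nat (int p - (L - A) div 2)) (nat (int p - (L + A) div 2))))"
  proof (rule sum.reindex_bij_witness[where
      i = "\<lambda>(L, A). (nat (int q - int p + L), nat (int p - (L + A) div 2))" and
      j = "\<lambda>(i, r). (int p - int q + int i, int (?s i r) - int r)"])
    fix x assume x: "x \<in> U"
    obtain i r where ir: "x = (i, r)" by (cases x)
    have *: "i \<le> q" "q - i \<le> r" "r \<le> p" "r < ?s i r" using x ir by (auto simp: U_def T_def)
    have s: "int (?s i r) = int q - int i + int p - int r" using * by linarith
    have half: "(int p - int q + int i + (int (?s i r) - int r)) div 2 = int p - int r"
      "(int p - int q + int i - (int (?s i r) - int r)) div 2 = int r + int i - int q"
      "even (int p - int q + int i - (int (?s i r) - int r))"
      unfolding s by presburger+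
    have n: "nat (int p - (int p - int r)) = r" "nat (int p - (int r + int i - int q)) = ?s i r"
      "nat (int q - int p + (int p - int q + int i)) = i" "nat (int p - (int p - int q + int i)) = q - i"
      using * by linarith+
    have pos: "0 \<le> int p - (int p - int q + int i) \<and> 0 \<le> int p - (int p - int r)"
      "0 \<le> int p - (int p - int q + int i) \<and> 0 \<le> int p - (int r + int i - int q)"
      using * by linarith+
    show "(case case x of (i, r) \<Rightarrow> (int p - int q + int i, int (?s i r) - int r) of (L, A) \<Rightarrow>
        (nat (int q - int p + L), nat (int p - (L + A) div 2))) = x"
      unfolding ir prod.case half n ..
    show "(case x of (i, r) \<Rightarrow> (int p - int q + int i, int (?s i r) - int r)) \<in>
        {(L, A). 0 < A \<and> A \<le> L \<and> L \<le> int p \<and> even (L - A) \<and> 0 \<le> int q - int p + L}"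
      unfolding ir prod.case mem_Collect_eq using half(3) * by auto
    show "(case case x of (i, r) \<Rightarrow> (int p - int q + int i, int (?s i r) - int r) of (L, A) \<Rightarrow>
      binom2 (int p - (L + A) div 2) (int p - L) * binom2 (int p - (L - A) div 2) (int p - L) *
      (D (nat (int q - int p + L)) (nat (int p - (L + A) div 2)) (nat (int p - (L - A) div 2)) +
       D (nat (int q - int p + L)) (nat (int p - (L - A) div 2)) (nat (int p - (L + A) div 2)))) =
      (case x of (i, r) \<Rightarrow> ?C i r * (D i r (?s i r) + D i (?s i r) r))"
      unfolding ir prod.case half binom2_nat if_P[OF pos(1)] if_P[OF pos(2)] n ..
  next
    fix y assume y: "y \<in> {(L, A). 0 < A \<and> A \<le> L \<and> L \<le> int p \<and> even (L - A) \<and> 0 \<le> int q - int p + L}"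
    obtain L A where LA: "y = (L, A)" by (cases y)
    have *: "0 < A" "A \<le> L" "L \<le> int p" "even (L - A)" "0 \<le> int q - int p + L" using y LA by auto
    obtain h where h: "L = A + 2 * h" using *(4) by (metis add.commute diff_add_cancel dvdE)
    have div: "(L + A) div 2 = A + h" unfolding h by presburger
    define i r where "i = nat (int q - int p + L)" and "r = nat (int p - (A + h))"
    have ir: "int i = int q - int p + L" "int r = int p - (A + h)" "i \<le> q"
      using * h by (auto simp: i_def r_def)
    have s: "int (?s i r) = int p - h" using ir h * by linarith
    show "(case case y of (L, A) \<Rightarrow> (nat (int q - int p + L), nat (int p - (L + A) div 2)) of (i, r) \<Rightarrow>
        (int p - int q + int i, int (?s i r) - int r)) = y"
      unfolding LA prod.case div i_def[symmetric] r_def[symmetric] s using ir h by simp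
    have "q - i \<le> r" "r \<le> p" "r < ?s i r" using ir s h * by linarith+
    then show "(case y of (L, A) \<Rightarrow> (nat (int q - int p + L), nat (int p - (L + A) div 2))) \<in> U"
      unfolding LA prod.case div i_def[symmetric] r_def[symmetric] U_def T_def using ir(3) by simp
  qed
  finally show ?thesis .
qed

lemma cup_cup_spull:
  assumes X: "simplicial_set X" "u \<in> simplices X" and V: "V \<in> mono_lists (sdim X u)" and \<alpha>: "ncochain X \<alpha>"
  shows "cup X m (cup X r \<alpha> \<alpha>) (cup X s \<alpha> \<alpha>) (spull X u V) =
    cupw m (cupw r (ev X u \<alpha>) (ev X u \<alpha>)) (cupw s (ev X u \<alpha>) (ev X u \<alpha>)) V"
proof -
  have "ev X u (cup X r \<alpha> \<alpha>) L = cupw r (ev X u \<alpha>) (ev X u \<alpha>) L" if "L \<in> mono_lists (sdim X u)" for r L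
    using cup_spull[OF X that \<alpha> \<alpha>] that unfolding ev_def[of X u "cup X r \<alpha> \<alpha>"] by simp
  then show ?thesis
    unfolding cup_spull[OF X V ncochain_cup ncochain_cup] by (intro cupw_cong[OF V]) simp_all
qed

lemma Sq_eq_cup: "k \<le> i \<Longrightarrow> Sq X i k \<beta> = cup X (nat (i - k)) \<beta> \<beta>"
  by (simp add: Sq_def)

lemma dels_mono_lists:
  assumes "V \<in> mono_lists N" "V' \<in> set (dels V)"
  shows "V' = [] \<or> V' \<in> mono_lists N"
proof -
  have "sorted V'" if "sorted V" "V' \<in> set (dels V)" for V V' :: "nat list"
    using that
  proof (induction V arbitrary: V')
    case (Cons x V)
    then show ?case using set_dels[of _ V] by fastforce
  qed simp
  then show ?thesis using assms set_dels[OF assms(2)] by (auto simp: mono_lists_def)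
qed

lemma act_identity:
  fixes X :: "'a sset" and q p n :: nat
  assumes X: "simplicial_set X" and \<alpha>: "\<alpha> \<in> cochains X n" "cobd X \<alpha> = 0"
  shows "Sigma4_act X (q + p) (BG_incl Sigma4 (x_cross q p)) \<alpha>
       + cobd X (Sigma4_act X (q + p + 1) (BG_incl Sigma4 (Jbar_Psi (q + p) (x_cross q p))) \<alpha>)
     = (\<Sum>l\<in>{l::int. 0 \<le> l \<and> 2 * l \<le> int p \<and> 0 \<le> int q - int p + 2 * l}.
          smul (binom2 (int p - l) (int p - 2 * l))
            (Sq X (2 * int n - int p + l) (2 * int n - int q - l)
              (Sq X (int n) (int n - int p + l) \<alpha>)))
       + cobd X (N_cochain X (int q) (int p) (int n) \<alpha>)"
    (is "?act + cobd X ?J = ?Sq + cobd X ?N")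
proof
  let ?S1 = "{l::int. 0 \<le> l \<and> 2 * l \<le> int p \<and> 0 \<le> int q - int p + 2 * l}"
  let ?S2 = "{(L, A). 0 < A \<and> A \<le> L \<and> L \<le> int p \<and> even (L - A) \<and> 0 \<le> int q - int p + L}"
  let ?cc = "\<lambda>m r s. cup X m (cup X r \<alpha> \<alpha>) (cup X s \<alpha> \<alpha>)"
  let ?B = "\<lambda>L A. binom2 (int p - (L + A) div 2) (int p - L) * binom2 (int p - (L - A) div 2) (int p - L)"
  have nc: "ncochain X \<alpha>" using \<alpha>(1) by (auto simp: ncochain_def cochains_def)
  have Sq: "?Sq = (\<Sum>l\<in>?S1. smul (binom2 (int p - l) (int p - 2 * l))
      (?cc (nat (int q - int p + 2 * l)) (nat (int p - l)) (nat (int p - l))))"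
  proof (rule sum.cong[OF refl])
    fix l assume "l \<in> ?S1"
    then have "int n - int p + l \<le> int n" "2 * int n - int q - l \<le> 2 * int n - int p + l"
      "int n - (int n - int p + l) = int p - l"
      "2 * int n - int p + l - (2 * int n - int q - l) = int q - int p + 2 * l" by auto
    then show "smul (binom2 (int p - l) (int p - 2 * l)) (Sq X (2 * int n - int p + l) (2 * int n - int q - l)
        (Sq X (int n) (int n - int p + l) \<alpha>)) =
      smul (binom2 (int p - l) (int p - 2 * l)) (?cc (nat (int q - int p + 2 * l)) (nat (int p - l)) (nat (int p - l)))"
      by (simp only: Sq_eq_cup)
  qed
  have N: "?N = (\<Sum>(L, A)\<in>?S2. smul (?B L A)
      (?cc (nat (int q - int p + L + 1)) (nat (int p - (L + A) div 2)) (nat (int p - (L - A) div 2))))"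
    unfolding N_cochain_def
  proof (rule sum.cong[OF refl])
    fix x assume "x \<in> ?S2"
    then obtain L A where x: "x = (L, A)" and LA: "0 < A" "A \<le> L" "L \<le> int p" by (cases x) auto
    have "(L + A) div 2 \<le> int p" "(L - A) div 2 \<le> int p" using LA by auto
    then have "int n - int p + (L + A) div 2 \<le> int n" "int n - int p + (L - A) div 2 \<le> int n"
      "int n - (int n - int p + (L + A) div 2) = int p - (L + A) div 2"
      "int n - (int n - int p + (L - A) div 2) = int p - (L - A) div 2" by auto
    then show "(case x of (L, A) \<Rightarrow> smul (?B L A) (cup X (nat (int q - int p + L + 1))
          (Sq X (int n) (int n - int p + (L + A) div 2) \<alpha>) (Sq X (int n) (int n - int p + (L - A) div 2) \<alpha>))) =
        (case x of (L, A) \<Rightarrow> smul (?B L A)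
          (?cc (nat (int q - int p + L + 1)) (nat (int p - (L + A) div 2)) (nat (int p - (L - A) div 2))))"
      unfolding x prod.case by (simp only: Sq_eq_cup)
  qed
  have ncN: "ncochain X ?N"
    using ncochain_cup[of X] by (auto simp: N ncochain_def sum_fun_apply smul_def intro!: sum.neutral)
  fix u
  show "(?act + cobd X ?J) u = (?Sq + cobd X ?N) u"
  proof (cases "u \<in> nondegenerate X")
    case False
    then have "?act u = 0" using ncochain_Sigma4_act[of X] by (simp add: ncochain_def)
    moreover have "?Sq u = 0"
      unfolding Sq using False ncochain_cup[of X] by (simp add: ncochain_def sum_fun_apply smul_def)
    ultimately show ?thesis using False by (simp add: cobd_def on_basis_def)
  next
    case True
    then have u: "u \<in> simplices X" by (simp add: nondegenerate_def)
    define V where "V = [0..<Suc (sdim X u)]"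
    define \<phi> where "\<phi> = ev X u \<alpha>"
    have V: "V \<in> mono_lists (sdim X u)" unfolding V_def by (rule mono_upt)
    then have V': "sorted V" "set V \<subseteq> {..sdim X u}" by (auto simp: mono_lists_def)
    have uV: "spull X u V = u" unfolding V_def by (rule simplicial_setD(1)[OF X u])
    have \<phi>: "\<phi> [] = 0" "stutter_free \<phi>" "cocw (sdim X u) \<phi>"
      unfolding \<phi>_def using ev_stutter[OF X u nc] cocw_ev[OF X u nc \<alpha>(2)] by (auto simp: stutter_free_def)
    note dels = dels_mono_lists[OF V]
    let ?D = "\<lambda>m r s. cupw m (cupw r \<phi> \<phi>) (cupw s \<phi> \<phi>)"
    have "(?act + cobd X ?J) u = (\<Sum>l\<leftarrow>shuf (alt False q) (alt False p). tabF \<phi> V (map rowl (map iota l))) +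
        (\<Sum>V'\<leftarrow>dels V. \<Sum>l\<leftarrow>shuf (alt False q) (alt False p). jsum l (\<lambda>\<rho>. tabF \<phi> V' (map rowl \<rho>)))"
    proof -
      have 1: "?act u = (\<Sum>l\<leftarrow>shuf (alt False q) (alt False p). tabF \<phi> V (map rowl (map iota l)))"
        using Sigma4_act_x_cross[OF X u V nc] by (simp only: uV \<phi>_def)
      have 2: "cobd X ?J u = (\<Sum>V'\<leftarrow>dels V. ev X u ?J V')"
        unfolding V_def by (rule cobd_eq[OF X True ncochain_Sigma4_act])
      have 3: "ev X u ?J V' = (\<Sum>l\<leftarrow>shuf (alt False q) (alt False p). jsum l (\<lambda>\<rho>. tabF \<phi> V' (map rowl \<rho>)))"
        if "V' \<in> set (dels V)" for V'
      proof (cases "V' = []")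
        case True
        have "tabF \<phi> [] rows = 0" for rows
          by (auto simp: tabF_def act4_def actw_def intro: sum_list_zero)
        then show ?thesis by (simp add: True jsum_zero)
      next
        case False
        then have V': "V' \<in> mono_lists (sdim X u)" using dels[OF that] by blast
        then show ?thesis
          using Sigma4_act_Jbar_Psi[OF X u V' nc, of q p] unfolding ev_def[of X u ?J] \<phi>_def by simp
      qed
      have 4: "(\<Sum>V'\<leftarrow>dels V. ev X u ?J V') =
        (\<Sum>V'\<leftarrow>dels V. \<Sum>l\<leftarrow>shuf (alt False q) (alt False p). jsum l (\<lambda>\<rho>. tabF \<phi> V' (map rowl \<rho>)))"
        by (rule sum_list_cong) (rule 3)
      show ?thesis unfolding plus_fun_def 1 2 4 ..
    qed
    also have "\<dots> = (\<Sum>i\<le>q. \<Sum>r\<le>q - i + p. of_nat (r choose (q - i)) * of_nat ((q - i + p - r) choose (q - i)) *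
        ?D i r (q - i + p - r) V)"
      by (rule homotopy_formula[OF \<phi> V'])
    also have "\<dots> = (\<Sum>l\<in>?S1. binom2 (int p - l) (int p - 2 * l) *
          ?D (nat (int q - int p + 2 * l)) (nat (int p - l)) (nat (int p - l)) V) +
        (\<Sum>(L, A)\<in>?S2. ?B L A * (
          ?D (nat (int q - int p + L)) (nat (int p - (L + A) div 2)) (nat (int p - (L - A) div 2)) V +
          ?D (nat (int q - int p + L)) (nat (int p - (L - A) div 2)) (nat (int p - (L + A) div 2)) V))"
      by (rule sum_reindex[where D = "\<lambda>m r s. ?D m r s V"])
    also have "(\<Sum>l\<in>?S1. binom2 (int p - l) (int p - 2 * l) *
          ?D (nat (int q - int p + 2 * l)) (nat (int p - l)) (nat (int p - l)) V) = ?Sq u"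
      unfolding Sq using cup_cup_spull[OF X u V nc] by (simp add: sum_fun_apply smul_def uV \<phi>_def)
    also have "(\<Sum>(L, A)\<in>?S2. ?B L A * (
          ?D (nat (int q - int p + L)) (nat (int p - (L + A) div 2)) (nat (int p - (L - A) div 2)) V +
          ?D (nat (int q - int p + L)) (nat (int p - (L - A) div 2)) (nat (int p - (L + A) div 2)) V)) =
        (\<Sum>(L, A)\<in>?S2. \<Sum>V'\<leftarrow>dels V. ?B L A *
          ?D (nat (int q - int p + L + 1)) (nat (int p - (L + A) div 2)) (nat (int p - (L - A) div 2)) V')"
    proof (rule sum.cong[OF refl])
      fix x assume "x \<in> ?S2"
      then obtain L A where x: "x = (L, A)" and L: "0 \<le> int q - int p + L" by (cases x) auto
      have m: "nat (int q - int p + L + 1) = Suc (nat (int q - int p + L))" using L by simp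
      have "(\<Sum>V'\<leftarrow>dels V. ?D (Suc m) r s V') = ?D m r s V + ?D m s r V" for m r s
        using cupw_dels[OF cupw_Nil cupw_Nil stutter_free_cupw[OF \<phi>(2,2)] stutter_free_cupw[OF \<phi>(2,2)]
          cocw_cupw[OF \<phi>] cocw_cupw[OF \<phi>] V', of "Suc m"] by simp
      then show "(case x of (L, A) \<Rightarrow> ?B L A * (
          ?D (nat (int q - int p + L)) (nat (int p - (L + A) div 2)) (nat (int p - (L - A) div 2)) V +
          ?D (nat (int q - int p + L)) (nat (int p - (L - A) div 2)) (nat (int p - (L + A) div 2)) V)) =
        (case x of (L, A) \<Rightarrow> \<Sum>V'\<leftarrow>dels V. ?B L A *
          ?D (nat (int q - int p + L + 1)) (nat (int p - (L + A) div 2)) (nat (int p - (L - A) div 2)) V')"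
        unfolding x prod.case m sum_list_const_mult by (simp only:)
    qed
    also have "\<dots> = (\<Sum>V'\<leftarrow>dels V. \<Sum>(L, A)\<in>?S2. ?B L A *
          ?D (nat (int q - int p + L + 1)) (nat (int p - (L + A) div 2)) (nat (int p - (L - A) div 2)) V')"
      unfolding sum_list_sum_swap by (simp only: case_prod_unfold)
    also have "\<dots> = (\<Sum>V'\<leftarrow>dels V. ev X u ?N V')"
    proof (rule sum_list_cong)
      fix V' assume "V' \<in> set (dels V)"
      from dels[OF this] show "(\<Sum>(L, A)\<in>?S2. ?B L A *
          ?D (nat (int q - int p + L + 1)) (nat (int p - (L + A) div 2)) (nat (int p - (L - A) div 2)) V') = ev X u ?N V'"
      proof
        assume V': "V' \<in> mono_lists (sdim X u)"
        then show ?thesis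
          unfolding ev_def[of X u ?N] if_P[OF V'] unfolding N
          using cup_cup_spull[OF X u V' nc]
          by (simp add: sum_fun_apply smul_def \<phi>_def case_prod_unfold)
      qed (simp add: case_prod_unfold)
    qed
    also have "\<dots> = cobd X ?N u" unfolding V_def by (rule cobd_eq[OF X True ncN, symmetric])
    finally show ?thesis by simp
  qed
qed

theorem theorem0p2:
  fixes X :: "'a sset" and q p n :: nat and \<alpha> :: "'a cochain"
  assumes "simplicial_set X"
    and "\<alpha> \<in> cochains X n"
    and "cobd X \<alpha> = 0"
  shows
    "(Sigma4_act X (q + p) (BG_incl Sigma4 (x_cross q p)) \<alpha>
       + cobd X (Sigma4_act X (q + p + 1) (BG_incl Sigma4 (Jbar_Psi (q + p) (x_cross q p))) \<alpha>)
     = (\<Sum>l\<in>{l::int. 0 \<le> l \<and> 2 * l \<le> int p \<and> 0 \<le> int q - int p + 2 * l}.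
          smul (binom2 (int p - l) (int p - 2 * l))
            (Sq X (2 * int n - int p + l) (2 * int n - int q - l)
              (Sq X (int n) (int n - int p + l) \<alpha>)))
       + cobd X (N_cochain X (int q) (int p) (int n) \<alpha>))
    \<and>
     (Sigma4_act X (p + q) (BG_incl Sigma4 (x_cross p q)) \<alpha>
       + cobd X (Sigma4_act X (p + q + 1) (BG_incl Sigma4 (Jbar_Psi (p + q) (x_cross p q))) \<alpha>)
     = (\<Sum>l\<in>{l::int. 0 \<le> l \<and> 2 * l \<le> int q \<and> 0 \<le> int p - int q + 2 * l}.
          smul (binom2 (int q - l) (int q - 2 * l))
            (Sq X (2 * int n - int q + l) (2 * int n - int p - l)
              (Sq X (int n) (int n - int q + l) \<alpha>)))
       + cobd X (N_cochain X (int p) (int q) (int n) \<alpha>))"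
  by (intro conjI act_identity assms)

end
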